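(* Let $M$ be a closed manifold and let $\lambda:\mathbb{R}\to\mathbb{R}$ be a smooth cut-off function with $\lambda(s)=0$ for $s\le0$, $\lambda(s)=1$ for $s\ge1$ and $0<\lambda(s)<1$ for $0<s<1$. There exists an isomorphism $$\Upsilon':H^*(\Omega^*(\Sigma M))\xrightarrow{\ \cong\ }H^*\bigl(\Omega^*(M\times\mathbb{R})\times_{\Omega^*(M)\times\Omega^*(M)}(\Omega^*( * )\times\Omega^*( * ))\bigr).$$ Here the pullback in the right-hand side is given by the inclusion $(j_0,j_1):M\coprod M\to M\times\mathbb{R}$ defined by $j_t(x)=(x,t)$ for $t=0$ and $1$. Moreover, for each element $\omega$ in $H^*(\Omega^*(\Sigma M))$ with $\deg\omega>0$, there exists a cocycle $\beta\in\Omega^*(M)$ such that $\Upsilon'(\omega)=(\beta\cdot\lambda^*(dt),0)$.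
   Context: Souriau–de Rham complex: for a diffeological space $X$, a $p$-form assigns to each plot $U\to X$ a smooth $p$-form on $U$, compatibly with precomposition by smooth maps; $\Omega^*(X)$ is the resulting CDGA. For manifolds it is identified with the usual de Rham complex. $dt$ is the standard $1$-form on $\mathbb{R}$, and $\beta\cdot\lambda^*(dt)$ denotes the product in $\Omega^*(M\times\mathbb{R})$ of the pullbacks of $\beta$ and $\lambda^*(dt)$ along the two projections. A stratifold is a pair $(S,\mathcal{C})$ of a space with an algebra of continuous real functions (in the sense of Kreck); the functor $k$ from stratifolds to diffeological spaces sends $(S,\mathcal{C})$ to the set $S$ with plots the maps $u:U\to S$, $U$ open in some $\mathbb{R}^q$, such that $\phi\circ u$ is smooth for all $\phi\in\mathcal{C}$. For a stratifold $(S,\mathcal{C})$, a manifold $W$ of dimension greater than that of $S$ with compact boundary and collar $c:\partial W\times[0,\varepsilon)\to W$, and a morphism $f:\partial W\to S$, the adjunction space $S\cup_fW$ is a stratifold with the algebra of functions $g$ such that $g|_S\in\mathcal{C}$, $g|_{W\setminus\partial W}$ is smooth and, for some positive $\delta<\varepsilon$, $gc(w,t)=gf(w)$ for $w\in\partial W$, $t<\delta$. With $I=[0,1]$, the unreduced suspension is $\Sigma M:=k((M\times I)\cup_{M\coprod M}( *\coprod * ))$, the adjunction of $M\times I$ along $(x\mapsto(x,0),\,x\mapsto(x,1)):M\coprod M\to M\times I$ and the trivial map $f:M\coprod M\to*\coprod*$ (sending the first copy to the first point and the second copy to the second). In the fibre product, the map $\Omega^*( * )\times\Omega^*( * )\to\Omega^*(M)\times\Omega^*(M)$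 is induced by $f$. *)

theory Defs
  imports "HOL-Analysis.Analysis"
begin

section \<open>Smooth maps between open subsets of Euclidean spaces\<close>

text \<open>
  The definition of a diffeology quantifies over all dimensions, so the \<open>q\<close>-dimensional
  real space is the carrier of the library's \<^term>\<open>Euclidean_space q\<close>: the functions
  \<open>nat \<Rightarrow> real\<close> that vanish at all indices \<open>\<ge> q\<close>.
\<close>

abbreviation vecs :: "nat \<Rightarrow> (nat \<Rightarrow> real) set" where
  "vecs q \<equiv> topspace (Euclidean_space q)"

definition pd :: "nat \<Rightarrow> ((nat \<Rightarrow> real) \<Rightarrow> real) \<Rightarrow> (nat \<Rightarrow> real) \<Rightarrow> real" where
  "pd i f x = deriv (\<lambda>s. f (x(i := s))) (x i)"

fun Ck :: "nat \<Rightarrow> nat \<Rightarrow> (nat \<Rightarrow> real) set \<Rightarrow> ((nat \<Rightarrow> real) \<Rightarrow> real) \<Rightarrow> bool" where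
  "Ck 0 q U f \<longleftrightarrow> continuous_map (subtopology (Euclidean_space q) U) euclideanreal f"
| "Ck (Suc k) q U f \<longleftrightarrow>
     continuous_map (subtopology (Euclidean_space q) U) euclideanreal f \<and>
     (\<forall>i<q. (\<forall>x\<in>U. (\<lambda>s. f (x(i := s))) differentiable (at (x i))) \<and> Ck k q U (pd i f))"

text \<open>Used only for \<open>U\<close> open in the \<open>q\<close>-dimensional space; values outside \<open>U\<close> are irrelevant.\<close>

definition smooth_on :: "nat \<Rightarrow> (nat \<Rightarrow> real) set \<Rightarrow> ((nat \<Rightarrow> real) \<Rightarrow> real) \<Rightarrow> bool" where
  "smooth_on q U f \<longleftrightarrow> (\<forall>k. Ck k q U f)"

definition smooth_map_on ::
    "nat \<Rightarrow> (nat \<Rightarrow> real) set \<Rightarrow> nat \<Rightarrow> ((nat \<Rightarrow> real) \<Rightarrow> nat \<Rightarrow> real) \<Rightarrow> bool" where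
  "smooth_map_on q U n h \<longleftrightarrow> h ` U \<subseteq> vecs n \<and> (\<forall>j<n. smooth_on q U (\<lambda>x. h x j))"

text \<open>The total derivative (Jacobian) of \<open>h\<close> at \<open>x\<close> applied to the vector \<open>v\<close>.\<close>

definition jac ::
    "nat \<Rightarrow> ((nat \<Rightarrow> real) \<Rightarrow> nat \<Rightarrow> real) \<Rightarrow> (nat \<Rightarrow> real) \<Rightarrow> (nat \<Rightarrow> real) \<Rightarrow> nat \<Rightarrow> real" where
  "jac q h x v = (\<lambda>j. \<Sum>i<q. pd i (\<lambda>y. h y j) x * v i)"


section \<open>Smooth manifolds\<close>

record 'a mfd =
  mdim :: nat
  mtop :: "'a topology"
  matlas :: "('a set \<times> ('a \<Rightarrow> nat \<Rightarrow> real)) set"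

definition smooth_manifold :: "'a mfd \<Rightarrow> bool" where
  "smooth_manifold M \<longleftrightarrow>
     Hausdorff_space (mtop M) \<and> second_countable (mtop M) \<and>
     \<Union> (fst ` matlas M) = topspace (mtop M) \<and>
     (\<forall>(D, \<phi>)\<in>matlas M.
        openin (mtop M) D \<and> openin (Euclidean_space (mdim M)) (\<phi> ` D) \<and>
        homeomorphic_map (subtopology (mtop M) D)
          (subtopology (Euclidean_space (mdim M)) (\<phi> ` D)) \<phi>) \<and>
     (\<forall>(D, \<phi>)\<in>matlas M. \<forall>(E, \<psi>)\<in>matlas M.
        smooth_map_on (mdim M) (\<phi> ` (D \<inter> E)) (mdim M) (\<psi> \<circ> inv_into D \<phi>))"

definition closed_manifold :: "'a mfd \<Rightarrow> bool" where
  "closed_manifold M \<longleftrightarrow> smooth_manifold M \<and> compact_space (mtop M)"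

definition smooth_fun :: "'a mfd \<Rightarrow> ('a \<Rightarrow> real) \<Rightarrow> bool" where
  "smooth_fun M g \<longleftrightarrow>
     (\<forall>(D, \<phi>)\<in>matlas M. smooth_on (mdim M) (\<phi> ` D) (g \<circ> inv_into D \<phi>))"

definition open_submfd :: "'a mfd \<Rightarrow> 'a set \<Rightarrow> 'a mfd" where
  "open_submfd M G =
     \<lparr>mdim = mdim M, mtop = subtopology (mtop M) G,
      matlas = (\<lambda>(D, \<phi>). (D \<inter> G, \<phi>)) ` matlas M\<rparr>"

definition concat_vec :: "nat \<Rightarrow> (nat \<Rightarrow> real) \<Rightarrow> (nat \<Rightarrow> real) \<Rightarrow> nat \<Rightarrow> real" where
  "concat_vec m x y = (\<lambda>i. if i < m then x i else y (i - m))"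

definition prod_mfd :: "'a mfd \<Rightarrow> 'b mfd \<Rightarrow> ('a \<times> 'b) mfd" where
  "prod_mfd M N =
     \<lparr>mdim = mdim M + mdim N, mtop = prod_topology (mtop M) (mtop N),
      matlas = {(D \<times> E, \<lambda>(x, y). concat_vec (mdim M) (\<phi> x) (\<psi> y)) | D \<phi> E \<psi>.
                  (D, \<phi>) \<in> matlas M \<and> (E, \<psi>) \<in> matlas N}\<rparr>"

definition real_mfd :: "real mfd" where
  "real_mfd =
     \<lparr>mdim = 1, mtop = euclideanreal, matlas = {(UNIV, \<lambda>t i. if i = 0 then t else 0)}\<rparr>"


section \<open>Plots\<close>

text \<open>
  A plot is a triple \<open>(q, U, u)\<close> with \<open>U\<close> open in the \<open>q\<close>-dimensional space and
  \<open>u\<close> an extensional function on \<open>U\<close>. A diffeological space is given by its set of plots.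
\<close>

type_synonym 'a plot = "nat \<times> (nat \<Rightarrow> real) set \<times> ((nat \<Rightarrow> real) \<Rightarrow> 'a)"

definition mfd_plots :: "'a mfd \<Rightarrow> 'a plot set" where
  "mfd_plots M =
     {(q, U, u). openin (Euclidean_space q) U \<and> u \<in> U \<rightarrow>\<^sub>E topspace (mtop M) \<and>
        continuous_map (subtopology (Euclidean_space q) U) (mtop M) u \<and>
        (\<forall>(D, \<phi>)\<in>matlas M. smooth_map_on q {x\<in>U. u x \<in> D} (mdim M) (\<phi> \<circ> u))}"

definition point_plots :: "unit plot set" where
  "point_plots = {(q, U, u). openin (Euclidean_space q) U \<and> u \<in> U \<rightarrow>\<^sub>E UNIV}"


section \<open>The Souriau-de Rham complex\<close>

text \<open>
  A differential form on an open set is a function of a point and a list of tangent vectors.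
  Outside its domain (point not in \<open>U\<close>, vectors not in the \<open>q\<close>-dimensional space, wrong number of
  vectors) a form is required to vanish, so that equality of forms is equality of functions.
\<close>

type_synonym eform = "(nat \<Rightarrow> real) \<Rightarrow> (nat \<Rightarrow> real) list \<Rightarrow> real"

definition smooth_form :: "nat \<Rightarrow> (nat \<Rightarrow> real) set \<Rightarrow> nat \<Rightarrow> eform \<Rightarrow> bool" where
  "smooth_form q U p \<alpha> \<longleftrightarrow>
     (\<forall>x vs. \<not> (x \<in> U \<and> set vs \<subseteq> vecs q \<and> length vs = p) \<longrightarrow> \<alpha> x vs = 0) \<and>
     (\<forall>x\<in>U. \<forall>vs. set vs \<subseteq> vecs q \<and> length vs = p \<longrightarrow>
        (\<forall>i<p. \<forall>v\<in>vecs q. \<forall>w\<in>vecs q. \<forall>a b.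
           \<alpha> x (vs[i := (\<lambda>k. a * v k + b * w k)]) = a * \<alpha> x (vs[i := v]) + b * \<alpha> x (vs[i := w])) \<and>
        (\<forall>i<p. \<forall>j<p. i \<noteq> j \<and> vs ! i = vs ! j \<longrightarrow> \<alpha> x vs = 0)) \<and>
     (\<forall>vs. set vs \<subseteq> vecs q \<and> length vs = p \<longrightarrow> smooth_on q U (\<lambda>x. \<alpha> x vs))"

definition pull_eform ::
    "nat \<Rightarrow> (nat \<Rightarrow> real) set \<Rightarrow> ((nat \<Rightarrow> real) \<Rightarrow> nat \<Rightarrow> real) \<Rightarrow> eform \<Rightarrow> eform" where
  "pull_eform r V h \<alpha> =
     (\<lambda>y ws. if y \<in> V \<and> set ws \<subseteq> vecs r then \<alpha> (h y) (map (jac r h y) ws) else 0)"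

text \<open>
  \<open>(d\<alpha>) x (v\<^sub>0, ..., v\<^sub>p) = \<Sum>\<^sub>i (-1)\<^sup>i \<partial>\<^bsub>v\<^sub>i\<^esub> \<alpha> (v\<^sub>0, ..., v\<^sub>i omitted, ..., v\<^sub>p)\<close> for constant
  vector fields \<open>v\<^sub>i\<close>, where \<open>\<partial>\<^bsub>v\<^esub> = \<Sum>\<^sub>k v k * \<partial>\<^sub>k\<close>.
\<close>

definition ext_deriv :: "nat \<Rightarrow> (nat \<Rightarrow> real) set \<Rightarrow> eform \<Rightarrow> eform" where
  "ext_deriv q U \<alpha> =
     (\<lambda>x vs. if x \<in> U \<and> set vs \<subseteq> vecs q
        then \<Sum>i<length vs. (- 1) ^ i *
               (\<Sum>k<q. (vs ! i) k * pd k (\<lambda>y. \<alpha> y (take i vs @ drop (Suc i) vs)) x)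
        else 0)"

text \<open>
  The wedge product as a sum over shuffles: \<open>S\<close> is the set of positions handed to the first
  factor, and the sign is that of the permutation listing \<open>S\<close> before its complement. For forms of
  degrees \<open>p\<close> and \<open>r\<close> only the sets \<open>S\<close> with \<open>p\<close> elements contribute.
\<close>

definition shuffle_sign :: "nat \<Rightarrow> nat set \<Rightarrow> real" where
  "shuffle_sign n S = (- 1) ^ card {(i, j). i \<in> S \<and> j \<notin> S \<and> j < i \<and> i < n}"

definition wedge :: "eform \<Rightarrow> eform \<Rightarrow> eform" where
  "wedge \<alpha> \<beta> =
     (\<lambda>x vs. \<Sum>S\<in>Pow {..<length vs}.
        shuffle_sign (length vs) S * \<alpha> x (nths vs S) * \<beta> x (nths vs (- S)))"

type_synonym 'a dform = "'a plot \<Rightarrow> eform"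

definition dforms :: "'a plot set \<Rightarrow> nat \<Rightarrow> 'a dform set" where
  "dforms P p =
     {\<omega>. (\<forall>(q, U, u)\<in>P. smooth_form q U p (\<omega> (q, U, u))) \<and>
         (\<forall>pl. pl \<notin> P \<longrightarrow> \<omega> pl = (\<lambda>_ _. 0)) \<and>
         (\<forall>(q, U, u)\<in>P. \<forall>r V h.
            openin (Euclidean_space r) V \<and> smooth_map_on r V q h \<and> h ` V \<subseteq> U \<longrightarrow>
            \<omega> (r, V, restrict (u \<circ> h) V) = pull_eform r V h (\<omega> (q, U, u)))}"

text \<open>Graded algebras and CDGAs, given by their homogeneous components.\<close>

record 'x galg =
  gcomp :: "nat \<Rightarrow> 'x set"
  gzero :: "nat \<Rightarrow> 'x"
  gadd :: "nat \<Rightarrow> 'x \<Rightarrow> 'x \<Rightarrow> 'x"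
  gscale :: "nat \<Rightarrow> real \<Rightarrow> 'x \<Rightarrow> 'x"
  gone :: 'x
  gmult :: "nat \<Rightarrow> nat \<Rightarrow> 'x \<Rightarrow> 'x \<Rightarrow> 'x"

record 'x cdga = "'x galg" +
  gdiff :: "nat \<Rightarrow> 'x \<Rightarrow> 'x"

definition deRham :: "'a plot set \<Rightarrow> 'a dform cdga" where
  "deRham P =
     \<lparr>gcomp = dforms P,
      gzero = (\<lambda>_ _ _ _. 0),
      gadd = (\<lambda>_ \<omega> \<eta> pl x vs. \<omega> pl x vs + \<eta> pl x vs),
      gscale = (\<lambda>_ c \<omega> pl x vs. c * \<omega> pl x vs),
      gone = (\<lambda>(q, U, u) x vs. if (q, U, u) \<in> P \<and> x \<in> U \<and> vs = [] then 1 else 0),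
      gmult = (\<lambda>_ _ \<omega> \<eta> pl. wedge (\<omega> pl) (\<eta> pl)),
      gdiff = (\<lambda>_ \<omega> (q, U, u). ext_deriv q U (\<omega> (q, U, u)))\<rparr>"

text \<open>The map of de Rham complexes induced by a smooth map \<open>f\<close> out of the space with plots \<open>P\<close>.\<close>

definition pull :: "'a plot set \<Rightarrow> ('a \<Rightarrow> 'b) \<Rightarrow> 'b dform \<Rightarrow> 'a dform" where
  "pull P f \<omega> =
     (\<lambda>(q, U, u). if (q, U, u) \<in> P then \<omega> (q, U, restrict (f \<circ> u) U) else (\<lambda>_ _. 0))"

text \<open>The standard 1-form on the real line: its value on a plot \<open>u\<close> is \<open>\<Sum>\<^sub>i \<partial>\<^sub>i u dx\<^sub>i\<close>.\<close>

definition dt :: "real dform" where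
  "dt = (\<lambda>(q, U, u) x vs.
     if (q, U, u) \<in> mfd_plots real_mfd \<and> x \<in> U \<and> set vs \<subseteq> vecs q \<and> length vs = 1
     then \<Sum>i<q. pd i u x * hd vs i else 0)"


section \<open>Products, fibre products and cohomology\<close>

definition prod_cdga :: "'x cdga \<Rightarrow> 'y cdga \<Rightarrow> ('x \<times> 'y) cdga" where
  "prod_cdga A B =
     \<lparr>gcomp = (\<lambda>n. gcomp A n \<times> gcomp B n),
      gzero = (\<lambda>n. (gzero A n, gzero B n)),
      gadd = (\<lambda>n (a, b) (a', b'). (gadd A n a a', gadd B n b b')),
      gscale = (\<lambda>n c (a, b). (gscale A n c a, gscale B n c b)),
      gone = (gone A, gone B),
      gmult = (\<lambda>n m (a, b) (a', b'). (gmult A n m a a', gmult B n m b b')),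
      gdiff = (\<lambda>n (a, b). (gdiff A n a, gdiff B n b))\<rparr>"

definition fibre_prod :: "'x cdga \<Rightarrow> ('x \<Rightarrow> 'z) \<Rightarrow> 'y cdga \<Rightarrow> ('y \<Rightarrow> 'z) \<Rightarrow> ('x \<times> 'y) cdga" where
  "fibre_prod A F B G =
     (prod_cdga A B)\<lparr>gcomp := (\<lambda>n. {(a, b) \<in> gcomp A n \<times> gcomp B n. F a = G b})\<rparr>"

definition cocycles :: "'x cdga \<Rightarrow> nat \<Rightarrow> 'x set" where
  "cocycles A n = {z \<in> gcomp A n. gdiff A n z = gzero A (Suc n)}"

definition coboundaries :: "'x cdga \<Rightarrow> nat \<Rightarrow> 'x set" where
  "coboundaries A n = (case n of 0 \<Rightarrow> {gzero A 0} | Suc k \<Rightarrow> gdiff A k ` gcomp A k)"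

definition cohomologous :: "'x cdga \<Rightarrow> nat \<Rightarrow> ('x \<times> 'x) set" where
  "cohomologous A n =
     {(z, z'). z \<in> cocycles A n \<and> z' \<in> cocycles A n \<and> (\<exists>b\<in>coboundaries A n. z' = gadd A n z b)}"

definition cohom_class :: "'x cdga \<Rightarrow> nat \<Rightarrow> 'x \<Rightarrow> 'x set" where
  "cohom_class A n z = cohomologous A n `` {z}"

definition cohomology :: "'x cdga \<Rightarrow> 'x set galg" where
  "cohomology A =
     \<lparr>gcomp = (\<lambda>n. cocycles A n // cohomologous A n),
      gzero = (\<lambda>n. cohom_class A n (gzero A n)),
      gadd = (\<lambda>n X Y. \<Union>x\<in>X. \<Union>y\<in>Y. cohom_class A n (gadd A n x y)),
      gscale = (\<lambda>n c X. \<Union>x\<in>X. cohom_class A n (gscale A n c x)),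
      gone = cohom_class A 0 (gone A),
      gmult = (\<lambda>n m X Y. \<Union>x\<in>X. \<Union>y\<in>Y. cohom_class A (n + m) (gmult A n m x y))\<rparr>"

definition galg_iso :: "'x galg \<Rightarrow> 'y galg \<Rightarrow> (nat \<Rightarrow> 'x \<Rightarrow> 'y) \<Rightarrow> bool" where
  "galg_iso A B \<Phi> \<longleftrightarrow>
     (\<forall>n. bij_betw (\<Phi> n) (gcomp A n) (gcomp B n)) \<and>
     (\<forall>n. \<forall>x\<in>gcomp A n. \<forall>y\<in>gcomp A n. \<Phi> n (gadd A n x y) = gadd B n (\<Phi> n x) (\<Phi> n y)) \<and>
     (\<forall>n c. \<forall>x\<in>gcomp A n. \<Phi> n (gscale A n c x) = gscale B n c (\<Phi> n x)) \<and>
     \<Phi> 0 (gone A) = gone B \<and>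
     (\<forall>n m. \<forall>x\<in>gcomp A n. \<forall>y\<in>gcomp A m.
        \<Phi> (n + m) (gmult A n m x y) = gmult B n m (\<Phi> n x) (\<Phi> m y))"


section \<open>Stratifolds, the functor \<open>k\<close> and the suspension\<close>

text \<open>
  Only the data of a stratifold are recorded: a space and an algebra of functions on it (values
  outside the space are irrelevant).
\<close>

type_synonym 's strat = "'s topology \<times> ('s \<Rightarrow> real) set"

definition k_functor :: "'s strat \<Rightarrow> 's plot set" where
  "k_functor X =
     {(q, U, u). openin (Euclidean_space q) U \<and> u \<in> U \<rightarrow>\<^sub>E topspace (fst X) \<and>
        (\<forall>\<phi>\<in>snd X. smooth_on q U (\<phi> \<circ> u))}"

text \<open>
  The part of a manifold with boundary and collar that enters an adjunction: its space, its boundary,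
  its interior as a manifold, and the collar \<open>c(w, t)\<close>, \<open>0 \<le> t < \<epsilon>\<close>.
\<close>

record 'w collared_mfd =
  wtop :: "'w topology"
  wbdry :: "'w set"
  wint :: "'w mfd"
  wcollar :: "'w \<Rightarrow> real \<Rightarrow> 'w"
  wwidth :: real

text \<open>
  The underlying set of the adjunction is the disjoint union of \<open>S\<close> and the interior of \<open>W\<close>;
  \<open>adj_map\<close> is the canonical map from \<open>W\<close>.
\<close>

definition adj_map :: "'w set \<Rightarrow> ('w \<Rightarrow> 's) \<Rightarrow> 'w \<Rightarrow> 's + 'w" where
  "adj_map B f w = (if w \<in> B then Inl (f w) else Inr w)"

definition adj_open ::
    "'s topology \<Rightarrow> 'w topology \<Rightarrow> 'w set \<Rightarrow> ('w \<Rightarrow> 's) \<Rightarrow> ('s + 'w) set \<Rightarrow> bool" where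
  "adj_open S W B f V \<longleftrightarrow>
     V \<subseteq> Inl ` topspace S \<union> Inr ` (topspace W - B) \<and>
     openin S {s \<in> topspace S. Inl s \<in> V} \<and> openin W {w \<in> topspace W. adj_map B f w \<in> V}"

lemma istopology_adj_open: "istopology (adj_open S W B f)"
proof -
  have "adj_open S W B f (V \<inter> V')" if "adj_open S W B f V" "adj_open S W B f V'" for V V'
  proof -
    have "{s \<in> topspace S. Inl s \<in> V \<inter> V'} = {s \<in> topspace S. Inl s \<in> V} \<inter> {s \<in> topspace S. Inl s \<in> V'}"
      "{w \<in> topspace W. adj_map B f w \<in> V \<inter> V'} =
        {w \<in> topspace W. adj_map B f w \<in> V} \<inter> {w \<in> topspace W. adj_map B f w \<in> V'}"
      by auto
    with that show ?thesis
      unfolding adj_open_def by (auto intro: openin_Int)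
  qed
  moreover have "adj_open S W B f (\<Union> \<V>)" if "\<forall>V\<in>\<V>. adj_open S W B f V" for \<V>
  proof -
    have "{s \<in> topspace S. Inl s \<in> \<Union> \<V>} = (\<Union>V\<in>\<V>. {s \<in> topspace S. Inl s \<in> V})"
      "{w \<in> topspace W. adj_map B f w \<in> \<Union> \<V>} = (\<Union>V\<in>\<V>. {w \<in> topspace W. adj_map B f w \<in> V})"
      by auto
    moreover have "\<Union> \<V> \<subseteq> Inl ` topspace S \<union> Inr ` (topspace W - B)"
      using that unfolding adj_open_def by blast
    moreover have "openin S (\<Union>V\<in>\<V>. {s \<in> topspace S. Inl s \<in> V})"
      "openin W (\<Union>V\<in>\<V>. {w \<in> topspace W. adj_map B f w \<in> V})"
      by (rule openin_Union, use that in \<open>force simp: adj_open_def\<close>)+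
    ultimately show ?thesis
      unfolding adj_open_def by simp
  qed
  ultimately show ?thesis
    unfolding istopology_def by blast
qed

definition adjunction :: "'s strat \<Rightarrow> 'w collared_mfd \<Rightarrow> ('w \<Rightarrow> 's) \<Rightarrow> ('s + 'w) strat" where
  "adjunction S W f =
     (topology (adj_open (fst S) (wtop W) (wbdry W) f),
      {g. (\<lambda>s. g (Inl s)) \<in> snd S \<and>
          smooth_fun (wint W) (\<lambda>w. g (Inr w)) \<and>
          (\<exists>\<delta>>0. \<delta> < wwidth W \<and>
             (\<forall>w\<in>wbdry W. \<forall>t. 0 \<le> t \<and> t < \<delta> \<longrightarrow>
                g (adj_map (wbdry W) f (wcollar W w t)) = g (Inl (f w))))})"

definition cylinder :: "'a mfd \<Rightarrow> ('a \<times> real) collared_mfd" where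
  "cylinder M =
     \<lparr>wtop = prod_topology (mtop M) (top_of_set {0..1}),
      wbdry = topspace (mtop M) \<times> {0, 1},
      wint = prod_mfd M (open_submfd real_mfd {0<..<1}),
      wcollar = (\<lambda>(x, s) t. if s = 0 then (x, t) else (x, 1 - t)),
      wwidth = 1/2\<rparr>"

definition two_points :: "(unit + unit) strat" where
  "two_points = (discrete_topology UNIV, UNIV)"

definition suspension :: "'a mfd \<Rightarrow> ((unit + unit) + ('a \<times> real)) plot set" where
  "suspension M =
     k_functor (adjunction two_points (cylinder M)
       (\<lambda>(x, s). if s = 0 then Inl () else Inr ()))"


section \<open>The fibre product\<close>

definition end_restrict :: "'a mfd \<Rightarrow> ('a \<times> real) dform \<Rightarrow> 'a dform \<times> 'a dform" where
  "end_restrict M \<eta> = (pull (mfd_plots M) (\<lambda>x. (x, 0)) \<eta>, pull (mfd_plots M) (\<lambda>x. (x, 1)) \<eta>)"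

definition end_const :: "'a mfd \<Rightarrow> unit dform \<times> unit dform \<Rightarrow> 'a dform \<times> 'a dform" where
  "end_const M = (\<lambda>(a, b). (pull (mfd_plots M) (\<lambda>_. ()) a, pull (mfd_plots M) (\<lambda>_. ()) b))"

definition susp_model :: "'a mfd \<Rightarrow> (('a \<times> real) dform \<times> unit dform \<times> unit dform) cdga" where
  "susp_model M =
     fibre_prod (deRham (mfd_plots (prod_mfd M real_mfd))) (end_restrict M)
       (prod_cdga (deRham point_plots) (deRham point_plots)) (end_const M)"

text \<open>\<open>\<beta> \<cdot> \<lambda>\<^sup>*(dt)\<close> for a form \<open>\<beta>\<close> of degree \<open>p\<close>.\<close>

definition times_cutoff_dt :: "'a mfd \<Rightarrow> (real \<Rightarrow> real) \<Rightarrow> nat \<Rightarrow> 'a dform \<Rightarrow> ('a \<times> real) dform" where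
  "times_cutoff_dt M lam p \<beta> =
     gmult (deRham (mfd_plots (prod_mfd M real_mfd))) p 1
       (pull (mfd_plots (prod_mfd M real_mfd)) fst \<beta>)
       (pull (mfd_plots (prod_mfd M real_mfd)) snd (pull (mfd_plots real_mfd) lam dt))"

end

theory Submission
  imports Defs
begin

text \<open>The functions in the algebra of \<open>\<Sigma>M\<close> are constant near the cone points, so the clamping map
  \<open>M \<times> \<real> \<rightarrow> \<Sigma>M\<close>, sending \<open>(a, t)\<close> to a cone point unless \<open>0 < t < 1\<close>, is smooth; pulling back along
  it gives \<open>\<Upsilon>'\<close>. Conversely, pulling back along \<open>(a, t) \<mapsto> (a, \<rho> t)\<close>, with \<open>\<rho>\<close> constant near
  \<open>0\<close> and \<open>1\<close>, turns a form on \<open>M \<times> \<real>\<close> whose restrictions to both ends come from the point into a form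
  on \<open>\<Sigma>M\<close>. Both composites are induced by \<open>\<rho>\<close>, which is smoothly homotopic to the identity
  relative to the ends; integration along the homotopy coordinate shows that they are the
  identity on cohomology.

  In positive degree a cocycle of the fibre product is a closed form \<open>\<eta>\<close> on \<open>M \<times> \<real>\<close> whose
  restrictions to \<open>M \<times> 0\<close> and \<open>M \<times> 1\<close> vanish. Contracting \<open>\<real>\<close> to \<open>0\<close> gives \<open>\<eta> = d\<kappa>\<close>
  with \<open>\<kappa>\<close> vanishing on \<open>M \<times> 0\<close>; if \<open>\<beta>\<close> is the restriction of \<open>\<kappa>\<close> to \<open>M \<times> 1\<close>, then
  \<open>\<kappa> - \<beta> \<cdot> \<lambda>\<close> vanishes at both ends, and its differential is \<open>\<eta> \<mp> \<beta> \<cdot> \<lambda>\<^sup>*(dt)\<close>.\<close>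

section \<open>Calculus on open subsets of Euclidean spaces\<close>

text \<open>The obstacle is that a plot of \<Sigma>M is known only through functions that are
  constant near the cone points. Its height is continuous, but its smoothness can be tested only
  strictly between 0 and 1, and its component in M exists only there. So a form on M \<times>
  \<real> cannot be evaluated directly on such a plot near a cone point. After crushing by \<rho>,
  its value at heights below 1/3 or above 2/3 is the form supplied by the point. These regions
  overlap the heights strictly between 0 and 1, where \<eta> itself is evaluated, and the
  descriptions glue. Between the cone points, continuity and smoothness are recovered by testing
  with functions built from \<lambda>: bump functions on M and cut-offs of the height. Only the map
  into the fibre product has to respect products. The map back is used as an additive cochain map,
  which is enough for bijectivity on cohomology. Exterior calculus is done by induction on the list
  of vectors: contracting with the first vector, through Cartan's formula for a constant field,
  reduces each identity to shorter lists.\<close>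

lemma Euclidean_space_eq_top_of_set: "Euclidean_space q = top_of_set {x. \<forall>i\<ge>q. x i = 0}"
  by (simp add: Euclidean_space_def euclidean_product_topology)

lemma in_vecs_iff: "x \<in> vecs q \<longleftrightarrow> (\<forall>i\<ge>q. x i = 0)"
  by (simp add: topspace_Euclidean_space)

lemma open_vecs_subset: "openin (Euclidean_space q) U \<Longrightarrow> U \<subseteq> vecs q"
  by (rule openin_subset)

lemma continuous_map_sub_Euclidean_iff:
  assumes "U \<subseteq> vecs q"
  shows "continuous_map (subtopology (Euclidean_space q) U) euclideanreal f \<longleftrightarrow> continuous_on U f"
proof -
  have "{x. \<forall>i\<ge>q. x i = 0} \<inter> U = U" using assms by (auto simp: topspace_Euclidean_space)
  then show ?thesis
    by (simp add: Euclidean_space_eq_top_of_set subtopology_subtopology)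
qed

lemma openin_Euclidean_preimage:
  fixes h :: "(nat \<Rightarrow> real) \<Rightarrow> nat \<Rightarrow> real"
  assumes "openin (Euclidean_space q) U" "continuous_on U h" "h ` U \<subseteq> vecs n"
    and "openin (Euclidean_space n) V"
  shows "openin (Euclidean_space q) {x\<in>U. h x \<in> V}"
proof -
  have "openin (top_of_set U) (U \<inter> h -` V)"
    using assms(2-4) by (intro continuous_openin_preimage[of U h "vecs n" V]) (auto simp: Euclidean_space_eq_top_of_set)
  moreover have "U \<inter> h -` V = {x\<in>U. h x \<in> V}" by auto
  ultimately show ?thesis using assms(1) openin_trans[of U _ "vecs q"]
    by (simp add: Euclidean_space_eq_top_of_set)
qed

lemma openin_Euclidean_preimage_open:
  fixes h :: "(nat \<Rightarrow> real) \<Rightarrow> 'b::topological_space"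
  assumes "openin (Euclidean_space q) U" "continuous_on U h" "open V"
  shows "openin (Euclidean_space q) {x\<in>U. h x \<in> V}"
proof -
  have "openin (top_of_set U) (U \<inter> h -` V)"
    using assms by (intro continuous_openin_preimage_gen)
  moreover have "U \<inter> h -` V = {x\<in>U. h x \<in> V}" by auto
  ultimately show ?thesis using assms(1) openin_trans[of U _ "vecs q"]
    by (simp add: Euclidean_space_eq_top_of_set)
qed

text \<open>The space carries the product topology, whose basic sets restrict finitely many
  coordinates. Vectors in \<open>vecs q\<close> agree from index q on, so a box in the first q
  coordinates is enough; such boxes take the place of metric balls below.\<close>

lemma open_vecs_box:
  assumes "openin (Euclidean_space q) U" "x \<in> U"
  obtains e where "e > 0" "\<And>y. y \<in> vecs q \<Longrightarrow> (\<And>i. i < q \<Longrightarrow> \<bar>y i - x i\<bar> < e) \<Longrightarrow> y \<in> U"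
proof -
  obtain T where T: "openin (powertop_real UNIV) T" "U = T \<inter> vecs q"
    using assms(1) by (auto simp: Euclidean_space_def openin_subtopology)
  obtain X where X: "x \<in> Pi\<^sub>E UNIV X" "\<And>i. openin euclideanreal (X i)" "Pi\<^sub>E UNIV X \<subseteq> T"
    using product_topology_open_contains_basis[OF T(1)] assms(2) T(2) by blast
  have "\<exists>d>0. ball (x i) d \<subseteq> X i" for i
    using X(1) X(2)[of i] by (metis PiE_mem UNIV_I open_contains_ball open_openin)
  then obtain d where d: "\<And>i. d i > 0" "\<And>i. ball (x i) (d i) \<subseteq> X i" by metis
  \<comment> \<open>The extra element 1 keeps the minimum defined when q = 0.\<close>
  define e where "e = Min (insert 1 (d ` {..<q}))"
  have e: "e > 0" "\<And>i. i < q \<Longrightarrow> e \<le> d i"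
    unfolding e_def using d(1) by auto
  have "y \<in> U" if y: "y \<in> vecs q" "\<And>i. i < q \<Longrightarrow> \<bar>y i - x i\<bar> < e" for y
  proof -
    have "y i \<in> X i" for i
    proof (cases "i < q")
      case True
      then have "y i \<in> ball (x i) (d i)" 
        using y(2)[OF True] e(2)[OF True] by (auto simp: dist_real_def)
      then show ?thesis using d(2) by blast
    next
      case False
      moreover have "x \<in> vecs q" using assms by (auto dest: open_vecs_subset)
      ultimately have "y i = x i" using y(1) by (simp add: in_vecs_iff)
      then show ?thesis using X(1) by auto
    qed
    then have "y \<in> Pi\<^sub>E UNIV X" by auto
    then show ?thesis using X(3) T(2) y(1) by blast
  qed
  with e(1) that show ?thesis by blast
qed

text \<open>Partial derivatives are derivatives along \<open>x(i := s)\<close>; this is what makes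
  them depend only on the values of a function on an open set containing x.\<close>

lemma eventually_upd_in_open:
  assumes "openin (Euclidean_space q) U" "x \<in> U" "i < q"
  shows "\<forall>\<^sub>F s in nhds (x i). x(i := s) \<in> U"
proof -
  obtain e where e: "e > 0" "\<And>y. y \<in> vecs q \<Longrightarrow> (\<And>i. i < q \<Longrightarrow> \<bar>y i - x i\<bar> < e) \<Longrightarrow> y \<in> U"
    using open_vecs_box[OF assms(1,2)] by blast
  have x: "x \<in> vecs q" using assms by (auto dest: open_vecs_subset)
  have "x(i := s) \<in> U" if "dist s (x i) < e" for s
    using that x e(1) assms(3) by (intro e(2)) (auto simp: in_vecs_iff dist_real_def)
  then show ?thesis using e(1) by (auto simp: eventually_nhds_metric)
qed

subsection \<open>Partial derivatives and the classes of differentiability\<close>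

lemma pd_cong:
  assumes "openin (Euclidean_space q) U" "x \<in> U" "i < q" "\<And>y. y \<in> U \<Longrightarrow> f y = g y"
  shows "pd i f x = pd i g x"
proof -
  have "\<forall>\<^sub>F s in nhds (x i). f (x(i := s)) = g (x(i := s))"
    using eventually_upd_in_open[OF assms(1-3)] by eventually_elim (use assms(4) in auto)
  then show ?thesis unfolding pd_def by (intro deriv_cong_ev) auto
qed

lemma differentiable_upd_cong:
  fixes f g :: "(nat \<Rightarrow> real) \<Rightarrow> real"
  assumes "openin (Euclidean_space q) U" "x \<in> U" "i < q" "\<And>y. y \<in> U \<Longrightarrow> f y = g y"
    and "(\<lambda>s. f (x(i := s))) differentiable (at (x i))"
  shows "(\<lambda>s. g (x(i := s))) differentiable (at (x i))"
proof -
  have ev: "\<forall>\<^sub>F s in nhds (x i). f (x(i := s)) = g (x(i := s))"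
    using eventually_upd_in_open[OF assms(1-3)] by eventually_elim (use assms(4) in auto)
  obtain D where D: "((\<lambda>s. f (x(i := s))) has_real_derivative D) (at (x i))"
    using assms(5) real_differentiable_def by blast
  have "((\<lambda>s. g (x(i := s))) has_real_derivative D) (at (x i))"
    using D DERIV_cong_ev[OF refl ev refl] by simp
  then show ?thesis using real_differentiable_def by blast
qed

lemma Ck_continuous:
  "Ck k q U f \<Longrightarrow> U \<subseteq> vecs q \<Longrightarrow> continuous_on U f"
  by (cases k) (simp_all add: continuous_map_sub_Euclidean_iff)

lemma Ck_SucD:
  assumes "Ck (Suc k) q U f" "i < q"
  shows "Ck k q U (pd i f)"
    and "x \<in> U \<Longrightarrow> ((\<lambda>s. f (x(i := s))) has_real_derivative pd i f x) (at (x i))"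
  using assms by (auto simp: pd_def DERIV_deriv_iff_real_differentiable)

lemma Ck_SucD_upd:
  assumes "Ck (Suc k) q U f" "i < q" "x(i := t) \<in> U"
  shows "((\<lambda>s. f (x(i := s))) has_real_derivative pd i f (x(i := t))) (at t)"
  using Ck_SucD(2)[OF assms] by simp

text \<open>The given derivatives \<open>f'\<close> agree with \<open>pd i f\<close> on U only, so
  congruence of \<open>Ck\<close> is needed to pass from one to the other. It is a premise here and
  is discharged in \<open>Ck_SucI'\<close>.\<close>

lemma Ck_SucI:
  fixes f :: "(nat \<Rightarrow> real) \<Rightarrow> real"
  assumes "continuous_on U f" "U \<subseteq> vecs q"
    and "\<And>i x. i < q \<Longrightarrow> x \<in> U \<Longrightarrow> ((\<lambda>s. f (x(i := s))) has_real_derivative f' i x) (at (x i))"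
    and "\<And>i. i < q \<Longrightarrow> Ck k q U (f' i)" and "openin (Euclidean_space q) U"
    and cong: "\<And>f g. Ck k q U f \<Longrightarrow> (\<And>x. x \<in> U \<Longrightarrow> f x = g x) \<Longrightarrow> Ck k q U g"
  shows "Ck (Suc k) q U f"
proof -
  have "pd i f x = f' i x" if "i < q" "x \<in> U" for i x
    unfolding pd_def using assms(3)[OF that] by (rule DERIV_imp_deriv)
  then have "Ck k q U (pd i f)" if "i < q" for i
    using cong[OF assms(4)[OF that]] that by metis
  moreover have "(\<lambda>s. f (x(i := s))) differentiable (at (x i))" if "i < q" "x \<in> U" for i x
    using assms(3)[OF that] real_differentiable_def by blast
  ultimately show ?thesis
    using assms(1,2) by (simp add: continuous_map_sub_Euclidean_iff)
qed

lemma Ck_cong_imp: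
  assumes "openin (Euclidean_space q) U"
  shows "Ck k q U f \<Longrightarrow> (\<And>x. x \<in> U \<Longrightarrow> f x = g x) \<Longrightarrow> Ck k q U g"
proof (induction k arbitrary: f g)
  case 0
  then show ?case 
    using continuous_on_cong[of U U f g] by (auto simp: continuous_map_sub_Euclidean_iff open_vecs_subset assms)
next
  case (Suc k)
  have "continuous_on U f" using Suc(2) Ck_continuous open_vecs_subset assms by blast
  then have "continuous_on U g" using Suc(3) continuous_on_cong[of U U f g] by auto
  moreover have "pd i f x = pd i g x" if "i < q" "x \<in> U" for i x
    using pd_cong[OF assms] Suc(3) that by blast
  then have "Ck k q U (pd i g)" if "i < q" for i
    using Suc(1)[of "pd i f" "pd i g"] Suc(2) that by auto
  moreover have "(\<lambda>s. g (x(i := s))) differentiable (at (x i))" if "i < q" "x \<in> U" for i x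
    by (rule differentiable_upd_cong[OF assms that(2,1), of f]) (use Suc(2,3) that in auto)
  ultimately show ?case by (auto simp: continuous_map_sub_Euclidean_iff open_vecs_subset assms)
qed

lemma Ck_SucI':
  assumes "openin (Euclidean_space q) U" "continuous_on U f"
    and "\<And>i x. i < q \<Longrightarrow> x \<in> U \<Longrightarrow> ((\<lambda>s. f (x(i := s))) has_real_derivative f' i x) (at (x i))"
    and "\<And>i. i < q \<Longrightarrow> Ck k q U (f' i)" 
  shows "Ck (Suc k) q U f"
  using Ck_SucI[of U f q f' k] assms Ck_cong_imp open_vecs_subset by blast

lemma Ck_Suc_imp: "Ck (Suc k) q U f \<Longrightarrow> Ck k q U f"
  by (induction k arbitrary: f) auto

lemma Ck_subset:
  assumes "V \<subseteq> U" "U \<subseteq> vecs q"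
  shows "Ck k q U f \<Longrightarrow> Ck k q V f"
proof (induction k arbitrary: f)
  case 0
  then show ?case using assms by (auto simp: continuous_map_sub_Euclidean_iff intro: continuous_on_subset)
next
  case (Suc k)
  then show ?case using assms by (auto simp: continuous_map_sub_Euclidean_iff intro: continuous_on_subset)
qed

lemma continuous_on_local:
  assumes "openin (Euclidean_space q) U"
    and "\<And>x. x \<in> U \<Longrightarrow> \<exists>V. openin (Euclidean_space q) V \<and> x \<in> V \<and> continuous_on (U \<inter> V) f"
  shows "continuous_on U f"
  unfolding continuous_on_eq_continuous_within
proof
  fix x assume x: "x \<in> U"
  obtain V where V: "openin (Euclidean_space q) V" "x \<in> V" "continuous_on (U \<inter> V) f"
    using assms(2)[OF x] by blast
  obtain T where T: "open T" "V = T \<inter> vecs q"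
    using V(1) by (auto simp: Euclidean_space_eq_top_of_set openin_open)
  have "at x within U = at x within (U \<inter> V)"
    by (rule at_within_nhd[of _ T]) (use T V open_vecs_subset[OF assms(1)] in auto)
  then show "continuous (at x within U) f"
    using V x by (simp add: continuous_on_eq_continuous_within)
qed

lemma Ck_local:
  assumes "openin (Euclidean_space q) U"
  shows "(\<And>x. x \<in> U \<Longrightarrow> \<exists>V. openin (Euclidean_space q) V \<and> x \<in> V \<and> Ck k q (U \<inter> V) f) \<Longrightarrow> Ck k q U f"
proof (induction k arbitrary: f)
  case 0
  have "\<exists>V. openin (Euclidean_space q) V \<and> x \<in> V \<and> continuous_on (U \<inter> V) f" if "x \<in> U" for x
    using 0[OF that] open_vecs_subset[OF assms] 
    by (simp add: continuous_map_sub_Euclidean_iff inf.coboundedI1)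
  then show ?case using continuous_on_local[OF assms, of f] open_vecs_subset[OF assms]
    by (simp add: continuous_map_sub_Euclidean_iff)
next
  case (Suc k)
  have "continuous_on U f"
    using continuous_on_local[OF assms] Suc(2) Ck_continuous open_vecs_subset[OF assms] 
    by (meson inf.coboundedI1)
  moreover have "(\<lambda>s. f (x(i := s))) differentiable (at (x i))" if "i < q" "x \<in> U" for i x
    using Suc(2)[OF that(2)] that by auto
  moreover have "Ck k q U (pd i f)" if "i < q" for i
    using Suc(2) that by (intro Suc(1)) (meson Ck.simps(2))
  ultimately show ?case using assms by (auto simp: continuous_map_sub_Euclidean_iff open_vecs_subset)
qed

lemma Ck_const: "U \<subseteq> vecs q \<Longrightarrow> Ck k q U (\<lambda>x. c)"
proof (induction k arbitrary: c)
  case 0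
  then show ?case by simp
next
  case (Suc k)
  have "pd i (\<lambda>x. c) = (\<lambda>x. 0)" for i unfolding pd_def by simp
  with Suc show ?case by simp
qed

lemma Ck_coord: "U \<subseteq> vecs q \<Longrightarrow> Ck k q U (\<lambda>x. x j)"
proof (cases k)
  case 0
  assume "U \<subseteq> vecs q"
  moreover have "continuous_on U (\<lambda>x. x j)"
    by (rule continuous_on_subset[OF continuous_on_product_coordinates subset_UNIV])
  ultimately show ?thesis using 0 by (simp add: continuous_map_sub_Euclidean_iff)
next
  case (Suc k')
  assume U: "U \<subseteq> vecs q"
  have *: "((\<lambda>s. (x(i := s)) j) has_real_derivative (if i = j then 1 else 0)) (at (x i))" for i and x :: "nat \<Rightarrow> real"
    by (auto intro!: derivative_eq_intros)
  have "pd i (\<lambda>x. x j) = (\<lambda>x. if i = j then 1 else 0)" for i unfolding pd_def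
    using DERIV_imp_deriv[OF *] by (rule ext)
  moreover have "continuous_on U (\<lambda>x. x j)"
    by (rule continuous_on_subset[OF continuous_on_product_coordinates subset_UNIV])
  moreover have "(\<lambda>s. (x(i := s)) j) differentiable (at (x i))" for i and x :: "nat \<Rightarrow> real"
    using * real_differentiable_def by blast
  ultimately show ?thesis using U Suc
    by (simp add: Ck_const continuous_map_sub_Euclidean_iff)
qed

declare Ck.simps(2) [simp del]

lemma Ck_add:
  assumes "openin (Euclidean_space q) U"
  shows "Ck k q U f \<Longrightarrow> Ck k q U g \<Longrightarrow> Ck k q U (\<lambda>x. f x + g x)"
proof (induction k arbitrary: f g)
  case 0
  then show ?case using assms by (auto simp: continuous_map_sub_Euclidean_iff open_vecs_subset intro: continuous_on_add)
next
  case (Suc k)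
  show ?case
  proof (rule Ck_SucI'[OF assms, of _ "\<lambda>i x. pd i f x + pd i g x"])
    show "continuous_on U (\<lambda>x. f x + g x)"
      using Suc(2,3) Ck_continuous open_vecs_subset[OF assms] by (blast intro: continuous_on_add)
    show "((\<lambda>s. f (x(i := s)) + g (x(i := s))) has_real_derivative pd i f x + pd i g x) (at (x i))"
      if "i < q" "x \<in> U" for i x
      by (rule DERIV_add[OF Ck_SucD(2)[OF Suc(2) that] Ck_SucD(2)[OF Suc(3) that]])
    show "Ck k q U (\<lambda>x. pd i f x + pd i g x)" if "i < q" for i
      using Suc that by (intro Suc.IH) (auto dest: Ck_SucD)
  qed
qed

lemma Ck_sum:
  "openin (Euclidean_space q) U \<Longrightarrow> (\<And>i. i \<in> I \<Longrightarrow> Ck k q U (f i)) \<Longrightarrow> Ck k q U (\<lambda>x. \<Sum>i\<in>I. f i x)"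
  by (induction I rule: infinite_finite_induct)
     (auto intro!: Ck_add Ck_const dest: open_vecs_subset)

lemma Ck_mult:
  assumes "openin (Euclidean_space q) U"
  shows "Ck k q U f \<Longrightarrow> Ck k q U g \<Longrightarrow> Ck k q U (\<lambda>x. f x * g x)"
proof (induction k arbitrary: f g)
  case 0
  then show ?case using assms by (auto simp: continuous_map_sub_Euclidean_iff open_vecs_subset intro: continuous_on_mult)
next
  case (Suc k)
  show ?case
  proof (rule Ck_SucI'[OF assms, of _ "\<lambda>i x. pd i f x * g x + f x * pd i g x"])
    show "continuous_on U (\<lambda>x. f x * g x)"
      using Suc(2,3) Ck_continuous open_vecs_subset[OF assms] by (blast intro: continuous_on_mult)
    show "((\<lambda>s. f (x(i := s)) * g (x(i := s))) has_real_derivative pd i f x * g x + f x * pd i g x) (at (x i))"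
      if "i < q" "x \<in> U" for i x
      using DERIV_mult[OF Ck_SucD(2)[OF Suc(2) that] Ck_SucD(2)[OF Suc(3) that]]
      by (simp add: mult.commute del: fun_upd_apply)
    show "Ck k q U (\<lambda>x. pd i f x * g x + f x * pd i g x)" if "i < q" for i
      using Suc that by (intro Ck_add[OF assms] Suc.IH) (auto dest: Ck_SucD Ck_Suc_imp)
  qed
qed

subsection \<open>Total differentiability\<close>

text \<open>Continuity of the partial derivatives gives total differentiability: go from x to y
  changing one coordinate at a time, and bound each step by the mean value inequality.\<close>

lemma C1_estimate:
  assumes U: "openin (Euclidean_space q) U" and f: "Ck (Suc 0) q U f" and x: "x \<in> U" and e: "e > 0"
  obtains d where "d > 0"
    "\<And>y. y \<in> vecs q \<Longrightarrow> (\<And>i. i < q \<Longrightarrow> \<bar>y i - x i\<bar> < d) \<Longrightarrow>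
       \<bar>f y - f x - (\<Sum>i<q. pd i f x * (y i - x i))\<bar> \<le> e * (\<Sum>i<q. \<bar>y i - x i\<bar>)"
proof -
  have xv: "x \<in> vecs q" using x open_vecs_subset[OF U] by blast
  \<comment> \<open>The points where every partial derivative is within e of its value at x. This
    set is open by continuity of the derivatives, so it contains a box around x.\<close>
  define N where "N = {z\<in>U. \<forall>i<q. \<bar>pd i f z - pd i f x\<bar> < e}"
  have "openin (Euclidean_space q) {z\<in>U. \<bar>pd i f z - pd i f x\<bar> < e}" if "i < q" for i
  proof -
    have "continuous_on U (pd i f)" 
      using Ck_SucD(1)[OF f that] Ck_continuous open_vecs_subset[OF U] by blast
    then have "openin (Euclidean_space q) {z\<in>U. pd i f z \<in> ball (pd i f x) e}"
      by (intro openin_Euclidean_preimage_open[OF U]) auto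
    then show ?thesis by (simp add: dist_real_def abs_minus_commute)
  qed
  then have "openin (Euclidean_space q) (\<Inter> (insert U ((\<lambda>i. {z\<in>U. \<bar>pd i f z - pd i f x\<bar> < e}) ` {..<q})))"
    using U by (intro openin_Inter) auto
  moreover have "\<Inter> (insert U ((\<lambda>i. {z\<in>U. \<bar>pd i f z - pd i f x\<bar> < e}) ` {..<q})) = N"
    unfolding N_def by auto
  ultimately have "openin (Euclidean_space q) N" by simp
  moreover have "x \<in> N" unfolding N_def using x e by auto
  ultimately obtain d where d: "d > 0" "\<And>y. y \<in> vecs q \<Longrightarrow> (\<And>i. i < q \<Longrightarrow> \<bar>y i - x i\<bar> < d) \<Longrightarrow> y \<in> N"
    using open_vecs_box by metis
  have "\<bar>f y - f x - (\<Sum>i<q. pd i f x * (y i - x i))\<bar> \<le> e * (\<Sum>i<q. \<bar>y i - x i\<bar>)"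
    if y: "y \<in> vecs q" "\<And>i. i < q \<Longrightarrow> \<bar>y i - x i\<bar> < d" for y
  proof -
    \<comment> \<open>The path from x to y, after the first k coordinates have moved.\<close>
    define z where "z k = (\<lambda>i. if i < k then y i else x i)" for k :: nat
    have step: "\<bar>f (z (Suc k)) - f (z k) - pd k f x * (y k - x k)\<bar> \<le> e * \<bar>y k - x k\<bar>" if k: "k < q" for k
    proof -
      have in_N: "(z k)(k := s) \<in> N" if "s \<in> ball (x k) d" for s
        using that y xv k d(1) by (intro d(2)) (auto simp: z_def in_vecs_iff dist_real_def abs_minus_commute)
      have "((\<lambda>s. f ((z k)(k := s)) - pd k f x * s) has_real_derivative
          (pd k f ((z k)(k := s)) - pd k f x)) (at s within ball (x k) d)" if "s \<in> ball (x k) d" for s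
        using Ck_SucD_upd[OF f k, of "z k" s] in_N[OF that]
        by (auto simp: N_def intro!: derivative_eq_intros intro: has_field_derivative_at_within)
      moreover have "norm (pd k f ((z k)(k := s)) - pd k f x) \<le> e" if "s \<in> ball (x k) d" for s
        using in_N[OF that] k by (auto simp: N_def less_imp_le)
      ultimately have "norm ((f ((z k)(k := y k)) - pd k f x * y k) - (f ((z k)(k := x k)) - pd k f x * x k))
          \<le> e * norm (y k - x k)"
        using y(2)[OF k] d(1)
        by (intro field_differentiable_bound[where S = "ball (x k) d" and
              f' = "\<lambda>s. pd k f ((z k)(k := s)) - pd k f x" and f = "\<lambda>s. f ((z k)(k := s)) - pd k f x * s"])
           (simp_all add: dist_real_def abs_minus_commute del: fun_upd_apply)
      moreover have "(z k)(k := y k) = z (Suc k)" "(z k)(k := x k) = z k"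
        by (auto simp: z_def fun_eq_iff less_Suc_eq)
      ultimately show ?thesis by (simp add: algebra_simps)
    qed
    have "z 0 = x" "z q = y" using xv y by (auto simp: z_def fun_eq_iff in_vecs_iff)
    then have "f y - f x = (\<Sum>k<q. f (z (Suc k)) - f (z k))"
      using sum_lessThan_telescope[of "\<lambda>k. f (z k)" q] by simp
    then have "f y - f x - (\<Sum>i<q. pd i f x * (y i - x i)) = (\<Sum>k<q. f (z (Suc k)) - f (z k) - pd k f x * (y k - x k))"
      by (simp add: sum_subtractf)
    also have "\<bar>\<dots>\<bar> \<le> (\<Sum>k<q. e * \<bar>y k - x k\<bar>)"
      by (rule order_trans[OF sum_abs]) (intro sum_mono, use step in auto)
    finally show ?thesis by (simp add: sum_distrib_left)
  qed
  with d(1) that show ?thesis by blast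
qed

text \<open>Divide the estimate of \<open>C1_estimate\<close> at \<gamma> s by s - s0. The curve has
  to be differentiable only at s0, coordinate by coordinate, so the rule applies to the image of a
  coordinate line under a map.\<close>

lemma chain_rule_curve:
  assumes U: "openin (Euclidean_space q) U" and f: "Ck (Suc 0) q U f" and x: "\<gamma> s0 \<in> U"
    and v: "\<forall>\<^sub>F s in at s0. \<gamma> s \<in> vecs q"
    and g: "\<And>i. i < q \<Longrightarrow> ((\<lambda>s. \<gamma> s i) has_real_derivative g i) (at s0)"
  shows "((\<lambda>s. f (\<gamma> s)) has_real_derivative (\<Sum>i<q. pd i f (\<gamma> s0) * g i)) (at s0)"
proof -
  define x where "x = \<gamma> s0"
  define Q where "Q i s = (\<gamma> s i - x i) / (s - s0)" for i s
  have Q: "(Q i \<longlongrightarrow> g i) (at s0)" if "i < q" for i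
    using g[OF that] unfolding Q_def x_def has_field_derivative_iff by simp
  define R where "R s = (f (\<gamma> s) - f x) / (s - s0) - (\<Sum>i<q. pd i f x * Q i s)" for s
  \<comment> \<open>Strictly above the limit of the sum of the |Q i s|, so it eventually bounds that
    sum; the estimate, taken with e'/B, then keeps the remainder below e'.\<close>
  define B where "B = 1 + (\<Sum>i<q. \<bar>g i\<bar>)"
  have B: "B > 0" unfolding B_def by (smt (verit) sum_nonneg abs_ge_zero)
  have evB: "\<forall>\<^sub>F s in at s0. (\<Sum>i<q. \<bar>Q i s\<bar>) < B"
  proof -
    have "((\<lambda>s. \<Sum>i<q. \<bar>Q i s\<bar>) \<longlongrightarrow> (\<Sum>i<q. \<bar>g i\<bar>)) (at s0)"
      by (intro tendsto_intros Q) auto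
    then show ?thesis by (rule order_tendstoD) (simp add: B_def)
  qed
  have "(R \<longlongrightarrow> 0) (at s0)"
  proof (rule tendstoI)
    fix e' :: real assume e': "e' > 0"
    obtain d where d: "d > 0" "\<And>y. y \<in> vecs q \<Longrightarrow> (\<And>i. i < q \<Longrightarrow> \<bar>y i - x i\<bar> < d) \<Longrightarrow>
       \<bar>f y - f x - (\<Sum>i<q. pd i f x * (y i - x i))\<bar> \<le> (e'/B) * (\<Sum>i<q. \<bar>y i - x i\<bar>)"
      using C1_estimate[OF U f, of x "e'/B"] assms(3) e' B unfolding x_def by auto
    have "\<forall>\<^sub>F s in at s0. \<bar>\<gamma> s i - x i\<bar> < d" if "i < q" for i
    proof -
      have "((\<lambda>s. \<gamma> s i) \<longlongrightarrow> x i) (at s0)"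
        using DERIV_isCont[OF g[OF that]] by (simp add: isCont_def x_def)
      then show ?thesis using tendstoD[of _ "x i" _ d] d(1) by (simp add: dist_real_def)
    qed
    then have "\<forall>\<^sub>F s in at s0. \<forall>i\<in>{..<q}. \<bar>\<gamma> s i - x i\<bar> < d"
      by (intro eventually_ball_finite) auto
    then show "\<forall>\<^sub>F s in at s0. dist (R s) 0 < e'"
      using v evB eventually_neq_at_within[of s0 s0 UNIV]
    proof eventually_elim
      case (elim s)
      have ne: "\<bar>s - s0\<bar> > 0" using elim by auto
      have "R s * (s - s0) = f (\<gamma> s) - f x - (\<Sum>i<q. pd i f x * (\<gamma> s i - x i))"
        using elim(4) by (simp add: R_def Q_def left_diff_distrib sum_distrib_right diff_divide_distrib[symmetric] divide_simps)
      then have "\<bar>R s\<bar> * \<bar>s - s0\<bar> \<le> (e'/B) * (\<Sum>i<q. \<bar>\<gamma> s i - x i\<bar>)"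
        using d(2)[of "\<gamma> s"] elim by (simp add: abs_mult[symmetric])
      also have "(\<Sum>i<q. \<bar>\<gamma> s i - x i\<bar>) = (\<Sum>i<q. \<bar>Q i s\<bar>) * \<bar>s - s0\<bar>"
        using ne by (simp add: Q_def abs_divide sum_distrib_right)
      finally have "\<bar>R s\<bar> \<le> (e'/B) * (\<Sum>i<q. \<bar>Q i s\<bar>)"
        using ne mult_right_le_imp_le[of "\<bar>R s\<bar>" "\<bar>s - s0\<bar>"] by (simp only: mult.assoc[symmetric])
      also have "\<dots> < (e'/B) * B" using elim(3) e' B by (intro mult_strict_left_mono) auto
      finally show ?case using B by simp
    qed
  qed
  moreover have "((\<lambda>s. \<Sum>i<q. pd i f x * Q i s) \<longlongrightarrow> (\<Sum>i<q. pd i f x * g i)) (at s0)"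
    by (intro tendsto_intros Q) auto
  ultimately have "((\<lambda>s. R s + (\<Sum>i<q. pd i f x * Q i s)) \<longlongrightarrow> 0 + (\<Sum>i<q. pd i f x * g i)) (at s0)"
    by (rule tendsto_add)
  then show ?thesis unfolding has_field_derivative_iff R_def x_def by simp
qed

subsection \<open>Smooth functions and maps\<close>

lemma smooth_on_continuous: "smooth_on q U f \<Longrightarrow> U \<subseteq> vecs q \<Longrightarrow> continuous_on U f"
  using Ck_continuous unfolding smooth_on_def by blast

lemma smooth_on_pd: "smooth_on q U f \<Longrightarrow> i < q \<Longrightarrow> smooth_on q U (pd i f)"
  unfolding smooth_on_def using Ck_SucD(1) by blast

lemma smooth_on_DERIV:
  "smooth_on q U f \<Longrightarrow> i < q \<Longrightarrow> x \<in> U \<Longrightarrow> ((\<lambda>s. f (x(i := s))) has_real_derivative pd i f x) (at (x i))"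
  unfolding smooth_on_def using Ck_SucD(2) by blast

lemma smooth_on_DERIV_upd:
  "smooth_on q U f \<Longrightarrow> i < q \<Longrightarrow> x(i := t) \<in> U \<Longrightarrow>
    ((\<lambda>s. f (x(i := s))) has_real_derivative pd i f (x(i := t))) (at t)"
  unfolding smooth_on_def using Ck_SucD_upd by blast

lemma smooth_on_cong:
  "openin (Euclidean_space q) U \<Longrightarrow> (\<And>x. x \<in> U \<Longrightarrow> f x = g x) \<Longrightarrow> smooth_on q U f \<longleftrightarrow> smooth_on q U g"
  unfolding smooth_on_def using Ck_cong_imp by metis

lemma smooth_on_subset: "smooth_on q U f \<Longrightarrow> V \<subseteq> U \<Longrightarrow> U \<subseteq> vecs q \<Longrightarrow> smooth_on q V f"
  unfolding smooth_on_def using Ck_subset by blast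

lemma smooth_on_local:
  assumes "openin (Euclidean_space q) U"
    and "\<And>x. x \<in> U \<Longrightarrow> \<exists>V. openin (Euclidean_space q) V \<and> x \<in> V \<and> smooth_on q (U \<inter> V) f"
  shows "smooth_on q U f"
  unfolding smooth_on_def
proof
  fix k show "Ck k q U f"
    by (rule Ck_local[OF assms(1)]) (use assms(2) in \<open>auto simp: smooth_on_def\<close>)
qed

lemma smooth_on_const: "U \<subseteq> vecs q \<Longrightarrow> smooth_on q U (\<lambda>x. c)"
  unfolding smooth_on_def using Ck_const by blast

lemma smooth_on_coord: "U \<subseteq> vecs q \<Longrightarrow> smooth_on q U (\<lambda>x. x j)"
  unfolding smooth_on_def using Ck_coord by blast

lemma smooth_on_add:
  "openin (Euclidean_space q) U \<Longrightarrow> smooth_on q U f \<Longrightarrow> smooth_on q U g \<Longrightarrow> smooth_on q U (\<lambda>x. f x + g x)"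
  unfolding smooth_on_def using Ck_add by blast

lemma smooth_on_mult:
  "openin (Euclidean_space q) U \<Longrightarrow> smooth_on q U f \<Longrightarrow> smooth_on q U g \<Longrightarrow> smooth_on q U (\<lambda>x. f x * g x)"
  unfolding smooth_on_def using Ck_mult by blast

lemma smooth_on_cmult:
  "openin (Euclidean_space q) U \<Longrightarrow> smooth_on q U f \<Longrightarrow> smooth_on q U (\<lambda>x. c * f x)"
  by (rule smooth_on_mult) (auto intro: smooth_on_const dest: open_vecs_subset)

lemma smooth_on_diff:
  assumes "openin (Euclidean_space q) U" "smooth_on q U f" "smooth_on q U g"
  shows "smooth_on q U (\<lambda>x. f x - g x)"
  using smooth_on_add[OF assms(1,2) smooth_on_cmult[OF assms(1,3), of "-1"]] by simp

lemma smooth_on_sum: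
  "openin (Euclidean_space q) U \<Longrightarrow> (\<And>i. i \<in> I \<Longrightarrow> smooth_on q U (f i)) \<Longrightarrow> smooth_on q U (\<lambda>x. \<Sum>i\<in>I. f i x)"
  by (induction I rule: infinite_finite_induct)
     (auto intro!: smooth_on_add smooth_on_const dest: open_vecs_subset)

lemma smooth_on_prod:
  "openin (Euclidean_space q) U \<Longrightarrow> (\<And>i. i \<in> I \<Longrightarrow> smooth_on q U (f i)) \<Longrightarrow> smooth_on q U (\<lambda>x. \<Prod>i\<in>I. f i x)"
  by (induction I rule: infinite_finite_induct)
     (auto intro!: smooth_on_mult smooth_on_const dest: open_vecs_subset)

text \<open>Smoothness speaks of the first n coordinates; the others vanish because the image lies
  in \<open>vecs n\<close>.\<close>

lemma smooth_map_on_continuous: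
  assumes "smooth_map_on q U n h" "U \<subseteq> vecs q"
  shows "continuous_on U h"
proof (rule continuous_on_coordinatewise_then_product)
  fix j show "continuous_on U (\<lambda>x. h x j)"
  proof (cases "j < n")
    case True
    then show ?thesis using assms smooth_on_continuous by (auto simp: smooth_map_on_def)
  next
    case False
    then have "h x j = 0" if "x \<in> U" for x 
      using assms that unfolding smooth_map_on_def by (metis image_subset_iff in_vecs_iff not_less)
    then show ?thesis using continuous_on_cong[of U U "\<lambda>x. h x j" "\<lambda>x. 0"] by auto
  qed
qed

lemma chain_rule_pd:
  assumes U: "openin (Euclidean_space q) U" and V: "openin (Euclidean_space n) V"
    and f: "Ck (Suc 0) n V f" and h: "\<And>j. j < n \<Longrightarrow> Ck (Suc 0) q U (\<lambda>x. h x j)"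
    and hU: "h ` U \<subseteq> V" and x: "x \<in> U" and i: "i < q"
  shows "((\<lambda>s. f (h (x(i := s)))) has_real_derivative
      (\<Sum>j<n. pd j f (h x) * pd i (\<lambda>x. h x j) x)) (at (x i))"
proof -
  have "\<forall>\<^sub>F s in at (x i). h (x(i := s)) \<in> vecs n"
  proof -
    have "\<forall>\<^sub>F s in at (x i). x(i := s) \<in> U"
      using eventually_upd_in_open[OF U x i] by (auto simp: eventually_at_filter elim: eventually_mono)
    then show ?thesis by eventually_elim (use hU open_vecs_subset[OF V] in auto)
  qed
  then have "((\<lambda>s. f (h (x(i := s)))) has_real_derivative
      (\<Sum>j<n. pd j f (h (x(i := x i))) * pd i (\<lambda>x. h x j) x)) (at (x i))"
    using hU x i Ck_SucD(2)[OF h i x]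
    by (intro chain_rule_curve[OF V f, where \<gamma> = "\<lambda>s. h (x(i := s))"]) auto
  then show ?thesis by simp
qed

text \<open>Induction on the order of differentiability, with f arbitrary: by the chain rule the
  derivatives of the composite are sums of products of derivatives of h with composites of
  \<open>pd j f\<close> and h, which are again of the same kind.\<close>

lemma smooth_on_compose:
  assumes U: "openin (Euclidean_space q) U" and V: "openin (Euclidean_space n) V"
    and f: "smooth_on n V f" and h: "smooth_map_on q U n h" and hU: "h ` U \<subseteq> V"
  shows "smooth_on q U (\<lambda>x. f (h x))"
proof -
  have hj: "Ck k q U (\<lambda>x. h x j)" if "j < n" for j k
    using h that by (auto simp: smooth_map_on_def smooth_on_def)
  have cont: "continuous_on U h"
    using smooth_map_on_continuous[OF h open_vecs_subset[OF U]] .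
  have "\<forall>f. smooth_on n V f \<longrightarrow> Ck k q U (\<lambda>x. f (h x))" for k
  proof (induction k)
    case 0
    have "continuous_on U (\<lambda>x. f (h x))" if "smooth_on n V f" for f
      by (rule continuous_on_compose2[OF smooth_on_continuous[OF that open_vecs_subset[OF V]] cont hU])
    then show ?case using open_vecs_subset[OF U] by (auto simp: continuous_map_sub_Euclidean_iff)
  next
    case (Suc k)
    show ?case
    proof (intro allI impI)
      fix f assume f: "smooth_on n V f"
      show "Ck (Suc k) q U (\<lambda>x. f (h x))"
      proof (rule Ck_SucI'[OF U, where f' = "\<lambda>i x. \<Sum>j<n. pd j f (h x) * pd i (\<lambda>x. h x j) x"])
        show "continuous_on U (\<lambda>x. f (h x))"
          by (rule continuous_on_compose2[OF smooth_on_continuous[OF f open_vecs_subset[OF V]] cont hU])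
        show "((\<lambda>s. f (h (x(i := s)))) has_real_derivative
            (\<Sum>j<n. pd j f (h x) * pd i (\<lambda>x. h x j) x)) (at (x i))" if "i < q" "x \<in> U" for i x
          using f by (intro chain_rule_pd[OF U V _ hj hU that(2,1)]) (auto simp: smooth_on_def)
        show "Ck k q U (\<lambda>x. \<Sum>j<n. pd j f (h x) * pd i (\<lambda>x. h x j) x)" if "i < q" for i
        proof -
          have "Ck k q U (\<lambda>x. pd j f (h x) * pd i (\<lambda>x. h x j) x)" if "j < n" for j
            using Suc smooth_on_pd[OF f that] Ck_SucD(1)[OF hj[OF that] \<open>i < q\<close>]
            by (intro Ck_mult[OF U]) auto
          then show ?thesis by (intro Ck_sum[OF U]) auto
        qed
      qed
    qed
  qed
  then show ?thesis using f unfolding smooth_on_def by blast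
qed

lemma pd_compose:
  assumes U: "openin (Euclidean_space q) U" and V: "openin (Euclidean_space n) V"
    and f: "smooth_on n V f" and h: "smooth_map_on q U n h" and hU: "h ` U \<subseteq> V"
    and x: "x \<in> U" and i: "i < q"
  shows "pd i (\<lambda>x. f (h x)) x = (\<Sum>j<n. pd j f (h x) * pd i (\<lambda>x. h x j) x)"
proof -
  have "((\<lambda>s. f (h (x(i := s)))) has_real_derivative
      (\<Sum>j<n. pd j f (h x) * pd i (\<lambda>x. h x j) x)) (at (x i))"
    using f h by (intro chain_rule_pd[OF U V _ _ hU x i]) (auto simp: smooth_on_def smooth_map_on_def)
  then show ?thesis unfolding pd_def[of i "\<lambda>x. f (h x)"] by (rule DERIV_imp_deriv)
qed

lemma pd_const: "pd i (\<lambda>x. c) x = 0"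
  unfolding pd_def by simp

lemma pd_coord: "pd i (\<lambda>x. x j) x = (if i = j then 1 else 0)"
proof -
  have "((\<lambda>s. (x(i := s)) j) has_real_derivative (if i = j then 1 else 0)) (at (x i))"
    by (auto intro!: derivative_eq_intros)
  then show ?thesis unfolding pd_def by (rule DERIV_imp_deriv)
qed

lemma pd_add:
  assumes "smooth_on q U f" "smooth_on q U g" "x \<in> U" "i < q"
  shows "pd i (\<lambda>x. f x + g x) x = pd i f x + pd i g x"
  using DERIV_imp_deriv[OF DERIV_add[OF smooth_on_DERIV[OF assms(1,4,3)] smooth_on_DERIV[OF assms(2,4,3)]]]
  by (simp add: pd_def)

lemma pd_mult:
  assumes "smooth_on q U f" "smooth_on q U g" "x \<in> U" "i < q"
  shows "pd i (\<lambda>x. f x * g x) x = pd i f x * g x + f x * pd i g x"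
  using DERIV_imp_deriv[OF DERIV_mult[OF smooth_on_DERIV[OF assms(1,4,3)] smooth_on_DERIV[OF assms(2,4,3)]]]
  by (simp add: pd_def mult.commute)

lemma pd_cmult:
  assumes "smooth_on q U f" "x \<in> U" "i < q"
  shows "pd i (\<lambda>x. c * f x) x = c * pd i f x"
  using DERIV_imp_deriv[OF DERIV_cmult[OF smooth_on_DERIV[OF assms(1,3,2)], of c]]
  by (simp add: pd_def)

lemma pd_sum:
  assumes "openin (Euclidean_space q) U" "\<And>j. j \<in> J \<Longrightarrow> smooth_on q U (f j)" "x \<in> U" "i < q"
  shows "pd i (\<lambda>x. \<Sum>j\<in>J. f j x) x = (\<Sum>j\<in>J. pd i (f j) x)"
  using assms(2)
proof (induction J rule: infinite_finite_induct)
  case (insert j J)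
  have "pd i (\<lambda>x. f j x + (\<Sum>j\<in>J. f j x)) x = pd i (f j) x + pd i (\<lambda>x. \<Sum>j\<in>J. f j x) x"
    using insert by (intro pd_add[of q U] smooth_on_sum[OF assms(1)] assms(3,4)) auto
  with insert show ?case by simp
qed (auto simp: pd_const)

subsection \<open>Symmetry of second derivatives\<close>

text \<open>The mean value theorem, applied first along i and then along j, turns the second
  difference over a square of side h into a mixed derivative at some point of the box. As the second
  difference is symmetric in i and j, both mixed derivatives are reached this way.\<close>

lemma mixed_difference:
  assumes U: "openin (Euclidean_space q) U" and f: "smooth_on q U f"
    and ij: "i < q" "j < q" "i \<noteq> j" and h: "h > 0"
    and box: "\<And>y. y \<in> vecs q \<Longrightarrow> (\<And>k. k < q \<Longrightarrow> \<bar>y k - x k\<bar> \<le> h) \<Longrightarrow> y \<in> U" and x: "x \<in> vecs q"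
  obtains z where "z \<in> vecs q" "\<And>k. k < q \<Longrightarrow> \<bar>z k - x k\<bar> \<le> h"
    "f (x(i := x i + h, j := x j + h)) - f (x(i := x i + h)) - f (x(j := x j + h)) + f x = h * (h * pd j (pd i f) z)"
proof -
  have inU: "x(j := t, i := s) \<in> U" if "\<bar>s - x i\<bar> \<le> h" "\<bar>t - x j\<bar> \<le> h" for s t
    using that ij h x by (intro box) (auto simp: in_vecs_iff)
  define \<phi> where "\<phi> s = f (x(j := x j + h, i := s)) - f (x(j := x j, i := s))" for s
  have "DERIV \<phi> s :> pd i f (x(j := x j + h, i := s)) - pd i f (x(j := x j, i := s))" 
    if "x i \<le> s" "s \<le> x i + h" for s
    unfolding \<phi>_def using that h inU[of s "x j + h"] inU[of s "x j"]
    by (intro DERIV_diff smooth_on_DERIV_upd[OF f ij(1)]) auto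
  then obtain \<xi> where \<xi>: "x i < \<xi>" "\<xi> < x i + h" 
    "\<phi> (x i + h) - \<phi> (x i) = (x i + h - x i) * (pd i f (x(j := x j + h, i := \<xi>)) - pd i f (x(j := x j, i := \<xi>)))"
    using MVT2[of "x i" "x i + h" \<phi> "\<lambda>s. pd i f (x(j := x j + h, i := s)) - pd i f (x(j := x j, i := s))"] h by auto
  define \<psi> where "\<psi> t = pd i f (x(i := \<xi>, j := t))" for t
  have "DERIV \<psi> t :> pd j (pd i f) (x(i := \<xi>, j := t))" if "x j \<le> t" "t \<le> x j + h" for t
    unfolding \<psi>_def using that h inU[of \<xi> t] \<xi>(1,2) ij(3)
    by (intro smooth_on_DERIV_upd[OF smooth_on_pd[OF f ij(1)] ij(2)]) (auto simp: fun_upd_twist)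
  then obtain \<eta> where \<eta>: "x j < \<eta>" "\<eta> < x j + h"
    "\<psi> (x j + h) - \<psi> (x j) = (x j + h - x j) * pd j (pd i f) (x(i := \<xi>, j := \<eta>))"
    using MVT2[of "x j" "x j + h" \<psi> "\<lambda>t. pd j (pd i f) (x(i := \<xi>, j := t))"] h by auto
  have "\<phi> (x i + h) - \<phi> (x i) = h * (h * pd j (pd i f) (x(i := \<xi>, j := \<eta>)))"
  proof -
    have "x(i := \<xi>, j := x j) = x(i := \<xi>)" "x(j := x j + h, i := \<xi>) = x(i := \<xi>, j := x j + h)"
      using ij(3) by auto
    with \<xi>(3) \<eta>(3) show ?thesis unfolding \<psi>_def by simp
  qed
  moreover have "x(i := \<xi>, j := \<eta>) \<in> vecs q" using x ij by (auto simp: in_vecs_iff)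
  moreover have "\<bar>(x(i := \<xi>, j := \<eta>)) k - x k\<bar> \<le> h" for k using \<xi> \<eta> h by auto
  moreover have "\<phi> (x i + h) - \<phi> (x i) = 
      f (x(i := x i + h, j := x j + h)) - f (x(i := x i + h)) - f (x(j := x j + h)) + f x"
    using ij(3) unfolding \<phi>_def by (simp add: fun_upd_twist fun_upd_idem)
  ultimately show ?thesis using that by metis
qed

lemma pd_commute:
  assumes U: "openin (Euclidean_space q) U" and f: "smooth_on q U f"
    and ij: "i < q" "j < q" and x: "x \<in> U"
  shows "pd i (pd j f) x = pd j (pd i f) x"
proof (cases "i = j")
  case False
  have xv: "x \<in> vecs q" using x open_vecs_subset[OF U] by blast
  define N where "N e a b = {z\<in>U. pd a (pd b f) z \<in> ball (pd a (pd b f) x) e}" for e a b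
  have N: "openin (Euclidean_space q) (N e a b)" if "a < q" "b < q" for e a b
    unfolding N_def using f that
    by (intro openin_Euclidean_preimage_open[OF U] smooth_on_continuous[of q] smooth_on_pd open_vecs_subset[OF U]) auto
  have "dist (pd i (pd j f) x) (pd j (pd i f) x) < e" if e: "e > 0" for e
  proof -
    have "openin (Euclidean_space q) (N (e/2) i j \<inter> N (e/2) j i)"
      using N ij by (intro openin_Int) auto
    moreover have "x \<in> N (e/2) i j \<inter> N (e/2) j i" using x e by (auto simp: N_def)
    ultimately obtain d where d: "d > 0" 
      "\<And>y. y \<in> vecs q \<Longrightarrow> (\<And>k. k < q \<Longrightarrow> \<bar>y k - x k\<bar> < d) \<Longrightarrow> y \<in> N (e/2) i j \<inter> N (e/2) j i"
      using open_vecs_box by metis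
    define h where "h = d / 2"
    have h: "h > 0" "h < d" using d(1) by (auto simp: h_def)
    have box: "y \<in> N (e/2) i j \<inter> N (e/2) j i" if "y \<in> vecs q" "\<And>k. k < q \<Longrightarrow> \<bar>y k - x k\<bar> \<le> h" for y
      using d(2)[OF that(1)] that(2) h(2) by (meson le_less_trans)
    then have boxU: "y \<in> U" if "y \<in> vecs q" "\<And>k. k < q \<Longrightarrow> \<bar>y k - x k\<bar> \<le> h" for y
      using that by (auto simp: N_def)
    obtain z where z: "z \<in> vecs q" "\<And>k. k < q \<Longrightarrow> \<bar>z k - x k\<bar> \<le> h"
      "f (x(i := x i + h, j := x j + h)) - f (x(i := x i + h)) - f (x(j := x j + h)) + f x = h * (h * pd j (pd i f) z)"
      using mixed_difference[OF U f ij False h(1) boxU xv] by blast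
    obtain w where w: "w \<in> vecs q" "\<And>k. k < q \<Longrightarrow> \<bar>w k - x k\<bar> \<le> h"
      "f (x(j := x j + h, i := x i + h)) - f (x(j := x j + h)) - f (x(i := x i + h)) + f x = h * (h * pd i (pd j f) w)"
      using mixed_difference[OF U f ij(2,1) _ h(1) boxU xv] False by metis
    \<comment> \<open>The two mixed derivatives, at two points of the same small box, both arise
      from one second difference. Continuity then carries the equality to x.\<close>
    have "h * (h * pd i (pd j f) w) = h * (h * pd j (pd i f) z)"
      using z(3) w(3) unfolding fun_upd_twist[OF False, of x "x i + h" "x j + h"] by linarith
    then have eq: "pd i (pd j f) w = pd j (pd i f) z" using h by simp
    have "dist (pd i (pd j f) x) (pd i (pd j f) w) < e/2" "dist (pd j (pd i f) x) (pd j (pd i f) z) < e/2"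
      using box[OF w(1,2)] box[OF z(1,2)] by (auto simp: N_def)
    then show ?thesis unfolding eq dist_real_def by linarith
  qed
  then have "\<not> dist (pd i (pd j f) x) (pd j (pd i f) x) > 0" by blast
  then show ?thesis by (simp del: zero_less_dist_iff add: zero_less_dist_iff)
qed auto

section \<open>Alternating forms, by recursion on the first argument\<close>

text \<open>Recursion on the degree matches induction on the list of vectors. Linearity and
  vanishing on a repeated vector are demanded in the leading places only; the recursive clause
  spreads them to the later ones. Values off the domain are zero by definition, as in
  \<open>smooth_form\<close>.\<close>

fun alt :: "nat \<Rightarrow> nat \<Rightarrow> ((nat \<Rightarrow> real) list \<Rightarrow> real) \<Rightarrow> bool" where
  "alt q 0 a \<longleftrightarrow> (\<forall>vs. vs \<noteq> [] \<longrightarrow> a vs = 0)"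
| "alt q (Suc p) a \<longleftrightarrow> a [] = 0 \<and> (\<forall>v vs. v \<notin> vecs q \<longrightarrow> a (v # vs) = 0) \<and>
     (\<forall>v\<in>vecs q. alt q p (\<lambda>vs. a (v # vs))) \<and>
     (\<forall>v\<in>vecs q. \<forall>w\<in>vecs q. \<forall>c d vs. a ((\<lambda>k. c * v k + d * w k) # vs) = c * a (v # vs) + d * a (w # vs)) \<and>
     (\<forall>v vs. a (v # v # vs) = 0)"

lemma vecs_lin: "v \<in> vecs q \<Longrightarrow> w \<in> vecs q \<Longrightarrow> (\<lambda>k. c * v k + d * w k) \<in> vecs q"
  by (simp add: in_vecs_iff)

lemma alt_zero: "alt q p (\<lambda>vs. 0)"
  by (induction p) auto

lemma alt_lin: "alt q p a \<Longrightarrow> alt q p b \<Longrightarrow> alt q p (\<lambda>vs. c * a vs + d * b vs)"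
  by (induction p arbitrary: a b) (auto simp: algebra_simps)

lemma alt_add: "alt q p a \<Longrightarrow> alt q p b \<Longrightarrow> alt q p (\<lambda>vs. a vs + b vs)"
  using alt_lin[of q p a b 1 1] by simp

lemma alt_cmult: "alt q p a \<Longrightarrow> alt q p (\<lambda>vs. c * a vs)"
  using alt_lin[of q p a a c 0] by simp

lemma alt_diff: "alt q p a \<Longrightarrow> alt q p b \<Longrightarrow> alt q p (\<lambda>vs. a vs - b vs)"
  using alt_lin[of q p a b 1 "-1"] by simp

lemma alt_tail: "alt q p a \<Longrightarrow> alt q (p - 1) (\<lambda>vs. a (v # vs))"
proof (cases p)
  case (Suc p')
  assume "alt q p a"
  then show ?thesis using Suc alt_zero by (cases "v \<in> vecs q") auto
qed (simp add: alt_zero)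

lemma alt_length: "alt q p a \<Longrightarrow> length vs \<noteq> p \<Longrightarrow> a vs = 0"
proof (induction vs arbitrary: p a)
  case Nil
  then show ?case by (cases p) auto
next
  case (Cons v vs)
  show ?case
  proof (cases p)
    case (Suc p')
    then show ?thesis using Cons(1)[of p' "\<lambda>vs. a (v # vs)"] Cons(2-) by (cases "v \<in> vecs q") auto
  qed (use Cons in auto)
qed

lemma alt_vecs: "alt q p a \<Longrightarrow> \<not> set vs \<subseteq> vecs q \<Longrightarrow> a vs = 0"
proof (induction vs arbitrary: p a)
  case (Cons v vs)
  show ?case
  proof (cases p)
    case (Suc p')
    then show ?thesis using Cons(1)[of p' "\<lambda>vs. a (v # vs)"] Cons(2-) by (cases "v \<in> vecs q") auto
  qed (use Cons in auto)
qed auto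

lemma alt_lin_Cons:
  assumes "alt q p a" "v \<in> vecs q" "w \<in> vecs q"
  shows "a ((\<lambda>k. c * v k + d * w k) # vs) = c * a (v # vs) + d * a (w # vs)"
  using assms by (cases p) auto

text \<open>Polarisation: expand the value on two equal leading arguments v + w.\<close>

lemma alt_swap:
  assumes a: "alt q p a"
  shows "a (v # w # vs) = - a (w # v # vs)"
proof (cases "v \<in> vecs q \<and> w \<in> vecs q")
  case False
  then show ?thesis using alt_vecs[OF a, of "v # w # vs"] alt_vecs[OF a, of "w # v # vs"] by auto
next
  case True
  let ?s = "\<lambda>k. 1 * v k + 1 * w k"
  have "\<forall>u vs. a (u # u # vs) = 0" using a by (cases p) auto
  then have "a (?s # ?s # vs) = 0" "a (v # v # vs) = 0" "a (w # w # vs) = 0" by blast+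
  moreover have "a (?s # ?s # vs) = a (v # ?s # vs) + a (w # ?s # vs)"
    using alt_lin_Cons[OF a, of v w 1 1] True by simp
  moreover have "a (u # ?s # vs) = a (u # v # vs) + a (u # w # vs)" for u
    using alt_lin_Cons[OF alt_tail[OF a, of u], of v w 1 1] True by simp
  ultimately show ?thesis by simp
qed

lemma alt_lin_nth:
  "alt q p a \<Longrightarrow> v \<in> vecs q \<Longrightarrow> w \<in> vecs q \<Longrightarrow> i < length vs \<Longrightarrow>
    a (vs[i := (\<lambda>k. c * v k + d * w k)]) = c * a (vs[i := v]) + d * a (vs[i := w])"
proof (induction vs arbitrary: p a i)
  case (Cons u vs)
  show ?case
  proof (cases i)
    case 0
    then show ?thesis using alt_lin_Cons[OF Cons(2-4)] by simp
  next
    case (Suc i')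
    then show ?thesis using Cons(1)[OF alt_tail[OF Cons(2)] Cons(3,4)] Cons(5) by simp
  qed
qed auto

lemma alt_nth_eq:
  "alt q p a \<Longrightarrow> i < j \<Longrightarrow> j < length vs \<Longrightarrow> vs ! i = vs ! j \<Longrightarrow> a vs = 0"
proof (induction p arbitrary: a vs i j)
  case 0
  then show ?case by (cases vs) auto
next
  case (Suc p)
  note a = Suc.prems(1)
  obtain u us where vs: "vs = u # us" using Suc.prems(3) by (cases vs) auto
  obtain j' where j: "j = Suc j'" using Suc.prems(2) by (cases j) auto
  have IH: "a (w # ws) = 0" if "k < l" "l < length ws" "ws ! k = ws ! l" for w ws k l
    using Suc.IH[of "\<lambda>vs. a (w # vs)", OF _ that] alt_tail[OF a, of w] by simp
  show ?case
  proof (cases i)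
    case 0
    obtain w ws where us: "us = w # ws" using Suc.prems(3) j vs by (cases us) auto
    show ?thesis
    proof (cases j')
      case 0
      then show ?thesis using a Suc.prems(4) \<open>i = 0\<close> vs us j by auto
    next
      case (Suc l)
      \<comment> \<open>Exchanging the first two vectors moves both copies of the repeated vector
        into the tail, where the induction hypothesis applies.\<close>
      have "a (w # u # ws) = 0"
        using IH[of 0 "Suc l" "u # ws" w] Suc.prems(3,4) \<open>i = 0\<close> vs us j Suc by simp
      then show ?thesis using alt_swap[OF a, of u w ws] vs us by simp
    qed
  next
    case (Suc i')
    then show ?thesis using IH[of i' j' us u] Suc.prems vs j by simp
  qed
qed

text \<open>The bridge from the positional conditions in \<open>smooth_form\<close> to the recursive
  notion.\<close>

lemma altI:
  assumes "\<And>vs. \<not> (set vs \<subseteq> vecs q \<and> length vs = p) \<Longrightarrow> a vs = 0"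
    and "\<And>vs i v w c d. set vs \<subseteq> vecs q \<Longrightarrow> length vs = p \<Longrightarrow> i < p \<Longrightarrow> v \<in> vecs q \<Longrightarrow> w \<in> vecs q \<Longrightarrow>
      a (vs[i := (\<lambda>k. c * v k + d * w k)]) = c * a (vs[i := v]) + d * a (vs[i := w])"
    and "\<And>vs i j. set vs \<subseteq> vecs q \<Longrightarrow> length vs = p \<Longrightarrow> i < p \<Longrightarrow> j < p \<Longrightarrow> i \<noteq> j \<Longrightarrow> vs ! i = vs ! j \<Longrightarrow> a vs = 0"
  shows "alt q p a"
  using assms
proof (induction p arbitrary: a)
  case 0
  then show ?case by auto
next
  case (Suc p)
  have "alt q p (\<lambda>vs. a (v # vs))" if v: "v \<in> vecs q" for v
  proof (rule Suc(1))
    show "a (v # vs) = 0" if "\<not> (set vs \<subseteq> vecs q \<and> length vs = p)" for vs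
      using Suc(2)[of "v # vs"] that by auto
    show "a (v # vs[i := \<lambda>k. c * u k + d * w k]) = c * a (v # vs[i := u]) + d * a (v # vs[i := w])"
      if "set vs \<subseteq> vecs q" "length vs = p" "i < p" "u \<in> vecs q" "w \<in> vecs q" for vs i u w c d
      using Suc(3)[of "v # vs" "Suc i" u w c d] that v by simp
    show "a (v # vs) = 0"
      if "set vs \<subseteq> vecs q" "length vs = p" "i < p" "j < p" "i \<noteq> j" "vs ! i = vs ! j" for vs i j
      using Suc(4)[of "v # vs" "Suc i" "Suc j"] that v by simp
  qed
  moreover have "a ((\<lambda>k. c * v k + d * w k) # vs) = c * a (v # vs) + d * a (w # vs)"
    if "v \<in> vecs q" "w \<in> vecs q" for v w c d vs
  proof (cases "set vs \<subseteq> vecs q \<and> length vs = p")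
    case True
    then show ?thesis using Suc(3)[of "v # vs" 0 v w c d] that by simp
  next
    case False
    then have "a (u # vs) = 0" for u using Suc(2)[of "u # vs"] by auto
    then show ?thesis by simp
  qed
  moreover have "a (v # v # vs) = 0" for v vs
  proof (cases "set (v # v # vs) \<subseteq> vecs q \<and> length (v # v # vs) = Suc p")
    case True
    then show ?thesis using Suc(4)[of "v # v # vs" 0 1] by auto
  next
    case False
    then show ?thesis using Suc(2) by blast
  qed
  moreover have "a [] = 0" "\<forall>v vs. v \<notin> vecs q \<longrightarrow> a (v # vs) = 0" using Suc(2) by auto
  ultimately show ?case by simp
qed

definition basis_vec :: "nat \<Rightarrow> nat \<Rightarrow> real" where
  "basis_vec k = (\<lambda>i. if i = k then 1 else 0)"

lemma basis_vec_in_vecs: "k < q \<Longrightarrow> basis_vec k \<in> vecs q"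
  by (auto simp: basis_vec_def in_vecs_iff)

text \<open>This expands a pushed-forward vector in the standard basis, so that pullback becomes a
  recursion on the list of vectors.\<close>

lemma alt_expand:
  assumes a: "alt q p a" and v: "v \<in> vecs q"
  shows "a (v # vs) = (\<Sum>k<q. v k * a (basis_vec k # vs))"
proof -
  \<comment> \<open>Induction over the truncations of v to its first n coordinates, adding one basis
    vector at a time.\<close>
  have "n \<le> q \<Longrightarrow> a ((\<lambda>k. if k < n then v k else 0) # vs) = (\<Sum>k<n. v k * a (basis_vec k # vs))" for n
  proof (induction n)
    case 0
    have "(\<lambda>k. 0::real) \<in> vecs q" by (simp add: in_vecs_iff)
    then show ?case using alt_lin_Cons[OF a, of "\<lambda>k. 0" "\<lambda>k. 0" 0 0] by simp
  next
    case (Suc n)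
    have "(\<lambda>k. if k < n then v k else 0) \<in> vecs q" using Suc v by (auto simp: in_vecs_iff)
    moreover have "(\<lambda>k. if k < Suc n then v k else 0) = (\<lambda>k. 1 * (if k < n then v k else 0) + v n * basis_vec n k)"
      by (auto simp: basis_vec_def fun_eq_iff less_Suc_eq)
    ultimately show ?case
      using alt_lin_Cons[OF a, of _ "basis_vec n" 1 "v n" vs] basis_vec_in_vecs[of n q] Suc by simp
  qed
  from this[of q] have "a ((\<lambda>k. if k < q then v k else 0) # vs) = (\<Sum>k<q. v k * a (basis_vec k # vs))" by simp
  moreover have "(\<lambda>k. if k < q then v k else 0) = v" using v by (auto simp: in_vecs_iff fun_eq_iff)
  ultimately show ?thesis by simp
qed

text \<open>The guard restores the vanishing outside \<open>vecs r\<close>, which composition with L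
  alone could lose.\<close>

lemma alt_map:
  assumes L: "\<And>v. v \<in> vecs r \<Longrightarrow> L v \<in> vecs q"
    and lin: "\<And>v w c d. L (\<lambda>k. c * v k + d * w k) = (\<lambda>k. c * L v k + d * L w k)"
  shows "alt q p a \<Longrightarrow> alt r p (\<lambda>ws. if set ws \<subseteq> vecs r then a (map L ws) else 0)"
proof (induction p arbitrary: a)
  case (Suc p)
  have "alt r p (\<lambda>ws. if set (w # ws) \<subseteq> vecs r then a (map L (w # ws)) else 0)" if "w \<in> vecs r" for w
    using Suc(1)[of "\<lambda>ws. a (L w # ws)"] Suc(2) that L by (simp cong: if_cong)
  moreover have "\<forall>u vs. a (u # u # vs) = 0" using Suc(2) by auto
  ultimately show ?case using Suc(2) L vecs_lin[of _ r] by (auto simp: lin)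
qed auto

subsection \<open>Smooth forms\<close>

text \<open>The interior product with the constant field v.\<close>

definition contr :: "(nat \<Rightarrow> real) \<Rightarrow> eform \<Rightarrow> eform" where
  "contr v \<alpha> = (\<lambda>x vs. \<alpha> x (v # vs))"

definition dird :: "nat \<Rightarrow> (nat \<Rightarrow> real) \<Rightarrow> ((nat \<Rightarrow> real) \<Rightarrow> real) \<Rightarrow> (nat \<Rightarrow> real) \<Rightarrow> real" where
  "dird q v f x = (\<Sum>k<q. v k * pd k f x)"

text \<open>The Lie derivative along the constant field v. The flow of such a field is a
  translation, so only the coefficients are differentiated.\<close>

definition lie :: "nat \<Rightarrow> (nat \<Rightarrow> real) set \<Rightarrow> (nat \<Rightarrow> real) \<Rightarrow> eform \<Rightarrow> eform" where
  "lie q U v \<alpha> = (\<lambda>x vs. if x \<in> U then dird q v (\<lambda>y. \<alpha> y vs) x else 0)"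

text \<open>Since \<open>alt\<close> includes the vanishing on lists of the wrong length or with
  foreign vectors, smoothness can be stated for all lists. This removes the side conditions from the
  inductions on lists that follow.\<close>

lemma smooth_form_iff:
  assumes "openin (Euclidean_space q) U"
  shows "smooth_form q U p \<alpha> \<longleftrightarrow>
    (\<forall>x vs. x \<notin> U \<longrightarrow> \<alpha> x vs = 0) \<and> (\<forall>x\<in>U. alt q p (\<alpha> x)) \<and> (\<forall>vs. smooth_on q U (\<lambda>x. \<alpha> x vs))"
proof (intro iffI conjI allI impI ballI)
  assume sf: "smooth_form q U p \<alpha>"
  show "x \<notin> U \<Longrightarrow> \<alpha> x vs = 0" for x vs using sf by (auto simp: smooth_form_def)
  show "alt q p (\<alpha> x)" if "x \<in> U" for x
  proof (rule altI)
    note S = sf[unfolded smooth_form_def, THEN conjunct2, THEN conjunct1, rule_format, OF that]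
    show "\<alpha> x vs = 0" if "\<not> (set vs \<subseteq> vecs q \<and> length vs = p)" for vs
      using sf that by (auto simp: smooth_form_def)
    show "\<alpha> x (vs[i := (\<lambda>k. c * v k + d * w k)]) = c * \<alpha> x (vs[i := v]) + d * \<alpha> x (vs[i := w])"
      if "set vs \<subseteq> vecs q" "length vs = p" "i < p" "v \<in> vecs q" "w \<in> vecs q" for vs i v w c d
      using S[of vs, THEN conjunct1, rule_format, of i v w c d] that by simp
    show "\<alpha> x vs = 0"
      if "set vs \<subseteq> vecs q" "length vs = p" "i < p" "j < p" "i \<noteq> j" "vs ! i = vs ! j" for vs i j
      using S[of vs, THEN conjunct2, rule_format, of i j] that by simp
  qed
  show "smooth_on q U (\<lambda>x. \<alpha> x vs)" for vs
  proof (cases "set vs \<subseteq> vecs q \<and> length vs = p")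
    case True
    then show ?thesis using sf by (auto simp: smooth_form_def)
  next
    case False
    then have "(\<lambda>x. \<alpha> x vs) = (\<lambda>x. 0)" using sf by (auto simp: smooth_form_def)
    then show ?thesis using smooth_on_const open_vecs_subset[OF assms] by simp
  qed
next
  assume *: "(\<forall>x vs. x \<notin> U \<longrightarrow> \<alpha> x vs = 0) \<and> (\<forall>x\<in>U. alt q p (\<alpha> x)) \<and> (\<forall>vs. smooth_on q U (\<lambda>x. \<alpha> x vs))"
  have "\<alpha> x vs = 0" if "\<not> (x \<in> U \<and> set vs \<subseteq> vecs q \<and> length vs = p)" for x vs
    using that * alt_length alt_vecs by blast
  moreover have "\<alpha> x vs = 0" if "x \<in> U" "length vs = p" "i < p" "j < p" "i \<noteq> j" "vs ! i = vs ! j" for x vs i j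
    using that * alt_nth_eq[of q p "\<alpha> x" i j vs] alt_nth_eq[of q p "\<alpha> x" j i vs] by (metis nat_neq_iff)
  moreover have "\<alpha> x (vs[i := (\<lambda>k. c * v k + d * w k)]) = c * \<alpha> x (vs[i := v]) + d * \<alpha> x (vs[i := w])"
    if "x \<in> U" "length vs = p" "i < p" "v \<in> vecs q" "w \<in> vecs q" for x vs i v w c d
    using that * alt_lin_nth by blast
  ultimately show "smooth_form q U p \<alpha>" using *
    by (simp add: smooth_form_def)
qed

lemma dird_const: "dird q v (\<lambda>y. c) x = 0"
  by (simp add: dird_def pd_const)

lemma dird_lin_vec: "dird q (\<lambda>k. c * v k + d * w k) f x = c * dird q v f x + d * dird q w f x"
  by (simp add: dird_def sum.distrib sum_distrib_left algebra_simps)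

lemma dird_basis_vec: "k < q \<Longrightarrow> dird q (basis_vec k) f x = pd k f x"
  by (simp add: dird_def basis_vec_def if_distrib[of "\<lambda>c. c * _"] cong: if_cong)

lemma ext_deriv_Nil: "ext_deriv q U \<alpha> x [] = 0"
  by (simp add: ext_deriv_def)

lemma ext_deriv_outside: "x \<notin> U \<Longrightarrow> ext_deriv q U \<alpha> x vs = 0" "\<not> set vs \<subseteq> vecs q \<Longrightarrow> ext_deriv q U \<alpha> x vs = 0"
  by (auto simp: ext_deriv_def)

lemma ext_deriv_zero: "ext_deriv q U (\<lambda>x vs. 0) = (\<lambda>x vs. 0)"
  by (auto simp: ext_deriv_def pd_const fun_eq_iff)

section \<open>Interior product, Lie derivative and exterior derivative on a fixed open set\<close>

context
  fixes q :: nat and U :: "(nat \<Rightarrow> real) set"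
  assumes U: "openin (Euclidean_space q) U"
begin

lemma smooth_formI:
  assumes "\<And>x vs. x \<notin> U \<Longrightarrow> \<alpha> x vs = 0" "\<And>x. x \<in> U \<Longrightarrow> alt q p (\<alpha> x)" "\<And>vs. smooth_on q U (\<lambda>x. \<alpha> x vs)"
  shows "smooth_form q U p \<alpha>"
  using assms smooth_form_iff[OF U] by blast

lemma smooth_formD:
  assumes "smooth_form q U p \<alpha>"
  shows "x \<notin> U \<Longrightarrow> \<alpha> x vs = 0" "x \<in> U \<Longrightarrow> alt q p (\<alpha> x)" "smooth_on q U (\<lambda>x. \<alpha> x vs)"
  using assms smooth_form_iff[OF U] by blast+

lemma smooth_form_alt: "smooth_form q U p \<alpha> \<Longrightarrow> alt q p (\<alpha> x)"
proof (cases "x \<in> U")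
  case False
  moreover assume "smooth_form q U p \<alpha>"
  ultimately have "\<alpha> x = (\<lambda>vs. 0)" by (intro ext smooth_formD(1))
  then show ?thesis by (simp add: alt_zero)
qed (rule smooth_formD(2))

lemma smooth_form_zero: "smooth_form q U p (\<lambda>x vs. 0)"
  by (intro smooth_formI alt_zero smooth_on_const open_vecs_subset U) auto

lemma smooth_form_lin:
  assumes "smooth_form q U p \<alpha>" "smooth_form q U p \<beta>"
  shows "smooth_form q U p (\<lambda>x vs. c * \<alpha> x vs + d * \<beta> x vs)"
  using smooth_formD[OF assms(1)] smooth_formD[OF assms(2)]
  by (intro smooth_formI alt_lin smooth_on_add[OF U] smooth_on_cmult[OF U]) auto

lemma smooth_form_add:
  assumes "smooth_form q U p \<alpha>" "smooth_form q U p \<beta>"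
  shows "smooth_form q U p (\<lambda>x vs. \<alpha> x vs + \<beta> x vs)"
  using smooth_form_lin[OF assms, of 1 1] by simp

lemma smooth_form_sum:
  "(\<And>j. j \<in> J \<Longrightarrow> smooth_form q U p (\<alpha> j)) \<Longrightarrow> smooth_form q U p (\<lambda>x vs. \<Sum>j\<in>J. \<alpha> j x vs)"
  by (induction J rule: infinite_finite_induct) (auto intro!: smooth_form_zero smooth_form_add)

lemma smooth_form_fmult:
  assumes "smooth_form q U p \<alpha>" "smooth_on q U f"
  shows "smooth_form q U p (\<lambda>x vs. f x * \<alpha> x vs)"
  using smooth_formD[OF assms(1)] assms(2)
  by (intro smooth_formI alt_cmult smooth_on_mult[OF U]) auto

text \<open>For p = 0 the contraction is zero, so the truncated degree 0 is still correct.\<close>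

lemma smooth_form_contr:
  assumes "smooth_form q U p \<alpha>"
  shows "smooth_form q U (p - 1) (contr v \<alpha>)"
  using smooth_formD[OF assms] alt_tail unfolding contr_def by (intro smooth_formI) blast+

lemma contr_degree_0:
  assumes "smooth_form q U 0 \<alpha>"
  shows "contr v \<alpha> = (\<lambda>x vs. 0)"
  using alt_length[OF smooth_form_alt[OF assms]] by (auto simp: contr_def fun_eq_iff)

lemma contr_lin:
  assumes "smooth_form q U p \<alpha>" "v \<in> vecs q" "w \<in> vecs q"
  shows "contr (\<lambda>k. c * v k + d * w k) \<alpha> = (\<lambda>x vs. c * contr v \<alpha> x vs + d * contr w \<alpha> x vs)"
  using alt_lin_Cons[OF smooth_form_alt[OF assms(1)] assms(2,3)] by (auto simp: contr_def fun_eq_iff)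

lemma contr_contr_same:
  assumes "smooth_form q U p \<alpha>"
  shows "contr v (contr v \<alpha>) = (\<lambda>x vs. 0)"
proof -
  have "\<alpha> x (v # v # vs) = 0" for x vs using smooth_form_alt[OF assms, of x] by (cases p) auto
  then show ?thesis by (auto simp: contr_def fun_eq_iff)
qed

lemma contr_contr_swap:
  assumes "smooth_form q U p \<alpha>"
  shows "contr v (contr w \<alpha>) x vs = - contr w (contr v \<alpha>) x vs"
  unfolding contr_def by (rule alt_swap[OF smooth_form_alt[OF assms]])

lemma dird_cong: "x \<in> U \<Longrightarrow> (\<And>y. y \<in> U \<Longrightarrow> f y = g y) \<Longrightarrow> dird q v f x = dird q v g x"
  unfolding dird_def by (intro sum.cong refl arg_cong2[where f = "(*)"] pd_cong[OF U]) auto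

lemma dird_lin:
  assumes "smooth_on q U f" "smooth_on q U g" "x \<in> U"
  shows "dird q v (\<lambda>y. c * f y + d * g y) x = c * dird q v f x + d * dird q v g x"
  using assms pd_add[OF smooth_on_cmult[OF U assms(1)] smooth_on_cmult[OF U assms(2)]]
    pd_cmult[of q U]
  by (simp add: dird_def sum.distrib sum_distrib_left algebra_simps)

lemma dird_mult:
  assumes "smooth_on q U f" "smooth_on q U g" "x \<in> U"
  shows "dird q v (\<lambda>y. f y * g y) x = dird q v f x * g x + f x * dird q v g x"
  using assms pd_mult[of q U f g x]
  by (simp add: dird_def sum.distrib sum_distrib_left sum_distrib_right algebra_simps)

lemma dird_cmult:
  assumes "smooth_on q U f" "x \<in> U"
  shows "dird q v (\<lambda>y. c * f y) x = c * dird q v f x"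
  using dird_lin[OF assms(1,1,2), of v c 0] by simp

lemma dird_sum:
  assumes "\<And>j. j \<in> J \<Longrightarrow> smooth_on q U (f j)" "x \<in> U"
  shows "dird q v (\<lambda>y. \<Sum>j\<in>J. f j y) x = (\<Sum>j\<in>J. dird q v (f j) x)"
  unfolding dird_def using assms pd_sum[OF U, of J f] 
  by (simp add: sum_distrib_left) (rule sum.swap)

lemma smooth_on_dird: "smooth_on q U f \<Longrightarrow> smooth_on q U (dird q v f)"
  unfolding dird_def using smooth_on_pd by (intro smooth_on_sum[OF U] smooth_on_cmult[OF U]) auto

lemma dird_commute:
  assumes f: "smooth_on q U f" and x: "x \<in> U"
  shows "dird q v (dird q w f) x = dird q w (dird q v f) x"
proof -
  have *: "dird q v (dird q w f) x = (\<Sum>k<q. \<Sum>l<q. v k * (w l * pd k (pd l f) x))" for v w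
  proof -
    have "pd k (\<lambda>x. \<Sum>l<q. w l * pd l f x) x = (\<Sum>l<q. w l * pd k (pd l f) x)" if "k < q" for k
      using pd_sum[OF U, of "{..<q}" "\<lambda>l x. w l * pd l f x" x k] f x that
      by (simp add: smooth_on_cmult[OF U] smooth_on_pd pd_cmult[of q U])
    moreover have "dird q w f = (\<lambda>x. \<Sum>l<q. w l * pd l f x)" by (simp add: dird_def fun_eq_iff)
    ultimately show ?thesis by (simp add: dird_def[of q v] sum_distrib_left)
  qed
  show ?thesis unfolding *[of v w] *[of w v]
    by (subst sum.swap) (auto intro!: sum.cong simp: pd_commute[OF U f _ _ x] mult.left_commute)
qed

lemma smooth_form_lie: "smooth_form q U p \<alpha> \<Longrightarrow> smooth_form q U p (lie q U v \<alpha>)"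
proof (rule smooth_formI)
  assume \<alpha>: "smooth_form q U p \<alpha>"
  show "smooth_on q U (\<lambda>x. lie q U v \<alpha> x vs)" for vs
    using smooth_on_cong[OF U, of "\<lambda>x. lie q U v \<alpha> x vs" "dird q v (\<lambda>y. \<alpha> y vs)"]
      smooth_on_dird[OF smooth_formD(3)[OF \<alpha>]] by (auto simp: lie_def)
  show "alt q p (lie q U v \<alpha> x)" if x: "x \<in> U" for x
    using \<alpha>
  proof (induction p arbitrary: \<alpha>)
    case 0
    have "lie q U v \<alpha> x vs = 0" if "vs \<noteq> []" for vs
      using alt_length[OF smooth_form_alt[OF 0]] that by (simp add: lie_def dird_const)
    then show ?case by simp
  next
    case (Suc p)
    note a = smooth_form_alt[OF Suc(2)]
    have z: "lie q U v \<alpha> x vs = 0" if "\<And>y. \<alpha> y vs = 0" for vs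
      using that by (simp add: lie_def dird_const)
    have "alt q p (\<lambda>vs. lie q U v \<alpha> x (w # vs))" for w
      using Suc(1)[OF smooth_form_contr[OF Suc(2), of w, simplified]] x by (simp add: contr_def lie_def)
    moreover have "lie q U v \<alpha> x ((\<lambda>k. c * w k + d * u k) # vs) =
        c * lie q U v \<alpha> x (w # vs) + d * lie q U v \<alpha> x (u # vs)" if "w \<in> vecs q" "u \<in> vecs q" for w u c d vs
      using x alt_lin_Cons[OF a that] dird_lin[OF smooth_formD(3)[OF Suc(2)] smooth_formD(3)[OF Suc(2)] x]
      by (simp add: lie_def)
    ultimately show ?case using a by (auto intro!: z)
  qed
qed (simp add: lie_def)

text \<open>Cartan's formula for a constant field. The summand that omits v is the Lie derivative;
  in every other summand v stays in front and the index shifts by one, which produces the minus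
  sign.\<close>

lemma ext_deriv_Cons:
  assumes "smooth_form q U p \<alpha>" "v \<in> vecs q"
  shows "ext_deriv q U \<alpha> x (v # vs) = lie q U v \<alpha> x vs - ext_deriv q U (contr v \<alpha>) x vs"
proof (cases "x \<in> U \<and> set vs \<subseteq> vecs q")
  case True
  then show ?thesis using assms(2)
    by (simp add: ext_deriv_def lie_def dird_def contr_def sum.lessThan_Suc_shift sum_negf del: sum.lessThan_Suc)
next
  case False
  have "lie q U v \<alpha> x vs = 0"
    using alt_vecs[OF smooth_form_alt[OF smooth_form_lie[OF assms(1)]], of vs v x] False
    by (cases "x \<in> U") (simp_all add: lie_def)
  then show ?thesis using False by (auto simp: ext_deriv_def)
qed

lemma contr_ext_deriv:
  assumes "smooth_form q U p \<alpha>" "v \<in> vecs q"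
  shows "contr v (ext_deriv q U \<alpha>) = (\<lambda>x vs. lie q U v \<alpha> x vs - ext_deriv q U (contr v \<alpha>) x vs)"
  using ext_deriv_Cons[OF assms] by (auto simp: contr_def fun_eq_iff)

lemma ext_deriv_lin:
  assumes "smooth_form q U p \<alpha>" "smooth_form q U r \<beta>"
  shows "ext_deriv q U (\<lambda>x vs. c * \<alpha> x vs + d * \<beta> x vs) x vs = c * ext_deriv q U \<alpha> x vs + d * ext_deriv q U \<beta> x vs"
proof (cases "x \<in> U")
  case True
  have "ext_deriv q U \<gamma> x vs = (if set vs \<subseteq> vecs q
        then \<Sum>i<length vs. (- 1) ^ i * dird q (vs ! i) (\<lambda>y. \<gamma> y (take i vs @ drop (Suc i) vs)) x else 0)" for \<gamma>
    using True by (simp add: ext_deriv_def dird_def)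
  then show ?thesis
    using dird_lin[OF smooth_formD(3)[OF assms(1)] smooth_formD(3)[OF assms(2)] True]
    by (simp add: sum.distrib sum_distrib_left algebra_simps)
qed (simp add: ext_deriv_def)

text \<open>On two equal leading vectors Cartan's formula gives the same Lie derivative twice with
  opposite signs, and a remainder in which \<alpha> is contracted twice with v.\<close>

lemma alt_ext_deriv_step:
  assumes \<alpha>: "smooth_form q U p \<alpha>" and cc: "\<And>v. alt q p (ext_deriv q U (contr v \<alpha>) x)"
  shows "alt q (Suc p) (ext_deriv q U \<alpha> x)"
proof -
  have "ext_deriv q U \<alpha> x [] = 0" by (rule ext_deriv_Nil)
  moreover have "ext_deriv q U \<alpha> x (v # vs) = 0" if "v \<notin> vecs q" for v vs
    using that by (intro ext_deriv_outside) simp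
  moreover have "alt q p (\<lambda>vs. ext_deriv q U \<alpha> x (v # vs))" if "v \<in> vecs q" for v
    using alt_diff[OF smooth_form_alt[OF smooth_form_lie[OF \<alpha>, of v], of x] cc[of v]] ext_deriv_Cons[OF \<alpha> that]
    by simp
  moreover have "ext_deriv q U \<alpha> x ((\<lambda>k. c * v k + d * w k) # vs) =
      c * ext_deriv q U \<alpha> x (v # vs) + d * ext_deriv q U \<alpha> x (w # vs)"
    if "v \<in> vecs q" "w \<in> vecs q" for v w c d vs
    using contr_lin[OF \<alpha> that, of c d] ext_deriv_lin[OF smooth_form_contr[OF \<alpha>, of v] smooth_form_contr[OF \<alpha>, of w], of c d]
    by (simp add: ext_deriv_Cons[OF \<alpha>] that vecs_lin lie_def dird_lin_vec algebra_simps)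
  moreover have "ext_deriv q U \<alpha> x (v # v # vs) = 0" for v vs
  proof (cases "v \<in> vecs q")
    case True
    then show ?thesis
      using ext_deriv_Cons[OF smooth_form_contr[OF \<alpha>, of v] True, of x vs] contr_contr_same[OF \<alpha>, of v]
      by (simp add: ext_deriv_Cons[OF \<alpha> True] ext_deriv_zero) (simp add: lie_def contr_def)
  qed (simp add: ext_deriv_outside)
  ultimately show ?thesis by simp
qed

lemma smooth_form_ext_deriv: "smooth_form q U p \<alpha> \<Longrightarrow> smooth_form q U (Suc p) (ext_deriv q U \<alpha>)"
proof (rule smooth_formI)
  assume \<alpha>: "smooth_form q U p \<alpha>"
  show "smooth_on q U (\<lambda>x. ext_deriv q U \<alpha> x vs)" for vs
  proof (cases "set vs \<subseteq> vecs q")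
    case True
    then have "smooth_on q U (\<lambda>x. ext_deriv q U \<alpha> x vs) \<longleftrightarrow> 
      smooth_on q U (\<lambda>x. \<Sum>i<length vs. (- 1) ^ i * dird q (vs ! i) (\<lambda>y. \<alpha> y (take i vs @ drop (Suc i) vs)) x)"
      by (intro smooth_on_cong[OF U]) (simp add: ext_deriv_def dird_def)
    moreover have "smooth_on q U (\<lambda>x. \<Sum>i<length vs. (- 1) ^ i * dird q (vs ! i) (\<lambda>y. \<alpha> y (take i vs @ drop (Suc i) vs)) x)"
      by (intro smooth_on_sum[OF U] smooth_on_cmult[OF U] smooth_on_dird smooth_formD(3)[OF \<alpha>])
    ultimately show ?thesis by simp
  next
    case False
    then show ?thesis using smooth_on_const[OF open_vecs_subset[OF U], of 0] by (simp add: ext_deriv_def)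
  qed
  show "alt q (Suc p) (ext_deriv q U \<alpha> x)" if x: "x \<in> U" for x
    using \<alpha>
  proof (induction p arbitrary: \<alpha>)
    case 0
    show ?case
      by (rule alt_ext_deriv_step[OF 0]) (simp add: contr_degree_0[OF 0] ext_deriv_zero alt_zero)
  next
    case (Suc p)
    show ?case
      by (rule alt_ext_deriv_step[OF Suc(2)]) (rule Suc(1)[OF smooth_form_contr[OF Suc(2), simplified]])
  qed
qed (simp add: ext_deriv_outside)

end

text \<open>The Lie derivative differentiates the coefficients, so the claim comes down to the
  symmetry of second derivatives.\<close>

lemma lie_ext_deriv:
  assumes U: "openin (Euclidean_space q) U" and \<alpha>: "smooth_form q U p \<alpha>"
  shows "lie q U v (ext_deriv q U \<alpha>) = ext_deriv q U (lie q U v \<alpha>)"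
proof (intro ext)
  fix x vs
  note sm = smooth_formD(3)[OF U \<alpha>]
  show "lie q U v (ext_deriv q U \<alpha>) x vs = ext_deriv q U (lie q U v \<alpha>) x vs"
  proof (cases "x \<in> U \<and> set vs \<subseteq> vecs q")
    case True
    let ?f = "\<lambda>i y. \<alpha> y (take i vs @ drop (Suc i) vs)"
    have "dird q v (\<lambda>y. ext_deriv q U \<alpha> y vs) x =
        dird q v (\<lambda>y. \<Sum>i<length vs. (- 1) ^ i * dird q (vs ! i) (?f i) y) x"
      using True by (intro dird_cong[OF U]) (auto simp: ext_deriv_def dird_def)
    also have "\<dots> = (\<Sum>i<length vs. dird q v (\<lambda>y. (- 1) ^ i * dird q (vs ! i) (?f i) y) x)"
      using True by (intro dird_sum[OF U] smooth_on_cmult[OF U] smooth_on_dird[OF U] sm) auto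
    also have "\<dots> = (\<Sum>i<length vs. (- 1) ^ i * dird q v (dird q (vs ! i) (?f i)) x)"
      using True by (intro sum.cong refl dird_cmult[OF U] smooth_on_dird[OF U] sm) auto
    also have "\<dots> = (\<Sum>i<length vs. (- 1) ^ i * dird q (vs ! i) (dird q v (?f i)) x)"
      using dird_commute[OF U sm] True by (intro sum.cong refl arg_cong2[where f = "(*)"]) auto
    also have "\<dots> = (\<Sum>i<length vs. (- 1) ^ i * dird q (vs ! i) (\<lambda>y. lie q U v \<alpha> y (take i vs @ drop (Suc i) vs)) x)"
      using True by (intro sum.cong refl arg_cong2[where f = "(*)"] dird_cong[OF U]) (auto simp: lie_def)
    finally show ?thesis using True by (simp add: lie_def ext_deriv_def dird_def)
  next
    case False
    then consider "x \<notin> U" | "\<not> set vs \<subseteq> vecs q" by blast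
    then show ?thesis by cases (simp_all add: lie_def ext_deriv_outside dird_const)
  qed
qed

text \<open>Cartan's formula, used twice, leaves the commutator of d with the Lie derivative, which
  is zero, and d d of the contraction on a shorter list.\<close>

lemma ext_deriv_ext_deriv:
  assumes U: "openin (Euclidean_space q) U"
  shows "smooth_form q U p \<alpha> \<Longrightarrow> ext_deriv q U (ext_deriv q U \<alpha>) x vs = 0"
proof (induction vs arbitrary: p \<alpha>)
  case Nil
  then show ?case by (simp add: ext_deriv_def)
next
  case (Cons v vs)
  note \<alpha> = Cons(2)
  show ?case
  proof (cases "v \<in> vecs q")
    case True
    note sl = smooth_form_lie[OF U \<alpha>, of v]
    note sc = smooth_form_contr[OF U \<alpha>, of v]
    have "ext_deriv q U (ext_deriv q U \<alpha>) x (v # vs) =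
        lie q U v (ext_deriv q U \<alpha>) x vs - ext_deriv q U (contr v (ext_deriv q U \<alpha>)) x vs"
      by (rule ext_deriv_Cons[OF U smooth_form_ext_deriv[OF U \<alpha>] True])
    also have "ext_deriv q U (contr v (ext_deriv q U \<alpha>)) x vs =
        ext_deriv q U (lie q U v \<alpha>) x vs - ext_deriv q U (ext_deriv q U (contr v \<alpha>)) x vs"
      using ext_deriv_lin[OF U sl smooth_form_ext_deriv[OF U sc], of 1 "-1" x vs]
      by (simp add: contr_ext_deriv[OF U \<alpha> True])
    finally show ?thesis using Cons(1)[OF sc] by (simp add: lie_ext_deriv[OF U \<alpha>])
  qed (auto simp: ext_deriv_def)
qed

subsection \<open>The wedge product\<close>

lemma wedge_Nil: "wedge \<alpha> \<beta> x [] = \<alpha> x [] * \<beta> x []"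
  by (simp add: wedge_def shuffle_sign_def)

text \<open>Position 0 goes to the first factor: it has no smaller position in the complement, so it
  adds no inversion.\<close>

lemma shuffle_sign_insert_0: "shuffle_sign (Suc n) (insert 0 (Suc ` T)) = shuffle_sign n T"
proof -
  have "{(i, j). i \<in> insert 0 (Suc ` T) \<and> j \<notin> insert 0 (Suc ` T) \<and> j < i \<and> i < Suc n} =
      (\<lambda>(i, j). (Suc i, Suc j)) ` {(i, j). i \<in> T \<and> j \<notin> T \<and> j < i \<and> i < n}"
  proof (intro equalityI subsetI)
    fix z assume "z \<in> {(i, j). i \<in> insert 0 (Suc ` T) \<and> j \<notin> insert 0 (Suc ` T) \<and> j < i \<and> i < Suc n}"
    then obtain i j where ij: "z = (i, j)" "i \<in> insert 0 (Suc ` T)" "j \<notin> insert 0 (Suc ` T)" "j < i" "i < Suc n" by auto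
    then obtain i' j' where "i = Suc i'" "j = Suc j'" by (cases i; cases j) auto
    with ij show "z \<in> (\<lambda>(i, j). (Suc i, Suc j)) ` {(i, j). i \<in> T \<and> j \<notin> T \<and> j < i \<and> i < n}"
      by (auto intro!: image_eqI[of _ _ "(i', j')"])
  qed auto
  moreover have "inj_on (\<lambda>(i, j). (Suc i, Suc j)) A" for A by (auto simp: inj_on_def)
  ultimately show ?thesis by (simp add: shuffle_sign_def card_image)
qed

text \<open>Position 0 goes to the second factor, so each position of the first factor gains one
  inversion, namely with 0.\<close>

lemma shuffle_sign_Suc_image:
  assumes "T \<subseteq> {..<n}"
  shows "shuffle_sign (Suc n) (Suc ` T) = (- 1) ^ card T * shuffle_sign n T"
proof -
  let ?A = "{(i, j). i \<in> T \<and> j \<notin> T \<and> j < i \<and> i < n}"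
  have "{(i, j). i \<in> Suc ` T \<and> j \<notin> Suc ` T \<and> j < i \<and> i < Suc n} =
      (\<lambda>(i, j). (Suc i, Suc j)) ` ?A \<union> (\<lambda>i. (Suc i, 0)) ` T"
  proof (intro equalityI subsetI)
    fix z assume "z \<in> {(i, j). i \<in> Suc ` T \<and> j \<notin> Suc ` T \<and> j < i \<and> i < Suc n}"
    then obtain i j where ij: "z = (i, j)" "i \<in> Suc ` T" "j \<notin> Suc ` T" "j < i" "i < Suc n" by auto
    then obtain i' where i: "i = Suc i'" by (cases i) auto
    show "z \<in> (\<lambda>(i, j). (Suc i, Suc j)) ` ?A \<union> (\<lambda>i. (Suc i, 0)) ` T"
    proof (cases j)
      case 0
      then show ?thesis using ij i by auto
    next
      case (Suc j')
      then show ?thesis using ij i by (auto intro!: image_eqI[of _ _ "(i', j')"])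
    qed
  qed (use assms in auto)
  moreover have "card ((\<lambda>(i, j). (Suc i, Suc j)) ` ?A \<union> (\<lambda>i. (Suc i, 0)) ` T) =
      card ((\<lambda>(i, j). (Suc i, Suc j)) ` ?A) + card ((\<lambda>i. (Suc i, 0 :: nat)) ` T)"
  proof (rule card_Un_disjoint)
    have "finite ?A" by (rule finite_subset[of _ "{..<n} \<times> {..<n}"]) auto
    then show "finite ((\<lambda>(i, j). (Suc i, Suc j)) ` ?A)" by blast
    have "finite T" using assms finite_subset by blast
    then show "finite ((\<lambda>i. (Suc i, 0 :: nat)) ` T)" by blast
  qed auto
  moreover have "card ((\<lambda>(i, j). (Suc i, Suc j)) ` ?A) = card ?A" "card ((\<lambda>i. (Suc i, 0 :: nat)) ` T) = card T"
    by (rule card_image; auto simp: inj_on_def)+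
  ultimately have "card {(i, j). i \<in> Suc ` T \<and> j \<notin> Suc ` T \<and> j < i \<and> i < Suc n} = card ?A + card T"
    by simp
  then show ?thesis by (simp add: shuffle_sign_def power_add)
qed

text \<open>The interior product is an antiderivation. The shuffles are split according to the
  factor that receives the first vector.\<close>

lemma wedge_Cons:
  assumes \<alpha>: "\<And>vs. length vs \<noteq> p \<Longrightarrow> \<alpha> x vs = 0"
  shows "wedge \<alpha> \<beta> x (v # vs) = wedge (contr v \<alpha>) \<beta> x vs + (- 1) ^ p * wedge \<alpha> (contr v \<beta>) x vs"
proof -
  let ?n = "length vs"
  let ?g = "\<lambda>S. shuffle_sign (Suc ?n) S * \<alpha> x (nths (v # vs) S) * \<beta> x (nths (v # vs) (- S))"
  let ?P = "Pow {..<?n}"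
  have "{..<Suc ?n} = insert 0 (Suc ` {..<?n})"
    by (auto simp: image_iff less_Suc_eq_0_disj)
  then have P: "Pow {..<Suc ?n} = (image Suc) ` ?P \<union> (\<lambda>T. insert 0 (Suc ` T)) ` ?P"
    by (simp add: Pow_insert image_Pow_surj[OF refl, symmetric] image_image)
  have "wedge \<alpha> \<beta> x (v # vs) = sum ?g (Pow {..<Suc ?n})" by (simp add: wedge_def)
  also have "\<dots> = sum ?g ((image Suc) ` ?P) + sum ?g ((\<lambda>T. insert 0 (Suc ` T)) ` ?P)"
    unfolding P by (intro sum.union_disjoint) auto
  also have "sum ?g ((\<lambda>T. insert 0 (Suc ` T)) ` ?P) = (\<Sum>T\<in>?P. ?g (insert 0 (Suc ` T)))"
  proof (rule sum.reindex_cong[OF _ refl refl])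
    show "inj_on (\<lambda>T. insert 0 (Suc ` T)) ?P" by (auto simp: inj_on_def insert_eq_iff inj_image_eq_iff)
  qed
  also have "\<dots> = wedge (contr v \<alpha>) \<beta> x vs"
  proof -
    have "{j. Suc j \<in> - insert 0 (Suc ` T)} = - T" "{j. Suc j \<in> insert 0 (Suc ` T)} = T" for T by auto
    then show ?thesis by (simp add: wedge_def contr_def shuffle_sign_insert_0 nths_Cons)
  qed
  also have "sum ?g ((image Suc) ` ?P) = (\<Sum>T\<in>?P. ?g (Suc ` T))"
    by (rule sum.reindex_cong[OF _ refl refl]) (auto simp: inj_on_def inj_image_eq_iff)
  also have "\<dots> = (\<Sum>T\<in>?P. (- 1) ^ p * (shuffle_sign ?n T * \<alpha> x (nths vs T) * \<beta> x (v # nths vs (- T))))"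
  proof (rule sum.cong[OF refl])
    fix T assume T: "T \<in> ?P"
    have *: "{j. Suc j \<in> - (Suc ` T)} = - T" "{j. Suc j \<in> Suc ` T} = T" "{j. j \<notin> T} = - T" by auto
    have "?g (Suc ` T) = (- 1) ^ card T * shuffle_sign ?n T * \<alpha> x (nths vs T) * \<beta> x (v # nths vs (- T))"
      using T shuffle_sign_Suc_image[of T ?n] by (simp add: nths_Cons * image_iff)
    moreover have "length (nths vs T) = card T"
    proof -
      have "{i. i < length vs \<and> i \<in> T} = T" using T by auto
      then show ?thesis by (simp add: length_nths)
    qed
    \<comment> \<open>Since \<alpha> vanishes on lists of length other than p, the number
      \<open>card T\<close> in the sign may be replaced by p.\<close>
    ultimately show "?g (Suc ` T) = (- 1) ^ p * (shuffle_sign ?n T * \<alpha> x (nths vs T) * \<beta> x (v # nths vs (- T)))"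
      using \<alpha>[of "nths vs T"] by (cases "card T = p") auto
  qed
  also have "\<dots> = (- 1) ^ p * wedge \<alpha> (contr v \<beta>) x vs"
    by (simp add: wedge_def contr_def sum_distrib_left)
  finally show ?thesis by simp
qed

lemma wedge_lin_left:
  "wedge (\<lambda>x vs. c * \<alpha> x vs + d * \<beta> x vs) \<gamma> x vs = c * wedge \<alpha> \<gamma> x vs + d * wedge \<beta> \<gamma> x vs"
  by (simp add: wedge_def sum.distrib sum_distrib_left algebra_simps)

lemma wedge_lin_right:
  "wedge \<gamma> (\<lambda>x vs. c * \<alpha> x vs + d * \<beta> x vs) x vs = c * wedge \<gamma> \<alpha> x vs + d * wedge \<gamma> \<beta> x vs"
  by (simp add: wedge_def sum.distrib sum_distrib_left algebra_simps)

lemma wedge_zero_left: "\<alpha> x = (\<lambda>vs. 0) \<Longrightarrow> wedge \<alpha> \<beta> x vs = 0"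
  and wedge_zero_right: "\<beta> x = (\<lambda>vs. 0) \<Longrightarrow> wedge \<alpha> \<beta> x vs = 0"
  by (simp_all add: wedge_def)

lemma wedge_cong: "\<alpha> x = \<alpha>' x \<Longrightarrow> \<beta> x = \<beta>' x \<Longrightarrow> wedge \<alpha> \<beta> x vs = wedge \<alpha>' \<beta>' x vs"
  by (simp add: wedge_def)

text \<open>Induction on the total degree with \<open>wedge_Cons\<close>. On a repeated leading
  vector, the two terms with one contraction in each factor cancel by their signs.\<close>

lemma alt_wedge:
  "alt q p (\<alpha> x) \<Longrightarrow> alt q r (\<beta> x) \<Longrightarrow> n = p + r \<Longrightarrow> alt q n (wedge \<alpha> \<beta> x)"
proof (induction n arbitrary: p r \<alpha> \<beta>)
  case 0
  have "wedge \<alpha> \<beta> x (v # vs) = 0" for v vs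
    using 0 wedge_Cons[of 0 \<alpha> x \<beta> v vs] 
    by (simp add: wedge_zero_left wedge_zero_right contr_def)
  then show ?case by (metis alt.simps(1) list.exhaust)
next
  case (Suc n)
  note a = Suc.prems(1) and b = Suc.prems(2)
  have W: "wedge \<alpha> \<beta> x (v # vs) = wedge (contr v \<alpha>) \<beta> x vs + (- 1) ^ p * wedge \<alpha> (contr v \<beta>) x vs" for \<beta> v vs
    by (rule wedge_Cons) (rule alt_length[OF a])
  have ca: "alt q (p - 1) (contr v \<alpha> x)" "alt q (r - 1) (contr v \<beta> x)" for v
    using alt_tail[OF a] alt_tail[OF b] by (auto simp: contr_def)
  have "wedge \<alpha> \<beta> x [] = 0"
    using Suc alt_length[OF a, of "[]"] alt_length[OF b, of "[]"] by (cases p) (auto simp: wedge_Nil)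
  moreover have "wedge \<alpha> \<beta> x (v # vs) = 0" if "v \<notin> vecs q" for v vs
  proof -
    have "contr v \<alpha> x = (\<lambda>vs. 0)" "contr v \<beta> x = (\<lambda>vs. 0)"
      using alt_vecs[OF a] alt_vecs[OF b] that by (auto simp: contr_def fun_eq_iff)
    then show ?thesis by (simp add: W wedge_zero_left wedge_zero_right)
  qed
  moreover have "alt q n (\<lambda>vs. wedge \<alpha> \<beta> x (v # vs))" for v
  proof -
    have "alt q n (wedge (contr v \<alpha>) \<beta> x)"
    \<comment> \<open>In degree 0 the truncated \<open>p - 1\<close> would break the degree count;
      there the contraction is zero.\<close>
    proof (cases p)
      case 0
      then have "contr v \<alpha> x = (\<lambda>vs. 0)" using a by (auto simp: contr_def fun_eq_iff)
      then have "wedge (contr v \<alpha>) \<beta> x = (\<lambda>vs. 0)" by (simp add: wedge_zero_left fun_eq_iff)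
      then show ?thesis by (simp add: alt_zero)
    next
      case (Suc p')
      then show ?thesis using Suc.IH[of "p - 1" "contr v \<alpha>" r \<beta>] ca(1) b Suc.prems(3) by simp
    qed
    moreover have "alt q n (wedge \<alpha> (contr v \<beta>) x)"
    proof (cases r)
      case 0
      then have "contr v \<beta> x = (\<lambda>vs. 0)" using b by (auto simp: contr_def fun_eq_iff)
      then have "wedge \<alpha> (contr v \<beta>) x = (\<lambda>vs. 0)" by (simp add: wedge_zero_right fun_eq_iff)
      then show ?thesis by (simp add: alt_zero)
    next
      case (Suc r')
      then show ?thesis using Suc.IH[of p \<alpha> "r - 1" "contr v \<beta>"] a ca(2) Suc.prems(3) by simp
    qed
    ultimately show ?thesis by (simp add: W alt_add alt_cmult)
  qed
  moreover have "wedge \<alpha> \<beta> x ((\<lambda>k. c * v k + d * w k) # vs) = c * wedge \<alpha> \<beta> x (v # vs) + d * wedge \<alpha> \<beta> x (w # vs)"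
    if "v \<in> vecs q" "w \<in> vecs q" for v w c d vs
  proof -
    let ?s = "\<lambda>k. c * v k + d * w k"
    have "wedge (contr ?s \<alpha>) \<beta> x vs = wedge (\<lambda>x vs. c * contr v \<alpha> x vs + d * contr w \<alpha> x vs) \<beta> x vs"
      using alt_lin_Cons[OF a that] by (intro wedge_cong) (auto simp: contr_def)
    moreover have "wedge \<alpha> (contr ?s \<beta>) x vs = wedge \<alpha> (\<lambda>x vs. c * contr v \<beta> x vs + d * contr w \<beta> x vs) x vs"
      using alt_lin_Cons[OF b that] by (intro wedge_cong) (auto simp: contr_def)
    ultimately show ?thesis by (simp add: W wedge_lin_left wedge_lin_right algebra_simps)
  qed
  moreover have "wedge \<alpha> \<beta> x (v # v # vs) = 0" for v vs
  proof -
    have "\<alpha> x (v # v # vs) = 0" "\<beta> x (v # v # vs) = 0" for vs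
      using a b by (cases p, auto) (cases r, auto)
    then have cc: "contr v (contr v \<alpha>) x = (\<lambda>vs. 0)" "contr v (contr v \<beta>) x = (\<lambda>vs. 0)"
      by (auto simp: contr_def)
    have W': "wedge (contr v \<alpha>) \<beta> x (v # vs) =
        wedge (contr v (contr v \<alpha>)) \<beta> x vs + (- 1) ^ (p - 1) * wedge (contr v \<alpha>) (contr v \<beta>) x vs"
      by (rule wedge_Cons) (rule alt_length[OF ca(1)])
    show ?thesis
    proof (cases p)
      case 0
      then have "contr v \<alpha> x = (\<lambda>vs. 0)" using a by (auto simp: contr_def fun_eq_iff)
      then show ?thesis by (simp add: W cc wedge_zero_left wedge_zero_right)
    next
      case (Suc p')
      then show ?thesis unfolding W W' using cc by (simp add: W wedge_zero_left wedge_zero_right)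
    qed
  qed
  ultimately show ?case by simp
qed

context
  fixes q :: nat and U :: "(nat \<Rightarrow> real) set"
  assumes U: "openin (Euclidean_space q) U"
begin

lemma smooth_form_wedge:
  assumes \<alpha>: "smooth_form q U p \<alpha>" and \<beta>: "smooth_form q U r \<beta>"
  shows "smooth_form q U (p + r) (wedge \<alpha> \<beta>)"
proof (rule smooth_formI[OF U])
  show "wedge \<alpha> \<beta> x vs = 0" if "x \<notin> U" for x vs
    using smooth_formD(1)[OF U \<alpha> that] by (simp add: wedge_zero_left fun_eq_iff)
  show "alt q (p + r) (wedge \<alpha> \<beta> x)" for x
    by (rule alt_wedge[OF smooth_form_alt[OF U \<alpha>] smooth_form_alt[OF U \<beta>] refl])
  show "smooth_on q U (\<lambda>x. wedge \<alpha> \<beta> x vs)" for vs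
    unfolding wedge_def mult.assoc
    by (intro smooth_on_sum[OF U] smooth_on_cmult[OF U] smooth_on_mult[OF U] smooth_formD(3)[OF U \<alpha>] smooth_formD(3)[OF U \<beta>])
qed

lemma wedge_Cons_form:
  assumes "smooth_form q U p \<alpha>"
  shows "wedge \<alpha> \<beta> x (v # vs) = wedge (contr v \<alpha>) \<beta> x vs + (- 1) ^ p * wedge \<alpha> (contr v \<beta>) x vs"
  by (rule wedge_Cons) (rule alt_length[OF smooth_form_alt[OF U assms]])

lemma lie_wedge:
  assumes \<alpha>: "smooth_form q U p \<alpha>" and \<beta>: "smooth_form q U r \<beta>"
  shows "lie q U v (wedge \<alpha> \<beta>) x vs = wedge (lie q U v \<alpha>) \<beta> x vs + wedge \<alpha> (lie q U v \<beta>) x vs"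
proof (cases "x \<in> U")
  case True
  note sa = smooth_formD(3)[OF U \<alpha>] and sb = smooth_formD(3)[OF U \<beta>]
  let ?n = "length vs"
  have "dird q v (\<lambda>y. wedge \<alpha> \<beta> y vs) x = (\<Sum>S\<in>Pow {..<?n}. 
      dird q v (\<lambda>y. shuffle_sign ?n S * (\<alpha> y (nths vs S) * \<beta> y (nths vs (- S)))) x)"
    unfolding wedge_def mult.assoc using True
    by (intro dird_sum[OF U] smooth_on_cmult[OF U] smooth_on_mult[OF U] sa sb)
  also have "\<dots> = (\<Sum>S\<in>Pow {..<?n}. shuffle_sign ?n S * 
      (dird q v (\<lambda>y. \<alpha> y (nths vs S)) x * \<beta> x (nths vs (- S)) + \<alpha> x (nths vs S) * dird q v (\<lambda>y. \<beta> y (nths vs (- S))) x))"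
    using True by (simp add: dird_cmult[OF U smooth_on_mult[OF U sa sb] True] dird_mult[OF U sa sb True])
  finally show ?thesis using True 
    by (simp add: lie_def wedge_def sum.distrib algebra_simps)
next
  case False
  then show ?thesis
    using smooth_formD(1)[OF U \<alpha> False] smooth_formD(1)[OF U smooth_form_lie[OF U \<alpha>] False]
    by (simp add: lie_def wedge_zero_left fun_eq_iff)
qed

text \<open>Cartan's formula and the antiderivation rule reduce both sides to products in which one
  factor is contracted. The contraction lowers the degree of that factor, so p and r vary in the
  induction.\<close>

lemma ext_deriv_wedge:
  "smooth_form q U p \<alpha> \<Longrightarrow> smooth_form q U r \<beta> \<Longrightarrow>
    ext_deriv q U (wedge \<alpha> \<beta>) x vs =
      wedge (ext_deriv q U \<alpha>) \<beta> x vs + (- 1) ^ p * wedge \<alpha> (ext_deriv q U \<beta>) x vs"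
proof (induction vs arbitrary: p r \<alpha> \<beta>)
  case Nil
  then show ?case by (simp add: wedge_Nil ext_deriv_Nil)
next
  case (Cons v vs)
  note \<alpha> = Cons.prems(1) and \<beta> = Cons.prems(2)
  note d\<alpha> = smooth_form_ext_deriv[OF U \<alpha>] and d\<beta> = smooth_form_ext_deriv[OF U \<beta>]
  note c\<alpha> = smooth_form_contr[OF U \<alpha>, of v] and c\<beta> = smooth_form_contr[OF U \<beta>, of v]
  show ?case
  proof (cases "v \<in> vecs q")
    case False
    then have ns: "\<not> set (v # vs) \<subseteq> vecs q" by simp
    have "wedge (ext_deriv q U \<alpha>) \<beta> x (v # vs) = 0" 
      by (rule alt_vecs[OF smooth_form_alt[OF U smooth_form_wedge[OF d\<alpha> \<beta>]] ns])
    moreover have "wedge \<alpha> (ext_deriv q U \<beta>) x (v # vs) = 0" 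
      by (rule alt_vecs[OF smooth_form_alt[OF U smooth_form_wedge[OF \<alpha> d\<beta>]] ns])
    ultimately show ?thesis using ext_deriv_outside(2)[OF ns] by simp
  next
    case True
    have "contr v (wedge \<alpha> \<beta>) = (\<lambda>x vs. 1 * wedge (contr v \<alpha>) \<beta> x vs + (- 1) ^ p * wedge \<alpha> (contr v \<beta>) x vs)"
      using wedge_Cons_form[OF \<alpha>] by (auto simp: contr_def[of _ "wedge _ _"] fun_eq_iff)
    then have "ext_deriv q U (contr v (wedge \<alpha> \<beta>)) x vs = 
        ext_deriv q U (wedge (contr v \<alpha>) \<beta>) x vs + (- 1) ^ p * ext_deriv q U (wedge \<alpha> (contr v \<beta>)) x vs"
      using ext_deriv_lin[OF U smooth_form_wedge[OF c\<alpha> \<beta>] smooth_form_wedge[OF \<alpha> c\<beta>], of 1 "(- 1) ^ p" x vs] by simp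
    then have L: "ext_deriv q U (wedge \<alpha> \<beta>) x (v # vs) =
        wedge (lie q U v \<alpha>) \<beta> x vs + wedge \<alpha> (lie q U v \<beta>) x vs -
        (wedge (ext_deriv q U (contr v \<alpha>)) \<beta> x vs + (- 1) ^ (p - 1) * wedge (contr v \<alpha>) (ext_deriv q U \<beta>) x vs +
         (- 1) ^ p * (wedge (ext_deriv q U \<alpha>) (contr v \<beta>) x vs + (- 1) ^ p * wedge \<alpha> (ext_deriv q U (contr v \<beta>)) x vs))"
      using ext_deriv_Cons[OF U smooth_form_wedge[OF \<alpha> \<beta>] True, of x vs] lie_wedge[OF \<alpha> \<beta>, of v x vs]
        Cons.IH[OF c\<alpha> \<beta>] Cons.IH[OF \<alpha> c\<beta>] by simp
    have R1: "wedge (contr v (ext_deriv q U \<alpha>)) \<beta> x vs = 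
        wedge (lie q U v \<alpha>) \<beta> x vs - wedge (ext_deriv q U (contr v \<alpha>)) \<beta> x vs"
      using wedge_lin_left[of 1 "lie q U v \<alpha>" "-1" "ext_deriv q U (contr v \<alpha>)" \<beta> x vs]
      by (simp add: contr_ext_deriv[OF U \<alpha> True])
    have R2: "wedge \<alpha> (contr v (ext_deriv q U \<beta>)) x vs = 
        wedge \<alpha> (lie q U v \<beta>) x vs - wedge \<alpha> (ext_deriv q U (contr v \<beta>)) x vs"
      using wedge_lin_right[of \<alpha> 1 "lie q U v \<beta>" "-1" "ext_deriv q U (contr v \<beta>)" x vs]
      by (simp add: contr_ext_deriv[OF U \<beta> True])
    have sg: "(- 1 :: real) ^ p * (- 1) ^ p = 1" by (simp add: power_mult_distrib[symmetric])
    show ?thesis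
    \<comment> \<open>For p = 0 the sign with exponent \<open>p - 1\<close> is wrong, but the terms
      that carry it vanish.\<close>
    proof (cases p)
      case 0
      then have "wedge (contr v \<alpha>) \<gamma> x vs = 0" for \<gamma>
        using contr_degree_0[OF U, of \<alpha> v] \<alpha> by (simp add: wedge_zero_left)
      then show ?thesis unfolding L wedge_Cons_form[OF \<alpha>] wedge_Cons_form[OF d\<alpha>] R1 R2
        using 0 by simp
    next
      case (Suc p')
      then show ?thesis unfolding L wedge_Cons_form[OF \<alpha>] wedge_Cons_form[OF d\<alpha>] R1 R2
        using sg by (simp add: algebra_simps)
    qed
  qed
qed

end

subsection \<open>Pullback\<close>

lemma jac_eq_dird: "jac r h y v k = dird r v (\<lambda>y. h y k) y"
  by (simp add: jac_def dird_def mult.commute)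

lemma jac_lin: "jac r h y (\<lambda>k. c * v k + d * w k) = (\<lambda>k. c * jac r h y v k + d * jac r h y w k)"
  by (rule ext) (simp add: jac_eq_dird dird_lin_vec)

lemma jac_in_vecs:
  assumes V: "openin (Euclidean_space r) V" and h: "smooth_map_on r V q h" and y: "y \<in> V"
  shows "jac r h y v \<in> vecs q"
proof -
  have "jac r h y v k = 0" if k: "k \<ge> q" for k
  proof -
    have "h z k = 0" if "z \<in> V" for z
      using h that k by (auto simp: smooth_map_on_def in_vecs_iff image_subset_iff)
    then have "dird r v (\<lambda>y. h y k) y = dird r v (\<lambda>y. 0) y" by (intro dird_cong[OF V y])
    then show ?thesis by (simp add: jac_eq_dird dird_const)
  qed
  then show ?thesis by (simp add: in_vecs_iff)
qed

text \<open>The wedge product of a covector \<open>\<phi>\<close> with a form; with \<open>\<phi> = df\<close> it is the defect of \<open>d\<close>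
  from commuting with multiplication by \<open>f\<close>.\<close>

primrec covec_wedge :: "((nat \<Rightarrow> real) \<Rightarrow> real) \<Rightarrow> ((nat \<Rightarrow> real) list \<Rightarrow> real) \<Rightarrow> (nat \<Rightarrow> real) list \<Rightarrow> real" where
  "covec_wedge \<phi> a [] = 0"
| "covec_wedge \<phi> a (v # vs) = \<phi> v * a vs - covec_wedge \<phi> (\<lambda>us. a (v # us)) vs"

lemma covec_wedge_lin: 
  "covec_wedge \<phi> (\<lambda>vs. c * a vs + d * b vs) vs = c * covec_wedge \<phi> a vs + d * covec_wedge \<phi> b vs"
  by (induction vs arbitrary: a b) (simp_all add: algebra_simps)

lemma covec_wedge_zero: "covec_wedge \<phi> (\<lambda>vs. 0) vs = 0"
  using covec_wedge_lin[of \<phi> 0 "\<lambda>_. 0" 0 "\<lambda>_. 0" vs] by simp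

lemma covec_wedge_sum: 
  "covec_wedge \<phi> (\<lambda>vs. \<Sum>k\<in>K. g k * a k vs) vs = (\<Sum>k\<in>K. g k * covec_wedge \<phi> (a k) vs)"
proof (induction K rule: infinite_finite_induct)
  case (insert k K)
  then show ?case using covec_wedge_lin[of \<phi> "g k" "a k" 1 "\<lambda>vs. \<Sum>k\<in>K. g k * a k vs" vs] by simp
qed (simp_all add: covec_wedge_zero)

lemma ext_deriv_fmult:
  assumes U: "openin (Euclidean_space q) U" and f: "smooth_on q U f" and x: "x \<in> U"
  shows "smooth_form q U p \<alpha> \<Longrightarrow> set vs \<subseteq> vecs q \<Longrightarrow>
    ext_deriv q U (\<lambda>x vs. f x * \<alpha> x vs) x vs =
      covec_wedge (\<lambda>u. dird q u f x) (\<alpha> x) vs + f x * ext_deriv q U \<alpha> x vs"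
proof (induction vs arbitrary: p \<alpha>)
  case Nil
  then show ?case by (simp add: ext_deriv_Nil)
next
  case (Cons v vs)
  then have v: "v \<in> vecs q" by simp
  have "contr v (\<lambda>x vs. f x * \<alpha> x vs) = (\<lambda>x vs. f x * contr v \<alpha> x vs)" by (simp add: contr_def)
  then have "ext_deriv q U (\<lambda>x vs. f x * \<alpha> x vs) x (v # vs) = dird q v (\<lambda>x. f x * \<alpha> x vs) x -
      ext_deriv q U (\<lambda>x vs. f x * contr v \<alpha> x vs) x vs"
    using ext_deriv_Cons[OF U smooth_form_fmult[OF U Cons(2) f] v, of x vs] x by (simp add: lie_def)
  moreover have "dird q v (\<lambda>x. f x * \<alpha> x vs) x = dird q v f x * \<alpha> x vs + f x * dird q v (\<lambda>x. \<alpha> x vs) x"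
    by (rule dird_mult[OF U f smooth_formD(3)[OF U Cons(2)] x])
  moreover have "ext_deriv q U (\<lambda>x vs. f x * contr v \<alpha> x vs) x vs =
      covec_wedge (\<lambda>u. dird q u f x) (contr v \<alpha> x) vs + f x * ext_deriv q U (contr v \<alpha>) x vs"
    using Cons.IH[OF smooth_form_contr[OF U Cons(2), of v]] Cons.prems(2) by simp
  moreover have "f x * ext_deriv q U \<alpha> x (v # vs) =
      f x * dird q v (\<lambda>x. \<alpha> x vs) x - f x * ext_deriv q U (contr v \<alpha>) x vs"
    using ext_deriv_Cons[OF U Cons(2) v, of x vs] x by (simp add: lie_def right_diff_distrib)
  moreover have "contr v \<alpha> x = (\<lambda>us. \<alpha> x (v # us))" by (simp add: contr_def)
  ultimately show ?case by simp
qed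

lemma ext_deriv_sum:
  assumes U: "openin (Euclidean_space q) U" and "finite K"
  shows "(\<And>k. k \<in> K \<Longrightarrow> smooth_form q U p (\<alpha> k)) \<Longrightarrow>
    ext_deriv q U (\<lambda>x vs. \<Sum>k\<in>K. \<alpha> k x vs) x vs = (\<Sum>k\<in>K. ext_deriv q U (\<alpha> k) x vs)"
  using assms(2)
proof (induction K)
  case (insert k K)
  then show ?case
    using ext_deriv_lin[OF U, of p "\<alpha> k" p "\<lambda>x vs. \<Sum>k\<in>K. \<alpha> k x vs" 1 1 x vs] smooth_form_sum[OF U, of K p \<alpha>] by simp
qed (simp add: ext_deriv_zero)

locale pullback =
  fixes r V q U h
  assumes V: "openin (Euclidean_space r) V" and U: "openin (Euclidean_space q) U"
    and h: "smooth_map_on r V q h" and hU: "h ` V \<subseteq> U"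
begin

abbreviation "P \<equiv> pull_eform r V h"

lemma h_coord: "k < q \<Longrightarrow> smooth_on r V (\<lambda>y. h y k)"
  using h by (simp add: smooth_map_on_def)

text \<open>Pullback as a recursion: the pushed-forward vector has the coordinates
  \<open>dird r w (\<lambda>y. h y k) y\<close>. Smoothness of the pullback and its compatibility
  with d follow by induction on the vectors.\<close>

lemma pull_Cons:
  assumes \<alpha>: "smooth_form q U p \<alpha>" and w: "w \<in> vecs r"
  shows "P \<alpha> y (w # ws) = (\<Sum>k<q. dird r w (\<lambda>y. h y k) y * P (contr (basis_vec k) \<alpha>) y ws)"
proof (cases "y \<in> V \<and> set ws \<subseteq> vecs r")
  case True
  then have y: "y \<in> V" by simp
  show ?thesis
    using alt_expand[OF smooth_form_alt[OF U \<alpha>] jac_in_vecs[OF V h y], of "h y" w "map (jac r h y) ws"] True w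
    by (simp add: pull_eform_def contr_def jac_eq_dird[of r h y w])
next
  case False
  then have "P \<beta> y ws = 0" "P \<beta> y (w # ws) = 0" for \<beta> by (auto simp: pull_eform_def)
  then show ?thesis by simp
qed

lemma pull_Cons_outside: "w \<notin> vecs r \<Longrightarrow> P \<alpha> y (w # ws) = 0"
  by (simp add: pull_eform_def)

lemma smooth_form_pull: "smooth_form q U p \<alpha> \<Longrightarrow> smooth_form r V p (P \<alpha>)"
proof (rule smooth_formI[OF V])
  assume \<alpha>: "smooth_form q U p \<alpha>"
  show "P \<alpha> y vs = 0" if "y \<notin> V" for y vs using that by (simp add: pull_eform_def)
  show "alt r p (P \<alpha> y)" if "y \<in> V" for y
    using alt_map[of r "jac r h y" q p "\<alpha> (h y)", OF jac_in_vecs[OF V h that] jac_lin smooth_form_alt[OF U \<alpha>]] that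
    by (simp add: pull_eform_def)
  show "smooth_on r V (\<lambda>y. P \<alpha> y ws)" for ws
    using \<alpha>
  proof (induction ws arbitrary: p \<alpha>)
    case Nil
    have "smooth_on r V (\<lambda>y. \<alpha> (h y) [])"
      by (rule smooth_on_compose[OF V U smooth_formD(3)[OF U Nil] h hU])
    then show ?case
      using smooth_on_cong[OF V, of "\<lambda>y. P \<alpha> y []" "\<lambda>y. \<alpha> (h y) []"] by (simp add: pull_eform_def)
  next
    case (Cons w ws)
    show ?case
    proof (cases "w \<in> vecs r")
      case True
      show ?thesis unfolding pull_Cons[OF Cons(2) True]
        using Cons.IH[OF smooth_form_contr[OF U Cons(2)]]
        by (intro smooth_on_sum[OF V] smooth_on_mult[OF V] smooth_on_dird[OF V] h_coord) auto
    next
      case False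
      then show ?thesis by (simp add: pull_Cons_outside smooth_on_const open_vecs_subset[OF V])
    qed
  qed
qed

text \<open>The first sum is the chain rule for the coefficients of \<alpha>. The second collects
  the second derivatives of h. It has the shape of the defect in \<open>ext_deriv_fmult\<close> for
  the functions \<open>dird r w (\<lambda>y. h y k)\<close>, and for this reason it cancels in
  \<open>ext_deriv_pull\<close>.\<close>

lemma dird_pull:
  assumes y: "y \<in> V" and w: "w \<in> vecs r"
  shows "smooth_form q U p \<alpha> \<Longrightarrow> set ws \<subseteq> vecs r \<Longrightarrow>
    dird r w (\<lambda>y. P \<alpha> y ws) y =
      (\<Sum>k<q. dird r w (\<lambda>y. h y k) y * P (lie q U (basis_vec k) \<alpha>) y ws) +
      (\<Sum>k<q. covec_wedge (\<lambda>u. dird r u (dird r w (\<lambda>y. h y k)) y) (P (contr (basis_vec k) \<alpha>) y) ws)"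
proof (induction ws arbitrary: p \<alpha>)
  case Nil
  have hy: "h y \<in> U" using hU y by blast
  have "dird r w (\<lambda>y. P \<alpha> y []) y = dird r w (\<lambda>y. \<alpha> (h y) []) y"
    by (rule dird_cong[OF V y]) (simp add: pull_eform_def)
  also have "\<dots> = (\<Sum>i<r. w i * (\<Sum>k<q. pd k (\<lambda>x. \<alpha> x []) (h y) * pd i (\<lambda>y. h y k) y))"
    unfolding dird_def
    using pd_compose[OF V U smooth_formD(3)[OF U Nil(1), of "[]"] h hU y] by simp
  also have "\<dots> = (\<Sum>k<q. \<Sum>i<r. w i * (pd k (\<lambda>x. \<alpha> x []) (h y) * pd i (\<lambda>y. h y k) y))"
    unfolding sum_distrib_left by (rule sum.swap)
  also have "\<dots> = (\<Sum>k<q. dird r w (\<lambda>y. h y k) y * P (lie q U (basis_vec k) \<alpha>) y [])"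
    using y hy by (intro sum.cong refl)
      (simp add: pull_eform_def lie_def dird_basis_vec dird_def[of r w] sum_distrib_left mult_ac)
  finally show ?case by simp
next
  case (Cons u us)
  note \<alpha> = Cons.prems(1)
  have u: "u \<in> vecs r" and us: "set us \<subseteq> vecs r" using Cons.prems(2) by auto
  define f where "f k = dird r w (\<lambda>y. h y k)" for k
  define g where "g k = dird r u (\<lambda>y. h y k)" for k
  note c\<alpha> = smooth_form_contr[OF U \<alpha>]
  have sP: "smooth_on r V (\<lambda>y. P (contr v \<alpha>) y us)" for v
    by (rule smooth_formD(3)[OF V smooth_form_pull[OF c\<alpha>]])
  have sg: "smooth_on r V (g k)" if "k < q" for k
    unfolding g_def by (rule smooth_on_dird[OF V h_coord[OF that]])
  have fg: "dird r w (g k) y = dird r u (f k) y" if "k < q" for k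
    unfolding g_def f_def by (rule dird_commute[OF V h_coord[OF that] y])
  have "dird r w (\<lambda>y. P \<alpha> y (u # us)) y = dird r w (\<lambda>y. \<Sum>l<q. g l y * P (contr (basis_vec l) \<alpha>) y us) y"
    by (simp add: pull_Cons[OF \<alpha> u] g_def)
  also have "\<dots> = (\<Sum>l<q. dird r w (\<lambda>y. g l y * P (contr (basis_vec l) \<alpha>) y us) y)"
    using sg sP y by (intro dird_sum[OF V] smooth_on_mult[OF V]) auto
  also have "\<dots> = (\<Sum>l<q. dird r w (g l) y * P (contr (basis_vec l) \<alpha>) y us) +
      (\<Sum>l<q. g l y * dird r w (\<lambda>y. P (contr (basis_vec l) \<alpha>) y us) y)"
    using sg sP y by (simp add: dird_mult[OF V] sum.distrib)
  also have "(\<Sum>l<q. g l y * dird r w (\<lambda>y. P (contr (basis_vec l) \<alpha>) y us) y) =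
      (\<Sum>l<q. g l y * (\<Sum>k<q. f k y * P (lie q U (basis_vec k) (contr (basis_vec l) \<alpha>)) y us)) +
      (\<Sum>l<q. g l y * (\<Sum>k<q. covec_wedge (\<lambda>u. dird r u (f k) y) (P (contr (basis_vec k) (contr (basis_vec l) \<alpha>)) y) us))"
    using Cons.IH[OF c\<alpha> us] by (simp add: f_def distrib_left sum.distrib)
  also have "(\<Sum>l<q. g l y * (\<Sum>k<q. f k y * P (lie q U (basis_vec k) (contr (basis_vec l) \<alpha>)) y us)) =
      (\<Sum>k<q. f k y * P (lie q U (basis_vec k) \<alpha>) y (u # us))"
  proof -
    have "lie q U v (contr w \<alpha>) = contr w (lie q U v \<alpha>)" for v w by (simp add: lie_def contr_def)
    then show ?thesis
      unfolding pull_Cons[OF smooth_form_lie[OF U \<alpha>] u] g_def[symmetric] sum_distrib_left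
      by (subst sum.swap) (simp add: mult.left_commute)
  qed
  \<comment> \<open>Contractions with two basis vectors anticommute. After exchanging them,
    \<open>pull_Cons\<close> absorbs the sum over l into a pullback evaluated on u # vs.\<close>
  also have "(\<Sum>l<q. g l y * (\<Sum>k<q. covec_wedge (\<lambda>u. dird r u (f k) y) (P (contr (basis_vec k) (contr (basis_vec l) \<alpha>)) y) us)) =
      - (\<Sum>k<q. covec_wedge (\<lambda>u. dird r u (f k) y) (\<lambda>vs. P (contr (basis_vec k) \<alpha>) y (u # vs)) us)"
  proof -
    have swap: "P (contr (basis_vec k) (contr (basis_vec l) \<alpha>)) y = (\<lambda>vs. - P (contr (basis_vec l) (contr (basis_vec k) \<alpha>)) y vs)" for k l
      using contr_contr_swap[OF U \<alpha>, of "basis_vec k" "basis_vec l"] by (auto simp: pull_eform_def fun_eq_iff)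
    have neg: "covec_wedge \<phi> (\<lambda>vs. - a vs) vs = - covec_wedge \<phi> a vs" for \<phi> a vs
      using covec_wedge_lin[of \<phi> "-1" a 0 a vs] by simp
    let ?E = "\<lambda>k l. covec_wedge (\<lambda>u. dird r u (f k) y) (P (contr (basis_vec l) (contr (basis_vec k) \<alpha>)) y) us"
    have "covec_wedge (\<lambda>u. dird r u (f k) y) (P (contr (basis_vec k) (contr (basis_vec l) \<alpha>)) y) us = - ?E k l" for k l
      by (subst swap) (rule neg)
    then have "(\<Sum>l<q. g l y * (\<Sum>k<q. covec_wedge (\<lambda>u. dird r u (f k) y) (P (contr (basis_vec k) (contr (basis_vec l) \<alpha>)) y) us)) =
        (\<Sum>l<q. \<Sum>k<q. - (g l y * ?E k l))"
      by (simp only: sum_distrib_left mult_minus_right)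
    also have "\<dots> = (\<Sum>k<q. \<Sum>l<q. - (g l y * ?E k l))" by (rule sum.swap)
    also have "\<dots> = - (\<Sum>k<q. covec_wedge (\<lambda>u. dird r u (f k) y) (\<lambda>vs. P (contr (basis_vec k) \<alpha>) y (u # vs)) us)"
      unfolding pull_Cons[OF c\<alpha> u] g_def[symmetric] covec_wedge_sum by (simp only: sum_negf)
    finally show ?thesis .
  qed
  \<comment> \<open>Symmetry of the second derivatives of h turns this sum into the leading term of
    \<open>covec_wedge\<close> on the list u # us.\<close>
  also have "(\<Sum>l<q. dird r w (g l) y * P (contr (basis_vec l) \<alpha>) y us) =
      (\<Sum>l<q. dird r u (f l) y * P (contr (basis_vec l) \<alpha>) y us)"
    using fg by simp
  finally show ?case by (simp add: f_def sum_subtractf)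
qed

text \<open>Contract with the first vector w. In Cartan's formula the second derivatives of h from
  \<open>dird_pull\<close> cancel against those from \<open>ext_deriv_fmult\<close>. What remains is
  Cartan's formula for \<alpha>, weighted by the coordinates of the pushed-forward w.\<close>

lemma ext_deriv_pull: "smooth_form q U p \<alpha> \<Longrightarrow> ext_deriv r V (P \<alpha>) y ws = P (ext_deriv q U \<alpha>) y ws"
proof (induction ws arbitrary: p \<alpha>)
  case Nil
  then show ?case by (simp add: ext_deriv_Nil pull_eform_def)
next
  case (Cons w ws)
  note \<alpha> = Cons.prems
  note c\<alpha> = smooth_form_contr[OF U \<alpha>]
  show ?case
  proof (cases "y \<in> V \<and> set (w # ws) \<subseteq> vecs r")
    case False
    then show ?thesis by (auto simp: ext_deriv_def pull_eform_def)
  next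
    case True
    then have y: "y \<in> V" and w: "w \<in> vecs r" and ws: "set ws \<subseteq> vecs r" by auto
    define f where "f k = dird r w (\<lambda>y. h y k)" for k
    have sf: "smooth_on r V (f k)" if "k < q" for k
      unfolding f_def by (rule smooth_on_dird[OF V h_coord[OF that]])
    have "contr w (P \<alpha>) = (\<lambda>y ws. \<Sum>k<q. f k y * P (contr (basis_vec k) \<alpha>) y ws)"
      unfolding f_def contr_def[of w] pull_Cons[OF \<alpha> w] ..
    then have "ext_deriv r V (contr w (P \<alpha>)) y ws =
        (\<Sum>k<q. ext_deriv r V (\<lambda>y ws. f k y * P (contr (basis_vec k) \<alpha>) y ws) y ws)"
      using ext_deriv_sum[OF V finite_lessThan, of q "p - 1" "\<lambda>k y ws. f k y * P (contr (basis_vec k) \<alpha>) y ws" y ws]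
        smooth_form_fmult[OF V smooth_form_pull[OF c\<alpha>] sf] by simp
    also have "\<dots> = (\<Sum>k<q. covec_wedge (\<lambda>u. dird r u (f k) y) (P (contr (basis_vec k) \<alpha>) y) ws) +
        (\<Sum>k<q. f k y * P (ext_deriv q U (contr (basis_vec k) \<alpha>)) y ws)"
      using ext_deriv_fmult[OF V sf y smooth_form_pull[OF c\<alpha>] ws] Cons.IH[OF c\<alpha>] by (simp add: sum.distrib)
    finally have "ext_deriv r V (P \<alpha>) y (w # ws) = (\<Sum>k<q. f k y * P (lie q U (basis_vec k) \<alpha>) y ws) -
        (\<Sum>k<q. f k y * P (ext_deriv q U (contr (basis_vec k) \<alpha>)) y ws)"
      using ext_deriv_Cons[OF V smooth_form_pull[OF \<alpha>] w, of y ws] dird_pull[OF y w \<alpha> ws] y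
      by (simp add: lie_def[of r] f_def)
    also have "\<dots> = (\<Sum>k<q. f k y * P (contr (basis_vec k) (ext_deriv q U \<alpha>)) y ws)"
      unfolding sum_subtractf[symmetric]
      using contr_ext_deriv[OF U \<alpha> basis_vec_in_vecs]
      by (intro sum.cong refl) (auto simp: pull_eform_def algebra_simps)
    also have "\<dots> = P (ext_deriv q U \<alpha>) y (w # ws)"
      unfolding pull_Cons[OF smooth_form_ext_deriv[OF U \<alpha>] w] f_def ..
    finally show ?thesis .
  qed
qed

lemma pull_wedge: "P (wedge \<alpha> \<beta>) = wedge (P \<alpha>) (P \<beta>)"
proof (intro ext)
  fix y ws
  show "P (wedge \<alpha> \<beta>) y ws = wedge (P \<alpha>) (P \<beta>) y ws"
  proof (cases "y \<in> V \<and> set ws \<subseteq> vecs r")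
    case True
    then have "set (nths ws S) \<subseteq> vecs r" for S using set_nths_subset by fastforce
    with True show ?thesis by (simp add: wedge_def pull_eform_def nths_map)
  next
    case False
    \<comment> \<open>Every vector of ws lands in one of the two sublists; so if one of them lies
      outside \<open>vecs r\<close>, or y outside V, some factor is zero.\<close>
    have *: "P \<alpha> y (nths ws S) * P \<beta> y (nths ws (- S)) = 0" for S
    proof (rule ccontr)
      assume "P \<alpha> y (nths ws S) * P \<beta> y (nths ws (- S)) \<noteq> 0"
      then have "y \<in> V" "set (nths ws S) \<subseteq> vecs r" "set (nths ws (- S)) \<subseteq> vecs r"
        by (auto simp: pull_eform_def split: if_splits)
      moreover have "set ws \<subseteq> set (nths ws S) \<union> set (nths ws (- S))"
      proof
        fix v assume "v \<in> set ws"
        then obtain i where "i < length ws" "v = ws ! i" by (auto simp: in_set_conv_nth)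
        then show "v \<in> set (nths ws S) \<union> set (nths ws (- S))"
          by (cases "i \<in> S") (auto simp: set_nths)
      qed
      ultimately show False using False by blast
    qed
    then have "wedge (P \<alpha>) (P \<beta>) y ws = 0"
      unfolding wedge_def mult.assoc by (simp only: * mult_zero_right sum.neutral_const)
    moreover have "P (wedge \<alpha> \<beta>) y ws = 0" using False by (auto simp: pull_eform_def)
    ultimately show ?thesis by simp
  qed
qed

end

section \<open>Integration along the last coordinate\<close>

text \<open>This is U \<times> \<real>, with the new coordinate at index q. The whole line is taken,
  not the unit interval, so that the set is open and can be the domain of a plot.\<close>

definition cyl :: "nat \<Rightarrow> (nat \<Rightarrow> real) set \<Rightarrow> (nat \<Rightarrow> real) set" where
  "cyl q U = {y \<in> vecs (Suc q). y(q := 0) \<in> U}"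

lemma continuous_on_upd:
  fixes f :: "'b::topological_space \<Rightarrow> nat \<Rightarrow> real"
  shows "continuous_on S f \<Longrightarrow> continuous_on S g \<Longrightarrow> continuous_on S (\<lambda>y. (f y)(q := g y))"
proof (rule continuous_on_coordinatewise_then_product)
  assume f: "continuous_on S f" and g: "continuous_on S g"
  show "continuous_on S (\<lambda>y. ((f y)(q := g y)) i)" for i
    using g continuous_on_product_then_coordinatewise[OF f, of i] by (cases "i = q") auto
qed

lemma openin_cyl:
  assumes "openin (Euclidean_space q) U"
  shows "openin (Euclidean_space (Suc q)) (cyl q U)"
  unfolding cyl_def
  by (rule openin_Euclidean_preimage[OF openin_topspace _ _ assms])
     (intro continuous_on_upd continuous_intros, auto simp: in_vecs_iff)

lemma upd_in_cyl: 
  assumes "openin (Euclidean_space q) U" "x \<in> U"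
  shows "x(q := s) \<in> cyl q U"
proof -
  have "x \<in> vecs q" using assms open_vecs_subset by blast
  moreover from this have "x(q := 0) = x" by (auto simp: in_vecs_iff)
  ultimately show ?thesis using assms(2) by (simp add: cyl_def in_vecs_iff)
qed

definition fibre_int :: "nat \<Rightarrow> (nat \<Rightarrow> real) set \<Rightarrow> eform \<Rightarrow> eform" where
  "fibre_int q U \<alpha> = (\<lambda>x vs. if x \<in> U \<and> set vs \<subseteq> vecs q
     then integral {0..1} (\<lambda>s. \<alpha> (x(q := s)) (basis_vec q # vs)) else 0)"

lemma upd_zero_open: "openin (Euclidean_space q) U \<Longrightarrow> x \<in> U \<Longrightarrow> x(q := 0) = x"
proof -
  assume "openin (Euclidean_space q) U" "x \<in> U"
  then have "x \<in> vecs q" using open_vecs_subset by blast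
  then show ?thesis by (intro fun_upd_idem) (simp add: in_vecs_iff)
qed

context
  fixes q :: nat and U :: "(nat \<Rightarrow> real) set"
  assumes U: "openin (Euclidean_space q) U"
begin

lemma continuous_on_cyl_slice:
  assumes "smooth_on (Suc q) (cyl q U) g" "x \<in> U"
  shows "continuous_on S (\<lambda>s. g (x(q := s)))"
  by (rule continuous_on_compose2[OF smooth_on_continuous[OF assms(1) open_vecs_subset[OF openin_cyl[OF U]]]])
     (intro continuous_on_upd continuous_intros, use upd_in_cyl[OF U assms(2)] in auto)

lemma integrable_cyl_slice:
  "smooth_on (Suc q) (cyl q U) g \<Longrightarrow> x \<in> U \<Longrightarrow> (\<lambda>s. g (x(q := s))) integrable_on {0..1}"
  by (intro integrable_continuous_interval continuous_on_cyl_slice)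

lemma DERIV_param_integral:
  assumes g: "smooth_on (Suc q) (cyl q U) g" and x: "x \<in> U" and i: "i < q"
  shows "((\<lambda>s. integral {0..1} (\<lambda>t. g (x(i := s, q := t)))) has_real_derivative
    integral {0..1} (\<lambda>t. pd i g (x(q := t)))) (at (x i))"
proof -
  obtain e where e: "e > 0" "\<And>s. dist s (x i) < e \<Longrightarrow> x(i := s) \<in> U"
    using eventually_upd_in_open[OF U x i] by (auto simp: eventually_nhds_metric)
  have inU: "x(i := s) \<in> U" if "s \<in> ball (x i) e" for s using e(2) that by (simp add: dist_commute)
  have "((\<lambda>s. integral (cbox 0 1) (\<lambda>t. g (x(i := s, q := t)))) has_real_derivative
      integral (cbox 0 1) (\<lambda>t. pd i g (x(i := x i, q := t)))) (at (x i) within ball (x i) e)"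
  proof (rule leibniz_rule_field_derivative[where fx = "\<lambda>s t. pd i g (x(i := s, q := t))"])
    fix s t :: real assume s: "s \<in> ball (x i) e"
    have tw: "x(i := s, q := t) = x(q := t, i := s)" for s using i by (simp add: fun_upd_twist)
    have "x(q := t, i := s) \<in> cyl q U" using upd_in_cyl[OF U inU[OF s], of t] tw by simp
    then have "((\<lambda>s. g (x(q := t, i := s))) has_real_derivative pd i g (x(q := t, i := s))) (at s)"
      using i by (intro smooth_on_DERIV_upd[OF g]) auto
    then show "((\<lambda>s. g (x(i := s, q := t))) has_real_derivative pd i g (x(i := s, q := t))) (at s within ball (x i) e)"
      by (simp only: tw) (rule has_field_derivative_at_within)
  next
    fix s :: real assume "s \<in> ball (x i) e"
    then show "(\<lambda>t. g (x(i := s, q := t))) integrable_on cbox 0 1"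
      using integrable_cyl_slice[OF g inU] by simp
  next
    have "continuous_on (ball (x i) e \<times> cbox 0 1) (\<lambda>p. pd i g (x(i := fst p, q := snd p)))"
    proof (rule continuous_on_compose2[OF smooth_on_continuous[OF smooth_on_pd[OF g] open_vecs_subset[OF openin_cyl[OF U]]]])
      show "continuous_on (ball (x i) e \<times> cbox 0 1) (\<lambda>p. x(i := fst p, q := snd p))"
        by (intro continuous_on_upd continuous_intros)
      show "(\<lambda>p. x(i := fst p, q := snd p)) ` (ball (x i) e \<times> cbox 0 1) \<subseteq> cyl q U"
        using upd_in_cyl[OF U inU] by auto
    qed (use i in simp)
    then show "continuous_on (ball (x i) e \<times> cbox 0 1) (\<lambda>(s, t). pd i g (x(i := s, q := t)))"
      by (simp add: split_beta)
  qed (use e(1) in auto)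
  then show ?thesis using at_within_open[of "x i" "ball (x i) e"] e(1) by simp
qed

lemma pd_param_integral:
  assumes "smooth_on (Suc q) (cyl q U) g" "x \<in> U" "i < q"
  shows "pd i (\<lambda>x. integral {0..1} (\<lambda>t. g (x(q := t)))) x = integral {0..1} (\<lambda>t. pd i g (x(q := t)))"
  using DERIV_imp_deriv[OF DERIV_param_integral[OF assms]] by (simp add: pd_def)

text \<open>Differentiation under the integral sign yields an integral of the same kind, with
  \<open>pd i g\<close> in place of g, so the order of differentiability rises by induction.\<close>

lemma smooth_on_param_integral:
  assumes "smooth_on (Suc q) (cyl q U) g"
  shows "smooth_on q U (\<lambda>x. integral {0..1} (\<lambda>t. g (x(q := t))))"
proof -
  have cont: "continuous_on U (\<lambda>x. integral {0..1} (\<lambda>t. g (x(q := t))))" if g: "smooth_on (Suc q) (cyl q U) g" for g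
  proof -
    have "continuous_on (U \<times> cbox 0 1) (\<lambda>p. g ((fst p)(q := snd p)))"
      by (rule continuous_on_compose2[OF smooth_on_continuous[OF g open_vecs_subset[OF openin_cyl[OF U]]]])
         (intro continuous_on_upd continuous_intros, use upd_in_cyl[OF U] in auto)
    then show ?thesis
      using integral_continuous_on_param[of U 0 1 "\<lambda>x t. g (x(q := t))"] by (simp add: split_beta)
  qed
  have "\<forall>g. smooth_on (Suc q) (cyl q U) g \<longrightarrow> Ck k q U (\<lambda>x. integral {0..1} (\<lambda>t. g (x(q := t))))" for k
  proof (induction k)
    case 0
    show ?case
      using cont unfolding Ck.simps(1) continuous_map_sub_Euclidean_iff[OF open_vecs_subset[OF U]] by blast
  next
    case (Suc k)
    show ?case
    proof (intro allI impI)
      fix g assume g: "smooth_on (Suc q) (cyl q U) g"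
      show "Ck (Suc k) q U (\<lambda>x. integral {0..1} (\<lambda>t. g (x(q := t))))"
      proof (rule Ck_SucI'[OF U cont[OF g] DERIV_param_integral[OF g]])
        show "Ck k q U (\<lambda>x. integral {0..1} (\<lambda>t. pd i g (x(q := t))))" if "i < q" for i
          using Suc[rule_format, of "pd i g"] smooth_on_pd[OF g, of i] that by simp
      qed
    qed
  qed
  then show ?thesis using assms unfolding smooth_on_def by blast
qed

end

lemma alt_integral:
  assumes "\<And>s. alt q p (a s)" "\<And>vs. (\<lambda>s. a s vs) integrable_on {0..1::real}"
  shows "alt q p (\<lambda>vs. integral {0..1} (\<lambda>s. a s vs))"
  using assms
proof (induction p arbitrary: a)
  case 0
  then show ?case by simp
next
  case (Suc p)
  note i = Suc.prems(2)
  have "alt q p (\<lambda>vs. integral {0..1} (\<lambda>s. a s (v # vs)))" for v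
    using Suc.IH[of "\<lambda>s vs. a s (v # vs)"] alt_tail[OF Suc.prems(1)] i by simp
  moreover have "integral {0..1} (\<lambda>s. a s ((\<lambda>k. c * v k + d * w k) # vs)) =
      c * integral {0..1} (\<lambda>s. a s (v # vs)) + d * integral {0..1} (\<lambda>s. a s (w # vs))"
    if "v \<in> vecs q" "w \<in> vecs q" for v w c d vs
  proof -
    have "integral {0..1} (\<lambda>s. a s ((\<lambda>k. c * v k + d * w k) # vs)) =
        integral {0..1} (\<lambda>s. c * a s (v # vs) + d * a s (w # vs))"
      by (intro integral_cong alt_lin_Cons[OF Suc.prems(1) that])
    also have "\<dots> = integral {0..1} (\<lambda>s. c * a s (v # vs)) + integral {0..1} (\<lambda>s. d * a s (w # vs))"
      using i by (intro integral_add integrable_on_mult_right) auto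
    finally show ?thesis by simp
  qed
  ultimately show ?case using Suc.prems(1) by simp
qed

context
  fixes q :: nat and U :: "(nat \<Rightarrow> real) set"
  assumes U: "openin (Euclidean_space q) U"
begin

lemma smooth_form_fibre_int:
  assumes \<alpha>: "smooth_form (Suc q) (cyl q U) p \<alpha>"
  shows "smooth_form q U (p - 1) (fibre_int q U \<alpha>)"
proof (rule smooth_formI[OF U])
  note UC = openin_cyl[OF U]
  note sm = smooth_formD(3)[OF UC \<alpha>]
  show "fibre_int q U \<alpha> x vs = 0" if "x \<notin> U" for x vs using that by (simp add: fibre_int_def)
  show "alt q (p - 1) (fibre_int q U \<alpha> x)" if x: "x \<in> U" for x
  proof -
    have "alt (Suc q) (p - 1) (\<lambda>vs. integral {0..1} (\<lambda>s. \<alpha> (x(q := s)) (basis_vec q # vs)))"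
      by (intro alt_integral alt_tail smooth_form_alt[OF UC \<alpha>] integrable_cyl_slice[OF U sm x])
    from alt_map[of q "\<lambda>v. v", OF _ _ this] show ?thesis
      using x by (simp add: fibre_int_def in_vecs_iff cong: if_cong)
  qed
  show "smooth_on q U (\<lambda>x. fibre_int q U \<alpha> x vs)" for vs
  proof (cases "set vs \<subseteq> vecs q")
    case True
    then show ?thesis
      using smooth_on_cong[OF U, of "\<lambda>x. fibre_int q U \<alpha> x vs" "\<lambda>x. integral {0..1} (\<lambda>s. \<alpha> (x(q := s)) (basis_vec q # vs))"]
        smooth_on_param_integral[OF U sm, of "basis_vec q # vs"] by (simp add: fibre_int_def)
  next
    case False
    then show ?thesis using smooth_on_const[OF open_vecs_subset[OF U], of 0] by (simp add: fibre_int_def)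
  qed
qed

lemma ext_deriv_fibre_int:
  assumes \<alpha>: "smooth_form (Suc q) (cyl q U) p \<alpha>" and x: "x \<in> U" and vs: "set vs \<subseteq> vecs q"
  shows "ext_deriv q U (fibre_int q U \<alpha>) x vs =
    integral {0..1} (\<lambda>s. ext_deriv (Suc q) (cyl q U) (contr (basis_vec q) \<alpha>) (x(q := s)) vs)"
proof -
  note UC = openin_cyl[OF U]
  note sm = smooth_formD(3)[OF UC smooth_form_contr[OF UC \<alpha>, of "basis_vec q"]]
  let ?om = "\<lambda>i. take i vs @ drop (Suc i) vs"
  let ?f = "\<lambda>i y. contr (basis_vec q) \<alpha> y (?om i)"
  have vsS: "set vs \<subseteq> vecs (Suc q)" using vs by (auto simp: in_vecs_iff)
  have om: "set (?om i) \<subseteq> vecs q" for i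
    using vs set_take_subset[of i vs] set_drop_subset[of "Suc i" vs] by auto
  have int: "(\<lambda>s. pd k (?f i) (x(q := s))) integrable_on {0..1}" if "k < q" for i k
    using that by (intro integrable_cyl_slice[OF U _ x] smooth_on_pd sm) auto
  have pdf: "pd k (\<lambda>y. fibre_int q U \<alpha> y (?om i)) x = integral {0..1} (\<lambda>s. pd k (?f i) (x(q := s)))" if "k < q" for i k
  proof -
    have "pd k (\<lambda>y. fibre_int q U \<alpha> y (?om i)) x = pd k (\<lambda>y. integral {0..1} (\<lambda>s. ?f i (y(q := s)))) x"
      using om by (intro pd_cong[OF U x that]) (simp add: fibre_int_def contr_def)
    then show ?thesis using pd_param_integral[OF U sm x that] by simp
  qed
  \<comment> \<open>The vectors of vs have no component along the fibre, so the derivative in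
    direction q drops out of the exterior derivative on the cylinder.\<close>
  have vq: "(vs ! i) q = 0" if "i < length vs" for i
    using vs nth_mem[OF that] by (auto simp: in_vecs_iff)
  have "ext_deriv q U (fibre_int q U \<alpha>) x vs =
      (\<Sum>i<length vs. (- 1) ^ i * (\<Sum>k<q. (vs ! i) k * integral {0..1} (\<lambda>s. pd k (?f i) (x(q := s)))))"
    using x vs pdf by (simp add: ext_deriv_def)
  also have "\<dots> = integral {0..1} (\<lambda>s. \<Sum>i<length vs. (- 1) ^ i * (\<Sum>k<q. (vs ! i) k * pd k (?f i) (x(q := s))))"
  proof -
    have "integral {0..1} (\<lambda>s. \<Sum>k<q. (vs ! i) k * pd k (?f i) (x(q := s))) =
        (\<Sum>k<q. (vs ! i) k * integral {0..1} (\<lambda>s. pd k (?f i) (x(q := s))))"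
      and "(\<lambda>s. \<Sum>k<q. (vs ! i) k * pd k (?f i) (x(q := s))) integrable_on {0..1}" for i
      by (subst integral_sum; auto intro!: integrable_on_mult_right int)
         (auto intro!: integrable_sum integrable_on_mult_right int)
    then show ?thesis
      by (subst integral_sum) (auto intro!: integrable_on_mult_right)
  qed
  also have "\<dots> = integral {0..1} (\<lambda>s. ext_deriv (Suc q) (cyl q U) (contr (basis_vec q) \<alpha>) (x(q := s)) vs)"
    using vsS upd_in_cyl[OF U x] vq by (intro integral_cong) (simp add: ext_deriv_def)
  finally show ?thesis .
qed

text \<open>Contract d\<alpha> with the fibre direction: by Cartan's formula this is the derivative
  along the fibre minus d of the contraction. Integrated, the first term is the difference of the
  end values and the second is minus d of the fibre integral.\<close>

lemma fibre_int_homotopy: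
  assumes \<alpha>: "smooth_form (Suc q) (cyl q U) p \<alpha>" and x: "x \<in> U" and vs: "set vs \<subseteq> vecs q"
  shows "ext_deriv q U (fibre_int q U \<alpha>) x vs + fibre_int q U (ext_deriv (Suc q) (cyl q U) \<alpha>) x vs =
    \<alpha> (x(q := 1)) vs - \<alpha> (x(q := 0)) vs"
proof -
  note UC = openin_cyl[OF U]
  note sm = smooth_formD(3)[OF UC \<alpha>]
  have e: "basis_vec q \<in> vecs (Suc q)" by (rule basis_vec_in_vecs) simp
  have "fibre_int q U (ext_deriv (Suc q) (cyl q U) \<alpha>) x vs =
      integral {0..1} (\<lambda>s. pd q (\<lambda>y. \<alpha> y vs) (x(q := s)) - ext_deriv (Suc q) (cyl q U) (contr (basis_vec q) \<alpha>) (x(q := s)) vs)"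
    using x vs upd_in_cyl[OF U x] by (simp add: fibre_int_def ext_deriv_Cons[OF UC \<alpha> e] lie_def dird_basis_vec)
  also have "\<dots> = integral {0..1} (\<lambda>s. pd q (\<lambda>y. \<alpha> y vs) (x(q := s))) -
      integral {0..1} (\<lambda>s. ext_deriv (Suc q) (cyl q U) (contr (basis_vec q) \<alpha>) (x(q := s)) vs)"
    by (intro integral_diff integrable_cyl_slice[OF U _ x] smooth_on_pd sm
        smooth_formD(3)[OF UC smooth_form_ext_deriv[OF UC smooth_form_contr[OF UC \<alpha>]]]) simp
  also have "integral {0..1} (\<lambda>s. pd q (\<lambda>y. \<alpha> y vs) (x(q := s))) = \<alpha> (x(q := 1)) vs - \<alpha> (x(q := 0)) vs"
  proof (rule integral_unique, rule fundamental_theorem_of_calculus)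
    show "((\<lambda>s. \<alpha> (x(q := s)) vs) has_vector_derivative pd q (\<lambda>y. \<alpha> y vs) (x(q := s))) (at s within {0..1})" for s
      using smooth_on_DERIV_upd[OF sm lessI upd_in_cyl[OF U x]]
      by (simp add: has_real_derivative_iff_has_vector_derivative[symmetric] has_field_derivative_at_within)
  qed simp
  finally show ?thesis using ext_deriv_fibre_int[OF \<alpha> x vs] by (simp del: fun_upd_apply)
qed

end

subsection \<open>Naturality\<close>

text \<open>The product of h with the identity of the line.\<close>

definition cyl_map :: "nat \<Rightarrow> nat \<Rightarrow> ((nat \<Rightarrow> real) \<Rightarrow> nat \<Rightarrow> real) \<Rightarrow> (nat \<Rightarrow> real) \<Rightarrow> nat \<Rightarrow> real" where
  "cyl_map r q h y = (h (y(r := 0)))(q := y r)"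

lemma smooth_map_on_upd_last:
  "openin (Euclidean_space q) U \<Longrightarrow> smooth_map_on (Suc q) (cyl q U) q (\<lambda>y. y(q := 0))"
  by (auto simp: smooth_map_on_def cyl_def in_vecs_iff intro!: smooth_on_coord)

context pullback
begin

lemma cyl_map_upd: 
  assumes "y \<in> V" shows "cyl_map r q h (y(r := s)) = (h y)(q := s)"
proof -
  have "y(r := 0) = y" by (rule upd_zero_open[OF V assms])
  then show ?thesis by (simp add: cyl_map_def)
qed

lemma cyl_map_in_cyl: "cyl_map r q h ` cyl r V \<subseteq> cyl q U"
proof
  fix z assume "z \<in> cyl_map r q h ` cyl r V"
  then obtain y where y: "y \<in> cyl r V" "z = cyl_map r q h y" by blast
  then have "h (y(r := 0)) \<in> U" using hU by (auto simp: cyl_def)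
  then show "z \<in> cyl q U" using upd_in_cyl[OF U] by (simp add: y(2) cyl_map_def)
qed

lemma smooth_map_cyl_map: "smooth_map_on (Suc r) (cyl r V) (Suc q) (cyl_map r q h)"
  unfolding smooth_map_on_def
proof (intro conjI allI impI)
  show "cyl_map r q h ` cyl r V \<subseteq> vecs (Suc q)"
    using cyl_map_in_cyl open_vecs_subset[OF openin_cyl[OF U]] by blast
  fix j assume "j < Suc q"
  show "smooth_on (Suc r) (cyl r V) (\<lambda>y. cyl_map r q h y j)"
  proof (cases "j = q")
    case True
    then show ?thesis by (simp add: cyl_map_def smooth_on_coord open_vecs_subset openin_cyl V)
  next
    case False
    then have "smooth_on r V (\<lambda>y. h y j)" using \<open>j < Suc q\<close> by (intro h_coord) simp
    then have "smooth_on (Suc r) (cyl r V) (\<lambda>y. h (y(r := 0)) j)"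
      by (rule smooth_on_compose[OF openin_cyl[OF V] V _ smooth_map_on_upd_last[OF V]]) (auto simp: cyl_def)
    then show ?thesis using False by (simp add: cyl_map_def)
  qed
qed

lemma pd_cyl_map:
  assumes y: "y \<in> V" and k: "k < Suc r"
  shows "pd k (\<lambda>z. cyl_map r q h z j) (y(r := s)) =
    (if j = q then if k = r then 1 else 0 else if k = r then 0 else pd k (\<lambda>z. h z j) y)"
proof -
  note yr = upd_zero_open[OF V y]
  consider "j = q" | "j \<noteq> q" "k = r" | "j \<noteq> q" "k \<noteq> r" by blast
  then show ?thesis
  proof cases
    case 1
    then show ?thesis using pd_coord[of k r] by (auto simp: cyl_map_def)
  next
    case 2
    then show ?thesis by (simp add: cyl_map_def pd_def)
  next
    case 3
    have "(y(r := s))(k := t, r := 0) = y(k := t)" for t using yr 3 by (metis fun_upd_twist fun_upd_upd)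
    then show ?thesis using 3 by (simp add: cyl_map_def pd_def)
  qed
qed

lemma jac_cyl_map:
  assumes y: "y \<in> V"
  shows "jac (Suc r) (cyl_map r q h) (y(r := s)) (basis_vec r) = basis_vec q"
    and "w \<in> vecs r \<Longrightarrow> jac (Suc r) (cyl_map r q h) (y(r := s)) w = jac r h y w"
proof -
  show "jac (Suc r) (cyl_map r q h) (y(r := s)) (basis_vec r) = basis_vec q"
    by (rule ext) (simp add: jac_def pd_cyl_map[OF y] basis_vec_def)
  show "jac (Suc r) (cyl_map r q h) (y(r := s)) w = jac r h y w" if w: "w \<in> vecs r"
  proof
    fix j
    have "jac r h y w q = 0" using jac_in_vecs[OF V h y] by (auto simp: in_vecs_iff)
    moreover have "w r = 0" using w by (simp add: in_vecs_iff)
    ultimately show "jac (Suc r) (cyl_map r q h) (y(r := s)) w j = jac r h y w j"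
      by (cases "j = q") (simp_all add: jac_def pd_cyl_map[OF y])
  qed
qed

text \<open>The Jacobian of \<open>cyl_map\<close> fixes the fibre direction and acts like that of h
  on the other vectors. This naturality is what makes the homotopy operator compatible with all
  plots.\<close>

lemma fibre_int_pull:
  "fibre_int r V (pull_eform (Suc r) (cyl r V) (cyl_map r q h) \<alpha>) = P (fibre_int q U \<alpha>)"
proof (intro ext)
  fix y ws
  show "fibre_int r V (pull_eform (Suc r) (cyl r V) (cyl_map r q h) \<alpha>) y ws = P (fibre_int q U \<alpha>) y ws"
  proof (cases "y \<in> V \<and> set ws \<subseteq> vecs r")
    case True
    then have y: "y \<in> V" and ws: "set ws \<subseteq> vecs r" by auto
    have "set (basis_vec r # ws) \<subseteq> vecs (Suc r)" using ws basis_vec_in_vecs[of r "Suc r"] by (auto simp: in_vecs_iff)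
    moreover have "map (jac (Suc r) (cyl_map r q h) (y(r := s))) ws = map (jac r h y) ws" for s
      using jac_cyl_map(2)[OF y] ws by (intro map_cong) auto
    moreover have "h y \<in> U" using hU y by blast
    moreover have "set (map (jac r h y) ws) \<subseteq> vecs q" using jac_in_vecs[OF V h y] by auto
    ultimately show ?thesis using y ws
      by (simp add: fibre_int_def pull_eform_def upd_in_cyl[OF V] cyl_map_upd jac_cyl_map(1) del: map_eq_conv)
  qed (auto simp: fibre_int_def pull_eform_def)
qed

end

section \<open>Differential graded algebras and their cohomology\<close>

text \<open>The laws on which cohomology and its operations rest, stated once so that the complex of
  \<Sigma>M and the fibre product can be treated alike.\<close>

locale dga =
  fixes A :: "'x cdga"
  assumes zero_in: "gzero A n \<in> gcomp A n"
    and one_in: "gone A \<in> gcomp A 0"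
    and add_in: "x \<in> gcomp A n \<Longrightarrow> y \<in> gcomp A n \<Longrightarrow> gadd A n x y \<in> gcomp A n"
    and scale_in: "x \<in> gcomp A n \<Longrightarrow> gscale A n c x \<in> gcomp A n"
    and mult_in: "x \<in> gcomp A n \<Longrightarrow> y \<in> gcomp A m \<Longrightarrow> gmult A n m x y \<in> gcomp A (n + m)"
    and diff_in: "x \<in> gcomp A n \<Longrightarrow> gdiff A n x \<in> gcomp A (Suc n)"
    and add_assoc: "x \<in> gcomp A n \<Longrightarrow> y \<in> gcomp A n \<Longrightarrow> z \<in> gcomp A n \<Longrightarrow>
      gadd A n (gadd A n x y) z = gadd A n x (gadd A n y z)"
    and add_comm: "x \<in> gcomp A n \<Longrightarrow> y \<in> gcomp A n \<Longrightarrow> gadd A n x y = gadd A n y x"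
    and add_zero: "x \<in> gcomp A n \<Longrightarrow> gadd A n x (gzero A n) = x"
    and add_neg: "x \<in> gcomp A n \<Longrightarrow> gadd A n x (gscale A n (- 1) x) = gzero A n"
    and scale_add: "x \<in> gcomp A n \<Longrightarrow> y \<in> gcomp A n \<Longrightarrow>
      gscale A n c (gadd A n x y) = gadd A n (gscale A n c x) (gscale A n c y)"
    and scale_scale: "x \<in> gcomp A n \<Longrightarrow> gscale A n c (gscale A n d x) = gscale A n (c * d) x"
    and scale_one: "x \<in> gcomp A n \<Longrightarrow> gscale A n 1 x = x"
    and scale_zero: "gscale A n c (gzero A n) = gzero A n"
    and diff_add: "x \<in> gcomp A n \<Longrightarrow> y \<in> gcomp A n \<Longrightarrow>
      gdiff A n (gadd A n x y) = gadd A (Suc n) (gdiff A n x) (gdiff A n y)"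
    and diff_scale: "x \<in> gcomp A n \<Longrightarrow> gdiff A n (gscale A n c x) = gscale A (Suc n) c (gdiff A n x)"
    and diff_diff: "x \<in> gcomp A n \<Longrightarrow> gdiff A (Suc n) (gdiff A n x) = gzero A (Suc (Suc n))"
    and diff_one: "gdiff A 0 (gone A) = gzero A (Suc 0)"
    and mult_add_left: "x \<in> gcomp A n \<Longrightarrow> x' \<in> gcomp A n \<Longrightarrow> y \<in> gcomp A m \<Longrightarrow>
      gmult A n m (gadd A n x x') y = gadd A (n + m) (gmult A n m x y) (gmult A n m x' y)"
    and mult_add_right: "x \<in> gcomp A n \<Longrightarrow> y \<in> gcomp A m \<Longrightarrow> y' \<in> gcomp A m \<Longrightarrow>
      gmult A n m x (gadd A m y y') = gadd A (n + m) (gmult A n m x y) (gmult A n m x y')"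
    and mult_zero_left: "y \<in> gcomp A m \<Longrightarrow> gmult A n m (gzero A n) y = gzero A (n + m)"
    and mult_zero_right: "x \<in> gcomp A n \<Longrightarrow> gmult A n m x (gzero A m) = gzero A (n + m)"
    and leibniz: "x \<in> gcomp A n \<Longrightarrow> y \<in> gcomp A m \<Longrightarrow> gdiff A (n + m) (gmult A n m x y) =
      gadd A (Suc (n + m)) (gmult A (Suc n) m (gdiff A n x) y) (gscale A (Suc (n + m)) ((- 1) ^ n) (gmult A n (Suc m) x (gdiff A m y)))"
begin

lemma diff_zero: "gdiff A n (gzero A n) = gzero A (Suc n)"
proof -
  have "gdiff A n (gzero A n) = gdiff A n (gadd A n (gzero A n) (gscale A n (- 1) (gzero A n)))"
    by (simp add: add_neg zero_in)
  also have "\<dots> = gadd A (Suc n) (gdiff A n (gzero A n)) (gscale A (Suc n) (- 1) (gdiff A n (gzero A n)))"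
    by (simp only: diff_add diff_scale zero_in scale_in)
  also have "\<dots> = gzero A (Suc n)" by (simp add: add_neg diff_in zero_in)
  finally show ?thesis .
qed

lemma one_cocycle: "gone A \<in> cocycles A 0"
  by (simp add: cocycles_def one_in diff_one)

lemma cocycles_in: "x \<in> cocycles A n \<Longrightarrow> x \<in> gcomp A n"
  by (simp add: cocycles_def)

lemma add_cocycle: "x \<in> cocycles A n \<Longrightarrow> y \<in> cocycles A n \<Longrightarrow> gadd A n x y \<in> cocycles A n"
  by (simp add: cocycles_def add_in diff_add add_zero zero_in)

lemma scale_cocycle: "x \<in> cocycles A n \<Longrightarrow> gscale A n c x \<in> cocycles A n"
  by (simp add: cocycles_def scale_in diff_scale scale_zero)

lemma mult_cocycle: "x \<in> cocycles A n \<Longrightarrow> y \<in> cocycles A m \<Longrightarrow> gmult A n m x y \<in> cocycles A (n + m)"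
  using mult_zero_left[of y m "Suc n"] mult_zero_right[of x n "Suc m"]
  by (simp add: cocycles_def mult_in leibniz scale_zero add_zero zero_in)

lemma coboundary_in_cocycles: "b \<in> coboundaries A n \<Longrightarrow> b \<in> cocycles A n"
  by (cases n) (auto simp: coboundaries_def cocycles_def zero_in diff_zero diff_in diff_diff)

lemma coboundary_in: "b \<in> coboundaries A n \<Longrightarrow> b \<in> gcomp A n"
  by (intro cocycles_in coboundary_in_cocycles)

lemma zero_coboundary: "gzero A n \<in> coboundaries A n"
  using diff_zero zero_in by (cases n) (auto simp: coboundaries_def image_iff intro: sym)

lemma add_coboundary: "b \<in> coboundaries A n \<Longrightarrow> c \<in> coboundaries A n \<Longrightarrow> gadd A n b c \<in> coboundaries A n"
proof (cases n)
  case (Suc k)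
  assume "b \<in> coboundaries A n" "c \<in> coboundaries A n"
  then obtain x y where "x \<in> gcomp A k" "y \<in> gcomp A k" "b = gdiff A k x" "c = gdiff A k y"
    using Suc by (auto simp: coboundaries_def)
  then show ?thesis using Suc add_in[of x k y] diff_add[of x k y] by (auto simp: coboundaries_def image_iff intro!: bexI[of _ "gadd A k x y"])
qed (simp add: coboundaries_def add_zero zero_in)

lemma scale_coboundary: "b \<in> coboundaries A n \<Longrightarrow> gscale A n c b \<in> coboundaries A n"
proof (cases n)
  case (Suc k)
  assume "b \<in> coboundaries A n"
  then obtain x where "x \<in> gcomp A k" "b = gdiff A k x" using Suc by (auto simp: coboundaries_def)
  then show ?thesis using Suc scale_in[of x k c] diff_scale[of x k c]
    by (auto simp: coboundaries_def image_iff intro!: bexI[of _ "gscale A k c x"])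
qed (simp add: coboundaries_def scale_zero)

lemma mult_coboundary_left:
  assumes "b \<in> coboundaries A n" "y \<in> cocycles A m"
  shows "gmult A n m b y \<in> coboundaries A (n + m)"
proof (cases n)
  case 0
  then show ?thesis using assms zero_coboundary by (simp add: coboundaries_def mult_zero_left[of y m 0] cocycles_in)
next
  case (Suc k)
  then obtain a where a: "a \<in> gcomp A k" "b = gdiff A k a" using assms by (auto simp: coboundaries_def)
  have "gdiff A (k + m) (gmult A k m a y) = gmult A n m b y"
    using a assms(2) Suc leibniz[of a k y m] mult_zero_right[of a k "Suc m"] mult_in[of b n y m] coboundary_in[OF assms(1)]
    by (simp add: cocycles_def scale_zero add_zero)
  then show ?thesis using Suc mult_in[OF a(1) cocycles_in[OF assms(2)]]
    by (auto simp: coboundaries_def image_iff intro!: bexI[of _ "gmult A k m a y"])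
qed

lemma mult_coboundary_right:
  assumes "x \<in> cocycles A n" "b \<in> coboundaries A m"
  shows "gmult A n m x b \<in> coboundaries A (n + m)"
proof (cases m)
  case 0
  then show ?thesis using assms zero_coboundary[of n] by (simp add: coboundaries_def mult_zero_right[of x n 0] cocycles_in)
next
  case (Suc k)
  then obtain a where a: "a \<in> gcomp A k" "b = gdiff A k a" using assms by (auto simp: coboundaries_def)
  note xb = mult_in[OF cocycles_in[OF assms(1)] coboundary_in[OF assms(2)]]
  have "gdiff A (n + k) (gmult A n k x a) = gscale A (n + m) ((- 1) ^ n) (gmult A n m x b)"
    using a assms(1) Suc leibniz[of x n a k] mult_zero_left[of a k "Suc n"] add_comm[OF zero_in, of _ "n + m"] 
      scale_in[OF xb, of "(-1)^n"] add_zero[OF scale_in[OF xb, of "(-1)^n"]]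
    by (simp add: cocycles_def)
  moreover have "gdiff A (n + k) (gmult A n k x a) \<in> coboundaries A (n + m)"
    using Suc mult_in[OF cocycles_in[OF assms(1)] a(1)] by (auto simp: coboundaries_def)
  \<comment> \<open>The Leibniz rule gives the product only up to the sign (-1)^n; scaling by the
    same sign once more removes it.\<close>
  ultimately have "gscale A (n + m) ((- 1) ^ n) (gscale A (n + m) ((- 1) ^ n) (gmult A n m x b)) \<in> coboundaries A (n + m)"
    by (auto intro: scale_coboundary)
  then show ?thesis by (simp add: scale_scale[OF xb] power_mult_distrib[symmetric] scale_one[OF xb])
qed

section \<open>Cohomology classes and the operations on them\<close>

lemma cohomologousI: "z \<in> cocycles A n \<Longrightarrow> b \<in> coboundaries A n \<Longrightarrow> (z, gadd A n z b) \<in> cohomologous A n"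
  by (auto simp: cohomologous_def add_cocycle coboundary_in_cocycles)

lemma cohomologousE:
  assumes "(z, z') \<in> cohomologous A n"
  obtains b where "z \<in> cocycles A n" "z' \<in> cocycles A n" "b \<in> coboundaries A n" "z' = gadd A n z b"
  using assms by (auto simp: cohomologous_def)

lemma add_add_neg: "x \<in> gcomp A n \<Longrightarrow> b \<in> gcomp A n \<Longrightarrow> gadd A n (gadd A n x b) (gscale A n (- 1) b) = x"
  by (simp add: add_assoc scale_in add_neg add_zero)

lemma equiv_cohomologous: "equiv (cocycles A n) (cohomologous A n)"
proof (rule equivI)
  show "cohomologous A n \<subseteq> cocycles A n \<times> cocycles A n" by (auto simp: cohomologous_def)
  show "refl_on (cocycles A n) (cohomologous A n)"
    using cohomologousI[OF _ zero_coboundary] by (auto intro!: refl_onI simp: add_zero cocycles_in)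
  show "sym (cohomologous A n)"
  proof (rule symI)
    fix z z' assume "(z, z') \<in> cohomologous A n"
    then obtain b where b: "z \<in> cocycles A n" "z' \<in> cocycles A n" "b \<in> coboundaries A n" "z' = gadd A n z b"
      by (rule cohomologousE)
    then show "(z', z) \<in> cohomologous A n"
      using cohomologousI[OF b(2) scale_coboundary[OF b(3), of "- 1"]] add_add_neg[of z n b]
      by (simp add: cocycles_in coboundary_in)
  qed
  show "trans (cohomologous A n)"
  proof (rule transI)
    fix z z' z'' assume "(z, z') \<in> cohomologous A n" "(z', z'') \<in> cohomologous A n"
    then show "(z, z'') \<in> cohomologous A n"
      using cohomologousI[of z n] by (elim cohomologousE) (auto simp: add_assoc cocycles_in coboundary_in add_coboundary)
  qed
qed

lemma cohom_class_eq_iff: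
  "z \<in> cocycles A n \<Longrightarrow> z' \<in> cocycles A n \<Longrightarrow> cohom_class A n z = cohom_class A n z' \<longleftrightarrow> (z, z') \<in> cohomologous A n"
  unfolding cohom_class_def by (rule eq_equiv_class_iff[OF equiv_cohomologous])

lemma cohom_class_eqI: "(z, z') \<in> cohomologous A n \<Longrightarrow> cohom_class A n z = cohom_class A n z'"
  unfolding cohom_class_def by (rule equiv_class_eq[OF equiv_cohomologous])

lemma in_cohomE:
  assumes "X \<in> gcomp (cohomology A) n"
  obtains x where "x \<in> cocycles A n" "X = cohom_class A n x"
  using assms by (auto simp: cohomology_def cohom_class_def quotient_def)

lemma cohom_class_in: "x \<in> cocycles A n \<Longrightarrow> cohom_class A n x \<in> gcomp (cohomology A) n"
  by (auto simp: cohomology_def cohom_class_def quotient_def)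

lemma in_cohom_classD: "y \<in> cohom_class A n x \<Longrightarrow> (x, y) \<in> cohomologous A n"
  by (simp add: cohom_class_def)

lemma self_in_cohom_class: "x \<in> cocycles A n \<Longrightarrow> x \<in> cohom_class A n x"
  using equiv_class_self[OF equiv_cohomologous] by (simp add: cohom_class_def)

text \<open>The operations of \<open>cohomology\<close> are unions over all representatives; once
  the resulting class is independent of the representative, the union is a single class. Addition
  and multiplication below follow the same pattern.\<close>

lemma cohom_scale:
  assumes x: "x \<in> cocycles A n"
  shows "gscale (cohomology A) n c (cohom_class A n x) = cohom_class A n (gscale A n c x)"
proof -
  have "cohom_class A n (gscale A n c x') = cohom_class A n (gscale A n c x)" if x': "x' \<in> cohom_class A n x" for x'
  proof -
    obtain b where b: "x' = gadd A n x b" "b \<in> coboundaries A n"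
      using in_cohom_classD[OF x'] by (auto elim: cohomologousE)
    then show ?thesis
      using cohomologousI[OF scale_cocycle[OF x] scale_coboundary[OF b(2)], of c c]
      by (intro cohom_class_eqI[symmetric]) (simp add: scale_add cocycles_in[OF x] coboundary_in)
  qed
  then have "(\<Union>x'\<in>cohom_class A n x. cohom_class A n (gscale A n c x')) = cohom_class A n (gscale A n c x)"
    using self_in_cohom_class[OF x] by (intro SUP_eq_const) (blast, blast)
  then show ?thesis by (simp add: cohomology_def)
qed

lemma cohom_add:
  assumes x: "x \<in> cocycles A n" and y: "y \<in> cocycles A n"
  shows "gadd (cohomology A) n (cohom_class A n x) (cohom_class A n y) = cohom_class A n (gadd A n x y)"
proof -
  have "cohom_class A n (gadd A n x' y') = cohom_class A n (gadd A n x y)"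
    if x': "x' \<in> cohom_class A n x" and y': "y' \<in> cohom_class A n y" for x' y'
  proof -
    obtain b c where b: "x' = gadd A n x b" "b \<in> coboundaries A n" "y' = gadd A n y c" "c \<in> coboundaries A n"
      using in_cohom_classD[OF x'] in_cohom_classD[OF y'] by (auto elim!: cohomologousE)
    note in' = cocycles_in[OF x] cocycles_in[OF y] coboundary_in[OF b(2)] coboundary_in[OF b(4)]
    have "gadd A n x' y' = gadd A n x (gadd A n b (gadd A n y c))"
      unfolding b using in' by (simp add: add_assoc add_in)
    also have "gadd A n b (gadd A n y c) = gadd A n y (gadd A n b c)"
      using in' add_assoc[of b n y c] add_assoc[of y n b c] add_comm[of b n y] by simp
    also have "gadd A n x (gadd A n y (gadd A n b c)) = gadd A n (gadd A n x y) (gadd A n b c)"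
      using in' by (simp add: add_assoc add_in)
    finally show ?thesis
      using cohomologousI[OF add_cocycle[OF x y] add_coboundary[OF b(2,4)]]
      by (intro cohom_class_eqI[symmetric]) simp
  qed
  then have "(\<Union>x'\<in>cohom_class A n x. \<Union>y'\<in>cohom_class A n y. cohom_class A n (gadd A n x' y')) =
      cohom_class A n (gadd A n x y)"
    using self_in_cohom_class[OF x] self_in_cohom_class[OF y] by (intro SUP_eq_const) (blast, blast, blast)
  then show ?thesis by (simp add: cohomology_def)
qed

lemma cohom_mult:
  assumes x: "x \<in> cocycles A n" and y: "y \<in> cocycles A m"
  shows "gmult (cohomology A) n m (cohom_class A n x) (cohom_class A m y) = cohom_class A (n + m) (gmult A n m x y)"
proof -
  have "cohom_class A (n + m) (gmult A n m x' y') = cohom_class A (n + m) (gmult A n m x y)"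
    if x': "x' \<in> cohom_class A n x" and y': "y' \<in> cohom_class A m y" for x' y'
  proof -
    obtain b c where b: "x' = gadd A n x b" "b \<in> coboundaries A n" "x' \<in> cocycles A n"
      "y' = gadd A m y c" "c \<in> coboundaries A m"
      using in_cohom_classD[OF x'] in_cohom_classD[OF y'] by (auto elim!: cohomologousE)
    note in' = cocycles_in[OF x] cocycles_in[OF y] coboundary_in[OF b(2)] coboundary_in[OF b(5)]
    \<comment> \<open>The factors are replaced one at a time, so that each coboundary is multiplied
      by a cocycle.\<close>
    have "cohom_class A (n + m) (gmult A n m x' y') = cohom_class A (n + m) (gmult A n m x' y)"
      using cohomologousI[OF mult_cocycle[OF b(3) y] mult_coboundary_right[OF b(3,5)]] in' cocycles_in[OF b(3)]
      by (intro cohom_class_eqI[symmetric]) (simp add: b(4) mult_add_right)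
    also have "\<dots> = cohom_class A (n + m) (gmult A n m x y)"
      using cohomologousI[OF mult_cocycle[OF x y] mult_coboundary_left[OF b(2) y]] in'
      by (intro cohom_class_eqI[symmetric]) (simp add: b(1) mult_add_left)
    finally show ?thesis .
  qed
  then have "(\<Union>x'\<in>cohom_class A n x. \<Union>y'\<in>cohom_class A m y. cohom_class A (n + m) (gmult A n m x' y')) =
      cohom_class A (n + m) (gmult A n m x y)"
    using self_in_cohom_class[OF x] self_in_cohom_class[OF y] by (intro SUP_eq_const) (blast, blast, blast)
  then show ?thesis by (simp add: cohomology_def)
qed

end

section \<open>Homomorphisms, products, fibre products and induced isomorphisms\<close>

definition dga_hom :: "'x cdga \<Rightarrow> 'y cdga \<Rightarrow> ('x \<Rightarrow> 'y) \<Rightarrow> bool" where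
  "dga_hom A B F \<longleftrightarrow>
     (\<forall>n. \<forall>x\<in>gcomp A n. F x \<in> gcomp B n) \<and>
     (\<forall>n. F (gzero A n) = gzero B n) \<and> F (gone A) = gone B \<and>
     (\<forall>n. \<forall>x\<in>gcomp A n. \<forall>y\<in>gcomp A n. F (gadd A n x y) = gadd B n (F x) (F y)) \<and>
     (\<forall>n c. \<forall>x\<in>gcomp A n. F (gscale A n c x) = gscale B n c (F x)) \<and>
     (\<forall>n m. \<forall>x\<in>gcomp A n. \<forall>y\<in>gcomp A m. F (gmult A n m x y) = gmult B n m (F x) (F y)) \<and>
     (\<forall>n. \<forall>x\<in>gcomp A n. F (gdiff A n x) = gdiff B n (F x))"

lemma dga_homD:
  assumes "dga_hom A B F"
  shows "x \<in> gcomp A n \<Longrightarrow> F x \<in> gcomp B n" "F (gzero A n) = gzero B n" "F (gone A) = gone B"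
    "x \<in> gcomp A n \<Longrightarrow> y \<in> gcomp A n \<Longrightarrow> F (gadd A n x y) = gadd B n (F x) (F y)"
    "x \<in> gcomp A n \<Longrightarrow> F (gscale A n c x) = gscale B n c (F x)"
    "x \<in> gcomp A n \<Longrightarrow> z \<in> gcomp A m \<Longrightarrow> F (gmult A n m x z) = gmult B n m (F x) (F z)"
    "x \<in> gcomp A n \<Longrightarrow> F (gdiff A n x) = gdiff B n (F x)"
  using assms unfolding dga_hom_def by blast+

lemma dga_prod:
  assumes "dga A" "dga B"
  shows "dga (prod_cdga A B)"
proof -
  interpret A: dga A by fact
  interpret B: dga B by fact
  show ?thesis
    by unfold_locales
      (auto simp: prod_cdga_def A.zero_in B.zero_in A.one_in B.one_in A.add_in B.add_in A.scale_in B.scale_in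
        A.mult_in B.mult_in A.diff_in B.diff_in A.add_assoc B.add_assoc A.add_zero B.add_zero A.add_neg B.add_neg
        A.scale_add B.scale_add A.scale_scale B.scale_scale A.scale_one B.scale_one A.scale_zero B.scale_zero
        A.diff_add B.diff_add A.diff_scale B.diff_scale A.diff_diff B.diff_diff A.diff_one B.diff_one
        A.mult_add_left B.mult_add_left A.mult_add_right B.mult_add_right A.mult_zero_left B.mult_zero_left
        A.mult_zero_right B.mult_zero_right A.leibniz B.leibniz intro: A.add_comm B.add_comm)
qed

lemma gcomp_fibre_prod: "gcomp (fibre_prod A F B G) n = {z \<in> gcomp (prod_cdga A B) n. F (fst z) = G (snd z)}"
  by (auto simp: fibre_prod_def prod_cdga_def)

lemma fibre_prod_ops:
  "gzero (fibre_prod A F B G) = gzero (prod_cdga A B)" "gadd (fibre_prod A F B G) = gadd (prod_cdga A B)"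
  "gscale (fibre_prod A F B G) = gscale (prod_cdga A B)" "gone (fibre_prod A F B G) = gone (prod_cdga A B)"
  "gmult (fibre_prod A F B G) = gmult (prod_cdga A B)" "gdiff (fibre_prod A F B G) = gdiff (prod_cdga A B)"
  by (simp_all add: fibre_prod_def)

text \<open>The laws are inherited from the product; F and G enter in showing that the operations
  preserve the agreement of the two images.\<close>

lemma dga_fibre_prod:
  assumes "dga A" "dga B" and F: "dga_hom A C F" and G: "dga_hom B C G"
  shows "dga (fibre_prod A F B G)"
proof -
  interpret P: dga "prod_cdga A B" by (rule dga_prod) fact+
  note hom = dga_homD[OF F] dga_homD[OF G]
  show ?thesis
    unfolding dga_def fibre_prod_ops gcomp_fibre_prod
    by (intro conjI allI impI; (rule P.add_assoc P.add_comm P.add_zero P.add_neg P.scale_add P.scale_scale P.scale_one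
        P.scale_zero P.diff_add P.diff_scale P.diff_diff P.diff_one P.mult_add_left P.mult_add_right
        P.mult_zero_left P.mult_zero_right P.leibniz; blast)?)
      (use P.zero_in P.one_in P.add_in P.scale_in P.mult_in P.diff_in in 
        \<open>auto simp: prod_cdga_def hom\<close>)
qed

text \<open>Bijectivity is asked for on representatives, while products and the unit are handled by
  F alone. So a map in the other direction may be used for bijectivity without being
  multiplicative.\<close>

theorem galg_iso_cohomology:
  assumes "dga A" "dga B" and F: "dga_hom A B F"
    and surj: "\<And>n z. z \<in> cocycles B n \<Longrightarrow> \<exists>w\<in>cocycles A n. (F w, z) \<in> cohomologous B n"
    and inj: "\<And>n w w'. w \<in> cocycles A n \<Longrightarrow> w' \<in> cocycles A n \<Longrightarrow> (F w, F w') \<in> cohomologous B n \<Longrightarrow>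
      (w, w') \<in> cohomologous A n"
  defines "\<Phi> \<equiv> \<lambda>n X. \<Union>x\<in>X. cohom_class B n (F x)"
  shows "galg_iso (cohomology A) (cohomology B) \<Phi>"
proof -
  interpret A: dga A by fact
  interpret B: dga B by fact
  note hom = dga_homD[OF F]
  have Fz: "F x \<in> cocycles B n" if "x \<in> cocycles A n" for x n
    using that hom(2)[of "Suc n"] hom(7)[of x n] by (simp add: cocycles_def hom(1))
  have Fb: "F b \<in> coboundaries B n" if "b \<in> coboundaries A n" for b n
    using that hom(2)[of 0] hom(1,7) by (cases n) (auto simp: coboundaries_def)
  have \<Phi>: "\<Phi> n (cohom_class A n x) = cohom_class B n (F x)" if x: "x \<in> cocycles A n" for n x
  proof -
    have "cohom_class B n (F x') = cohom_class B n (F x)" if x': "x' \<in> cohom_class A n x" for x'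
    proof -
      obtain b where b: "x' = gadd A n x b" "b \<in> coboundaries A n"
        using A.in_cohom_classD[OF x'] by (auto elim: A.cohomologousE)
      then show ?thesis
        using B.cohomologousI[OF Fz[OF x] Fb[OF b(2)]]
        by (intro B.cohom_class_eqI[symmetric]) (simp add: hom A.cocycles_in[OF x] A.coboundary_in)
    qed
    then show ?thesis
      unfolding \<Phi>_def using A.self_in_cohom_class[OF x] by (intro SUP_eq_const) (blast, blast)
  qed
  have "bij_betw (\<Phi> n) (gcomp (cohomology A) n) (gcomp (cohomology B) n)" for n
  proof (rule bij_betw_imageI)
    show "inj_on (\<Phi> n) (gcomp (cohomology A) n)"
    proof (rule inj_onI)
      fix X Y assume X: "X \<in> gcomp (cohomology A) n" and Y: "Y \<in> gcomp (cohomology A) n" and eq: "\<Phi> n X = \<Phi> n Y"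
      obtain x y where "x \<in> cocycles A n" "X = cohom_class A n x" "y \<in> cocycles A n" "Y = cohom_class A n y"
        using X Y by (elim A.in_cohomE)
      then show "X = Y" using eq by (auto simp: \<Phi> B.cohom_class_eq_iff Fz intro!: A.cohom_class_eqI inj)
    qed
    show "\<Phi> n ` gcomp (cohomology A) n = gcomp (cohomology B) n"
    proof (intro equalityI subsetI)
      fix Z assume "Z \<in> \<Phi> n ` gcomp (cohomology A) n"
      then show "Z \<in> gcomp (cohomology B) n"
        by (auto simp: \<Phi> Fz elim!: A.in_cohomE intro!: B.cohom_class_in)
    next
      fix Z assume "Z \<in> gcomp (cohomology B) n"
      then obtain z where z: "z \<in> cocycles B n" "Z = cohom_class B n z" by (rule B.in_cohomE)
      obtain w where w: "w \<in> cocycles A n" "(F w, z) \<in> cohomologous B n" using surj[OF z(1)] by blast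
      then have "Z = \<Phi> n (cohom_class A n w)" using z B.cohom_class_eqI \<Phi> by simp
      then show "Z \<in> \<Phi> n ` gcomp (cohomology A) n" using A.cohom_class_in[OF w(1)] by blast
    qed
  qed
  moreover have "\<Phi> n (gadd (cohomology A) n X Y) = gadd (cohomology B) n (\<Phi> n X) (\<Phi> n Y)"
    if "X \<in> gcomp (cohomology A) n" "Y \<in> gcomp (cohomology A) n" for n X Y
    using that by (elim A.in_cohomE) (simp add: \<Phi> A.cohom_add B.cohom_add Fz A.add_cocycle hom A.cocycles_in)
  moreover have "\<Phi> n (gscale (cohomology A) n c X) = gscale (cohomology B) n c (\<Phi> n X)"
    if "X \<in> gcomp (cohomology A) n" for n c X
    using that by (elim A.in_cohomE) (simp add: \<Phi> A.cohom_scale B.cohom_scale Fz A.scale_cocycle hom A.cocycles_in)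
  moreover have "\<Phi> (n + m) (gmult (cohomology A) n m X Y) = gmult (cohomology B) n m (\<Phi> n X) (\<Phi> m Y)"
    if "X \<in> gcomp (cohomology A) n" "Y \<in> gcomp (cohomology A) m" for n m X Y
    using that by (elim A.in_cohomE) (simp add: \<Phi> A.cohom_mult B.cohom_mult Fz A.mult_cocycle hom A.cocycles_in)
  moreover have "\<Phi> 0 (gone (cohomology A)) = gone (cohomology B)"
    using \<Phi>[OF A.one_cocycle] by (simp add: cohomology_def hom)
  ultimately show ?thesis unfolding galg_iso_def by blast
qed

section \<open>De Rham complexes of diffeological spaces\<close>

definition diffeology :: "'a plot set \<Rightarrow> bool" where
  "diffeology P \<longleftrightarrow> (\<forall>(q, U, u)\<in>P. openin (Euclidean_space q) U \<and>
     (\<forall>r V h. openin (Euclidean_space r) V \<and> smooth_map_on r V q h \<and> h ` V \<subseteq> U \<longrightarrow>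
        (r, V, restrict (u \<circ> h) V) \<in> P))"

lemma diffeologyD:
  assumes "diffeology P" "(q, U, u) \<in> P"
  shows "openin (Euclidean_space q) U"
    and "openin (Euclidean_space r) V \<Longrightarrow> smooth_map_on r V q h \<Longrightarrow> h ` V \<subseteq> U \<Longrightarrow> (r, V, restrict (u \<circ> h) V) \<in> P"
  using assms by (auto simp: diffeology_def)

lemma dformsD:
  assumes "\<omega> \<in> dforms P p"
  shows "(q, U, u) \<in> P \<Longrightarrow> smooth_form q U p (\<omega> (q, U, u))"
    and "pl \<notin> P \<Longrightarrow> \<omega> pl = (\<lambda>_ _. 0)"
    and "(q, U, u) \<in> P \<Longrightarrow> openin (Euclidean_space r) V \<Longrightarrow> smooth_map_on r V q h \<Longrightarrow> h ` V \<subseteq> U \<Longrightarrow>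
      \<omega> (r, V, restrict (u \<circ> h) V) = pull_eform r V h (\<omega> (q, U, u))"
proof -
  show "(q, U, u) \<in> P \<Longrightarrow> smooth_form q U p (\<omega> (q, U, u))"
    and "(q, U, u) \<in> P \<Longrightarrow> openin (Euclidean_space r) V \<Longrightarrow> smooth_map_on r V q h \<Longrightarrow> h ` V \<subseteq> U \<Longrightarrow>
      \<omega> (r, V, restrict (u \<circ> h) V) = pull_eform r V h (\<omega> (q, U, u))"
    using assms by (auto simp: dforms_def)
  show "pl \<notin> P \<Longrightarrow> \<omega> pl = (\<lambda>_ _. 0)"
    using assms by (cases pl) (auto simp: dforms_def)
qed

lemma dformsI:
  assumes "\<And>q U u. (q, U, u) \<in> P \<Longrightarrow> smooth_form q U p (\<omega> (q, U, u))"
    and "\<And>q U u. (q, U, u) \<notin> P \<Longrightarrow> \<omega> (q, U, u) = (\<lambda>_ _. 0)"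
    and "\<And>q U u r V h. (q, U, u) \<in> P \<Longrightarrow> openin (Euclidean_space r) V \<Longrightarrow> smooth_map_on r V q h \<Longrightarrow> h ` V \<subseteq> U \<Longrightarrow>
      \<omega> (r, V, restrict (u \<circ> h) V) = pull_eform r V h (\<omega> (q, U, u))"
  shows "\<omega> \<in> dforms P p"
  using assms by (auto simp: dforms_def)

lemma pull_eform_lin:
  "pull_eform r V h (\<lambda>x vs. c * \<alpha> x vs + d * \<beta> x vs) y ws = c * pull_eform r V h \<alpha> y ws + d * pull_eform r V h \<beta> y ws"
  by (simp add: pull_eform_def)

lemma deRham_simps:
  "gcomp (deRham P) = dforms P" "gzero (deRham P) n = (\<lambda>_ _ _. 0)"
  "gadd (deRham P) n \<omega> \<eta> = (\<lambda>pl x vs. \<omega> pl x vs + \<eta> pl x vs)"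
  "gscale (deRham P) n c \<omega> = (\<lambda>pl x vs. c * \<omega> pl x vs)"
  "gone (deRham P) = (\<lambda>(q, U, u) x vs. if (q, U, u) \<in> P \<and> x \<in> U \<and> vs = [] then 1 else 0)"
  "gmult (deRham P) n m \<omega> \<eta> = (\<lambda>pl. wedge (\<omega> pl) (\<eta> pl))"
  "gdiff (deRham P) n \<omega> = (\<lambda>(q, U, u). ext_deriv q U (\<omega> (q, U, u)))"
  by (simp_all add: deRham_def)

lemma dforms_lin:
  assumes P: "diffeology P" and \<omega>: "\<omega> \<in> dforms P p" and \<eta>: "\<eta> \<in> dforms P p"
  shows "(\<lambda>pl x vs. c * \<omega> pl x vs + d * \<eta> pl x vs) \<in> dforms P p"
proof (rule dformsI)
  show "smooth_form q U p (\<lambda>x vs. c * \<omega> (q, U, u) x vs + d * \<eta> (q, U, u) x vs)" if "(q, U, u) \<in> P" for q U u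
    by (rule smooth_form_lin[OF diffeologyD(1)[OF P that] dformsD(1)[OF \<omega> that] dformsD(1)[OF \<eta> that]])
qed (auto simp: dformsD(2)[OF \<omega>] dformsD(2)[OF \<eta>] dformsD(3)[OF \<omega>] dformsD(3)[OF \<eta>] pull_eform_lin fun_eq_iff)

lemma dforms_add:
  "diffeology P \<Longrightarrow> \<omega> \<in> dforms P p \<Longrightarrow> \<eta> \<in> dforms P p \<Longrightarrow> (\<lambda>pl x vs. \<omega> pl x vs + \<eta> pl x vs) \<in> dforms P p"
  using dforms_lin[of P \<omega> p \<eta> 1 1] by simp

lemma dforms_cmult:
  "diffeology P \<Longrightarrow> \<omega> \<in> dforms P p \<Longrightarrow> (\<lambda>pl x vs. c * \<omega> pl x vs) \<in> dforms P p"
  using dforms_lin[of P \<omega> p \<omega> c 0] by simp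

lemma dforms_zero: "diffeology P \<Longrightarrow> (\<lambda>pl x vs. 0) \<in> dforms P p"
  by (rule dformsI) (auto simp: pull_eform_def fun_eq_iff intro: smooth_form_zero dest: diffeologyD(1))

lemma dforms_wedge:
  assumes P: "diffeology P" and \<omega>: "\<omega> \<in> dforms P p" and \<eta>: "\<eta> \<in> dforms P r"
  shows "(\<lambda>pl. wedge (\<omega> pl) (\<eta> pl)) \<in> dforms P (p + r)"
proof (rule dformsI)
  show "smooth_form q U (p + r) (wedge (\<omega> (q, U, u)) (\<eta> (q, U, u)))" if "(q, U, u) \<in> P" for q U u
    by (rule smooth_form_wedge[OF diffeologyD(1)[OF P that] dformsD(1)[OF \<omega> that] dformsD(1)[OF \<eta> that]])
  show "wedge (\<omega> (q, U, u)) (\<eta> (q, U, u)) = (\<lambda>_ _. 0)" if "(q, U, u) \<notin> P" for q U u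
    using dformsD(2)[OF \<omega> that] by (auto simp: wedge_def fun_eq_iff)
  fix q U u r V h
  assume *: "(q, U, u) \<in> P" "openin (Euclidean_space r) V" "smooth_map_on r V q h" "h ` V \<subseteq> U"
  interpret pullback r V q U h by unfold_locales (use * diffeologyD(1)[OF P] in auto)
  show "wedge (\<omega> (r, V, restrict (u \<circ> h) V)) (\<eta> (r, V, restrict (u \<circ> h) V)) =
      pull_eform r V h (wedge (\<omega> (q, U, u)) (\<eta> (q, U, u)))"
    by (simp add: dformsD(3)[OF \<omega> *] dformsD(3)[OF \<eta> *] pull_wedge)
qed

lemma dforms_ext_deriv:
  assumes P: "diffeology P" and \<omega>: "\<omega> \<in> dforms P p"
  shows "(\<lambda>(q, U, u). ext_deriv q U (\<omega> (q, U, u))) \<in> dforms P (Suc p)"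
proof (rule dformsI)
  show "smooth_form q U (Suc p) ((\<lambda>(q, U, u). ext_deriv q U (\<omega> (q, U, u))) (q, U, u))" if "(q, U, u) \<in> P" for q U u
    using smooth_form_ext_deriv[OF diffeologyD(1)[OF P that] dformsD(1)[OF \<omega> that]] by simp
  show "(\<lambda>(q, U, u). ext_deriv q U (\<omega> (q, U, u))) (q, U, u) = (\<lambda>_ _. 0)" if "(q, U, u) \<notin> P" for q U u
    using dformsD(2)[OF \<omega> that] ext_deriv_zero by simp
  fix q U u r V h
  assume *: "(q, U, u) \<in> P" "openin (Euclidean_space r) V" "smooth_map_on r V q h" "h ` V \<subseteq> U"
  interpret pullback r V q U h by unfold_locales (use * diffeologyD(1)[OF P] in auto)
  show "(\<lambda>(q, U, u). ext_deriv q U (\<omega> (q, U, u))) (r, V, restrict (u \<circ> h) V) =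
      pull_eform r V h ((\<lambda>(q, U, u). ext_deriv q U (\<omega> (q, U, u))) (q, U, u))"
    using ext_deriv_pull[OF dformsD(1)[OF \<omega> *(1)]] by (auto simp: dformsD(3)[OF \<omega> *] fun_eq_iff)
qed

lemma dforms_one:
  assumes P: "diffeology P"
  shows "gone (deRham P) \<in> dforms P 0"
proof (rule dformsI)
  show "smooth_form q U 0 (gone (deRham P) (q, U, u))" if "(q, U, u) \<in> P" for q U u
  proof (rule smooth_formI[OF diffeologyD(1)[OF P that]])
    show "smooth_on q U (\<lambda>x. gone (deRham P) (q, U, u) x vs)" for vs
      using smooth_on_cong[OF diffeologyD(1)[OF P that], of "\<lambda>x. gone (deRham P) (q, U, u) x vs" "\<lambda>x. if vs = [] then 1 else 0"]
        smooth_on_const[OF open_vecs_subset[OF diffeologyD(1)[OF P that]]] that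
      by (simp add: deRham_simps)
  qed (auto simp: deRham_simps)
qed (use diffeologyD(2)[OF P] in \<open>auto simp: deRham_simps pull_eform_def fun_eq_iff\<close>)

lemma deRham_diff_one: "diffeology P \<Longrightarrow> gdiff (deRham P) 0 (gone (deRham P)) = gzero (deRham P) (Suc 0)"
proof (intro ext)
  fix pl :: "'a plot" and x vs
  assume P: "diffeology P"
  obtain q U u where pl: "pl = (q, U, u)" by (metis prod_cases3)
  show "gdiff (deRham P) 0 (gone (deRham P)) pl x vs = gzero (deRham P) (Suc 0) pl x vs"
  proof (cases "pl \<in> P \<and> x \<in> U")
    case True
    then have U: "openin (Euclidean_space q) U" and x: "x \<in> U" using diffeologyD(1)[OF P] pl by auto
    have "pd k (\<lambda>y. gone (deRham P) (q, U, u) y ws) x = pd k (\<lambda>y. if ws = [] then 1 else 0) x" if "k < q" for k ws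
      using True pl by (intro pd_cong[OF U x that]) (simp add: deRham_simps)
    then show ?thesis by (simp add: deRham_simps(2,7) pl ext_deriv_def pd_const)
  next
    case False
    then have "pl \<notin> P \<or> x \<notin> U" by blast
    then show ?thesis by (auto simp: deRham_simps pl ext_deriv_def pd_const)
  qed
qed

theorem dga_deRham:
  assumes P: "diffeology P"
  shows "dga (deRham P)"
proof -
  have U: "openin (Euclidean_space q) U" if "(q, U, u) \<in> P" for q U u
    using diffeologyD(1)[OF P that] .
  have z: "wedge (\<lambda>_ _. 0) \<alpha> = (\<lambda>_ _. 0)" "wedge \<alpha> (\<lambda>_ _. 0) = (\<lambda>_ _. 0)" for \<alpha>
    by (auto simp: fun_eq_iff wedge_def)
  have ed: "ext_deriv q U (\<lambda>x vs. c * \<omega> (q, U, u) x vs + d * \<eta> (q, U, u) x vs) x vs =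
      c * ext_deriv q U (\<omega> (q, U, u)) x vs + d * ext_deriv q U (\<eta> (q, U, u)) x vs"
    if "\<omega> \<in> dforms P n" "\<eta> \<in> dforms P n" for q U u x vs c d \<omega> \<eta> n
  proof (cases "(q, U, u) \<in> P")
    case True
    show ?thesis by (rule ext_deriv_lin[OF U[OF True] dformsD(1)[OF that(1) True] dformsD(1)[OF that(2) True]])
  next
    case False
    show ?thesis by (simp add: dformsD(2)[OF that(1) False] dformsD(2)[OF that(2) False] ext_deriv_zero)
  qed
  show ?thesis
  proof
    show "gdiff (deRham P) n (gadd (deRham P) n x y) =
        gadd (deRham P) (Suc n) (gdiff (deRham P) n x) (gdiff (deRham P) n y)"
      if "x \<in> gcomp (deRham P) n" "y \<in> gcomp (deRham P) n" for x y n
      using ed[of x n y, where c = 1 and d = 1] that by (auto simp: deRham_simps fun_eq_iff)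
    show "gdiff (deRham P) n (gscale (deRham P) n c x) = gscale (deRham P) (Suc n) c (gdiff (deRham P) n x)"
      if "x \<in> gcomp (deRham P) n" for x n c
      using ed[of x n x, where c = c and d = 0] that by (auto simp: deRham_simps fun_eq_iff)
    show "gdiff (deRham P) (Suc n) (gdiff (deRham P) n x) = gzero (deRham P) (Suc (Suc n))"
      if x: "x \<in> gcomp (deRham P) n" for x n
    proof (intro ext)
      fix pl :: "'a plot" and y vs
      obtain q U u where pl: "pl = (q, U, u)" by (metis prod_cases3)
      show "gdiff (deRham P) (Suc n) (gdiff (deRham P) n x) pl y vs = gzero (deRham P) (Suc (Suc n)) pl y vs"
      proof (cases "pl \<in> P")
        case True
        then show ?thesis using x ext_deriv_ext_deriv[OF U dformsD(1)[of x P n q U u]] by (simp add: deRham_simps pl)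
      next
        case False
        then show ?thesis using dformsD(2)[of x P n pl] x by (simp add: deRham_simps pl ext_deriv_zero)
      qed
    qed
    show "gdiff (deRham P) (n + m) (gmult (deRham P) n m x y) =
       gadd (deRham P) (Suc (n + m)) (gmult (deRham P) (Suc n) m (gdiff (deRham P) n x) y)
        (gscale (deRham P) (Suc (n + m)) ((- 1) ^ n) (gmult (deRham P) n (Suc m) x (gdiff (deRham P) m y)))"
      if x: "x \<in> gcomp (deRham P) n" and y: "y \<in> gcomp (deRham P) m" for x y n m
    proof (intro ext)
      fix pl :: "'a plot" and a vs
      obtain q U u where pl: "pl = (q, U, u)" by (metis prod_cases3)
      show "gdiff (deRham P) (n + m) (gmult (deRham P) n m x y) pl a vs =
       gadd (deRham P) (Suc (n + m)) (gmult (deRham P) (Suc n) m (gdiff (deRham P) n x) y)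
        (gscale (deRham P) (Suc (n + m)) ((- 1) ^ n) (gmult (deRham P) n (Suc m) x (gdiff (deRham P) m y))) pl a vs"
      proof (cases "pl \<in> P")
        case True
        then have "(q, U, u) \<in> P" by (simp add: pl)
        from ext_deriv_wedge[OF U[OF this] dformsD(1)[of x P n q U u] dformsD(1)[of y P m q U u], OF _ this _ this] x y
        show ?thesis by (simp add: deRham_simps pl)
      next
        case False
        then show ?thesis using dformsD(2)[of x P n pl] x by (simp add: deRham_simps pl ext_deriv_zero z)
      qed
    qed
    show "gmult (deRham P) n m (gadd (deRham P) n x x') y =
        gadd (deRham P) (n + m) (gmult (deRham P) n m x y) (gmult (deRham P) n m x' y)" for n m x x' y
      using wedge_lin_left[of 1 _ 1] by (auto simp: deRham_simps fun_eq_iff)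
    show "gmult (deRham P) n m x (gadd (deRham P) m y y') =
        gadd (deRham P) (n + m) (gmult (deRham P) n m x y) (gmult (deRham P) n m x y')" for n m x y y'
      using wedge_lin_right[of _ 1 _ 1] by (auto simp: deRham_simps fun_eq_iff)
    show "gdiff (deRham P) 0 (gone (deRham P)) = gzero (deRham P) (Suc 0)"
      by (rule deRham_diff_one[OF P])
    show "gone (deRham P) \<in> gcomp (deRham P) 0"
      using dforms_one[OF P] by (simp add: deRham_simps(1))
  qed (auto simp: deRham_simps z algebra_simps dforms_zero[OF P] dforms_add[OF P] dforms_cmult[OF P]
      dforms_wedge[OF P] dforms_ext_deriv[OF P])
qed

subsection \<open>Induced maps\<close>

definition smooth_between :: "'a plot set \<Rightarrow> 'b plot set \<Rightarrow> ('a \<Rightarrow> 'b) \<Rightarrow> bool" where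
  "smooth_between P Q f \<longleftrightarrow> (\<forall>(q, U, u)\<in>P. (q, U, restrict (f \<circ> u) U) \<in> Q)"

lemma smooth_betweenD: "smooth_between P Q f \<Longrightarrow> (q, U, u) \<in> P \<Longrightarrow> (q, U, restrict (f \<circ> u) U) \<in> Q"
  by (auto simp: smooth_between_def)

lemma pull_in:
  assumes P: "diffeology P" and f: "smooth_between P Q f" and \<omega>: "\<omega> \<in> dforms Q p"
  shows "pull P f \<omega> \<in> dforms P p"
proof (rule dformsI)
  fix q U u r V h
  assume *: "(q, U, u) \<in> P" "openin (Euclidean_space r) V" "smooth_map_on r V q h" "h ` V \<subseteq> U"
  have "restrict (restrict (f \<circ> u) U \<circ> h) V = restrict (f \<circ> restrict (u \<circ> h) V) V"
    using *(4) by (auto simp: fun_eq_iff)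
  then show "pull P f \<omega> (r, V, restrict (u \<circ> h) V) = pull_eform r V h (pull P f \<omega> (q, U, u))"
    using dformsD(3)[OF \<omega> smooth_betweenD[OF f *(1)] *(2-4)] diffeologyD(2)[OF P *] *(1) by (simp add: pull_def)
qed (auto simp: pull_def intro: dformsD(1)[OF \<omega>] smooth_betweenD[OF f])

lemma dga_hom_pull:
  assumes P: "diffeology P" and f: "smooth_between P Q f"
  shows "dga_hom (deRham Q) (deRham P) (pull P f)"
  unfolding dga_hom_def
  using pull_in[OF assms] smooth_betweenD[OF f]
  by (auto simp: deRham_simps pull_def fun_eq_iff wedge_def ext_deriv_zero)

lemma pull_pull: "smooth_between P Q f \<Longrightarrow> pull P f (pull Q g \<omega>) = pull P (g \<circ> f) \<omega>"
proof (intro ext)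
  fix pl :: "'a plot" and x vs
  assume f: "smooth_between P Q f"
  obtain q U u where pl: "pl = (q, U, u)" by (metis prod_cases3)
  have "restrict (g \<circ> restrict (f \<circ> u) U) U = restrict (g \<circ> f \<circ> u) U" by (auto simp: fun_eq_iff)
  then show "pull P f (pull Q g \<omega>) pl x vs = pull P (g \<circ> f) \<omega> pl x vs"
    using smooth_betweenD[OF f, of q U u] by (simp add: pull_def pl)
qed

lemma smooth_map_on_id: "openin (Euclidean_space q) U \<Longrightarrow> V \<subseteq> U \<Longrightarrow> smooth_map_on q V q (\<lambda>x. x)"
  using open_vecs_subset[of q U] by (auto simp: smooth_map_on_def intro!: smooth_on_coord)

lemma jac_id: "v \<in> vecs q \<Longrightarrow> jac q (\<lambda>x. x) y v = v"
  by (rule ext) (auto simp: jac_def pd_coord in_vecs_iff if_distrib[of "\<lambda>c. c * _"] cong: if_cong)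

text \<open>Forms are local: the inclusion of V into U is a reparametrisation with identity
  Jacobian. This is how the values of a form on two plots that agree only near a point are
  compared.\<close>

lemma dforms_restrict:
  assumes \<omega>: "\<omega> \<in> dforms P p" and pl: "(q, U, u) \<in> P" and U: "openin (Euclidean_space q) U"
    and V: "openin (Euclidean_space q) V" "V \<subseteq> U" and x: "x \<in> V"
  shows "\<omega> (q, V, restrict u V) x vs = \<omega> (q, U, u) x vs"
proof -
  have "\<omega> (q, V, restrict (u \<circ> (\<lambda>x. x)) V) = pull_eform q V (\<lambda>x. x) (\<omega> (q, U, u))"
    using V smooth_map_on_id[OF U V(2)] by (intro dformsD(3)[OF \<omega> pl]) auto
  moreover have "map (jac q (\<lambda>x. x) x) vs = vs" if "set vs \<subseteq> vecs q"
    using that jac_id by (induction vs) auto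
  moreover have "\<omega> (q, U, u) x vs = 0" if "\<not> set vs \<subseteq> vecs q"
    using alt_vecs[OF smooth_form_alt[OF U dformsD(1)[OF \<omega> pl]] that] .
  ultimately show ?thesis using x by (auto simp: pull_eform_def o_def)
qed

subsection \<open>The homotopy operator\<close>

text \<open>The homotopy along u becomes a plot on U \<times> \<real>. Hence H must make sense for
  every real parameter, although only [0,1] is integrated over.\<close>

definition htpy_plot :: "('a \<Rightarrow> real \<Rightarrow> 'b) \<Rightarrow> nat \<Rightarrow> (nat \<Rightarrow> real) set \<Rightarrow> ((nat \<Rightarrow> real) \<Rightarrow> 'a) \<Rightarrow> 'b plot" where
  "htpy_plot H q U u = (Suc q, cyl q U, restrict (\<lambda>y. H (u (y(q := 0))) (y q)) (cyl q U))"

definition smooth_htpy :: "'a plot set \<Rightarrow> 'b plot set \<Rightarrow> ('a \<Rightarrow> real \<Rightarrow> 'b) \<Rightarrow> bool" where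
  "smooth_htpy P Q H \<longleftrightarrow> (\<forall>(q, U, u)\<in>P. htpy_plot H q U u \<in> Q)"

definition htpy_op :: "'a plot set \<Rightarrow> ('a \<Rightarrow> real \<Rightarrow> 'b) \<Rightarrow> 'b dform \<Rightarrow> 'a dform" where
  "htpy_op P H \<omega> = (\<lambda>(q, U, u). if (q, U, u) \<in> P then fibre_int q U (\<omega> (htpy_plot H q U u)) else (\<lambda>_ _. 0))"

lemma smooth_htpyD: "smooth_htpy P Q H \<Longrightarrow> (q, U, u) \<in> P \<Longrightarrow> htpy_plot H q U u \<in> Q"
  by (auto simp: smooth_htpy_def)

lemma slice_pull:
  assumes U: "openin (Euclidean_space q) U"
  shows "smooth_map_on q U (Suc q) (\<lambda>x. x(q := s))" "(\<lambda>x. x(q := s)) ` U \<subseteq> cyl q U"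
    "v \<in> vecs q \<Longrightarrow> jac q (\<lambda>x. x(q := s)) y v = v"
proof -
  show *: "(\<lambda>x. x(q := s)) ` U \<subseteq> cyl q U" using upd_in_cyl[OF U] by blast
  have "smooth_on q U (\<lambda>x. (x(q := s)) j)" for j
    using open_vecs_subset[OF U] by (cases "j = q") (auto intro: smooth_on_coord smooth_on_const)
  then show "smooth_map_on q U (Suc q) (\<lambda>x. x(q := s))"
    unfolding smooth_map_on_def using * open_vecs_subset[OF openin_cyl[OF U]] by blast
  show "jac q (\<lambda>x. x(q := s)) y v = v" if "v \<in> vecs q"
  proof
    fix j
    show "jac q (\<lambda>x. x(q := s)) y v j = v j"
    proof (cases "j = q")
      case True
      then show ?thesis using that by (simp add: jac_def pd_const in_vecs_iff)
    next
      case False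
      then show ?thesis using fun_cong[OF jac_id[OF that], of y j] by (simp add: jac_def)
    qed
  qed
qed

context
  fixes P :: "'a plot set" and Q :: "'b plot set" and H
  assumes P: "diffeology P" and Q: "diffeology Q" and H: "smooth_htpy P Q H"
begin

lemma htpy_smooth_form:
  assumes "\<omega> \<in> dforms Q p" "(q, U, u) \<in> P"
  shows "smooth_form (Suc q) (cyl q U) p (\<omega> (htpy_plot H q U u))"
  using dformsD(1)[OF assms(1)] smooth_htpyD[OF H assms(2)] by (simp add: htpy_plot_def)

lemma htpy_op_in:
  assumes \<omega>: "\<omega> \<in> dforms Q p"
  shows "htpy_op P H \<omega> \<in> dforms P (p - 1)"
proof (rule dformsI)
  show "smooth_form q U (p - 1) (htpy_op P H \<omega> (q, U, u))" if "(q, U, u) \<in> P" for q U u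
    using smooth_form_fibre_int[OF diffeologyD(1)[OF P that] htpy_smooth_form[OF \<omega> that]] that by (simp add: htpy_op_def)
  fix q U u r V h
  assume *: "(q, U, u) \<in> P" "openin (Euclidean_space r) V" "smooth_map_on r V q h" "h ` V \<subseteq> U"
  note U = diffeologyD(1)[OF P *(1)]
  interpret pullback r V q U h by unfold_locales (use * U in auto)
  define w where "w = restrict (\<lambda>y. H (u (y(q := 0))) (y q)) (cyl q U)"
  \<comment> \<open>Reparametrising the homotopy plot by h times the identity gives the homotopy
    plot of the reparametrised u, so \<open>fibre_int_pull\<close> applies.\<close>
  have "restrict (w \<circ> cyl_map r q h) (cyl r V) = restrict (\<lambda>y. H (restrict (u \<circ> h) V (y(r := 0))) (y r)) (cyl r V)"
  proof (rule restrict_ext)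
    fix y assume y: "y \<in> cyl r V"
    then have V: "y(r := 0) \<in> V" by (simp add: cyl_def)
    have "(cyl_map r q h y)(q := 0) = h (y(r := 0))"
      using upd_zero_open[OF U, of "h (y(r := 0))"] *(4) V by (auto simp: cyl_map_def)
    then show "(w \<circ> cyl_map r q h) y = H (restrict (u \<circ> h) V (y(r := 0))) (y r)"
      using y V cyl_map_in_cyl by (auto simp: w_def cyl_map_def)
  qed
  then have "\<omega> (htpy_plot H r V (restrict (u \<circ> h) V)) = pull_eform (Suc r) (cyl r V) (cyl_map r q h) (\<omega> (htpy_plot H q U u))"
    using dformsD(3)[OF \<omega>, of "Suc q" "cyl q U" w, OF _ openin_cyl[OF V] smooth_map_cyl_map cyl_map_in_cyl]
      smooth_htpyD[OF H *(1)] by (simp add: htpy_plot_def w_def)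
  then show "htpy_op P H \<omega> (r, V, restrict (u \<circ> h) V) = pull_eform r V h (htpy_op P H \<omega> (q, U, u))"
    using diffeologyD(2)[OF P *] *(1) by (simp add: htpy_op_def fibre_int_pull)
qed (simp add: htpy_op_def)

text \<open>The degree \<open>p - 1\<close> is truncated, so \<open>htpy_op_in\<close> by itself
  would leave room for a nonzero 0-form here.\<close>

lemma htpy_op_degree_0: "\<omega> \<in> dforms Q 0 \<Longrightarrow> htpy_op P H \<omega> = (\<lambda>_ _ _. 0)"
proof -
  assume \<omega>: "\<omega> \<in> dforms Q 0"
  have "\<omega> (htpy_plot H q U u) x (v # vs) = 0" if "(q, U, u) \<in> P" for q U u x v vs
    using smooth_form_alt[OF openin_cyl[OF diffeologyD(1)[OF P that]] htpy_smooth_form[OF \<omega> that]] by simp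
  then show ?thesis by (auto simp: htpy_op_def fibre_int_def fun_eq_iff)
qed

lemma htpy_plot_slice:
  assumes pl: "(q, U, u) \<in> P"
  shows "restrict (restrict (\<lambda>y. H (u (y(q := 0))) (y q)) (cyl q U) \<circ> (\<lambda>x. x(q := s))) U =
    restrict ((\<lambda>a. H a s) \<circ> u) U"
proof (rule restrict_ext)
  note U = diffeologyD(1)[OF P pl]
  fix y assume y: "y \<in> U"
  have "(y(q := s))(q := 0) = y" using upd_zero_open[OF U y] by simp
  then show "(restrict (\<lambda>y. H (u (y(q := 0))) (y q)) (cyl q U) \<circ> (\<lambda>x. x(q := s))) y = ((\<lambda>a. H a s) \<circ> u) y"
    using upd_in_cyl[OF U y, of s] by simp
qed

lemma smooth_htpy_slice: "smooth_between P Q (\<lambda>a. H a s)"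
  unfolding smooth_between_def
proof safe
  fix q U u assume pl: "(q, U, u) \<in> P"
  note U = diffeologyD(1)[OF P pl]
  from diffeologyD(2)[OF Q smooth_htpyD[OF H pl, unfolded htpy_plot_def] U slice_pull(1,2)[OF U]]
  show "(q, U, restrict ((\<lambda>a. H a s) \<circ> u) U) \<in> Q" unfolding htpy_plot_slice[OF pl] .
qed

lemma htpy_slice:
  assumes \<omega>: "\<omega> \<in> dforms Q p" and pl: "(q, U, u) \<in> P" and x: "x \<in> U" and vs: "set vs \<subseteq> vecs q"
  shows "\<omega> (htpy_plot H q U u) (x(q := s)) vs = pull P (\<lambda>a. H a s) \<omega> (q, U, u) x vs"
proof -
  note U = diffeologyD(1)[OF P pl]
  define w where "w = restrict (\<lambda>y. H (u (y(q := 0))) (y q)) (cyl q U)"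
  have wQ: "(Suc q, cyl q U, w) \<in> Q" using smooth_htpyD[OF H pl] by (simp add: htpy_plot_def w_def)
  have "restrict (w \<circ> (\<lambda>x. x(q := s))) U = restrict ((\<lambda>a. H a s) \<circ> u) U"
    unfolding w_def by (rule htpy_plot_slice[OF pl])
  then have "\<omega> (q, U, restrict ((\<lambda>a. H a s) \<circ> u) U) = pull_eform q U (\<lambda>x. x(q := s)) (\<omega> (Suc q, cyl q U, w))"
    using dformsD(3)[OF \<omega> wQ U slice_pull(1,2)[OF U]] by metis
  moreover have "map (jac q (\<lambda>x. x(q := s)) x) vs = vs"
    using vs slice_pull(3)[OF U] by (induction vs) auto
  ultimately show ?thesis using x vs pl by (simp add: pull_def pull_eform_def htpy_plot_def w_def)
qed

text \<open>This is \<open>fibre_int_homotopy\<close> on each plot. The indices m and m' are free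
  because the differential of \<open>deRham\<close> does not look at its degree, so instances can be
  chosen to fit the degrees at hand.\<close>

theorem htpy_formula:
  assumes \<omega>: "\<omega> \<in> dforms Q p"
  shows "(\<lambda>pl x vs. pull P (\<lambda>a. H a 0) \<omega> pl x vs + (gdiff (deRham P) m (htpy_op P H \<omega>) pl x vs
      + htpy_op P H (gdiff (deRham Q) m' \<omega>) pl x vs)) = pull P (\<lambda>a. H a 1) \<omega>"
proof (intro ext)
  fix pl :: "'a plot" and x vs
  obtain q U u where pl: "pl = (q, U, u)" by (metis prod_cases3)
  show "pull P (\<lambda>a. H a 0) \<omega> pl x vs + (gdiff (deRham P) m (htpy_op P H \<omega>) pl x vs
      + htpy_op P H (gdiff (deRham Q) m' \<omega>) pl x vs) = pull P (\<lambda>a. H a 1) \<omega> pl x vs"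
  proof (cases "pl \<in> P")
    case True
    then have pP: "(q, U, u) \<in> P" by (simp add: pl)
    note U = diffeologyD(1)[OF P pP]
    note sf = htpy_smooth_form[OF \<omega> pP]
    have d: "gdiff (deRham Q) m' \<omega> (htpy_plot H q U u) = ext_deriv (Suc q) (cyl q U) (\<omega> (htpy_plot H q U u))"
      by (simp add: htpy_plot_def deRham_simps)
    have 0: "pull P f \<omega> (q, U, u) x vs = 0" if "smooth_form q U p (pull P f \<omega> (q, U, u))" "\<not> (x \<in> U \<and> set vs \<subseteq> vecs q)" for f
      using that by (auto simp: smooth_form_def)
    have sp: "smooth_form q U p (pull P (\<lambda>a. H a s) \<omega> (q, U, u))" for s
      by (rule dformsD(1)[OF pull_in[OF P smooth_htpy_slice \<omega>] pP])
    show ?thesis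
    proof (cases "x \<in> U \<and> set vs \<subseteq> vecs q")
      case True
      then show ?thesis
        using fibre_int_homotopy[OF U sf, of x vs] htpy_slice[OF \<omega> pP, of x vs] pP
        by (simp add: pl htpy_op_def deRham_simps(7)[of P] d)
    next
      case False
      then show ?thesis using 0[OF sp] pP
        by (auto simp: pl htpy_op_def deRham_simps(7)[of P] d fibre_int_def ext_deriv_def)
    qed
  next
    case False
    then show ?thesis by (simp add: pl pull_def htpy_op_def deRham_simps ext_deriv_zero)
  qed
qed

end

lemma htpy_op_zero: "htpy_op P H (\<lambda>_ _ _. 0) = (\<lambda>_ _ _. 0)"
  by (auto simp: htpy_op_def fibre_int_def fun_eq_iff)

lemma pull_htpy_op:
  assumes f: "smooth_between R P f"
  shows "pull R f (htpy_op P H \<omega>) = htpy_op R (\<lambda>a. H (f a)) \<omega>"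
proof (intro ext)
  fix pl :: "'a plot" and x vs
  obtain q U u where pl: "pl = (q, U, u)" by (metis prod_cases3)
  have "htpy_plot H q U (restrict (f \<circ> u) U) = htpy_plot (\<lambda>a. H (f a)) q U u"
    by (auto simp: htpy_plot_def cyl_def fun_eq_iff)
  then show "pull R f (htpy_op P H \<omega>) pl x vs = htpy_op R (\<lambda>a. H (f a)) \<omega> pl x vs"
    using smooth_betweenD[OF f] by (auto simp: pl pull_def htpy_op_def)
qed

text \<open>For a constant homotopy the form is pulled back along the projection from U \<times>
  \<real> to U, whose Jacobian kills the fibre direction, so the integrand vanishes. A homotopy that
  fixes an end therefore produces primitives that vanish there.\<close>

lemma htpy_op_stationary:
  assumes P: "diffeology P" and f: "smooth_between P Q f" and \<omega>: "\<omega> \<in> dforms Q p"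
    and Q: "diffeology Q"
  shows "htpy_op P (\<lambda>a s. f a) \<omega> = (\<lambda>_ _ _. 0)"
proof (intro ext)
  fix pl :: "'a plot" and x vs
  obtain q U u where pl: "pl = (q, U, u)" by (metis prod_cases3)
  show "htpy_op P (\<lambda>a s. f a) \<omega> pl x vs = 0"
  proof (cases "pl \<in> P \<and> x \<in> U")
    case True
    then have pP: "(q, U, u) \<in> P" and x: "x \<in> U" by (auto simp: pl)
    note U = diffeologyD(1)[OF P pP]
    note fQ = smooth_betweenD[OF f pP]
    have "restrict (restrict (f \<circ> u) U \<circ> (\<lambda>y. y(q := 0))) (cyl q U) = restrict (\<lambda>y. f (u (y(q := 0)))) (cyl q U)"
      by (rule restrict_ext) (auto simp: cyl_def)
    then have *: "\<omega> (htpy_plot (\<lambda>a s. f a) q U u) = pull_eform (Suc q) (cyl q U) (\<lambda>y. y(q := 0)) (\<omega> (q, U, restrict (f \<circ> u) U))"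
      using dformsD(3)[OF \<omega> fQ openin_cyl[OF U] smooth_map_on_upd_last[OF U]] by (auto simp: htpy_plot_def cyl_def)
    have "jac (Suc q) (\<lambda>y. y(q := 0)) z (basis_vec q) = (\<lambda>_. 0)" for z
    proof
      fix j
      have "pd q (\<lambda>y. (y(q := 0)) j) z = 0" by (cases "j = q") (simp_all add: pd_def)
      then show "jac (Suc q) (\<lambda>y. y(q := 0)) z (basis_vec q) j = 0"
        by (simp add: jac_def basis_vec_def del: fun_upd_apply)
    qed
    moreover have "\<omega> (q, U, restrict (f \<circ> u) U) z ((\<lambda>_. 0) # ws) = 0" for z ws
      using alt_expand[OF smooth_form_alt[OF U dformsD(1)[OF \<omega> fQ]], of "\<lambda>_. 0" z ws] by (simp add: in_vecs_iff)
    ultimately have "\<omega> (htpy_plot (\<lambda>a s. f a) q U u) z (basis_vec q # vs) = 0" for z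
      unfolding * by (simp add: pull_eform_def)
    then show ?thesis by (simp add: pl htpy_op_def fibre_int_def)
  qed (auto simp: pl htpy_op_def fibre_int_def)
qed

section \<open>Plots of manifolds\<close>

text \<open>The part of \<^const>\<open>smooth_manifold\<close> that suffices for handling plots; unlike the whole notion,
  it is immediate for products and open submanifolds.\<close>

definition charted :: "'a mfd \<Rightarrow> bool" where
  "charted M \<longleftrightarrow> \<Union> (fst ` matlas M) = topspace (mtop M) \<and>
     (\<forall>(D, \<phi>)\<in>matlas M. openin (mtop M) D \<and> openin (Euclidean_space (mdim M)) (\<phi> ` D) \<and> inj_on \<phi> D)"

lemma chartedD:
  assumes "charted M" "(D, \<phi>) \<in> matlas M"
  shows "openin (mtop M) D" "openin (Euclidean_space (mdim M)) (\<phi> ` D)" "inj_on \<phi> D"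
  using assms by (auto simp: charted_def)

lemma charted_cover:
  assumes "charted M" "x \<in> topspace (mtop M)"
  obtains D \<phi> where "(D, \<phi>) \<in> matlas M" "x \<in> D"
proof -
  have "x \<in> \<Union> (fst ` matlas M)" using assms by (simp add: charted_def)
  then show ?thesis using that by force
qed

lemma charted_smooth_manifold: "smooth_manifold M \<Longrightarrow> charted M"
  unfolding smooth_manifold_def charted_def
proof (elim conjE, intro conjI)
  assume *: "\<forall>(D, \<phi>)\<in>matlas M. openin (mtop M) D \<and> openin (Euclidean_space (mdim M)) (\<phi> ` D) \<and>
      homeomorphic_map (subtopology (mtop M) D) (subtopology (Euclidean_space (mdim M)) (\<phi> ` D)) \<phi>"
  show "\<forall>(D, \<phi>)\<in>matlas M. openin (mtop M) D \<and> openin (Euclidean_space (mdim M)) (\<phi> ` D) \<and> inj_on \<phi> D"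
  proof safe
    fix D \<phi> assume D: "(D, \<phi>) \<in> matlas M"
    then have "D \<subseteq> topspace (mtop M)" "inj_on \<phi> (topspace (subtopology (mtop M) D))"
      using * homeomorphic_imp_injective_map openin_subset by blast+
    then show "inj_on \<phi> D" by (simp add: Int_absorb1)
  qed (use * in auto)
qed

lemma smooth_map_on_compose:
  assumes V: "openin (Euclidean_space r) V" and U: "openin (Euclidean_space q) U"
    and h: "smooth_map_on r V q h" and hU: "h ` V \<subseteq> U" and g: "smooth_map_on q U n g"
  shows "smooth_map_on r V n (g \<circ> h)"
proof -
  have "smooth_on r V (\<lambda>x. g (h x) j)" if "j < n" for j
    using smooth_on_compose[OF V U _ h hU, of "\<lambda>x. g x j"] g that by (simp add: smooth_map_on_def)
  moreover have "(g \<circ> h) ` V \<subseteq> vecs n" using g hU by (auto simp: smooth_map_on_def)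
  ultimately show ?thesis by (simp add: smooth_map_on_def)
qed

lemma smooth_on_localI:
  assumes "openin (Euclidean_space q) U"
    and "\<And>x. x \<in> U \<Longrightarrow> \<exists>W. openin (Euclidean_space q) W \<and> x \<in> W \<and> W \<subseteq> U \<and> smooth_on q W f"
  shows "smooth_on q U f"
  by (rule smooth_on_local[OF assms(1)]) (use assms(2) in \<open>metis inf.absorb2\<close>)

lemma smooth_map_on_subset:
  "smooth_map_on q U n h \<Longrightarrow> V \<subseteq> U \<Longrightarrow> U \<subseteq> vecs q \<Longrightarrow> smooth_map_on q V n h"
  unfolding smooth_map_on_def using smooth_on_subset by blast

lemma mfd_plotsD:
  assumes "(q, U, u) \<in> mfd_plots M"
  shows "openin (Euclidean_space q) U" "u \<in> extensional U" "u ` U \<subseteq> topspace (mtop M)"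
    "continuous_map (subtopology (Euclidean_space q) U) (mtop M) u"
    "(D, \<phi>) \<in> matlas M \<Longrightarrow> smooth_map_on q {x\<in>U. u x \<in> D} (mdim M) (\<phi> \<circ> u)"
  using assms by (auto simp: mfd_plots_def PiE_def)

lemma mfd_plotsI:
  assumes "openin (Euclidean_space q) U" "u \<in> extensional U" "u ` U \<subseteq> topspace (mtop M)"
    "continuous_map (subtopology (Euclidean_space q) U) (mtop M) u"
    "\<And>D \<phi>. (D, \<phi>) \<in> matlas M \<Longrightarrow> smooth_map_on q {x\<in>U. u x \<in> D} (mdim M) (\<phi> \<circ> u)"
  shows "(q, U, u) \<in> mfd_plots M"
  using assms by (auto simp: mfd_plots_def PiE_def)

lemma openin_plot_preimage:
  assumes U: "openin (Euclidean_space q) U"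
    and u: "continuous_map (subtopology (Euclidean_space q) U) X u" and D: "openin X D"
  shows "openin (Euclidean_space q) {x\<in>U. u x \<in> D}"
proof -
  have "topspace (subtopology (Euclidean_space q) U) = U" using open_vecs_subset[OF U] by auto
  then have "openin (subtopology (Euclidean_space q) U) {x\<in>U. u x \<in> D}"
    using openin_continuous_map_preimage[OF u D] by simp
  then show ?thesis using U openin_trans_full by blast
qed

lemma diffeology_mfd_plots:
  assumes M: "charted M"
  shows "diffeology (mfd_plots M)"
  unfolding diffeology_def
proof (safe)
  fix q U u assume pl: "(q, U, u) \<in> mfd_plots M"
  show U: "openin (Euclidean_space q) U" by (rule mfd_plotsD(1)[OF pl])
  fix r V h assume V: "openin (Euclidean_space r) V" and h: "smooth_map_on r V q h" and hU: "h ` V \<subseteq> U"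
  have cont: "continuous_map (subtopology (Euclidean_space r) V) (mtop M) (u \<circ> h)"
  proof (rule continuous_map_compose[OF _ mfd_plotsD(4)[OF pl]])
    have "continuous_on V h" by (rule smooth_map_on_continuous[OF h open_vecs_subset[OF V]])
    moreover have "topspace (subtopology (Euclidean_space r) V) = V" using open_vecs_subset[OF V] by auto
    ultimately show "continuous_map (subtopology (Euclidean_space r) V) (subtopology (Euclidean_space q) U) h"
      using hU open_vecs_subset[OF U]
      by (auto simp: continuous_map_in_subtopology cm_Euclidean_space_iff_continuous_on)
  qed
  show "(r, V, restrict (u \<circ> h) V) \<in> mfd_plots M"
  proof (rule mfd_plotsI[OF V])
    have ts: "topspace (subtopology (Euclidean_space r) V) = V" using open_vecs_subset[OF V] by auto
    show "continuous_map (subtopology (Euclidean_space r) V) (mtop M) (restrict (u \<circ> h) V)"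
      by (rule continuous_map_eq[OF cont]) (simp add: ts)
    show "restrict (u \<circ> h) V ` V \<subseteq> topspace (mtop M)" using mfd_plotsD(3)[OF pl] hU by auto
    fix D \<phi> assume D: "(D, \<phi>) \<in> matlas M"
    let ?V = "{x\<in>V. restrict (u \<circ> h) V x \<in> D}" and ?U = "{x\<in>U. u x \<in> D}"
    have V': "?V = {x\<in>V. (u \<circ> h) x \<in> D}" by auto
    have oV: "openin (Euclidean_space r) ?V" unfolding V' by (rule openin_plot_preimage[OF V cont chartedD(1)[OF M D]])
    have oU: "openin (Euclidean_space q) ?U" by (rule openin_plot_preimage[OF U mfd_plotsD(4)[OF pl] chartedD(1)[OF M D]])
    have "smooth_map_on r ?V (mdim M) ((\<phi> \<circ> u) \<circ> h)"
      using hU smooth_map_on_subset[OF h _ open_vecs_subset[OF V]]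
      by (intro smooth_map_on_compose[OF oV oU _ _ mfd_plotsD(5)[OF pl D]]) auto
    moreover have "(\<phi> \<circ> restrict (u \<circ> h) V) x = ((\<phi> \<circ> u) \<circ> h) x" if "x \<in> ?V" for x using that by auto
    ultimately show "smooth_map_on r ?V (mdim M) (\<phi> \<circ> restrict (u \<circ> h) V)"
      using smooth_on_cong[OF oV, of "\<lambda>x. (\<phi> \<circ> restrict (u \<circ> h) V) x j" "\<lambda>x. ((\<phi> \<circ> u) \<circ> h) x j" for j]
      unfolding smooth_map_on_def by (metis (mono_tags, lifting) image_cong)
  qed auto
qed

lemma inv_chart: "charted M \<Longrightarrow> (D, \<phi>) \<in> matlas M \<Longrightarrow> x \<in> D \<Longrightarrow> inv_into D \<phi> (\<phi> x) = x"
  using chartedD(3) inv_into_f_f by metis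

lemma smooth_fun_plot:
  assumes M: "charted M" and g: "smooth_fun M g" and pl: "(q, U, u) \<in> mfd_plots M"
  shows "smooth_on q U (\<lambda>x. g (u x))"
proof (rule smooth_on_local[OF mfd_plotsD(1)[OF pl]])
  note U = mfd_plotsD(1)[OF pl]
  fix x assume x: "x \<in> U"
  obtain D \<phi> where D: "(D, \<phi>) \<in> matlas M" "u x \<in> D"
    using charted_cover[OF M, of "u x"] mfd_plotsD(3)[OF pl] x by blast
  let ?V = "{x\<in>U. u x \<in> D}"
  have oV: "openin (Euclidean_space q) ?V" by (rule openin_plot_preimage[OF U mfd_plotsD(4)[OF pl] chartedD(1)[OF M D(1)]])
  have "smooth_on (mdim M) (\<phi> ` D) (g \<circ> inv_into D \<phi>)" using g D(1) by (auto simp: smooth_fun_def)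
  then have "smooth_on q ?V (\<lambda>x. (g \<circ> inv_into D \<phi>) ((\<phi> \<circ> u) x))"
    by (rule smooth_on_compose[OF oV chartedD(2)[OF M D(1)] _ mfd_plotsD(5)[OF pl D(1)]]) auto
  then have "smooth_on q ?V (\<lambda>x. g (u x))"
    using smooth_on_cong[OF oV, of "\<lambda>x. (g \<circ> inv_into D \<phi>) ((\<phi> \<circ> u) x)" "\<lambda>x. g (u x)"] inv_chart[OF M D(1)] by simp
  moreover have "U \<inter> ?V = ?V" by auto
  ultimately show "\<exists>V. openin (Euclidean_space q) V \<and> x \<in> V \<and> smooth_on q (U \<inter> V) (\<lambda>x. g (u x))"
    using oV x D(2) by (intro exI[of _ ?V]) auto
qed

subsection \<open>Products, open submanifolds and the real line\<close>

definition trunc_vec :: "nat \<Rightarrow> (nat \<Rightarrow> real) \<Rightarrow> nat \<Rightarrow> real" where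
  "trunc_vec m y = (\<lambda>i. if i < m then y i else 0)"

definition shift_vec :: "nat \<Rightarrow> (nat \<Rightarrow> real) \<Rightarrow> nat \<Rightarrow> real" where
  "shift_vec m y = (\<lambda>i. y (i + m))"

lemma trunc_concat: "a \<in> vecs m \<Longrightarrow> trunc_vec m (concat_vec m a b) = a"
  by (auto simp: trunc_vec_def concat_vec_def in_vecs_iff fun_eq_iff)

lemma shift_concat: "shift_vec m (concat_vec m a b) = b"
  by (auto simp: shift_vec_def concat_vec_def)

lemma concat_trunc_shift: "concat_vec m (trunc_vec m y) (shift_vec m y) = y"
  by (auto simp: shift_vec_def concat_vec_def trunc_vec_def)

lemma concat_in_vecs: "b \<in> vecs n \<Longrightarrow> concat_vec m a b \<in> vecs (m + n)"
  by (auto simp: in_vecs_iff concat_vec_def)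

lemma trunc_in_vecs: "trunc_vec m y \<in> vecs m"
  by (auto simp: in_vecs_iff trunc_vec_def)

lemma shift_in_vecs: "y \<in> vecs (m + n) \<Longrightarrow> shift_vec m y \<in> vecs n"
  by (auto simp: in_vecs_iff shift_vec_def)

lemma continuous_on_trunc: "continuous_on S (trunc_vec m)"
proof (rule continuous_on_coordinatewise_then_product)
  show "continuous_on S (\<lambda>y. trunc_vec m y i)" for i
    by (cases "i < m") (auto simp: trunc_vec_def intro: continuous_on_subset[OF continuous_on_product_coordinates])
qed

lemma continuous_on_shift: "continuous_on S (shift_vec m)"
  by (rule continuous_on_coordinatewise_then_product)
     (auto simp: shift_vec_def intro: continuous_on_subset[OF continuous_on_product_coordinates])

text \<open>The image is written as a preimage under the two continuous coordinate projections, from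
  which its openness follows.\<close>

lemma prod_chart_image:
  assumes "A \<subseteq> vecs m" "B \<subseteq> vecs n" "A = \<phi> ` D" "B = \<psi> ` E"
  shows "(\<lambda>(x, y). concat_vec m (\<phi> x) (\<psi> y)) ` (D \<times> E) =
    {y \<in> {y \<in> vecs (m + n). trunc_vec m y \<in> A}. shift_vec m y \<in> B}"
proof (intro equalityI subsetI)
  fix y assume "y \<in> (\<lambda>(x, y). concat_vec m (\<phi> x) (\<psi> y)) ` (D \<times> E)"
  then obtain a b where "a \<in> A" "b \<in> B" "y = concat_vec m a b" using assms(3,4) by auto
  then show "y \<in> {y \<in> {y \<in> vecs (m + n). trunc_vec m y \<in> A}. shift_vec m y \<in> B}"
    using assms(1,2) trunc_concat[of a m b] concat_in_vecs[of b n m a] by (auto simp: shift_concat)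
next
  fix y assume "y \<in> {y \<in> {y \<in> vecs (m + n). trunc_vec m y \<in> A}. shift_vec m y \<in> B}"
  then obtain a b where "a \<in> D" "b \<in> E" "trunc_vec m y = \<phi> a" "shift_vec m y = \<psi> b" using assms(3,4) by auto
  moreover from this have "y = concat_vec m (\<phi> a) (\<psi> b)" using concat_trunc_shift[of m y] by simp
  ultimately show "y \<in> (\<lambda>(x, y). concat_vec m (\<phi> x) (\<psi> y)) ` (D \<times> E)" by auto
qed

lemma prod_mfd_simps [simp]:
  "mdim (prod_mfd M N) = mdim M + mdim N" "mtop (prod_mfd M N) = prod_topology (mtop M) (mtop N)"
  by (simp_all add: prod_mfd_def)

lemma charted_prod:
  assumes M: "charted M" and N: "charted N"
  shows "charted (prod_mfd M N)"
  unfolding charted_def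
proof (intro conjI)
  show "\<Union> (fst ` matlas (prod_mfd M N)) = topspace (mtop (prod_mfd M N))"
  proof (intro equalityI subsetI)
    fix z assume "z \<in> \<Union> (fst ` matlas (prod_mfd M N))"
    then obtain D \<phi> E \<psi> where *: "(D, \<phi>) \<in> matlas M" "(E, \<psi>) \<in> matlas N" "z \<in> D \<times> E"
      by (auto simp: prod_mfd_def)
    then show "z \<in> topspace (mtop (prod_mfd M N))"
      using openin_subset[OF chartedD(1)[OF M *(1)]] openin_subset[OF chartedD(1)[OF N *(2)]] by auto
  next
    fix z assume "z \<in> topspace (mtop (prod_mfd M N))"
    then have "fst z \<in> topspace (mtop M)" "snd z \<in> topspace (mtop N)" by auto
    then obtain D \<phi> E \<psi> where *: "(D, \<phi>) \<in> matlas M" "(E, \<psi>) \<in> matlas N" "fst z \<in> D" "snd z \<in> E"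
      using charted_cover[OF M] charted_cover[OF N] by metis
    then have "(D \<times> E, \<lambda>(x, y). concat_vec (mdim M) (\<phi> x) (\<psi> y)) \<in> matlas (prod_mfd M N)"
      by (auto simp: prod_mfd_def)
    moreover have "z \<in> D \<times> E" using * by (cases z) auto
    ultimately show "z \<in> \<Union> (fst ` matlas (prod_mfd M N))" by force
  qed
  have "openin (prod_topology (mtop M) (mtop N)) (D \<times> E) \<and>
    openin (Euclidean_space (mdim M + mdim N)) ((\<lambda>(x, y). concat_vec (mdim M) (\<phi> x) (\<psi> y)) ` (D \<times> E)) \<and>
    inj_on (\<lambda>(x, y). concat_vec (mdim M) (\<phi> x) (\<psi> y)) (D \<times> E)"
    if D: "(D, \<phi>) \<in> matlas M" and E: "(E, \<psi>) \<in> matlas N" for D \<phi> E \<psi>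
  proof (intro conjI)
    note cD = chartedD[OF M D] and cE = chartedD[OF N E]
    show "openin (prod_topology (mtop M) (mtop N)) (D \<times> E)"
      using cD(1) cE(1) by (simp add: openin_prod_Times_iff)
    have "openin (Euclidean_space (mdim M + mdim N)) {y \<in> vecs (mdim M + mdim N). trunc_vec (mdim M) y \<in> \<phi> ` D}"
      by (rule openin_Euclidean_preimage[OF openin_topspace continuous_on_trunc _ cD(2)]) (auto intro: trunc_in_vecs)
    then show "openin (Euclidean_space (mdim M + mdim N)) ((\<lambda>(x, y). concat_vec (mdim M) (\<phi> x) (\<psi> y)) ` (D \<times> E))"
      unfolding prod_chart_image[OF open_vecs_subset[OF cD(2)] open_vecs_subset[OF cE(2)] refl refl]
      by (rule openin_Euclidean_preimage[OF _ continuous_on_shift _ cE(2)]) (auto intro: shift_in_vecs)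
    show "inj_on (\<lambda>(x, y). concat_vec (mdim M) (\<phi> x) (\<psi> y)) (D \<times> E)"
    proof (rule inj_onI, safe)
      fix a b a' b' assume *: "a \<in> D" "b \<in> E" "a' \<in> D" "b' \<in> E"
        and eq: "concat_vec (mdim M) (\<phi> a) (\<psi> b) = concat_vec (mdim M) (\<phi> a') (\<psi> b')"
      have "\<phi> a \<in> vecs (mdim M)" "\<phi> a' \<in> vecs (mdim M)" using open_vecs_subset[OF cD(2)] * by auto
      then have "\<phi> a = \<phi> a'" using eq trunc_concat by metis
      moreover have "\<psi> b = \<psi> b'" using eq shift_concat by metis
      ultimately show "a = a'" "b = b'" using cD(3) cE(3) * by (auto dest: inj_onD)
    qed
  qed
  then show "\<forall>(D, \<phi>)\<in>matlas (prod_mfd M N). openin (mtop (prod_mfd M N)) D \<and>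
      openin (Euclidean_space (mdim (prod_mfd M N))) (\<phi> ` D) \<and> inj_on \<phi> D"
    unfolding prod_mfd_simps by (fastforce simp: prod_mfd_def)
qed

lemma topspace_sub_Euclidean: "openin (Euclidean_space q) U \<Longrightarrow> topspace (subtopology (Euclidean_space q) U) = U"
  using open_vecs_subset by auto

lemma smooth_map_on_cong:
  assumes U: "openin (Euclidean_space q) U" and eq: "\<And>x. x \<in> U \<Longrightarrow> h x = g x" and g: "smooth_map_on q U n g"
  shows "smooth_map_on q U n h"
proof -
  have "smooth_on q U (\<lambda>x. h x j) = smooth_on q U (\<lambda>x. g x j)" for j
    by (rule smooth_on_cong[OF U]) (simp add: eq)
  moreover have "h ` U = g ` U" using eq by auto
  ultimately show ?thesis using g by (simp add: smooth_map_on_def)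
qed

lemma prod_plotI:
  assumes M: "charted M" and N: "charted N"
    and m: "(q, U, m) \<in> mfd_plots M" and t: "(q, U, t) \<in> mfd_plots N"
  shows "(q, U, restrict (\<lambda>x. (m x, t x)) U) \<in> mfd_plots (prod_mfd M N)"
proof (rule mfd_plotsI)
  show U: "openin (Euclidean_space q) U" by (rule mfd_plotsD(1)[OF m])
  have c: "continuous_map (subtopology (Euclidean_space q) U) (prod_topology (mtop M) (mtop N)) (\<lambda>x. (m x, t x))"
    using mfd_plotsD(4)[OF m] mfd_plotsD(4)[OF t] by (simp add: continuous_map_pairwise o_def)
  show "continuous_map (subtopology (Euclidean_space q) U) (mtop (prod_mfd M N)) (restrict (\<lambda>x. (m x, t x)) U)"
    unfolding prod_mfd_simps by (rule continuous_map_eq[OF c]) (simp add: topspace_sub_Euclidean[OF U])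
  show "restrict (\<lambda>x. (m x, t x)) U ` U \<subseteq> topspace (mtop (prod_mfd M N))"
    using mfd_plotsD(3)[OF m] mfd_plotsD(3)[OF t] by auto
  fix DE \<kappa> assume "(DE, \<kappa>) \<in> matlas (prod_mfd M N)"
  then obtain D \<phi> E \<psi> where DE: "DE = D \<times> E" "\<kappa> = (\<lambda>(x, y). concat_vec (mdim M) (\<phi> x) (\<psi> y))"
    and D: "(D, \<phi>) \<in> matlas M" and E: "(E, \<psi>) \<in> matlas N" by (auto simp: prod_mfd_def)
  let ?V = "{x\<in>U. restrict (\<lambda>x. (m x, t x)) U x \<in> DE}"
  have V: "?V = {x\<in>U. m x \<in> D} \<inter> {x\<in>U. t x \<in> E}" using DE(1) by auto
  have oD: "openin (Euclidean_space q) {x\<in>U. m x \<in> D}"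
    by (rule openin_plot_preimage[OF U mfd_plotsD(4)[OF m] chartedD(1)[OF M D]])
  have oE: "openin (Euclidean_space q) {x\<in>U. t x \<in> E}"
    by (rule openin_plot_preimage[OF U mfd_plotsD(4)[OF t] chartedD(1)[OF N E]])
  have oV: "openin (Euclidean_space q) ?V" unfolding V by (intro openin_Int oD oE)
  have mD: "smooth_map_on q ?V (mdim M) (\<phi> \<circ> m)"
    by (rule smooth_map_on_subset[OF mfd_plotsD(5)[OF m D] _ open_vecs_subset[OF oD]]) (use V in auto)
  have tE: "smooth_map_on q ?V (mdim N) (\<psi> \<circ> t)"
    by (rule smooth_map_on_subset[OF mfd_plotsD(5)[OF t E] _ open_vecs_subset[OF oE]]) (use V in auto)
  have "smooth_map_on q ?V (mdim M + mdim N) (\<lambda>x. concat_vec (mdim M) (\<phi> (m x)) (\<psi> (t x)))"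
    unfolding smooth_map_on_def
  proof (intro conjI allI impI)
    show "(\<lambda>x. concat_vec (mdim M) (\<phi> (m x)) (\<psi> (t x))) ` ?V \<subseteq> vecs (mdim M + mdim N)"
    proof
      fix y assume "y \<in> (\<lambda>x. concat_vec (mdim M) (\<phi> (m x)) (\<psi> (t x))) ` ?V"
      then obtain x where x: "x \<in> ?V" "y = concat_vec (mdim M) (\<phi> (m x)) (\<psi> (t x))" by blast
      have "(\<psi> \<circ> t) x \<in> vecs (mdim N)" using tE x(1) unfolding smooth_map_on_def by blast
      then show "y \<in> vecs (mdim M + mdim N)" unfolding x(2) by (intro concat_in_vecs) simp
    qed
    fix j assume j: "j < mdim M + mdim N"
    show "smooth_on q ?V (\<lambda>x. concat_vec (mdim M) (\<phi> (m x)) (\<psi> (t x)) j)"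
    proof (cases "j < mdim M")
      case True
      then show ?thesis using mD by (simp add: concat_vec_def smooth_map_on_def)
    next
      case False
      then have "j - mdim M < mdim N" using j by simp
      then show ?thesis using tE False by (simp add: concat_vec_def smooth_map_on_def)
    qed
  qed
  then show "smooth_map_on q ?V (mdim (prod_mfd M N)) (\<kappa> \<circ> restrict (\<lambda>x. (m x, t x)) U)"
    unfolding prod_mfd_simps by (rule smooth_map_on_cong[OF oV, rotated]) (simp add: DE(2))
qed auto

text \<open>The atlas of the product speaks of pairs of charts, so the smoothness of one component
  is checked locally, with some chart of the other factor around the given point.\<close>

lemma prod_plotD:
  assumes M: "charted M" and N: "charted N" and w: "(q, U, w) \<in> mfd_plots (prod_mfd M N)"
  shows "(q, U, restrict (\<lambda>x. fst (w x)) U) \<in> mfd_plots M" "(q, U, restrict (\<lambda>x. snd (w x)) U) \<in> mfd_plots N"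
proof -
  note U = mfd_plotsD(1)[OF w]
  have c: "continuous_map (subtopology (Euclidean_space q) U) (prod_topology (mtop M) (mtop N)) w"
    using mfd_plotsD(4)[OF w] by simp
  then have c1: "continuous_map (subtopology (Euclidean_space q) U) (mtop M) (\<lambda>x. fst (w x))"
    and c2: "continuous_map (subtopology (Euclidean_space q) U) (mtop N) (\<lambda>x. snd (w x))"
    by (auto simp: continuous_map_pairwise o_def)
  have DE: "smooth_map_on q {x\<in>U. w x \<in> D \<times> E} (mdim M + mdim N)
      ((\<lambda>(x, y). concat_vec (mdim M) (\<phi> x) (\<psi> y)) \<circ> w)"
    and oDE: "openin (Euclidean_space q) {x\<in>U. w x \<in> D \<times> E}"
    if D: "(D, \<phi>) \<in> matlas M" and E: "(E, \<psi>) \<in> matlas N" for D \<phi> E \<psi>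
  proof -
    have "(D \<times> E, \<lambda>(x, y). concat_vec (mdim M) (\<phi> x) (\<psi> y)) \<in> matlas (prod_mfd M N)"
      using D E by (auto simp: prod_mfd_def)
    then show "smooth_map_on q {x\<in>U. w x \<in> D \<times> E} (mdim M + mdim N) ((\<lambda>(x, y). concat_vec (mdim M) (\<phi> x) (\<psi> y)) \<circ> w)"
      using mfd_plotsD(5)[OF w] by simp
    show "openin (Euclidean_space q) {x\<in>U. w x \<in> D \<times> E}"
      by (rule openin_plot_preimage[OF U c]) (simp add: openin_prod_Times_iff chartedD(1)[OF M D] chartedD(1)[OF N E])
  qed
  have wt: "fst (w x) \<in> topspace (mtop M)" "snd (w x) \<in> topspace (mtop N)" if "x \<in> U" for x
    using mfd_plotsD(3)[OF w] that by (auto simp: mem_Times_iff)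
  show "(q, U, restrict (\<lambda>x. fst (w x)) U) \<in> mfd_plots M"
  proof (rule mfd_plotsI[OF U])
    show "continuous_map (subtopology (Euclidean_space q) U) (mtop M) (restrict (\<lambda>x. fst (w x)) U)"
      by (rule continuous_map_eq[OF c1]) (simp add: topspace_sub_Euclidean[OF U])
    fix D \<phi> assume D: "(D, \<phi>) \<in> matlas M"
    let ?V = "{x\<in>U. restrict (\<lambda>x. fst (w x)) U x \<in> D}"
    have "openin (Euclidean_space q) {x\<in>U. fst (w x) \<in> D}"
      by (rule openin_plot_preimage[OF U c1 chartedD(1)[OF M D]])
    moreover have "?V = {x\<in>U. fst (w x) \<in> D}" by auto
    ultimately have oV: "openin (Euclidean_space q) ?V" by simp
    show "smooth_map_on q ?V (mdim M) (\<phi> \<circ> restrict (\<lambda>x. fst (w x)) U)"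
      unfolding smooth_map_on_def
    proof (intro conjI allI impI)
      show "(\<phi> \<circ> restrict (\<lambda>x. fst (w x)) U) ` ?V \<subseteq> vecs (mdim M)"
        using open_vecs_subset[OF chartedD(2)[OF M D]] by auto
      fix j assume j: "j < mdim M"
      show "smooth_on q ?V (\<lambda>x. (\<phi> \<circ> restrict (\<lambda>x. fst (w x)) U) x j)"
      proof (rule smooth_on_localI[OF oV])
        fix x assume x: "x \<in> ?V"
        obtain E \<psi> where E: "(E, \<psi>) \<in> matlas N" "snd (w x) \<in> E" using charted_cover[OF N wt(2)] x by blast
        let ?W = "{x\<in>U. w x \<in> D \<times> E}"
        have "smooth_on q ?W (\<lambda>x. ((\<lambda>(x, y). concat_vec (mdim M) (\<phi> x) (\<psi> y)) \<circ> w) x j)"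
          using DE[OF D E(1)] j by (simp add: smooth_map_on_def)
        then have "smooth_on q ?W (\<lambda>x. (\<phi> \<circ> restrict (\<lambda>x. fst (w x)) U) x j)"
          using smooth_on_cong[OF oDE[OF D E(1)], of "\<lambda>x. ((\<lambda>(x, y). concat_vec (mdim M) (\<phi> x) (\<psi> y)) \<circ> w) x j"
            "\<lambda>x. (\<phi> \<circ> restrict (\<lambda>x. fst (w x)) U) x j"] j by (auto simp: concat_vec_def split_beta)
        moreover have "?W \<subseteq> ?V" "x \<in> ?W" using x E(2) by (auto simp: mem_Times_iff)
        ultimately show "\<exists>W. openin (Euclidean_space q) W \<and> x \<in> W \<and> W \<subseteq> ?V \<and> smooth_on q W (\<lambda>x. (\<phi> \<circ> restrict (\<lambda>x. fst (w x)) U) x j)"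
          using oDE[OF D E(1)] by (intro exI[of _ ?W] conjI)
      qed
    qed
  qed (use wt in auto)
  show "(q, U, restrict (\<lambda>x. snd (w x)) U) \<in> mfd_plots N"
  proof (rule mfd_plotsI[OF U])
    show "continuous_map (subtopology (Euclidean_space q) U) (mtop N) (restrict (\<lambda>x. snd (w x)) U)"
      by (rule continuous_map_eq[OF c2]) (simp add: topspace_sub_Euclidean[OF U])
    fix E \<psi> assume E: "(E, \<psi>) \<in> matlas N"
    let ?V = "{x\<in>U. restrict (\<lambda>x. snd (w x)) U x \<in> E}"
    have "openin (Euclidean_space q) {x\<in>U. snd (w x) \<in> E}"
      by (rule openin_plot_preimage[OF U c2 chartedD(1)[OF N E]])
    moreover have "?V = {x\<in>U. snd (w x) \<in> E}" by auto
    ultimately have oV: "openin (Euclidean_space q) ?V" by simp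
    show "smooth_map_on q ?V (mdim N) (\<psi> \<circ> restrict (\<lambda>x. snd (w x)) U)"
      unfolding smooth_map_on_def
    proof (intro conjI allI impI)
      show "(\<psi> \<circ> restrict (\<lambda>x. snd (w x)) U) ` ?V \<subseteq> vecs (mdim N)"
        using open_vecs_subset[OF chartedD(2)[OF N E]] by auto
      fix j assume j: "j < mdim N"
      show "smooth_on q ?V (\<lambda>x. (\<psi> \<circ> restrict (\<lambda>x. snd (w x)) U) x j)"
      proof (rule smooth_on_localI[OF oV])
        fix x assume x: "x \<in> ?V"
        obtain D \<phi> where D: "(D, \<phi>) \<in> matlas M" "fst (w x) \<in> D" using charted_cover[OF M wt(1)] x by blast
        let ?W = "{x\<in>U. w x \<in> D \<times> E}"
        have "smooth_on q ?W (\<lambda>x. ((\<lambda>(x, y). concat_vec (mdim M) (\<phi> x) (\<psi> y)) \<circ> w) x (j + mdim M))"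
          using DE[OF D(1) E] j by (simp add: smooth_map_on_def)
        then have "smooth_on q ?W (\<lambda>x. (\<psi> \<circ> restrict (\<lambda>x. snd (w x)) U) x j)"
          using smooth_on_cong[OF oDE[OF D(1) E], of "\<lambda>x. ((\<lambda>(x, y). concat_vec (mdim M) (\<phi> x) (\<psi> y)) \<circ> w) x (j + mdim M)"
            "\<lambda>x. (\<psi> \<circ> restrict (\<lambda>x. snd (w x)) U) x j"] j by (auto simp: concat_vec_def split_beta)
        moreover have "?W \<subseteq> ?V" "x \<in> ?W" using x D(2) by (auto simp: mem_Times_iff)
        ultimately show "\<exists>W. openin (Euclidean_space q) W \<and> x \<in> W \<and> W \<subseteq> ?V \<and> smooth_on q W (\<lambda>x. (\<psi> \<circ> restrict (\<lambda>x. snd (w x)) U) x j)"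
          using oDE[OF D(1) E] by (intro exI[of _ ?W] conjI)
      qed
    qed
  qed (use wt in auto)
qed

text \<open>Since \<open>charted\<close> does not make charts homeomorphisms, openness of the images
  of the smaller domains is a premise.\<close>

lemma charted_open_submfd:
  assumes M: "charted M" and "\<And>D \<phi>. (D, \<phi>) \<in> matlas M \<Longrightarrow> openin (Euclidean_space (mdim M)) (\<phi> ` (D \<inter> G))" "openin (mtop M) G"
  shows "charted (open_submfd M G)"
  unfolding charted_def
proof (intro conjI)
  show "\<Union> (fst ` matlas (open_submfd M G)) = topspace (mtop (open_submfd M G))"
  proof -
    have "\<Union> (fst ` matlas (open_submfd M G)) = \<Union> (fst ` matlas M) \<inter> G"
      by (force simp: open_submfd_def)
    then show ?thesis using M by (simp add: charted_def open_submfd_def)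
  qed
  have "openin (subtopology (mtop M) G) (D \<inter> G) \<and> openin (Euclidean_space (mdim M)) (\<phi> ` (D \<inter> G)) \<and> inj_on \<phi> (D \<inter> G)"
    if "(D, \<phi>) \<in> matlas M" for D \<phi>
    using assms(2)[OF that] chartedD[OF M that] by (auto simp: openin_subtopology_Int intro: inj_on_subset)
  then show "\<forall>(D, \<phi>)\<in>matlas (open_submfd M G). openin (mtop (open_submfd M G)) D \<and>
      openin (Euclidean_space (mdim (open_submfd M G))) (\<phi> ` D) \<and> inj_on \<phi> D"
    by (auto simp: open_submfd_def)
qed

lemma open_submfd_plotI:
  assumes u: "(q, U, u) \<in> mfd_plots M" and G: "u ` U \<subseteq> G"
  shows "(q, U, u) \<in> mfd_plots (open_submfd M G)"
proof -
  have "{x\<in>U. u x \<in> D \<inter> G} = {x\<in>U. u x \<in> D}" for D using G by auto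
  then show ?thesis
    using mfd_plotsD[OF u] G
    by (intro mfd_plotsI) (auto simp: open_submfd_def continuous_map_in_subtopology)
qed

abbreviation real_vec :: "real \<Rightarrow> nat \<Rightarrow> real" where
  "real_vec t \<equiv> \<lambda>i. if i = 0 then t else 0"

lemma real_vec_image: "real_vec ` S = {y \<in> vecs 1. y 0 \<in> S}"
proof (intro equalityI subsetI)
  fix y assume y: "y \<in> {y \<in> vecs 1. y 0 \<in> S}"
  then have "y = real_vec (y 0)" by (auto simp: in_vecs_iff fun_eq_iff)
  then show "y \<in> real_vec ` S" using y by blast
qed (auto simp: in_vecs_iff)

lemma inj_real_vec: "inj_on real_vec S"
  by (rule inj_onI) (auto dest: fun_cong[of _ _ 0])

lemma openin_real_vec_image: "open S \<Longrightarrow> openin (Euclidean_space 1) (real_vec ` S)"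
  unfolding real_vec_image
  by (rule openin_Euclidean_preimage_open[OF openin_topspace])
     (auto intro: continuous_on_subset[OF continuous_on_product_coordinates])

lemma charted_real: "charted real_mfd"
  using openin_real_vec_image[of UNIV] inj_real_vec by (auto simp: charted_def real_mfd_def)

lemma charted_real_sub: "open S \<Longrightarrow> charted (open_submfd real_mfd S)"
  using openin_real_vec_image by (intro charted_open_submfd charted_real) (auto simp: real_mfd_def)

lemma smooth_map_on_real_vec:
  "smooth_on q U f \<Longrightarrow> smooth_map_on q U 1 (\<lambda>x. real_vec (f x))"
  by (auto simp: smooth_map_on_def in_vecs_iff)

lemma real_plot_iff:
  "(q, U, u) \<in> mfd_plots real_mfd \<longleftrightarrow> openin (Euclidean_space q) U \<and> u \<in> extensional U \<and> smooth_on q U u"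
proof safe
  assume u: "(q, U, u) \<in> mfd_plots real_mfd"
  show "openin (Euclidean_space q) U" "u \<in> extensional U" by (rule mfd_plotsD[OF u])+
  show "smooth_on q U u"
    using mfd_plotsD(5)[OF u, of UNIV real_vec] by (auto simp: real_mfd_def smooth_map_on_def)
next
  assume U: "openin (Euclidean_space q) U" and u: "u \<in> extensional U" "smooth_on q U u"
  show "(q, U, u) \<in> mfd_plots real_mfd"
  proof (rule mfd_plotsI[OF U u(1)])
    show "continuous_map (subtopology (Euclidean_space q) U) (mtop real_mfd) u"
      using smooth_on_continuous[OF u(2) open_vecs_subset[OF U]]
      by (simp add: real_mfd_def continuous_map_sub_Euclidean_iff[OF open_vecs_subset[OF U]])
    fix D \<phi> assume "(D, \<phi>) \<in> matlas real_mfd"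
    then show "smooth_map_on q {x \<in> U. u x \<in> D} (mdim real_mfd) (\<phi> \<circ> u)"
      using smooth_map_on_real_vec[OF u(2)] by (auto simp: real_mfd_def o_def)
  qed (simp add: real_mfd_def)
qed

lemma smooth_on_real_fun:
  assumes g: "smooth_fun real_mfd g" and U: "openin (Euclidean_space q) U" and f: "smooth_on q U f"
  shows "smooth_on q U (\<lambda>x. g (f x))"
proof -
  have "(q, U, restrict f U) \<in> mfd_plots real_mfd"
    using smooth_on_cong[OF U, of f "restrict f U"] U f by (simp add: real_plot_iff)
  from smooth_fun_plot[OF charted_real g this] show ?thesis
    using smooth_on_cong[OF U, of "\<lambda>x. g (restrict f U x)" "\<lambda>x. g (f x)"] by simp
qed

text \<open>Smoothness of k is given as stability under composition, the form in which it is
  available for functions built from \<lambda>. In the product chart the coordinates of M come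
  first, so the height is the coordinate with index \<open>mdim M\<close>.\<close>

lemma smooth_fun_prod:
  assumes M: "charted M" and f: "smooth_fun M f"
    and k: "\<And>q U h. openin (Euclidean_space q) U \<Longrightarrow> smooth_on q U h \<Longrightarrow> smooth_on q U (\<lambda>x. k (h x) :: real)"
    and S: "open S"
  shows "smooth_fun (prod_mfd M (open_submfd real_mfd S)) (\<lambda>(a, t). f a * k t)"
  unfolding smooth_fun_def
proof safe
  fix DE \<kappa> assume DE: "(DE, \<kappa>) \<in> matlas (prod_mfd M (open_submfd real_mfd S))"
  note cN = charted_prod[OF M charted_real_sub[OF S]]
  obtain D \<phi> where D: "(D, \<phi>) \<in> matlas M" and eq: "DE = D \<times> S" "\<kappa> = (\<lambda>(x, y). concat_vec (mdim M) (\<phi> x) (real_vec y))"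
    using DE by (auto simp: prod_mfd_def open_submfd_def real_mfd_def)
  let ?I = "\<kappa> ` DE" and ?n = "mdim M + 1"
  have dim: "mdim (prod_mfd M (open_submfd real_mfd S)) = ?n" by (simp add: open_submfd_def real_mfd_def)
  have oI: "openin (Euclidean_space ?n) ?I" using chartedD(2)[OF cN DE] by (simp only: dim)
  note I = open_vecs_subset[OF oI]
  have \<phi>v: "\<phi> a \<in> vecs (mdim M)" if "a \<in> D" for a using open_vecs_subset[OF chartedD(2)[OF M D]] that by blast
  have "smooth_on (mdim M) (\<phi> ` D) (f \<circ> inv_into D \<phi>)" using f D by (auto simp: smooth_fun_def)
  then have 1: "smooth_on ?n ?I (\<lambda>y. (f \<circ> inv_into D \<phi>) (trunc_vec (mdim M) y))"
  proof (rule smooth_on_compose[OF oI chartedD(2)[OF M D]])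
    show "smooth_map_on ?n ?I (mdim M) (trunc_vec (mdim M))"
      using I by (auto simp: smooth_map_on_def trunc_vec_def in_vecs_iff intro: smooth_on_coord)
    show "trunc_vec (mdim M) ` ?I \<subseteq> \<phi> ` D" using \<phi>v by (auto simp: eq trunc_concat)
  qed
  have "smooth_on ?n ?I (\<lambda>y. k (y (mdim M)))" by (intro k oI smooth_on_coord I)
  with 1 have sm: "smooth_on ?n ?I (\<lambda>y. (f \<circ> inv_into D \<phi>) (trunc_vec (mdim M) y) * k (y (mdim M)))"
    by (rule smooth_on_mult[OF oI])
  have *: "(f \<circ> inv_into D \<phi>) (trunc_vec (mdim M) y) * k (y (mdim M)) = ((\<lambda>(a, t). f a * k t) \<circ> inv_into DE \<kappa>) y"
    if "y \<in> ?I" for y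
  proof -
    obtain a t where at: "(a, t) \<in> DE" "y = \<kappa> (a, t)" using \<open>y \<in> ?I\<close> by auto
    then have "inv_into DE \<kappa> y = (a, t)" using inv_chart[OF cN DE] by simp
    moreover have "inv_into D \<phi> (trunc_vec (mdim M) y) = a" "y (mdim M) = t"
      using at \<phi>v inv_chart[OF M D] by (auto simp: eq trunc_concat) (simp add: concat_vec_def)
    ultimately show ?thesis by simp
  qed
  have "smooth_on ?n ?I ((\<lambda>(a, t). f a * k t) \<circ> inv_into DE \<kappa>)"
    by (rule iffD1[OF smooth_on_cong[OF oI *] sm])
  then show "smooth_on (mdim (prod_mfd M (open_submfd real_mfd S))) (\<kappa> ` DE) ((\<lambda>(a, t). f a * k t) \<circ> inv_into DE \<kappa>)"
    by (simp only: dim)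
qed

lemma smooth_fun_const: "charted M \<Longrightarrow> smooth_fun M (\<lambda>_. c)"
  unfolding smooth_fun_def o_def by (safe intro!: smooth_on_const) (blast dest: chartedD(2) open_vecs_subset)

section \<open>Bump functions and the plots of the suspension\<close>

text \<open>Here the charts have to be homeomorphisms, hence \<open>smooth_manifold\<close> instead
  of \<open>charted\<close>.\<close>

lemma chart_image_open:
  assumes M: "smooth_manifold M" and D: "(D, \<phi>) \<in> matlas M" and W: "openin (mtop M) W" "W \<subseteq> D"
  shows "openin (Euclidean_space (mdim M)) (\<phi> ` W)"
proof -
  have h: "homeomorphic_map (subtopology (mtop M) D) (subtopology (Euclidean_space (mdim M)) (\<phi> ` D)) \<phi>"
    using M D by (auto simp: smooth_manifold_def)
  have "openin (subtopology (mtop M) D) W"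
    using W chartedD(1)[OF charted_smooth_manifold[OF M] D] by (simp add: openin_open_subtopology)
  then have "openin (subtopology (Euclidean_space (mdim M)) (\<phi> ` D)) (\<phi> ` W)"
    using homeomorphic_imp_open_map[OF h] by (simp add: open_map_def)
  then show ?thesis
    using openin_trans_full chartedD(2)[OF charted_smooth_manifold[OF M] D] by blast
qed

text \<open>Another chart E is treated on E \<inter> D by the transition map and on E - K by g = 0.
  These sets cover E because K lies in D, and E - K is open because K is closed.\<close>

lemma smooth_fun_extend_zero:
  assumes M: "smooth_manifold M" and D: "(D, \<phi>) \<in> matlas M" and K: "closedin (mtop M) K" "K \<subseteq> D"
    and g: "smooth_on (mdim M) (\<phi> ` D) (g \<circ> inv_into D \<phi>)" and z: "\<And>y. y \<in> topspace (mtop M) - K \<Longrightarrow> g y = 0"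
  shows "smooth_fun M g"
  unfolding smooth_fun_def
proof safe
  note cM = charted_smooth_manifold[OF M]
  fix E \<psi> assume E: "(E, \<psi>) \<in> matlas M"
  note oD = chartedD(1)[OF cM D] and oE = chartedD(1)[OF cM E]
  show "smooth_on (mdim M) (\<psi> ` E) (g \<circ> inv_into E \<psi>)"
  proof (rule smooth_on_localI[OF chartedD(2)[OF cM E]])
    fix y assume "y \<in> \<psi> ` E"
    then obtain e where e: "e \<in> E" "y = \<psi> e" by blast
    show "\<exists>W. openin (Euclidean_space (mdim M)) W \<and> y \<in> W \<and> W \<subseteq> \<psi> ` E \<and> smooth_on (mdim M) W (g \<circ> inv_into E \<psi>)"
    proof (cases "e \<in> D")
      case True
      let ?W = "\<psi> ` (E \<inter> D)"
      have oW: "openin (Euclidean_space (mdim M)) ?W"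
        by (rule chart_image_open[OF M E]) (use oD oE in auto)
      have "smooth_map_on (mdim M) ?W (mdim M) (\<phi> \<circ> inv_into E \<psi>)"
        using M E D unfolding smooth_manifold_def by blast
      moreover have "(\<phi> \<circ> inv_into E \<psi>) ` ?W \<subseteq> \<phi> ` D" using inv_chart[OF cM E] by auto
      ultimately have "smooth_on (mdim M) ?W (\<lambda>x. (g \<circ> inv_into D \<phi>) ((\<phi> \<circ> inv_into E \<psi>) x))"
        by (intro smooth_on_compose[OF oW chartedD(2)[OF cM D] g])
      moreover have "(g \<circ> inv_into D \<phi>) ((\<phi> \<circ> inv_into E \<psi>) x) = (g \<circ> inv_into E \<psi>) x" if "x \<in> ?W" for x
        using that inv_chart[OF cM E] inv_chart[OF cM D] by auto
      ultimately have "smooth_on (mdim M) ?W (g \<circ> inv_into E \<psi>)"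
        using smooth_on_cong[OF oW, of "\<lambda>x. (g \<circ> inv_into D \<phi>) ((\<phi> \<circ> inv_into E \<psi>) x)" "g \<circ> inv_into E \<psi>"] by simp
      moreover have "y \<in> ?W" "?W \<subseteq> \<psi> ` E" using e True by auto
      ultimately show ?thesis using oW by (intro exI[of _ ?W] conjI)
    next
      case False
      let ?W = "\<psi> ` (E - K)"
      have oW: "openin (Euclidean_space (mdim M)) ?W"
        by (rule chart_image_open[OF M E]) (use oE K in auto)
      have "(g \<circ> inv_into E \<psi>) x = 0" if "x \<in> ?W" for x
        using that inv_chart[OF cM E] z openin_subset[OF oE] by auto
      then have "smooth_on (mdim M) ?W (g \<circ> inv_into E \<psi>)"
        using smooth_on_cong[OF oW, of "g \<circ> inv_into E \<psi>" "\<lambda>_. 0"] smooth_on_const[OF open_vecs_subset[OF oW]] by simp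
      moreover have "y \<in> ?W" "?W \<subseteq> \<psi> ` E" using e False K by auto
      ultimately show ?thesis using oW by (intro exI[of _ ?W] conjI)
    qed
  qed
qed

lemma compactin_box: "compactin (Euclidean_space m) {y \<in> vecs m. \<forall>i<m. \<bar>y i - c i\<bar> \<le> r}"
proof -
  have "{y \<in> vecs m. \<forall>i<m. \<bar>y i - c i\<bar> \<le> r} = Pi\<^sub>E UNIV (\<lambda>i. if i < m then {c i - r..c i + r} else {0})"
    by (auto simp: in_vecs_iff PiE_iff abs_le_iff split: if_splits) (smt (verit) singletonD atLeastAtMost_iff)+
  moreover have "compactin (powertop_real UNIV) (Pi\<^sub>E UNIV (\<lambda>i. if i < m then {c i - r..c i + r} else {0}))"
    by (simp add: compactin_PiE)
  ultimately show ?thesis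
    by (auto simp: Euclidean_space_def compactin_subtopology in_vecs_iff)
qed

locale cutoff =
  fixes lam :: "real \<Rightarrow> real"
  assumes lam_smooth: "smooth_fun real_mfd lam"
    and lam_0: "s \<le> 0 \<Longrightarrow> lam s = 0"
    and lam_1: "s \<ge> 1 \<Longrightarrow> lam s = 1"
    and lam_01: "0 < s \<Longrightarrow> s < 1 \<Longrightarrow> 0 < lam s \<and> lam s < 1"
begin

lemma lam_range: "0 \<le> lam s" "lam s \<le> 1"
  using lam_0[of s] lam_1[of s] lam_01[of s] by (cases "s \<le> 0"; cases "s \<ge> 1"; force)+

lemma smooth_lam: "openin (Euclidean_space q) U \<Longrightarrow> smooth_on q U f \<Longrightarrow> smooth_on q U (\<lambda>x. lam (f x))"
  by (rule smooth_on_real_fun[OF lam_smooth])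

text \<open>The given cut-off supplies the bump functions. The closed set K contains the support, so
  extension by zero is smooth; b is 1 on a neighbourhood N of p, so multiplication by b changes
  nothing near p.\<close>

lemma exists_bump:
  assumes M: "smooth_manifold M" and D: "(D, \<phi>) \<in> matlas M" and p: "p \<in> D" and W: "openin (mtop M) W" "p \<in> W"
  obtains b K N where "closedin (mtop M) K" "K \<subseteq> D \<inter> W" "\<And>y. y \<notin> K \<Longrightarrow> b y = 0"
    "smooth_on (mdim M) (\<phi> ` D) (b \<circ> inv_into D \<phi>)"
    "openin (mtop M) N" "p \<in> N" "N \<subseteq> D" "\<And>y. y \<in> N \<Longrightarrow> b y = 1"
proof -
  note cM = charted_smooth_manifold[OF M]
  note oD = chartedD(1)[OF cM D] and oI = chartedD(2)[OF cM D]
  let ?m = "mdim M"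
  define c where "c = \<phi> p"
  have "openin (Euclidean_space ?m) (\<phi> ` (D \<inter> W))"
    by (rule chart_image_open[OF M D]) (use oD W in auto)
  moreover have "c \<in> \<phi> ` (D \<inter> W)" using p W by (auto simp: c_def)
  ultimately obtain e where e: "e > 0"
    "\<And>y. y \<in> vecs ?m \<Longrightarrow> (\<And>i. i < ?m \<Longrightarrow> \<bar>y i - c i\<bar> < e) \<Longrightarrow> y \<in> \<phi> ` (D \<inter> W)"
    using open_vecs_box by metis
  \<comment> \<open>The closed box of half-width 2d then lies in the open box of half-width e, and
    so in the chart.\<close>
  define d where "d = e / 4"
  have d: "d > 0" "2 * d < e" using e(1) by (auto simp: d_def)
  define B where "B = {y \<in> vecs ?m. \<forall>i<?m. \<bar>y i - c i\<bar> \<le> 2 * d}"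
  have BI: "B \<subseteq> \<phi> ` (D \<inter> W)" using e(2) d(2) by (force simp: B_def)
  \<comment> \<open>The function \<open>lam (2 - s\<^sup>2)\<close> is 1 for |s| \<le> 1 and 0 for
    |s| \<ge> 2.\<close>
  define \<beta> where "\<beta> y = (\<Prod>i<?m. lam (2 - ((y i - c i) / d)\<^sup>2))" for y :: "nat \<Rightarrow> real"
  have \<beta>0: "\<beta> y = 0" if y: "y \<in> vecs ?m" "y \<notin> B" for y
  proof -
    obtain i where i: "i < ?m" "\<bar>y i - c i\<bar> > 2 * d" using y by (auto simp: B_def)
    then have "\<bar>(y i - c i) / d\<bar> > 2" using d(1) by (simp add: abs_divide field_simps)
    then have "2\<^sup>2 < \<bar>(y i - c i) / d\<bar>\<^sup>2" by (intro power_strict_mono) auto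
    then have "4 < ((y i - c i) / d)\<^sup>2" unfolding power2_abs by simp
    then have "lam (2 - ((y i - c i) / d)\<^sup>2) = 0" by (intro lam_0) simp
    then show ?thesis using i(1) by (auto simp: \<beta>_def)
  qed
  have \<beta>1: "\<beta> y = 1" if "\<And>i. i < ?m \<Longrightarrow> \<bar>y i - c i\<bar> < d" for y
  proof -
    have "lam (2 - ((y i - c i) / d)\<^sup>2) = 1" if "i < ?m" for i
    proof -
      have "\<bar>(y i - c i) / d\<bar> \<le> 1" using \<open>\<And>i. i < ?m \<Longrightarrow> \<bar>y i - c i\<bar> < d\<close>[OF that] d(1) by (simp add: abs_divide)
      then have "((y i - c i) / d)\<^sup>2 \<le> 1" by (simp add: abs_square_le_1)
      then show ?thesis by (intro lam_1) simp
    qed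
    then show ?thesis by (simp add: \<beta>_def)
  qed
  have \<beta>s: "smooth_on ?m (\<phi> ` D) \<beta>"
  proof -
    have "smooth_on ?m (\<phi> ` D) (\<lambda>y. 2 - (1 / d * (y i - c i)) * (1 / d * (y i - c i)))" for i
      by (intro smooth_on_diff[OF oI] smooth_on_mult[OF oI] smooth_on_const smooth_on_coord open_vecs_subset[OF oI])
    then show ?thesis unfolding \<beta>_def
      by (intro smooth_on_prod[OF oI] smooth_lam[OF oI]) (simp add: power2_eq_square)
  qed
  define K where "K = {y \<in> D. \<phi> y \<in> B}"
  define b where "b y = (if y \<in> D then \<beta> (\<phi> y) else 0)" for y
  define N where "N = {y \<in> D. \<forall>i<?m. \<bar>\<phi> y i - c i\<bar> < d}"
  have h: "homeomorphic_map (subtopology (mtop M) D) (subtopology (Euclidean_space ?m) (\<phi> ` D)) \<phi>"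
    using M D by (auto simp: smooth_manifold_def)
  have tD: "topspace (subtopology (mtop M) D) = D" using openin_subset[OF oD] by auto
  show ?thesis
  proof
    \<comment> \<open>K corresponds to a compact box under the chart, so it is compact, and it is
      closed because M is Hausdorff.\<close>
    have "\<phi> ` K = B" using BI by (auto simp: K_def)
    then have "compactin (subtopology (Euclidean_space ?m) (\<phi> ` D)) (\<phi> ` K)"
      using compactin_box[of ?m c "2 * d"] BI by (auto simp: compactin_subtopology B_def)
    then have "compactin (subtopology (mtop M) D) K"
      using homeomorphic_map_compactness[OF h, of K] tD by (auto simp: K_def)
    then have "compactin (mtop M) K" by (simp add: compactin_subtopology)
    then show "closedin (mtop M) K"
      using M compactin_imp_closedin by (auto simp: smooth_manifold_def)
    show "K \<subseteq> D \<inter> W"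
    proof
      fix y assume y: "y \<in> K"
      then obtain z where "z \<in> D \<inter> W" "\<phi> y = \<phi> z" using BI by (auto simp: K_def)
      then show "y \<in> D \<inter> W" using y chartedD(3)[OF cM D] by (auto simp: K_def dest: inj_onD)
    qed
    show "b y = 0" if "y \<notin> K" for y
      using that \<beta>0[of "\<phi> y"] open_vecs_subset[OF oI] by (auto simp: b_def K_def)
    show "smooth_on ?m (\<phi> ` D) (b \<circ> inv_into D \<phi>)"
      by (rule iffD1[OF smooth_on_cong[OF oI] \<beta>s]) (use inv_chart[OF cM D] in \<open>auto simp: b_def\<close>)
    have "openin (Euclidean_space ?m) (\<phi> ` D \<inter> {y \<in> vecs ?m. \<forall>i<?m. \<bar>y i - c i\<bar> < d})"
    proof -
      have "openin (Euclidean_space ?m) {y \<in> \<phi> ` D. y i \<in> ball (c i) d}" for i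
        by (rule openin_Euclidean_preimage_open[OF oI]) (auto intro: continuous_on_subset[OF continuous_on_product_coordinates])
      then have "openin (Euclidean_space ?m) (\<Inter> (insert (\<phi> ` D) ((\<lambda>i. {y \<in> \<phi> ` D. y i \<in> ball (c i) d}) ` {..<?m})))"
        using oI by (intro openin_Inter) auto
      moreover have "\<Inter> (insert (\<phi> ` D) ((\<lambda>i. {y \<in> \<phi> ` D. y i \<in> ball (c i) d}) ` {..<?m})) =
          \<phi> ` D \<inter> {y \<in> vecs ?m. \<forall>i<?m. \<bar>y i - c i\<bar> < d}"
        using open_vecs_subset[OF oI] by (auto simp: dist_real_def abs_minus_commute)
      ultimately show ?thesis by simp
    qed
    then have "openin (subtopology (Euclidean_space ?m) (\<phi> ` D)) (\<phi> ` D \<inter> {y \<in> vecs ?m. \<forall>i<?m. \<bar>y i - c i\<bar> < d})"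
      using oI by (simp add: openin_open_subtopology)
    then have "openin (subtopology (mtop M) D) {x \<in> D. \<phi> x \<in> \<phi> ` D \<inter> {y \<in> vecs ?m. \<forall>i<?m. \<bar>y i - c i\<bar> < d}}"
      using openin_continuous_map_preimage[OF homeomorphic_imp_continuous_map[OF h]] by (simp only: tD)
    moreover have "{x \<in> D. \<phi> x \<in> \<phi> ` D \<inter> {y \<in> vecs ?m. \<forall>i<?m. \<bar>y i - c i\<bar> < d}} = N"
      using open_vecs_subset[OF oI] by (auto simp: N_def)
    ultimately show "openin (mtop M) N" using openin_trans_full oD by simp
    show "p \<in> N" using p d(1) by (simp add: N_def c_def)
    show "N \<subseteq> D" by (auto simp: N_def)
    show "b y = 1" if "y \<in> N" for y using that \<beta>1 by (simp add: b_def N_def)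
  qed
qed

subsection \<open>The space underlying the suspension\<close>

text \<open>A smooth approximation of the identity of [0,1] that is constant near the ends:
  \<lambda>(t/\<delta> - 1) switches on between \<delta> and 2\<delta>, and the other factor does
  the same seen from the end 1. Being constant near the ends is what puts the clamped height into
  the algebra of \<Sigma>M.\<close>

definition clamp :: "real \<Rightarrow> real \<Rightarrow> real" where
  "clamp \<delta> t = 1 - (1 - t * lam (t / \<delta> - 1)) * lam ((1 - t) / \<delta> - 1)"

lemma clamp_low: "0 < \<delta> \<Longrightarrow> \<delta> < 1/4 \<Longrightarrow> t \<le> \<delta> \<Longrightarrow> clamp \<delta> t = 0"
  by (simp add: clamp_def lam_0 lam_1 field_simps)

lemma clamp_high: "0 < \<delta> \<Longrightarrow> \<delta> < 1/4 \<Longrightarrow> 1 - \<delta> \<le> t \<Longrightarrow> clamp \<delta> t = 1"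
  by (simp add: clamp_def lam_0 field_simps)

lemma clamp_mid: "0 < \<delta> \<Longrightarrow> 2 * \<delta> \<le> t \<Longrightarrow> t \<le> 1 - 2 * \<delta> \<Longrightarrow> clamp \<delta> t = t"
  by (simp add: clamp_def lam_1 field_simps)

text \<open>Each end contributes at most 2\<delta>, because its cut-off acts only within distance
  2\<delta> of it. The bound is uniform in t, as needed for a uniform limit.\<close>

lemma clamp_approx:
  assumes \<delta>: "0 < \<delta>" and t: "0 \<le> t" "t \<le> 1"
  shows "\<bar>clamp \<delta> t - t\<bar> \<le> 4 * \<delta>"
proof -
  define \<mu> where "\<mu> = lam ((1 - t) / \<delta> - 1)"
  define \<nu> where "\<nu> = lam (t / \<delta> - 1)"
  have r: "0 \<le> \<mu>" "\<mu> \<le> 1" "0 \<le> \<nu>" "\<nu> \<le> 1" unfolding \<mu>_def \<nu>_def by (auto intro: lam_range)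
  have 1: "\<bar>(1 - t) * (1 - \<mu>)\<bar> \<le> 2 * \<delta>"
  proof (cases "1 - t \<ge> 2 * \<delta>")
    case True
    then have "\<mu> = 1" unfolding \<mu>_def using \<delta> by (intro lam_1) (simp add: field_simps)
    then show ?thesis using \<delta> by simp
  next
    case False
    have "\<bar>(1 - t) * (1 - \<mu>)\<bar> \<le> (1 - t) * 1" using r t by (simp add: abs_mult mult_left_le)
    then show ?thesis using False by simp
  qed
  have 2: "\<bar>(t - t * \<nu>) * \<mu>\<bar> \<le> 2 * \<delta>"
  proof (cases "t \<ge> 2 * \<delta>")
    case True
    then have "\<nu> = 1" unfolding \<nu>_def using \<delta> by (intro lam_1) (simp add: field_simps)
    then show ?thesis using \<delta> by simp
  next
    case False
    have "(t - t * \<nu>) * \<mu> = t * ((1 - \<nu>) * \<mu>)" by (simp add: algebra_simps)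
    moreover have "0 \<le> t * ((1 - \<nu>) * \<mu>)" using r t by simp
    ultimately have "\<bar>(t - t * \<nu>) * \<mu>\<bar> = t * ((1 - \<nu>) * \<mu>)" by (simp only: abs_of_nonneg)
    also have "\<dots> \<le> t * (1 * 1)" using r t by (intro mult_left_mono mult_mono) auto
    finally show ?thesis using False by simp
  qed
  have "clamp \<delta> t - t = (1 - t) * (1 - \<mu>) - (t - t * \<nu>) * \<mu>"
    unfolding clamp_def \<mu>_def[symmetric] \<nu>_def[symmetric] by (simp add: algebra_simps)
  then show ?thesis using 1 2 by linarith
qed

lemma smooth_clamp:
  assumes U: "openin (Euclidean_space q) U" and f: "smooth_on q U f"
  shows "smooth_on q U (\<lambda>x. clamp \<delta> (f x))"
proof -
  have *: "smooth_on q U (\<lambda>x. 1 / \<delta> * f x - 1)" "smooth_on q U (\<lambda>x. 1 / \<delta> * (1 - f x) - 1)"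
    by (intro smooth_on_diff[OF U] smooth_on_cmult[OF U] f smooth_on_const[OF open_vecs_subset[OF U]])+
  have "smooth_on q U (\<lambda>x. 1 - (1 - f x * lam (1 / \<delta> * f x - 1)) * lam (1 / \<delta> * (1 - f x) - 1))"
    by (intro smooth_on_diff[OF U] smooth_on_mult[OF U] smooth_lam[OF U] * f smooth_on_const[OF open_vecs_subset[OF U]])
  then show ?thesis by (simp add: clamp_def)
qed

end

type_synonym 'a susp = "(unit + unit) + ('a \<times> real)"

definition height :: "'a susp \<Rightarrow> real" where
  "height z = (case z of Inl e \<Rightarrow> (case e of Inl _ \<Rightarrow> 0 | Inr _ \<Rightarrow> 1) | Inr w \<Rightarrow> snd w)"

lemma height_simps [simp]: "height (Inl (Inl u)) = 0" "height (Inl (Inr u)) = 1" "height (Inr w) = snd w"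
  by (simp_all add: height_def)

definition susp_points :: "'a mfd \<Rightarrow> 'a susp set" where
  "susp_points M = {Inl (Inl ()), Inl (Inr ())} \<union> Inr ` (topspace (mtop M) \<times> {0<..<1})"

lemma susp_points_cases:
  assumes "z \<in> susp_points M"
  obtains "z = Inl (Inl ())" "height z = 0" | "z = Inl (Inr ())" "height z = 1"
    | a t where "z = Inr (a, t)" "a \<in> topspace (mtop M)" "0 < t" "t < 1" "height z = t"
  using assms by (auto simp: susp_points_def)

definition susp_algebra :: "'a mfd \<Rightarrow> ('a susp \<Rightarrow> real) set" where
  "susp_algebra M = {g. smooth_fun (prod_mfd M (open_submfd real_mfd {0<..<1})) (\<lambda>w. g (Inr w)) \<and>
     (\<exists>\<delta>>0. \<delta> < 1/2 \<and> (\<forall>a\<in>topspace (mtop M). \<forall>t. 0 < t \<and> t < \<delta> \<longrightarrow>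
        g (Inr (a, t)) = g (Inl (Inl ())) \<and> g (Inr (a, 1 - t)) = g (Inl (Inr ()))))}"

text \<open>The adjunction unwound: functions on the two-point base are arbitrary, and the collar
  condition becomes constancy near the two cone points.\<close>

lemma suspension_eq:
  "suspension M = {(q, U, u). openin (Euclidean_space q) U \<and> u \<in> U \<rightarrow>\<^sub>E susp_points M \<and>
     (\<forall>g\<in>susp_algebra M. smooth_on q U (g \<circ> u))}"
proof -
  let ?f = "\<lambda>(x :: 'a, s :: real). if s = 0 then Inl () else Inr ()"
  let ?B = "topspace (mtop M) \<times> {0, 1::real}"
  let ?W = "prod_topology (mtop M) (top_of_set {0..1::real})"
  let ?S = "discrete_topology (UNIV :: (unit + unit) set)"
  let ?open = "adj_open ?S ?W ?B ?f"
  have all: "Inl ` UNIV \<union> Inr ` (topspace ?W - ?B) = susp_points M"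
    by (auto simp: susp_points_def image_iff UNIV_sum UNIV_unit)
  have "{w \<in> topspace ?W. adj_map ?B ?f w \<in> susp_points M} = topspace ?W"
    by (auto simp: adj_map_def susp_points_def)
  then have "openin ?W {w \<in> topspace ?W. adj_map ?B ?f w \<in> susp_points M}"
    by (simp only: openin_topspace)
  then have "?open (susp_points M)"
    unfolding adj_open_def using all by simp
  moreover have "V \<subseteq> susp_points M" if "?open V" for V
    using that all unfolding adj_open_def by simp
  ultimately have top: "topspace (topology ?open) = susp_points M"
    by (auto simp: topspace_def topology_inverse'[OF istopology_adj_open])
  have alg: "snd (adjunction two_points (cylinder M) ?f) = susp_algebra M"
  proof -
    \<comment> \<open>At t = 0 the collar point lies on the boundary and the condition is trivial;
      for 0 < t < \<delta> < 1/2 it lies in the interior, where \<open>adj_map\<close> is the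
      injection \<open>Inr\<close>.\<close>
    have eq: "(\<forall>w\<in>?B. \<forall>t. 0 \<le> t \<and> t < \<delta> \<longrightarrow>
        g (adj_map ?B ?f ((\<lambda>(x, s) t. if s = 0 then (x, t) else (x, 1 - t)) w t)) = g (Inl (?f w))) \<longleftrightarrow>
      (\<forall>a\<in>topspace (mtop M). \<forall>t. 0 < t \<and> t < \<delta> \<longrightarrow>
        g (Inr (a, t)) = g (Inl (Inl ())) \<and> g (Inr (a, 1 - t)) = g (Inl (Inr ())))" (is "?L \<longleftrightarrow> ?R")
      if "0 < \<delta>" "\<delta> < 1/2" for \<delta> and g :: "'a susp \<Rightarrow> real"
    proof
      assume L: ?L
      show ?R
      proof (intro ballI allI impI)
        fix a t assume a: "a \<in> topspace (mtop M)" and t: "0 < t \<and> t < \<delta>"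
        then show "g (Inr (a, t)) = g (Inl (Inl ())) \<and> g (Inr (a, 1 - t)) = g (Inl (Inr ()))"
          using L[rule_format, of "(a, 0)" t] L[rule_format, of "(a, 1)" t] that by (auto simp: adj_map_def)
      qed
    next
      assume R: ?R
      show ?L
      proof (intro ballI allI impI)
        fix w t assume w: "w \<in> ?B" and t: "0 \<le> t \<and> t < \<delta>"
        then obtain a where "a \<in> topspace (mtop M)" "w = (a, 0) \<or> w = (a, 1)" by auto
        then show "g (adj_map ?B ?f ((\<lambda>(x, s) t. if s = 0 then (x, t) else (x, 1 - t)) w t)) = g (Inl (?f w))"
          using R[rule_format, of a t] t that by (cases "t = 0") (auto simp: adj_map_def)
      qed
    qed
    show ?thesis
      unfolding susp_algebra_def adjunction_def cylinder_def two_points_def snd_conv collared_mfd.select_convs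
      by (intro Collect_cong) (simp only: UNIV_I simp_thms eq cong: conj_cong)
  qed
  have "fst (adjunction two_points (cylinder M) ?f) = topology ?open"
    by (simp add: adjunction_def cylinder_def two_points_def)
  then show ?thesis unfolding suspension_def k_functor_def alg top[symmetric] by simp
qed

definition inner_dom :: "(nat \<Rightarrow> real) set \<Rightarrow> ((nat \<Rightarrow> real) \<Rightarrow> 'a susp) \<Rightarrow> (nat \<Rightarrow> real) set" where
  "inner_dom U u = {x\<in>U. 0 < height (u x) \<and> height (u x) < 1}"

text \<open>Unspecified at the cone points, hence applied only to points of a plot over
  \<open>inner_dom\<close>.\<close>

definition core :: "'a susp \<Rightarrow> 'a \<times> real" where
  "core z = (case z of Inr w \<Rightarrow> w)"

lemma core_Inr [simp]: "core (Inr w) = w"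
  by (simp add: core_def)

lemma diffeology_suspension: "diffeology (suspension M)"
  unfolding diffeology_def
proof safe
  fix q U u assume u: "(q, U, u) \<in> suspension M"
  show U: "openin (Euclidean_space q) U" using u by (simp add: suspension_eq)
  fix r V h assume V: "openin (Euclidean_space r) V" and h: "smooth_map_on r V q h" and hU: "h ` V \<subseteq> U"
  have "smooth_on r V (g \<circ> restrict (u \<circ> h) V)" if "g \<in> susp_algebra M" for g
  proof -
    have "smooth_on q U (g \<circ> u)" using u that by (simp add: suspension_eq)
    from smooth_on_compose[OF V U this h hU] show ?thesis
      using smooth_on_cong[OF V, of "\<lambda>x. (g \<circ> u) (h x)" "g \<circ> restrict (u \<circ> h) V"] by simp
  qed
  moreover have "restrict (u \<circ> h) V \<in> V \<rightarrow>\<^sub>E susp_points M"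
    using u hU by (auto simp: suspension_eq PiE_iff)
  ultimately show "(r, V, restrict (u \<circ> h) V) \<in> suspension M" using V by (simp add: suspension_eq)
qed

lemma susp_const_plot:
  assumes "openin (Euclidean_space q) U" "z \<in> susp_points M"
  shows "(q, U, restrict (\<lambda>_. z) U) \<in> suspension M"
proof -
  have "smooth_on q U (g \<circ> restrict (\<lambda>_. z) U)" for g
    using smooth_on_cong[OF assms(1), of "g \<circ> restrict (\<lambda>_. z) U" "\<lambda>_. g z"]
      smooth_on_const[OF open_vecs_subset[OF assms(1)]] by simp
  then show ?thesis using assms by (simp add: suspension_eq)
qed

text \<open>The shape of all the test functions that are applied to plots of \<Sigma>M
  below.\<close>

definition susp_ext :: "real \<Rightarrow> real \<Rightarrow> ('a \<Rightarrow> real) \<Rightarrow> (real \<Rightarrow> real) \<Rightarrow> 'a susp \<Rightarrow> real" where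
  "susp_ext c d f k z = (case z of Inl e \<Rightarrow> (case e of Inl _ \<Rightarrow> c | Inr _ \<Rightarrow> d) | Inr w \<Rightarrow> f (fst w) * k (snd w))"

lemma susp_ext_simps [simp]:
  "susp_ext c d f k (Inl (Inl v)) = c" "susp_ext c d f k (Inl (Inr v)) = d" "susp_ext c d f k (Inr w) = f (fst w) * k (snd w)"
  by (simp_all add: susp_ext_def)

section \<open>Testing plots of the suspension: the height and the component in M\<close>

locale suspended = cutoff lam for lam +
  fixes M :: "'a mfd"
  assumes M: "smooth_manifold M"
begin

abbreviation "R \<equiv> mfd_plots (prod_mfd M real_mfd)"
abbreviation "S \<equiv> suspension M"

lemma cM: "charted M" by (rule charted_smooth_manifold[OF M])
lemma cR: "charted (prod_mfd M real_mfd)" by (rule charted_prod[OF cM charted_real])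
lemma dM: "diffeology (mfd_plots M)" by (rule diffeology_mfd_plots[OF cM])
lemma dR: "diffeology R" by (rule diffeology_mfd_plots[OF cR])
lemma dS: "diffeology S" by (rule diffeology_suspension)

lemma susp_ext_in_algebra:
  assumes f: "smooth_fun M f"
    and k: "\<And>q U h. openin (Euclidean_space q) U \<Longrightarrow> smooth_on q U h \<Longrightarrow> smooth_on q U (\<lambda>x. k (h x))"
    and \<delta>: "0 < \<delta>" "\<delta> < 1/2"
    and ends: "\<And>a t. 0 < t \<Longrightarrow> t < \<delta> \<Longrightarrow> f a * k t = c \<and> f a * k (1 - t) = d"
  shows "susp_ext c d f k \<in> susp_algebra M"
proof -
  have "smooth_fun (prod_mfd M (open_submfd real_mfd {0<..<1})) (\<lambda>(a, t). f a * k t)"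
    by (rule smooth_fun_prod[OF cM f k]) auto
  then show ?thesis using \<delta> ends by (auto simp: susp_algebra_def case_prod_unfold)
qed

lemma susp_plot_open: "(q, U, u) \<in> S \<Longrightarrow> openin (Euclidean_space q) U"
  and susp_plot_ext: "(q, U, u) \<in> S \<Longrightarrow> u \<in> extensional U"
  and susp_plot_points: "(q, U, u) \<in> S \<Longrightarrow> x \<in> U \<Longrightarrow> u x \<in> susp_points M"
  by (auto simp: suspension_eq PiE_iff)

lemma susp_plot_smooth: "(q, U, u) \<in> S \<Longrightarrow> g \<in> susp_algebra M \<Longrightarrow> smooth_on q U (\<lambda>x. g (u x))"
  by (auto simp: suspension_eq o_def)

lemma height_range: "z \<in> susp_points M \<Longrightarrow> 0 \<le> height z \<and> height z \<le> 1"
  by (erule susp_points_cases) auto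

text \<open>The clamped height is constant near the cone points and so belongs to the algebra, which
  the height itself in general does not.\<close>

lemma smooth_clamp_height:
  assumes u: "(q, U, u) \<in> S" and \<delta>: "0 < \<delta>" "\<delta> < 1/4"
  shows "smooth_on q U (\<lambda>x. clamp \<delta> (height (u x)))"
proof -
  have eq: "susp_ext 0 1 (\<lambda>_. 1) (clamp \<delta>) (u x) = clamp \<delta> (height (u x))" if "x \<in> U" for x
    using susp_plot_points[OF u that] \<delta> by (elim susp_points_cases) (auto simp: clamp_low clamp_high)
  have "susp_ext 0 1 (\<lambda>_. 1) (clamp \<delta>) \<in> susp_algebra M"
    using \<delta> by (intro susp_ext_in_algebra[of _ _ \<delta>] smooth_fun_const cM smooth_clamp) (auto simp: clamp_low clamp_high)
  from susp_plot_smooth[OF u this] show ?thesis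
    using smooth_on_cong[OF susp_plot_open[OF u] eq] by simp
qed

text \<open>The height is the uniform limit of its clamped versions as \<delta> tends to 0 from
  above. At the cone points only continuity is available.\<close>

lemma continuous_height:
  assumes u: "(q, U, u) \<in> S"
  shows "continuous_on U (\<lambda>x. height (u x))"
proof (rule uniform_limit_theorem[of _ "\<lambda>\<delta> x. clamp \<delta> (height (u x))" "at_right 0"])
  have "continuous_on U (\<lambda>x. clamp \<delta> (height (u x)))" if "0 < \<delta>" "\<delta> < 1/4" for \<delta>
    by (rule smooth_on_continuous[OF smooth_clamp_height[OF u that] open_vecs_subset[OF susp_plot_open[OF u]]])
  then show "\<forall>\<^sub>F \<delta> in at_right 0. continuous_on U (\<lambda>x. clamp \<delta> (height (u x)))"
    unfolding eventually_at_right_field by (intro exI[of _ "1/4"]) auto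
  show "uniform_limit U (\<lambda>\<delta> x. clamp \<delta> (height (u x))) (\<lambda>x. height (u x)) (at_right 0)"
  proof (rule uniform_limitI)
    fix e :: real assume e: "e > 0"
    have "dist (clamp \<delta> (height (u x))) (height (u x)) < e" if "0 < \<delta>" "\<delta> < e / 4" "x \<in> U" for \<delta> x
      using clamp_approx[OF that(1), of "height (u x)"] height_range[OF susp_plot_points[OF u that(3)]] that(2)
      by (simp add: dist_real_def)
    then show "\<forall>\<^sub>F \<delta> in at_right 0. \<forall>x\<in>U. dist (clamp \<delta> (height (u x))) (height (u x)) < e"
      unfolding eventually_at_right_field using e by (intro exI[of _ "e/4"]) auto
  qed
qed simp

lemma open_height_set:
  assumes u: "(q, U, u) \<in> S" and A: "open A"
  shows "openin (Euclidean_space q) {x\<in>U. height (u x) \<in> A}"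
  by (rule openin_Euclidean_preimage_open[OF susp_plot_open[OF u] continuous_height[OF u] A])

lemma open_inner: "(q, U, u) \<in> S \<Longrightarrow> openin (Euclidean_space q) (inner_dom U u)"
  using open_height_set[of q U u "{0<..<1}"] by (simp add: inner_dom_def)

lemma inner_subset: "inner_dom U u \<subseteq> U" by (auto simp: inner_dom_def)

lemma inner_point:
  assumes "(q, U, u) \<in> S" "x \<in> inner_dom U u"
  shows "u x = Inr (core (u x))" "fst (core (u x)) \<in> topspace (mtop M)" "snd (core (u x)) = height (u x)"
    "0 < height (u x)" "height (u x) < 1"
proof -
  have "u x \<in> susp_points M" using assms susp_plot_points inner_subset by blast
  then show "u x = Inr (core (u x))" "fst (core (u x)) \<in> topspace (mtop M)" "snd (core (u x)) = height (u x)"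
  proof (atomize (full), cases rule: susp_points_cases)
    case (3 a t)
    then have "core (u x) = (a, t)" by simp
    with 3 show "u x = Inr (core (u x)) \<and> fst (core (u x)) \<in> topspace (mtop M) \<and> snd (core (u x)) = height (u x)"
      by simp
  qed (use assms(2) in \<open>auto simp: inner_dom_def\<close>)
qed (use assms in \<open>auto simp: inner_dom_def\<close>)

text \<open>Small enough that t lies strictly between 2\<delta> and 1 - 2\<delta> for \<delta> =
  \<open>margin t\<close>, where clamping changes nothing and the window below equals 1.\<close>

definition margin :: "real \<Rightarrow> real" where "margin t = min t (1 - t) / 8"

lemma margin: "0 < t \<Longrightarrow> t < 1 \<Longrightarrow> 0 < margin t \<and> margin t < 1/4 \<and> 2 * margin t < t \<and> t < 1 - 2 * margin t"
  by (auto simp: margin_def min_def field_simps)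

text \<open>Near a point with height strictly between 0 and 1 the height equals its clamped version
  for a small \<delta>.\<close>

lemma smooth_height_inner:
  assumes u: "(q, U, u) \<in> S"
  shows "smooth_on q (inner_dom U u) (\<lambda>x. height (u x))"
proof (rule smooth_on_localI[OF open_inner[OF u]])
  fix x assume x: "x \<in> inner_dom U u"
  define \<delta> where "\<delta> = margin (height (u x))"
  have \<delta>: "0 < \<delta>" "\<delta> < 1/4" "2 * \<delta> < height (u x)" "height (u x) < 1 - 2 * \<delta>"
    using margin[of "height (u x)"] inner_point[OF u x] by (auto simp: \<delta>_def)
  let ?W = "{y\<in>U. height (u y) \<in> {2 * \<delta><..<1 - 2 * \<delta>}}"
  have oW: "openin (Euclidean_space q) ?W" by (rule open_height_set[OF u]) simp
  have "smooth_on q ?W (\<lambda>y. clamp \<delta> (height (u y)))"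
    by (rule smooth_on_subset[OF smooth_clamp_height[OF u \<delta>(1,2)] _ open_vecs_subset[OF susp_plot_open[OF u]]]) auto
  then have "smooth_on q ?W (\<lambda>y. height (u y))"
    using smooth_on_cong[OF oW, of "\<lambda>y. clamp \<delta> (height (u y))" "\<lambda>y. height (u y)"] \<delta> by (simp add: clamp_mid)
  moreover have "x \<in> ?W" "?W \<subseteq> inner_dom U u" using x \<delta> by (auto simp: inner_dom_def)
  ultimately show "\<exists>W. openin (Euclidean_space q) W \<and> x \<in> W \<and> W \<subseteq> inner_dom U u \<and> smooth_on q W (\<lambda>x. height (u x))"
    using oW by (intro exI[of _ ?W] conjI)
qed

text \<open>A plateau: 1 between 2\<delta> and 1 - 2\<delta>, and 0 within \<delta> of the ends. A
  function on M times this one extends by zero over the cone points to an element of the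
  algebra.\<close>

definition window :: "real \<Rightarrow> real \<Rightarrow> real" where
  "window \<delta> t = lam (t / \<delta> - 1) * lam ((1 - t) / \<delta> - 1)"

lemma window_low: "0 < \<delta> \<Longrightarrow> t \<le> \<delta> \<Longrightarrow> window \<delta> t = 0"
  by (simp add: window_def lam_0 field_simps)

lemma window_high: "0 < \<delta> \<Longrightarrow> 1 - \<delta> \<le> t \<Longrightarrow> window \<delta> t = 0"
  by (simp add: window_def lam_0 field_simps)

lemma window_mid: "0 < \<delta> \<Longrightarrow> 2 * \<delta> \<le> t \<Longrightarrow> t \<le> 1 - 2 * \<delta> \<Longrightarrow> window \<delta> t = 1"
  by (simp add: window_def lam_1 field_simps)

lemma smooth_window:
  assumes U: "openin (Euclidean_space q) U" and f: "smooth_on q U f"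
  shows "smooth_on q U (\<lambda>x. window \<delta> (f x))"
proof -
  have *: "smooth_on q U (\<lambda>x. 1 / \<delta> * f x - 1)" "smooth_on q U (\<lambda>x. 1 / \<delta> * (1 - f x) - 1)"
    by (intro smooth_on_diff[OF U] smooth_on_cmult[OF U] f smooth_on_const[OF open_vecs_subset[OF U]])+
  have "smooth_on q U (\<lambda>x. lam (1 / \<delta> * f x - 1) * lam (1 / \<delta> * (1 - f x) - 1))"
    by (intro smooth_on_mult[OF U] smooth_lam[OF U] *)
  then show ?thesis by (simp add: window_def)
qed

lemma smooth_windowed:
  assumes u: "(q, U, u) \<in> S" and f: "smooth_fun M f" and \<delta>: "0 < \<delta>" "\<delta> < 1/4"
  shows "smooth_on q U (\<lambda>x. susp_ext 0 0 f (window \<delta>) (u x))"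
  using \<delta> by (intro susp_plot_smooth[OF u] susp_ext_in_algebra[OF f, of _ \<delta>] smooth_window)
    (auto simp: window_low window_high)

text \<open>Continuity of the component in M, which is not demanded of a plot. Test with a bump
  function supported in W, times a window: the points where the result is nonzero form an open
  neighbourhood of x inside the preimage.\<close>

lemma core_preimage_open:
  assumes u: "(q, U, u) \<in> S" and W: "openin (mtop M) W"
  shows "openin (Euclidean_space q) {x\<in>inner_dom U u. fst (core (u x)) \<in> W}"
proof (subst openin_subopen, intro ballI)
  fix x assume x: "x \<in> {x\<in>inner_dom U u. fst (core (u x)) \<in> W}"
  then have xi: "x \<in> inner_dom U u" by simp
  note ip = inner_point[OF u xi]
  obtain D \<phi> where D: "(D, \<phi>) \<in> matlas M" "fst (core (u x)) \<in> D" using charted_cover[OF cM ip(2)] by blast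
  obtain b K N where b: "closedin (mtop M) K" "K \<subseteq> D \<inter> W" "\<And>y. y \<notin> K \<Longrightarrow> b y = (0::real)"
    "smooth_on (mdim M) (\<phi> ` D) (b \<circ> inv_into D \<phi>)"
    "openin (mtop M) N" "fst (core (u x)) \<in> N" "N \<subseteq> D" "\<And>y. y \<in> N \<Longrightarrow> b y = 1"
    by (rule exists_bump[OF M D W]) (use x in simp, rule that)
  have bs: "smooth_fun M b" by (rule smooth_fun_extend_zero[OF M D(1) b(1) _ b(4)]) (use b in auto)
  define \<delta> where "\<delta> = margin (height (u x))"
  have \<delta>: "0 < \<delta>" "\<delta> < 1/4" "2 * \<delta> < height (u x)" "height (u x) < 1 - 2 * \<delta>"
    using margin[of "height (u x)"] ip by (auto simp: \<delta>_def)
  note U = susp_plot_open[OF u]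
  define g where "g y = susp_ext 0 0 b (window \<delta>) (u y)" for y
  have "continuous_on U g" unfolding g_def
    by (rule smooth_on_continuous[OF smooth_windowed[OF u bs \<delta>(1,2)] open_vecs_subset[OF U]])
  then have oT: "openin (Euclidean_space q) {y\<in>U. g y \<in> - {0}}"
    by (rule openin_Euclidean_preimage_open[OF U]) auto
  have "g x = 1" using \<delta> ip(2-5) b(6,8) by (subst g_def, subst ip(1)) (simp add: window_mid)
  then have "x \<in> {y\<in>U. g y \<in> - {0}}" using xi inner_subset by auto
  moreover have "{y\<in>U. g y \<in> - {0}} \<subseteq> {x\<in>inner_dom U u. fst (core (u x)) \<in> W}"
  proof
    fix y assume y: "y \<in> {y\<in>U. g y \<in> - {0}}"
    then have "u y \<in> susp_points M" using susp_plot_points[OF u] by blast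
    then show "y \<in> {x\<in>inner_dom U u. fst (core (u x)) \<in> W}"
    proof (cases rule: susp_points_cases)
      case (3 a t)
      then have "b a \<noteq> 0" using y by (auto simp: g_def)
      then have "a \<in> W" using b(2,3) by blast
      then show ?thesis using 3 y by (auto simp: inner_dom_def)
    qed (use y in \<open>auto simp: g_def\<close>)
  qed
  ultimately show "\<exists>T. openin (Euclidean_space q) T \<and> x \<in> T \<and> T \<subseteq> {x \<in> inner_dom U u. fst (core (u x)) \<in> W}"
    using oT by blast
qed

text \<open>A chart coordinate is meaningful only on D; multiplied by a bump function and a window
  it becomes a test function that equals it near the given point.\<close>

lemma inner_fst_plot:
  assumes u: "(q, U, u) \<in> S"
  shows "(q, inner_dom U u, restrict (\<lambda>x. fst (core (u x))) (inner_dom U u)) \<in> mfd_plots M"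
proof (rule mfd_plotsI[OF open_inner[OF u]])
  let ?I = "inner_dom U u" and ?m = "\<lambda>x. fst (core (u x))"
  note oI = open_inner[OF u]
  show im: "restrict ?m ?I ` ?I \<subseteq> topspace (mtop M)" using inner_point(2)[OF u] by auto
  have pre: "{x \<in> ?I. restrict ?m ?I x \<in> W} = {x \<in> ?I. ?m x \<in> W}" for W by auto
  show "continuous_map (subtopology (Euclidean_space q) ?I) (mtop M) (restrict ?m ?I)"
    unfolding continuous_map_def topspace_sub_Euclidean[OF oI] pre openin_open_subtopology[OF oI]
    using im core_preimage_open[OF u] by auto
  fix D \<phi> assume D: "(D, \<phi>) \<in> matlas M"
  let ?V = "{x \<in> ?I. restrict ?m ?I x \<in> D}"
  have oV: "openin (Euclidean_space q) ?V"
    unfolding pre by (rule core_preimage_open[OF u chartedD(1)[OF cM D]])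
  show "smooth_map_on q ?V (mdim M) (\<phi> \<circ> restrict ?m ?I)"
    unfolding smooth_map_on_def
  proof (intro conjI allI impI)
    show "(\<phi> \<circ> restrict ?m ?I) ` ?V \<subseteq> vecs (mdim M)"
      using open_vecs_subset[OF chartedD(2)[OF cM D]] by auto
    fix j assume j: "j < mdim M"
    show "smooth_on q ?V (\<lambda>x. (\<phi> \<circ> restrict ?m ?I) x j)"
    proof (rule smooth_on_localI[OF oV])
      fix x assume xV: "x \<in> ?V"
      then have x: "x \<in> ?I" "?m x \<in> D" by auto
      note ip = inner_point[OF u x(1)]
      obtain b K N where b: "closedin (mtop M) K" "K \<subseteq> D \<inter> D" "\<And>y. y \<notin> K \<Longrightarrow> b y = (0::real)"
        "smooth_on (mdim M) (\<phi> ` D) (b \<circ> inv_into D \<phi>)"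
        "openin (mtop M) N" "?m x \<in> N" "N \<subseteq> D" "\<And>y. y \<in> N \<Longrightarrow> b y = 1"
        by (rule exists_bump[OF M D x(2) chartedD(1)[OF cM D] x(2)]) (rule that)
      let ?f = "\<lambda>y. b y * \<phi> y j"
      have fs: "smooth_fun M ?f"
      proof (rule smooth_fun_extend_zero[OF M D b(1)])
        note oD = chartedD(2)[OF cM D]
        have "smooth_on (mdim M) (\<phi> ` D) (\<lambda>y. (b \<circ> inv_into D \<phi>) y * y j)"
          by (intro smooth_on_mult[OF oD] b(4) smooth_on_coord open_vecs_subset[OF oD])
        then show "smooth_on (mdim M) (\<phi> ` D) (?f \<circ> inv_into D \<phi>)"
          using smooth_on_cong[OF oD, of "\<lambda>y. (b \<circ> inv_into D \<phi>) y * y j" "?f \<circ> inv_into D \<phi>"] by (auto simp: f_inv_into_f)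
      qed (use b in auto)
      define \<delta> where "\<delta> = margin (height (u x))"
      have \<delta>: "0 < \<delta>" "\<delta> < 1/4" "2 * \<delta> < height (u x)" "height (u x) < 1 - 2 * \<delta>"
        using margin[of "height (u x)"] ip by (auto simp: \<delta>_def)
      let ?W = "{y\<in>?I. ?m y \<in> N} \<inter> {y\<in>U. height (u y) \<in> {2 * \<delta><..<1 - 2 * \<delta>}}"
      have oW: "openin (Euclidean_space q) ?W"
        by (intro openin_Int core_preimage_open[OF u b(5)] open_height_set[OF u]) simp
      have "smooth_on q ?W (\<lambda>y. susp_ext 0 0 ?f (window \<delta>) (u y))"
        by (rule smooth_on_subset[OF smooth_windowed[OF u fs \<delta>(1,2)] _ open_vecs_subset[OF susp_plot_open[OF u]]]) auto
      moreover have "susp_ext 0 0 ?f (window \<delta>) (u y) = (\<phi> \<circ> restrict ?m ?I) y j" if y: "y \<in> ?W" for y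
      proof -
        have yI: "y \<in> ?I" using y by simp
        show ?thesis using y \<delta> b(8) inner_point(3)[OF u yI]
          by (subst inner_point(1)[OF u yI]) (simp add: window_mid)
      qed
      ultimately have "smooth_on q ?W (\<lambda>x. (\<phi> \<circ> restrict ?m ?I) x j)"
        using smooth_on_cong[OF oW, of "\<lambda>y. susp_ext 0 0 ?f (window \<delta>) (u y)" "\<lambda>x. (\<phi> \<circ> restrict ?m ?I) x j"] by blast
      moreover have "x \<in> ?W" using x b(6) \<delta> inner_subset by auto
      moreover have "?W \<subseteq> ?V" using b(7) by auto
      ultimately show "\<exists>W. openin (Euclidean_space q) W \<and> x \<in> W \<and> W \<subseteq> ?V \<and> smooth_on q W (\<lambda>x. (\<phi> \<circ> restrict ?m ?I) x j)"
        using oW by (intro exI[of _ ?W] conjI)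
    qed
  qed
qed auto

lemma prodR_plotI:
  assumes "(q, U, m) \<in> mfd_plots M" "smooth_on q U t"
  shows "(q, U, restrict (\<lambda>x. (m x, t x)) U) \<in> R"
proof -
  note U = mfd_plotsD(1)[OF assms(1)]
  have "smooth_on q U (restrict t U)" using smooth_on_cong[OF U, of t "restrict t U"] assms(2) by simp
  then have "(q, U, restrict t U) \<in> mfd_plots real_mfd" using U by (simp add: real_plot_iff)
  from prod_plotI[OF cM charted_real assms(1) this] show ?thesis
    using restrict_ext[of U "\<lambda>x. (m x, restrict t U x)" "\<lambda>x. (m x, t x)"] by simp
qed

lemma R_plotD:
  assumes "(q, U, w) \<in> R"
  shows "(q, U, restrict (\<lambda>x. fst (w x)) U) \<in> mfd_plots M" "smooth_on q U (\<lambda>x. snd (w x))" "openin (Euclidean_space q) U"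
    "w \<in> extensional U"
proof -
  show U: "openin (Euclidean_space q) U" "w \<in> extensional U" by (rule mfd_plotsD[OF assms])+
  show "(q, U, restrict (\<lambda>x. fst (w x)) U) \<in> mfd_plots M" by (rule prod_plotD(1)[OF cM charted_real assms])
  have "smooth_on q U (restrict (\<lambda>x. snd (w x)) U)"
    using prod_plotD(2)[OF cM charted_real assms] by (simp add: real_plot_iff)
  then show "smooth_on q U (\<lambda>x. snd (w x))"
    using smooth_on_cong[OF U(1), of "\<lambda>x. snd (w x)" "restrict (\<lambda>x. snd (w x)) U"] by simp
qed

text \<open>The converse of the preceding analysis. A function of the algebra is constant where the
  height is close to 0 or to 1, so there continuity of the height suffices; elsewhere it is a smooth
  function of the component in M and the height.\<close>

lemma susp_plotI:
  assumes U: "openin (Euclidean_space q) U" and u: "u \<in> extensional U" "\<And>x. x \<in> U \<Longrightarrow> u x \<in> susp_points M"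
    and h: "continuous_on U (\<lambda>x. height (u x))"
    and m: "(q, inner_dom U u, m) \<in> mfd_plots M" "\<And>x. x \<in> inner_dom U u \<Longrightarrow> m x = fst (core (u x))"
    and t: "smooth_on q (inner_dom U u) (\<lambda>x. height (u x))"
  shows "(q, U, u) \<in> S"
proof -
  have oh: "openin (Euclidean_space q) {x\<in>U. height (u x) \<in> A}" if "open A" for A
    by (rule openin_Euclidean_preimage_open[OF U h that])
  have "smooth_on q U (g \<circ> u)" if g: "g \<in> susp_algebra M" for g
  proof (rule smooth_on_localI[OF U])
    obtain \<delta> where gs: "smooth_fun (prod_mfd M (open_submfd real_mfd {0<..<1})) (\<lambda>w. g (Inr w))"
      and \<delta>: "\<delta> > 0" "\<delta> < 1/2" "\<And>a t. a \<in> topspace (mtop M) \<Longrightarrow> 0 < t \<Longrightarrow> t < \<delta> \<Longrightarrow>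
        g (Inr (a, t)) = g (Inl (Inl ())) \<and> g (Inr (a, 1 - t)) = g (Inl (Inr ()))"
      using g by (auto simp: susp_algebra_def)
    fix x assume x: "x \<in> U"
    have const: "\<exists>W. openin (Euclidean_space q) W \<and> x \<in> W \<and> W \<subseteq> U \<and> smooth_on q W (g \<circ> u)"
      if A: "open A" "height (u x) \<in> A" "\<And>y. y \<in> U \<Longrightarrow> height (u y) \<in> A \<Longrightarrow> g (u y) = c" for A c
    proof -
      let ?W = "{x\<in>U. height (u x) \<in> A}"
      have "smooth_on q ?W (g \<circ> u)"
        using smooth_on_cong[OF oh[OF A(1)], of "g \<circ> u" "\<lambda>_. c"] A(3) smooth_on_const[OF open_vecs_subset[OF oh[OF A(1)]]] by simp
      moreover have "x \<in> ?W" "?W \<subseteq> U" using x A(2) by auto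
      ultimately show ?thesis using oh[OF A(1)] by (intro exI[of _ ?W] conjI)
    qed
    from u(2)[OF x] show "\<exists>W. openin (Euclidean_space q) W \<and> x \<in> W \<and> W \<subseteq> U \<and> smooth_on q W (g \<circ> u)"
    proof (cases rule: susp_points_cases)
      case 1
      show ?thesis
      proof (rule const[of "{..<\<delta>}"])
        show "g (u y) = g (Inl (Inl ()))" if y: "y \<in> U" "height (u y) \<in> {..<\<delta>}" for y
          using u(2)[OF y(1)]
        proof (cases rule: susp_points_cases)
          case (3 a t)
          then show ?thesis using \<delta>(3)[of a t] y(2) by auto
        qed (use y \<delta>(1,2) in auto)
      qed (use 1 \<delta>(1,2) in auto)
    next
      case 2
      show ?thesis
      proof (rule const[of "{1 - \<delta><..}"])
        show "g (u y) = g (Inl (Inr ()))" if y: "y \<in> U" "height (u y) \<in> {1 - \<delta><..}" for y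
          using u(2)[OF y(1)]
        proof (cases rule: susp_points_cases)
          case (3 a t)
          then show ?thesis using \<delta>(3)[of a "1 - t"] y(2) by auto
        qed (use y \<delta>(1,2) in auto)
      qed (use 2 \<delta>(1,2) in auto)
    next
      case 3
      let ?I = "inner_dom U u"
      have oI: "openin (Euclidean_space q) ?I" by (rule mfd_plotsD(1)[OF m(1)])
      have "smooth_on q ?I (restrict (\<lambda>x. height (u x)) ?I)"
        using smooth_on_cong[OF oI, of "restrict (\<lambda>x. height (u x)) ?I" "\<lambda>x. height (u x)"] t by simp
      then have "(q, ?I, restrict (\<lambda>x. height (u x)) ?I) \<in> mfd_plots real_mfd"
        using oI by (simp add: real_plot_iff)
      then have "(q, ?I, restrict (\<lambda>x. height (u x)) ?I) \<in> mfd_plots (open_submfd real_mfd {0<..<1})"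
        by (rule open_submfd_plotI) (auto simp: inner_dom_def)
      from smooth_fun_plot[OF charted_prod[OF cM charted_real_sub] gs prod_plotI[OF cM charted_real_sub m(1) this]]
      have sm: "smooth_on q ?I (\<lambda>x. g (Inr (restrict (\<lambda>x. (m x, restrict (\<lambda>x. height (u x)) ?I x)) ?I x)))"
        by simp
      have eq: "g (Inr (restrict (\<lambda>x. (m x, restrict (\<lambda>x. height (u x)) ?I x)) ?I y)) = (g \<circ> u) y" if y: "y \<in> ?I" for y
      proof -
        have "u y \<in> susp_points M" using u(2) y by (auto simp: inner_dom_def)
        then show ?thesis using y m(2)[OF y] by (cases rule: susp_points_cases) (auto simp: inner_dom_def)
      qed
      have "smooth_on q ?I (g \<circ> u)" by (rule iffD1[OF smooth_on_cong[OF oI eq] sm])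
      moreover have "x \<in> ?I" "?I \<subseteq> U" using 3 x by (auto simp: inner_dom_def)
      ultimately show ?thesis using oI by (intro exI[of _ ?I] conjI)
    qed
  qed
  then show ?thesis using U u by (simp add: suspension_eq PiE_iff)
qed

end

section \<open>The comparison map and its homotopy inverse\<close>

lemma plot_restrict:
  assumes "diffeology P" "(q, U, u) \<in> P" "openin (Euclidean_space q) V" "V \<subseteq> U"
  shows "(q, V, restrict u V) \<in> P"
proof -
  have "(\<lambda>x. x) ` V \<subseteq> U" using assms(4) by auto
  from diffeologyD(2)[OF assms(1,2,3) smooth_map_on_id[OF diffeologyD(1)[OF assms(1,2)] assms(4)] this]
  show ?thesis by (simp add: o_def)
qed

lemma diffeology_point: "diffeology point_plots"
  by (auto simp: diffeology_def point_plots_def)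

lemma const_point_plot: "openin (Euclidean_space q) U \<Longrightarrow> (q, U, restrict (\<lambda>_. ()) U) \<in> point_plots"
  by (simp add: point_plots_def)

lemma point_plotD: "(q, U, u) \<in> point_plots \<Longrightarrow> openin (Euclidean_space q) U" "(q, U, u) \<in> point_plots \<Longrightarrow> u = restrict (\<lambda>_. ()) U"
  by (auto simp: point_plots_def PiE_iff extensional_def fun_eq_iff)

lemma smooth_between_point: "diffeology P \<Longrightarrow> smooth_between P point_plots (\<lambda>_. ())"
  unfolding smooth_between_def o_def by (clarify, rule const_point_plot, rule diffeologyD(1))

text \<open>Every plot of the point factors through the zero-dimensional one, whose only tangent
  vector is zero. Hence in positive degree the last two components of an element of the fibre
  product vanish.\<close>

lemma point_forms_positive:
  assumes a: "a \<in> dforms point_plots n" and n: "n > 0"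
  shows "a = (\<lambda>_ _ _. 0)"
proof (intro ext)
  fix pl :: "unit plot" and x vs
  obtain q U u where pl: "pl = (q, U, u)" by (metis prod_cases3)
  show "a pl x vs = 0"
  proof (cases "pl \<in> point_plots")
    case True
    then have u: "u = restrict (\<lambda>_. ()) U" and U: "openin (Euclidean_space q) U" using point_plotD pl by auto
    have V: "openin (Euclidean_space 0) (vecs 0)" by simp
    let ?h = "\<lambda>(x :: nat \<Rightarrow> real) (i :: nat). 0 :: real"
    have h: "smooth_map_on q U 0 ?h" "?h ` U \<subseteq> vecs 0" by (auto simp: smooth_map_on_def in_vecs_iff)
    have eq: "restrict (restrict (\<lambda>_. ()) (vecs 0) \<circ> ?h) U = u" using h(2) unfolding u by (auto simp: fun_eq_iff)
    let ?\<alpha> = "a (0, vecs 0, restrict (\<lambda>_. ()) (vecs 0))"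
    note p0 = const_point_plot[OF V]
    have "a (q, U, u) = pull_eform q U ?h ?\<alpha>" using dformsD(3)[OF a p0 U h] unfolding eq .
    moreover have "?\<alpha> y ws = 0" for y ws
    proof (cases ws)
      case Nil
      then show ?thesis using alt_length[OF smooth_form_alt[OF V dformsD(1)[OF a p0]]] n by simp
    next
      case (Cons w ws')
      note al = smooth_form_alt[OF V dformsD(1)[OF a p0], of y]
      show ?thesis
      proof (cases "w \<in> vecs 0")
        case True
        then show ?thesis using alt_expand[OF al True, of ws'] Cons by simp
      next
        case False
        then show ?thesis using alt_vecs[OF al, of ws] Cons by simp
      qed
    qed
    ultimately show ?thesis by (simp add: pl pull_eform_def)
  qed (simp add: dformsD(2)[OF a])
qed

lemma ext_deriv_cong_local:
  assumes W: "openin (Euclidean_space q) W" "x \<in> W" "W \<subseteq> U" "W \<subseteq> U'" and eq: "\<And>y. y \<in> W \<Longrightarrow> \<alpha> y = \<beta> y"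
  shows "ext_deriv q U \<alpha> x vs = ext_deriv q U' \<beta> x vs"
proof -
  have "pd k (\<lambda>y. \<alpha> y us) x = pd k (\<lambda>y. \<beta> y us) x" if "k < q" for k us
    by (rule pd_cong[OF W(1,2) that]) (simp add: eq)
  then show ?thesis using W by (auto simp: ext_deriv_def)
qed

lemma dga_hom_pair:
  "dga_hom A B f \<Longrightarrow> dga_hom A C g \<Longrightarrow> dga_hom A (prod_cdga B C) (\<lambda>x. (f x, g x))"
  unfolding dga_hom_def by (simp add: prod_cdga_def)

lemma dga_hom_prod_map:
  "dga_hom A A' f \<Longrightarrow> dga_hom B B' g \<Longrightarrow> dga_hom (prod_cdga A B) (prod_cdga A' B') (\<lambda>(x, y). (f x, g y))"
  unfolding dga_hom_def by (simp add: prod_cdga_def)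

lemma dga_hom_fibre:
  assumes "dga_hom X A f" "dga_hom X B g" "\<And>n x. x \<in> gcomp X n \<Longrightarrow> F (f x) = G (g x)"
  shows "dga_hom X (fibre_prod A F B G) (\<lambda>x. (f x, g x))"
  using dga_hom_pair[OF assms(1,2)] assms(3) unfolding dga_hom_def fibre_prod_ops gcomp_fibre_prod by simp

text \<open>Defined on all of M \<times> \<real>, not only on the cylinder, because the first
  component of the fibre product consists of forms there.\<close>

definition cone :: "'a \<times> real \<Rightarrow> 'a susp" where
  "cone w = (if snd w \<le> 0 then Inl (Inl ()) else if snd w \<ge> 1 then Inl (Inr ()) else Inr w)"

text \<open>The cone points stay fixed whatever f is. The intended f fix 0 and 1 and map the unit
  interval into itself, as in \<open>smooth_htpy_susp\<close>.\<close>

definition susp_map :: "(real \<Rightarrow> real) \<Rightarrow> 'a susp \<Rightarrow> 'a susp" where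
  "susp_map f z = (case z of Inl e \<Rightarrow> Inl e | Inr w \<Rightarrow> cone (fst w, f (snd w)))"

lemma height_cone: "height (cone w) = max 0 (min 1 (snd w))"
  by (simp add: cone_def)

lemma core_cone: "0 < snd w \<Longrightarrow> snd w < 1 \<Longrightarrow> core (cone w) = w"
  by (simp add: cone_def)

lemma cone_in: "fst w \<in> topspace (mtop M) \<Longrightarrow> cone w \<in> susp_points M"
  by (cases w) (auto simp: cone_def susp_points_def)

text \<open>Smoothness in two real variables, stated by substitution, so that it applies on every
  domain without choosing coordinates of the plane.\<close>

definition smooth2 :: "(real \<Rightarrow> real \<Rightarrow> real) \<Rightarrow> bool" where
  "smooth2 h \<longleftrightarrow> (\<forall>q U f g. openin (Euclidean_space q) U \<longrightarrow> smooth_on q U f \<longrightarrow> smooth_on q U g \<longrightarrow>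
     smooth_on q U (\<lambda>x. h (f x) (g x)))"

lemma smooth2D: "smooth2 h \<Longrightarrow> openin (Euclidean_space q) U \<Longrightarrow> smooth_on q U f \<Longrightarrow> smooth_on q U g \<Longrightarrow>
    smooth_on q U (\<lambda>x. h (f x) (g x))"
  by (auto simp: smooth2_def)

text \<open>Substituting the two coordinates of the plane makes h a continuous function on the
  plane, which is then composed with the pair of f and g.\<close>

lemma continuous_on_smooth2:
  assumes h: "smooth2 h" and f: "continuous_on S f" and g: "continuous_on S g"
  shows "continuous_on S (\<lambda>x. h (f x) (g x))"
proof -
  have o: "openin (Euclidean_space 2) (vecs 2)" by simp
  have "continuous_on (vecs 2) (\<lambda>y. h (y 0) (y 1))"
    by (rule smooth_on_continuous[OF smooth2D[OF h o smooth_on_coord smooth_on_coord]]) auto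
  then have "continuous_on S (\<lambda>x. (\<lambda>y. h (y 0) (y 1)) (\<lambda>i :: nat. if i = 0 then f x else if i = 1 then g x else 0))"
  proof (rule continuous_on_compose2)
    show "continuous_on S (\<lambda>x (i :: nat). if i = 0 then f x else if i = 1 then g x else 0)"
    proof (rule continuous_on_coordinatewise_then_product)
      show "continuous_on S (\<lambda>x. if i = 0 then f x else if i = 1 then g x else 0)" for i :: nat
        using f g by (cases "i = 0"; cases "i = 1") auto
    qed
  qed (auto simp: in_vecs_iff)
  then show ?thesis by simp
qed

context suspended
begin

text \<open>The height of the image is the truncation of \<open>snd (w x)\<close> to the unit
  interval, which is continuous but need not be smooth at the ends; \<open>susp_plotI\<close> asks
  for no more there.\<close>

lemma smooth_between_cone: "smooth_between R S cone"
  unfolding smooth_between_def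
proof safe
  fix q U w assume w: "(q, U, w) \<in> R"
  note D = R_plotD[OF w]
  let ?u = "restrict (cone \<circ> w) U"
  have ht: "height (?u x) = max 0 (min 1 (snd (w x)))" if "x \<in> U" for x using that by (simp add: height_cone)
  have ct: "continuous_on U (\<lambda>x. snd (w x))" by (rule smooth_on_continuous[OF D(2) open_vecs_subset[OF D(3)]])
  have I: "inner_dom U ?u = {x\<in>U. snd (w x) \<in> {0<..<1}}" using ht by (auto simp: inner_dom_def)
  have oI: "openin (Euclidean_space q) (inner_dom U ?u)"
    unfolding I by (rule openin_Euclidean_preimage_open[OF D(3) ct]) simp
  show "(q, U, ?u) \<in> S"
  proof (rule susp_plotI[OF D(3)])
    show "?u x \<in> susp_points M" if "x \<in> U" for x
      using mfd_plotsD(3)[OF D(1)] that by (auto intro!: cone_in)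
    have "continuous_on U (\<lambda>x. max 0 (min 1 (snd (w x))))" by (intro continuous_intros ct)
    then show "continuous_on U (\<lambda>x. height (?u x))" using ht continuous_on_cong by fastforce
    show "(q, inner_dom U ?u, restrict (restrict (\<lambda>x. fst (w x)) U) (inner_dom U ?u)) \<in> mfd_plots M"
      by (rule plot_restrict[OF dM D(1) oI inner_subset])
    show "restrict (restrict (\<lambda>x. fst (w x)) U) (inner_dom U ?u) x = fst (core (?u x))" if "x \<in> inner_dom U ?u" for x
      using that unfolding I by (simp add: core_cone)
    have "smooth_on q (inner_dom U ?u) (\<lambda>x. snd (w x))"
      by (rule smooth_on_subset[OF D(2) inner_subset open_vecs_subset[OF D(3)]])
    then show "smooth_on q (inner_dom U ?u) (\<lambda>x. height (?u x))"
      by (rule iffD1[OF smooth_on_cong[OF oI], rotated]) (use ht in \<open>auto simp: I\<close>)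
  qed simp
qed

text \<open>Verified by \<open>susp_plotI\<close>: since h fixes the ends, the height may be
  followed continuously through the cone points, and the component in M is needed only away from
  them.\<close>

lemma smooth_htpy_susp:
  assumes h: "smooth2 h" and h0: "\<And>s. h 0 s = 0" and h1: "\<And>s. h 1 s = 1"
    and hr: "\<And>t s. 0 \<le> t \<Longrightarrow> t \<le> 1 \<Longrightarrow> 0 \<le> h t s \<and> h t s \<le> 1"
  shows "smooth_htpy S S (\<lambda>z s. susp_map (\<lambda>t. h t s) z)"
  unfolding smooth_htpy_def htpy_plot_def
proof safe
  fix q U u assume u: "(q, U, u) \<in> S"
  note U = susp_plot_open[OF u]
  note oC = openin_cyl[OF U]
  let ?v = "restrict (\<lambda>y. susp_map (\<lambda>t. h t (y q)) (u (y(q := 0)))) (cyl q U)"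
  let ?J = "inner_dom (cyl q U) ?v"
  have yU: "y(q := 0) \<in> U" if "y \<in> cyl q U" for y using that by (simp add: cyl_def)
  \<comment> \<open>As h preserves the unit interval, the truncation in \<open>cone\<close> leaves
    the new height unchanged.\<close>
  have ht: "height (?v y) = h (height (u (y(q := 0)))) (y q)" if y: "y \<in> cyl q U" for y
    using susp_plot_points[OF u yU[OF y]]
  proof (cases rule: susp_points_cases)
    case (3 a t)
    then show ?thesis using y hr[of t "y q"] by (simp add: susp_map_def height_cone del: fun_upd_apply)
  qed (use y h0 h1 in \<open>simp_all add: susp_map_def del: fun_upd_apply\<close>)
  have c0: "continuous_on (cyl q U) (\<lambda>y. y(q := 0))"
    by (rule smooth_map_on_continuous[OF smooth_map_on_upd_last[OF U] open_vecs_subset[OF oC]])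
  have "continuous_on (cyl q U) (\<lambda>y. h (height (u (y(q := 0)))) (y q))"
    by (intro continuous_on_smooth2[OF h] continuous_on_compose2[OF continuous_height[OF u] c0]
        continuous_on_subset[OF continuous_on_product_coordinates]) (use yU in auto)
  then have cv: "continuous_on (cyl q U) (\<lambda>y. height (?v y))"
    by (rule iffD1[OF continuous_on_cong[OF refl], rotated]) (rule ht[symmetric])
  have J: "?J = {y \<in> cyl q U. height (?v y) \<in> {0<..<1}}" by (auto simp: inner_dom_def)
  have oJ: "openin (Euclidean_space (Suc q)) ?J"
    unfolding J by (rule openin_Euclidean_preimage_open[OF oC cv]) simp
  \<comment> \<open>Since h fixes 0 and 1, an image strictly between the cone points comes from a
    point strictly between them, where the component in M is defined.\<close>
  have JI: "y(q := 0) \<in> inner_dom U u" if y: "y \<in> ?J" for y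
  proof -
    have yC: "y \<in> cyl q U" using y by (simp add: J)
    have "0 < h (height (u (y(q := 0)))) (y q)" "h (height (u (y(q := 0)))) (y q) < 1"
      using y ht[OF yC] by (auto simp: J)
    then have "height (u (y(q := 0))) \<noteq> 0" "height (u (y(q := 0))) \<noteq> 1" using h0[of "y q"] h1[of "y q"] by force+
    then show ?thesis using height_range[OF susp_plot_points[OF u yU[OF yC]]] yU[OF yC]
      unfolding inner_dom_def mem_Collect_eq by linarith
  qed
  have sJ: "smooth_map_on (Suc q) ?J q (\<lambda>y. y(q := 0))"
    by (rule smooth_map_on_subset[OF smooth_map_on_upd_last[OF U] inner_subset open_vecs_subset[OF oC]])
  have JI': "(\<lambda>y. y(q := 0)) ` ?J \<subseteq> inner_dom U u" using JI by blast
  show "(Suc q, cyl q U, ?v) \<in> S"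
  proof (rule susp_plotI[OF oC])
    show "?v y \<in> susp_points M" if y: "y \<in> cyl q U" for y
      using susp_plot_points[OF u yU[OF y]]
    proof (cases rule: susp_points_cases)
      case (3 a t)
      then show ?thesis using y by (auto simp: susp_map_def intro!: cone_in simp del: fun_upd_apply)
    qed (use y in \<open>simp_all add: susp_map_def susp_points_def del: fun_upd_apply\<close>)
    show "continuous_on (cyl q U) (\<lambda>y. height (?v y))" by (rule cv)
    show "(Suc q, ?J, restrict (restrict (\<lambda>x. fst (core (u x))) (inner_dom U u) \<circ> (\<lambda>y. y(q := 0))) ?J) \<in> mfd_plots M"
      by (rule diffeologyD(2)[OF dM inner_fst_plot[OF u] oJ sJ JI'])
    show "restrict (restrict (\<lambda>x. fst (core (u x))) (inner_dom U u) \<circ> (\<lambda>y. y(q := 0))) ?J y = fst (core (?v y))"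
      if y: "y \<in> ?J" for y
    proof -
      have yC: "y \<in> cyl q U" using y by (simp add: J)
      obtain w where w: "u (y(q := 0)) = Inr w" using inner_point(1)[OF u JI[OF y]] by blast
      then have v: "?v y = cone (fst w, h (snd w) (y q))" using yC by (simp add: susp_map_def del: fun_upd_apply)
      have "0 < height (?v y)" "height (?v y) < 1" using y by (auto simp: J)
      then have "core (?v y) = (fst w, h (snd w) (y q))"
        unfolding v height_cone by (intro core_cone) (auto simp: max_def min_def split: if_splits)
      then show ?thesis using y JI[OF y] w by (simp del: fun_upd_apply)
    qed
    have "smooth_on (Suc q) ?J (\<lambda>y. h (height (u (y(q := 0)))) (y q))"
      by (intro smooth2D[OF h oJ] smooth_on_compose[OF oJ open_inner[OF u] smooth_height_inner[OF u] sJ JI']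
          smooth_on_coord open_vecs_subset[OF oJ])
    then show "smooth_on (Suc q) ?J (\<lambda>y. height (?v y))"
      by (rule iffD1[OF smooth_on_cong[OF oJ], rotated]) (use ht in \<open>auto simp: J\<close>)
  qed simp
qed

lemma smooth_htpy_R:
  assumes h: "smooth2 h"
  shows "smooth_htpy R R (\<lambda>w s. (fst w, h (snd w) s))"
  unfolding smooth_htpy_def htpy_plot_def
proof safe
  fix q U w assume w: "(q, U, w) \<in> R"
  note D = R_plotD[OF w]
  note oC = openin_cyl[OF D(3)]
  note up = smooth_map_on_upd_last[OF D(3)]
  have im: "(\<lambda>y. y(q := 0)) ` cyl q U \<subseteq> U" by (auto simp: cyl_def)
  note m = diffeologyD(2)[OF dM D(1) oC up im]
  have t: "smooth_on (Suc q) (cyl q U) (\<lambda>y. h (snd (w (y(q := 0)))) (y q))"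
    by (intro smooth2D[OF h oC] smooth_on_compose[OF oC D(3) D(2) up im] smooth_on_coord open_vecs_subset[OF oC])
  have "restrict (\<lambda>y. (restrict (restrict (\<lambda>x. fst (w x)) U \<circ> (\<lambda>y. y(q := 0))) (cyl q U) y, h (snd (w (y(q := 0)))) (y q))) (cyl q U) =
      restrict (\<lambda>y. (fst (w (y(q := 0))), h (snd (w (y(q := 0)))) (y q))) (cyl q U)"
    using im by (intro restrict_ext) auto
  then show "(Suc q, cyl q U, restrict (\<lambda>y. (fst (w (y(q := 0))), h (snd (w (y(q := 0)))) (y q))) (cyl q U)) \<in> R"
    using prodR_plotI[OF m t] by simp
qed

lemma smooth_between_R_map:
  assumes k: "\<And>q U f. openin (Euclidean_space q) U \<Longrightarrow> smooth_on q U f \<Longrightarrow> smooth_on q U (\<lambda>x. k (f x))"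
  shows "smooth_between R R (\<lambda>w. (fst w, k (snd w)))"
  unfolding smooth_between_def
proof safe
  fix q U w assume w: "(q, U, w) \<in> R"
  note D = R_plotD[OF w]
  have "restrict (\<lambda>x. (restrict (\<lambda>x. fst (w x)) U x, k (snd (w x)))) U = restrict ((\<lambda>w. (fst w, k (snd w))) \<circ> w) U"
    by (intro restrict_ext) auto
  then show "(q, U, restrict ((\<lambda>w. (fst w, k (snd w))) \<circ> w) U) \<in> R"
    using prodR_plotI[OF D(1) k[OF D(3,2)]] by simp
qed

lemma smooth_between_slice: "smooth_between (mfd_plots M) R (\<lambda>a. (a, c))"
  unfolding smooth_between_def
proof safe
  fix q U m assume m: "(q, U, m) \<in> mfd_plots M"
  show "(q, U, restrict ((\<lambda>a. (a, c)) \<circ> m) U) \<in> R"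
    using prodR_plotI[OF m smooth_on_const[OF open_vecs_subset[OF mfd_plotsD(1)[OF m]], of c]] by (simp add: o_def)
qed

lemma smooth_between_fst: "smooth_between R (mfd_plots M) fst"
  unfolding smooth_between_def o_def using R_plotD(1) by blast

lemma smooth_between_snd: "smooth_between R (mfd_plots real_mfd) snd"
  unfolding smooth_between_def o_def using prod_plotD(2)[OF cM charted_real] by blast

lemma smooth_between_pole: "z \<in> susp_points M \<Longrightarrow> smooth_between point_plots S (\<lambda>_. z)"
  unfolding smooth_between_def o_def using point_plotD(1) susp_const_plot by blast

section \<open>The fibre product and the cochain map into it\<close>

abbreviation "\<Omega>M \<equiv> deRham (mfd_plots M)"
abbreviation "\<Omega>R \<equiv> deRham R"
abbreviation "\<Omega>P \<equiv> deRham point_plots"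
abbreviation "B \<equiv> susp_model M"

lemma end_restrict_hom: "dga_hom \<Omega>R (prod_cdga \<Omega>M \<Omega>M) (end_restrict M)"
  unfolding end_restrict_def by (intro dga_hom_pair dga_hom_pull dM smooth_between_slice)

lemma end_const_hom: "dga_hom (prod_cdga \<Omega>P \<Omega>P) (prod_cdga \<Omega>M \<Omega>M) (end_const M)"
  unfolding end_const_def by (intro dga_hom_prod_map dga_hom_pull dM smooth_between_point)

lemma dga_B: "dga B"
  unfolding susp_model_def
  by (intro dga_fibre_prod[OF _ _ end_restrict_hom end_const_hom] dga_prod dga_deRham dR diffeology_point)

lemma in_B_iff:
  "(\<eta>, a, b) \<in> gcomp B n \<longleftrightarrow> \<eta> \<in> dforms R n \<and> a \<in> dforms point_plots n \<and> b \<in> dforms point_plots n \<and>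
     pull (mfd_plots M) (\<lambda>x. (x, 0)) \<eta> = pull (mfd_plots M) (\<lambda>_. ()) a \<and>
     pull (mfd_plots M) (\<lambda>x. (x, 1)) \<eta> = pull (mfd_plots M) (\<lambda>_. ()) b"
  by (auto simp: susp_model_def gcomp_fibre_prod prod_cdga_def deRham_simps end_restrict_def end_const_def)

lemma B_ops:
  "gzero B n = (gzero \<Omega>R n, gzero \<Omega>P n, gzero \<Omega>P n)"
  "gadd B n (\<eta>, a, b) (\<eta>', a', b') = (gadd \<Omega>R n \<eta> \<eta>', gadd \<Omega>P n a a', gadd \<Omega>P n b b')"
  "gdiff B n (\<eta>, a, b) = (gdiff \<Omega>R n \<eta>, gdiff \<Omega>P n a, gdiff \<Omega>P n b)"
  by (simp_all add: susp_model_def fibre_prod_ops prod_cdga_def)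

text \<open>This induces \<Upsilon>' on cohomology. As \<open>cone\<close> is constant on the slices
  at heights 0 and 1, the restrictions of its pullback come from the forms at the cone points, which
  is the condition of the fibre product.\<close>

definition to_model :: "'a susp dform \<Rightarrow> ('a \<times> real) dform \<times> unit dform \<times> unit dform" where
  "to_model \<omega> = (pull R cone \<omega>, pull point_plots (\<lambda>_. Inl (Inl ())) \<omega>, pull point_plots (\<lambda>_. Inl (Inr ())) \<omega>)"

lemma poles: "Inl (Inl ()) \<in> susp_points M" "Inl (Inr ()) \<in> susp_points M"
  by (auto simp: susp_points_def)

lemma to_model_hom: "dga_hom (deRham S) B to_model"
proof -
  let ?M = "mfd_plots M"
  have "end_restrict M (pull R cone \<omega>) =
      end_const M (pull point_plots (\<lambda>_. Inl (Inl ())) \<omega>, pull point_plots (\<lambda>_. Inl (Inr ())) \<omega>)" for \<omega> :: "'a susp dform"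
    by (simp add: end_restrict_def end_const_def pull_pull[OF smooth_between_slice] pull_pull[OF smooth_between_point[OF dM]]
        o_def cone_def)
  then show ?thesis
    unfolding to_model_def[abs_def] susp_model_def
    by (intro dga_hom_fibre dga_hom_pair dga_hom_pull dR diffeology_point smooth_between_cone smooth_between_pole poles)
qed

text \<open>A reparametrisation of the interval that is constant near both ends: pulling back along it makes
  a form on \<open>M \<times> \<real>\<close> locally constant near the ends, so that it extends over the cone points.\<close>

definition \<rho> :: "real \<Rightarrow> real" where "\<rho> t = lam (3 * t - 1)"

definition crush :: "'a \<times> real \<Rightarrow> 'a \<times> real" where "crush w = (fst w, \<rho> (snd w))"

lemma \<rho>_low: "t \<le> 1/3 \<Longrightarrow> \<rho> t = 0" and \<rho>_high: "2/3 \<le> t \<Longrightarrow> \<rho> t = 1"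
  by (simp_all add: \<rho>_def lam_0 lam_1)

lemma smooth_\<rho>: "openin (Euclidean_space q) U \<Longrightarrow> smooth_on q U f \<Longrightarrow> smooth_on q U (\<lambda>x. \<rho> (f x))"
  unfolding \<rho>_def by (intro smooth_lam smooth_on_diff smooth_on_cmult smooth_on_const open_vecs_subset)

lemma smooth_between_crush: "smooth_between R R crush"
  unfolding crush_def[abs_def] by (rule smooth_between_R_map[OF smooth_\<rho>])

section \<open>The cochain map back to forms on the suspension\<close>

abbreviation "crush_plot U u \<equiv> restrict (\<lambda>x. crush (core (u x))) (inner_dom U u)"
abbreviation "pt U \<equiv> restrict (\<lambda>_. ()) U"

lemma crush_plot_in:
  assumes u: "(q, U, u) \<in> S"
  shows "(q, inner_dom U u, crush_plot U u) \<in> R"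
proof -
  have "restrict (\<lambda>x. (restrict (\<lambda>x. fst (core (u x))) (inner_dom U u) x, \<rho> (height (u x)))) (inner_dom U u) = crush_plot U u"
    using inner_point(3)[OF u] by (intro restrict_ext) (auto simp: crush_def)
  then show ?thesis
    using prodR_plotI[OF inner_fst_plot[OF u] smooth_\<rho>[OF open_inner[OF u] smooth_height_inner[OF u]]] by simp
qed

text \<open>Defined pointwise by the position of the plot. At a cone point the component in M is
  missing, so the form of the point is used; elsewhere \<eta> is evaluated on the crushed plot. That
  the pieces fit together smoothly is the content of \<open>from_model_local\<close>.\<close>

definition from_model :: "('a \<times> real) dform \<times> unit dform \<times> unit dform \<Rightarrow> 'a susp dform" where
  "from_model z = (\<lambda>(q, U, u) x vs. if (q, U, u) \<in> S \<and> x \<in> U then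
     (case u x of Inl e \<Rightarrow> (case e of Inl _ \<Rightarrow> fst (snd z) (q, U, pt U) x vs | Inr _ \<Rightarrow> snd (snd z) (q, U, pt U) x vs)
      | Inr _ \<Rightarrow> fst z (q, inner_dom U u, crush_plot U u) x vs) else 0)"

text \<open>The condition of the fibre product, read on plots of M \<times> \<real> that lie
  entirely over one end.\<close>

lemma end_value:
  assumes z: "(\<eta>, a, b) \<in> gcomp B n" and w: "(q, V, w) \<in> R"
  shows "(\<And>x. x \<in> V \<Longrightarrow> snd (w x) = 0) \<Longrightarrow> \<eta> (q, V, w) = a (q, V, pt V)"
    and "(\<And>x. x \<in> V \<Longrightarrow> snd (w x) = 1) \<Longrightarrow> \<eta> (q, V, w) = b (q, V, pt V)"
proof -
  let ?m = "restrict (\<lambda>x. fst (w x)) V"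
  note D = R_plotD[OF w]
  have eq: "restrict ((\<lambda>x. (x, c)) \<circ> ?m) V = w" if "\<And>x. x \<in> V \<Longrightarrow> snd (w x) = c" for c
  proof
    fix x show "restrict ((\<lambda>x. (x, c)) \<circ> ?m) V x = w x"
      using that[of x] D(4) by (cases "x \<in> V") (auto simp: extensional_def prod_eq_iff)
  qed
  have pz: "pull (mfd_plots M) (\<lambda>x. (x, 0)) \<eta> (q, V, ?m) = pull (mfd_plots M) (\<lambda>_. ()) a (q, V, ?m)"
    "pull (mfd_plots M) (\<lambda>x. (x, 1)) \<eta> (q, V, ?m) = pull (mfd_plots M) (\<lambda>_. ()) b (q, V, ?m)"
    using z by (simp_all add: in_B_iff)
  show "\<eta> (q, V, w) = a (q, V, pt V)" if "\<And>x. x \<in> V \<Longrightarrow> snd (w x) = 0"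
    using pz(1) D(1) eq[OF that] by (simp add: pull_def o_def)
  show "\<eta> (q, V, w) = b (q, V, pt V)" if "\<And>x. x \<in> V \<Longrightarrow> snd (w x) = 1"
    using pz(2) D(1) eq[OF that] by (simp add: pull_def o_def)
qed

lemma point_form_restrict:
  assumes a: "a \<in> dforms point_plots n" and "openin (Euclidean_space q) U" "openin (Euclidean_space q) V" "V \<subseteq> U" "x \<in> V"
  shows "a (q, V, pt V) x vs = a (q, U, pt U) x vs"
proof -
  have "restrict (pt U) V = pt V" using assms(4) by (auto simp: fun_eq_iff)
  then show ?thesis
    using dforms_restrict[OF a const_point_plot[OF assms(2)] assms(2-5), of vs] by simp
qed

lemma from_model_inner:
  assumes u: "(q, U, u) \<in> S" and x: "x \<in> inner_dom U u"
  shows "from_model z (q, U, u) x = fst z (q, inner_dom U u, crush_plot U u) x"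
proof -
  have "x \<in> U" using x inner_subset by blast
  then show ?thesis using u inner_point(1)[OF u x] by (cases "u x") (simp_all add: from_model_def)
qed

text \<open>Crushing sends heights below 1/3 to 0 and heights above 2/3 to 1. So one form of the
  point describes the result both at a cone point and at the points next to it.\<close>

lemma from_model_ends:
  assumes z: "(\<eta>, a, b) \<in> gcomp B n" and u: "(q, U, u) \<in> S" and x: "x \<in> U"
  shows "height (u x) < 1/3 \<Longrightarrow> from_model (\<eta>, a, b) (q, U, u) x = a (q, U, pt U) x"
    and "2/3 < height (u x) \<Longrightarrow> from_model (\<eta>, a, b) (q, U, u) x = b (q, U, pt U) x"
proof -
  note zB = z[unfolded in_B_iff]
  let ?I = "inner_dom U u"
  \<comment> \<open>On the open part where the height lies in A the crushed plot lies over one end,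
    so \<open>end_value\<close> applies; locality of forms carries the equality back to the whole
    plot.\<close>
  have *: "\<eta> (q, ?I, crush_plot U u) x vs = c (q, U, pt U) x vs"
    if c: "c \<in> dforms point_plots n" and A: "open A" "height (u x) \<in> A" and xI: "x \<in> ?I"
      and ev: "\<And>V w. (q, V, w) \<in> R \<Longrightarrow> (\<And>y. y \<in> V \<Longrightarrow> snd (w y) = e) \<Longrightarrow> \<eta> (q, V, w) = c (q, V, pt V)"
      and e: "\<And>t. t \<in> A \<Longrightarrow> \<rho> t = e" for A e c vs
  proof -
    let ?V = "?I \<inter> {y\<in>U. height (u y) \<in> A}"
    have oV: "openin (Euclidean_space q) ?V"
      by (intro openin_Int open_inner[OF u] open_height_set[OF u A(1)])
    have xV: "x \<in> ?V" using x xI A by simp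
    have VI: "?V \<subseteq> ?I" by blast
    have "\<eta> (q, ?I, crush_plot U u) x vs = \<eta> (q, ?V, restrict (crush_plot U u) ?V) x vs"
      using dforms_restrict[OF _ crush_plot_in[OF u] open_inner[OF u] oV VI xV, of \<eta> n vs] zB by simp
    also have "\<eta> (q, ?V, restrict (crush_plot U u) ?V) = c (q, ?V, pt ?V)"
    proof (rule ev)
      show "(q, ?V, restrict (crush_plot U u) ?V) \<in> R" by (rule plot_restrict[OF dR crush_plot_in[OF u] oV VI])
      show "snd (restrict (crush_plot U u) ?V y) = e" if "y \<in> ?V" for y
        using that inner_point(3)[OF u, of y] e by (simp add: crush_def)
    qed
    also have "c (q, ?V, pt ?V) x vs = c (q, U, pt U) x vs"
      using inner_subset by (intro point_form_restrict[OF c susp_plot_open[OF u] oV _ xV]) auto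
    finally show ?thesis .
  qed
  show "from_model (\<eta>, a, b) (q, U, u) x = a (q, U, pt U) x" if h: "height (u x) < 1/3"
    using susp_plot_points[OF u x]
  proof (cases rule: susp_points_cases)
    case 1
    then show ?thesis using u x by (simp add: from_model_def)
  next
    case (3 c t)
    then have xI: "x \<in> ?I" using x by (simp add: inner_dom_def)
    show ?thesis unfolding from_model_inner[OF u xI]
      using *[of a "{..<1/3}" 0, OF _ _ _ xI end_value(1)[OF z]] zB h \<rho>_low by (auto simp: fun_eq_iff)
  qed (use h in simp)
  show "from_model (\<eta>, a, b) (q, U, u) x = b (q, U, pt U) x" if h: "2/3 < height (u x)"
    using susp_plot_points[OF u x]
  proof (cases rule: susp_points_cases)
    case 2
    then show ?thesis using u x by (simp add: from_model_def)
  next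
    case (3 c t)
    then have xI: "x \<in> ?I" using x by (simp add: inner_dom_def)
    show ?thesis unfolding from_model_inner[OF u xI]
      using *[of b "{2/3<..}" 1, OF _ _ _ xI end_value(2)[OF z]] zB h \<rho>_high by (auto simp: fun_eq_iff)
  qed (use h in simp)
qed

lemma B_diff: "z \<in> gcomp B n \<Longrightarrow> gdiff B n z \<in> gcomp B (Suc n)"
  by (rule dga.diff_in[OF dga_B])

text \<open>The sets with height below 1/3, above 2/3 and strictly between 0 and 1 are open and
  cover U. Each carries a single smooth form, so membership in the complex and compatibility with d
  become local questions. W' may exceed W because a form of the point is defined over all of
  U.\<close>

lemma from_model_local:
  assumes z: "z \<in> gcomp B n" and u: "(q, U, u) \<in> S" and x: "x \<in> U"
  shows "\<exists>W W' \<beta>. openin (Euclidean_space q) W \<and> openin (Euclidean_space q) W' \<and> x \<in> W \<and> W \<subseteq> W' \<and> W \<subseteq> U \<and>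
    smooth_form q W' n \<beta> \<and> (\<forall>y\<in>W. from_model z (q, U, u) y = \<beta> y) \<and>
    (\<forall>y\<in>W. from_model (gdiff B n z) (q, U, u) y = ext_deriv q W' \<beta> y)"
proof -
  obtain \<eta> a b where ze: "z = (\<eta>, a, b)" by (metis prod_cases3)
  note zB = z[unfolded ze]
  note dz = B_diff[OF zB, unfolded B_ops(3)]
  note U = susp_plot_open[OF u]
  note forms = zB[unfolded in_B_iff]
  have ends: ?thesis
    if A: "open A" "height (u x) \<in> A" and c: "c \<in> dforms point_plots n"
      and 1: "\<And>y. y \<in> U \<Longrightarrow> height (u y) \<in> A \<Longrightarrow> from_model (\<eta>, a, b) (q, U, u) y = c (q, U, pt U) y"
      and 2: "\<And>y. y \<in> U \<Longrightarrow> height (u y) \<in> A \<Longrightarrow>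
        from_model (gdiff \<Omega>R n \<eta>, gdiff \<Omega>P n a, gdiff \<Omega>P n b) (q, U, u) y = gdiff \<Omega>P n c (q, U, pt U) y" for A c
  proof (rule exI[of _ "{y\<in>U. height (u y) \<in> A}"], rule exI[of _ U], rule exI[of _ "c (q, U, pt U)"], intro conjI ballI)
    show "openin (Euclidean_space q) {y\<in>U. height (u y) \<in> A}" by (rule open_height_set[OF u A(1)])
    show "smooth_form q U n (c (q, U, pt U))" by (rule dformsD(1)[OF c const_point_plot[OF U]])
    fix y assume "y \<in> {y\<in>U. height (u y) \<in> A}"
    then have y: "y \<in> U" "height (u y) \<in> A" by auto
    show "from_model z (q, U, u) y = c (q, U, pt U) y" unfolding ze by (rule 1[OF y])
    show "from_model (gdiff B n z) (q, U, u) y = ext_deriv q U (c (q, U, pt U)) y"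
      unfolding ze B_ops(3) 2[OF y] by (simp add: deRham_simps(7))
  qed (use U x A in auto)
  consider "height (u x) < 1/3" | "2/3 < height (u x)" | "0 < height (u x)" "height (u x) < 1" by linarith
  then show ?thesis
  proof cases
    case 1
    show ?thesis
      by (rule ends[of "{..<1/3}" a]) (use 1 forms from_model_ends(1)[OF zB u] from_model_ends(1)[OF dz u] in auto)
  next
    case 2
    show ?thesis
      by (rule ends[of "{2/3<..}" b]) (use 2 forms from_model_ends(2)[OF zB u] from_model_ends(2)[OF dz u] in auto)
  next
    case 3
    let ?I = "inner_dom U u"
    show ?thesis
    proof (intro exI[of _ ?I] exI[of _ "\<eta> (q, ?I, crush_plot U u)"] conjI ballI)
      show "smooth_form q ?I n (\<eta> (q, ?I, crush_plot U u))"
        using forms by (intro dformsD(1)[OF _ crush_plot_in[OF u]]) simp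
      fix y assume y: "y \<in> ?I"
      show "from_model z (q, U, u) y = \<eta> (q, ?I, crush_plot U u) y"
        unfolding ze from_model_inner[OF u y] by simp
      show "from_model (gdiff B n z) (q, U, u) y = ext_deriv q ?I (\<eta> (q, ?I, crush_plot U u)) y"
        unfolding ze B_ops(3) from_model_inner[OF u y] by (simp add: deRham_simps(7))
    qed (use 3 x open_inner[OF u] inner_subset[of U u] in \<open>auto simp: inner_dom_def\<close>)
  qed
qed

lemma from_model_outside: "x \<notin> U \<Longrightarrow> from_model z (q, U, u) x = (\<lambda>_. 0)" "(q, U, u) \<notin> S \<Longrightarrow> from_model z (q, U, u) = (\<lambda>_ _. 0)"
  by (auto simp: from_model_def fun_eq_iff)

lemma from_model_in:
  assumes z: "z \<in> gcomp B n"
  shows "from_model z \<in> dforms S n"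
proof (rule dformsI)
  fix q U u assume u: "(q, U, u) \<in> S"
  note U = susp_plot_open[OF u]
  show "smooth_form q U n (from_model z (q, U, u))"
  proof (rule smooth_formI[OF U])
    show "from_model z (q, U, u) x vs = 0" if "x \<notin> U" for x vs using that by (simp add: from_model_outside)
    show "alt q n (from_model z (q, U, u) x)" if x: "x \<in> U" for x
    proof -
      obtain W W' \<beta> where "openin (Euclidean_space q) W'" "x \<in> W" "smooth_form q W' n \<beta>" "\<forall>y\<in>W. from_model z (q, U, u) y = \<beta> y"
        using from_model_local[OF z u x] by blast
      then show ?thesis using smooth_form_alt by simp
    qed
    show "smooth_on q U (\<lambda>x. from_model z (q, U, u) x vs)" for vs
    proof (rule smooth_on_localI[OF U])
      fix x assume x: "x \<in> U"
      obtain W W' \<beta> where W: "openin (Euclidean_space q) W" "openin (Euclidean_space q) W'" "x \<in> W" "W \<subseteq> W'" "W \<subseteq> U"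
        "smooth_form q W' n \<beta>" "\<forall>y\<in>W. from_model z (q, U, u) y = \<beta> y"
        using from_model_local[OF z u x] by blast
      have "smooth_on q W (\<lambda>x. \<beta> x vs)"
        by (rule smooth_on_subset[OF smooth_formD(3)[OF W(2,6)] W(4) open_vecs_subset[OF W(2)]])
      then have "smooth_on q W (\<lambda>x. from_model z (q, U, u) x vs)"
        by (rule iffD1[OF smooth_on_cong[OF W(1)], rotated]) (simp add: W(7))
      then show "\<exists>W. openin (Euclidean_space q) W \<and> x \<in> W \<and> W \<subseteq> U \<and> smooth_on q W (\<lambda>x. from_model z (q, U, u) x vs)"
        using W(1,3,5) by (intro exI[of _ W] conjI)
    qed
  qed
next
  fix q U u r V h
  assume *: "(q, U, u) \<in> S" "openin (Euclidean_space r) V" "smooth_map_on r V q h" "h ` V \<subseteq> U"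
  obtain \<eta> a b where ze: "z = (\<eta>, a, b)" by (metis prod_cases3)
  note zB = z[unfolded ze in_B_iff]
  note U = susp_plot_open[OF *(1)]
  let ?v = "restrict (u \<circ> h) V"
  have v: "(r, V, ?v) \<in> S" by (rule diffeologyD(2)[OF dS *])
  have c: "c (r, V, pt V) = pull_eform r V h (c (q, U, pt U))" if "c \<in> dforms point_plots n" for c
  proof -
    have "restrict (pt U \<circ> h) V = pt V" using *(4) by (auto simp: fun_eq_iff)
    then show ?thesis using dformsD(3)[OF that const_point_plot[OF U] *(2-4)] by simp
  qed
  have "from_model z (r, V, ?v) y ws = pull_eform r V h (from_model z (q, U, u)) y ws" for y ws
  proof (cases "y \<in> V")
    case True
    then have hy: "h y \<in> U" using *(4) by blast
    have vy: "?v y = u (h y)" using True by simp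
    from susp_plot_points[OF *(1) hy] show ?thesis
    proof (cases rule: susp_points_cases)
      case (3 e t)
      let ?I = "inner_dom U u" and ?J = "inner_dom V ?v"
      have yJ: "y \<in> ?J" and hI: "h y \<in> ?I" using 3 True hy by (auto simp: inner_dom_def)
      have hJ: "h ` ?J \<subseteq> ?I" using *(4) by (auto simp: inner_dom_def)
      have sJ: "smooth_map_on r ?J q h"
        by (rule smooth_map_on_subset[OF *(3) inner_subset open_vecs_subset[OF *(2)]])
      have "restrict (crush_plot U u \<circ> h) ?J = crush_plot V ?v"
        using hJ inner_subset[of V ?v] by (intro restrict_ext) auto
      then have "\<eta> (r, ?J, crush_plot V ?v) = pull_eform r ?J h (\<eta> (q, ?I, crush_plot U u))"
        using dformsD(3)[OF _ crush_plot_in[OF *(1)] open_inner[OF v] sJ hJ, of \<eta> n] zB by simp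
      then show ?thesis
        using yJ hI True from_model_inner[OF v yJ] from_model_inner[OF *(1) hI] by (simp add: ze pull_eform_def)
    qed (use True hy v vy * c zB in \<open>auto simp: from_model_def ze pull_eform_def\<close>)
  qed (simp add: from_model_outside pull_eform_def)
  then show "from_model z (r, V, ?v) = pull_eform r V h (from_model z (q, U, u))" by (intro ext)
qed (simp add: from_model_outside)

lemma from_model_diff:
  assumes z: "z \<in> gcomp B n"
  shows "from_model (gdiff B n z) = gdiff (deRham S) n (from_model z)"
proof (intro ext)
  fix pl :: "'a susp plot" and x vs
  obtain q U u where pl: "pl = (q, U, u)" by (metis prod_cases3)
  show "from_model (gdiff B n z) pl x vs = gdiff (deRham S) n (from_model z) pl x vs"
  proof (cases "pl \<in> S \<and> x \<in> U")
    case True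
    then have u: "(q, U, u) \<in> S" and x: "x \<in> U" by (auto simp: pl)
    obtain W W' \<beta> where W: "openin (Euclidean_space q) W" "x \<in> W" "W \<subseteq> W'" "W \<subseteq> U"
      "\<forall>y\<in>W. from_model z (q, U, u) y = \<beta> y" "\<forall>y\<in>W. from_model (gdiff B n z) (q, U, u) y = ext_deriv q W' \<beta> y"
      using from_model_local[OF z u x] by blast
    then show ?thesis using ext_deriv_cong_local[OF W(1,2,4,3), of "from_model z (q, U, u)" \<beta> vs]
      by (simp add: pl deRham_simps(7))
  next
    case False
    then show ?thesis
      by (auto simp: pl deRham_simps(7) from_model_outside ext_deriv_zero ext_deriv_outside)
  qed
qed

lemma from_model_add: "from_model (gadd B n z z') = gadd (deRham S) n (from_model z) (from_model z')"
proof -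
  obtain \<eta> a b \<eta>' a' b' where "z = (\<eta>, a, b)" "z' = (\<eta>', a', b')" by (metis prod_cases3)
  then show ?thesis
    by (auto simp: from_model_def B_ops deRham_simps fun_eq_iff split: sum.split)
qed

lemma from_model_zero: "from_model (gzero B n) = gzero (deRham S) n"
  by (auto simp: from_model_def B_ops deRham_simps fun_eq_iff split: sum.split)

end

context suspended
begin

text \<open>Clamping the height before \<rho> has no effect, since \<rho> is already constant
  outside the unit interval. So clamping followed by crushing is crushing.\<close>

lemma to_from_model:
  assumes z: "(\<eta>, a, b) \<in> gcomp B n"
  shows "to_model (from_model (\<eta>, a, b)) = (pull R crush \<eta>, a, b)"
proof -
  note zB = z[unfolded in_B_iff]
  have pole: "pull point_plots (\<lambda>_. p) (from_model (\<eta>, a, b)) = c"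
    if p: "p \<in> susp_points M" and c: "c \<in> dforms point_plots n"
      and v: "\<And>q U u x. (q, U, u) \<in> S \<Longrightarrow> x \<in> U \<Longrightarrow> u x = p \<Longrightarrow> from_model (\<eta>, a, b) (q, U, u) x = c (q, U, pt U) x" for p c
  proof (intro ext)
    fix pl :: "unit plot" and x vs
    obtain q U u where pl: "pl = (q, U, u)" by (metis prod_cases3)
    show "pull point_plots (\<lambda>_. p) (from_model (\<eta>, a, b)) pl x vs = c pl x vs"
    proof (cases "pl \<in> point_plots")
      case True
      then have U: "openin (Euclidean_space q) U" and u: "u = pt U" using point_plotD pl by auto
      show ?thesis
      proof (cases "x \<in> U")
        case x: True
        then show ?thesis
          using v[OF susp_const_plot[OF U p] x] True by (simp add: pull_def pl u o_def)
      next
        case False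
        then show ?thesis
          using smooth_formD(1)[OF U dformsD(1)[OF c const_point_plot[OF U]] False] True
          by (simp add: pull_def pl u from_model_outside(1)[OF False])
      qed
    qed (simp add: pull_def dformsD(2)[OF c] pl)
  qed
  have "pull R cone (from_model (\<eta>, a, b)) = pull R crush \<eta>"
  proof (intro ext)
    fix pl :: "('a \<times> real) plot" and x vs
    obtain q U w where pl: "pl = (q, U, w)" by (metis prod_cases3)
    show "pull R cone (from_model (\<eta>, a, b)) pl x vs = pull R crush \<eta> pl x vs"
    proof (cases "pl \<in> R")
      case True
      then have w: "(q, U, w) \<in> R" by (simp add: pl)
      let ?u = "restrict (cone \<circ> w) U" and ?c = "restrict (crush \<circ> w) U"
      note D = R_plotD[OF w]
      note u = smooth_betweenD[OF smooth_between_cone w] and c = smooth_betweenD[OF smooth_between_crush w]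
      have ht: "height (?u y) = max 0 (min 1 (snd (w y)))" if "y \<in> U" for y using that by (simp add: height_cone)
      have ct: "continuous_on U (\<lambda>x. snd (w x))" by (rule smooth_on_continuous[OF D(2) open_vecs_subset[OF D(3)]])
      have ends: "\<eta> (q, U, ?c) x vs = e (q, U, pt U) x vs"
        if A: "open A" "snd (w x) \<in> A" and x: "x \<in> U" and e: "e \<in> dforms point_plots n"
          and ev: "\<And>V w. (q, V, w) \<in> R \<Longrightarrow> (\<And>y. y \<in> V \<Longrightarrow> snd (w y) = k) \<Longrightarrow> \<eta> (q, V, w) = e (q, V, pt V)"
          and k: "\<And>t. t \<in> A \<Longrightarrow> \<rho> t = k" for A e k
      proof -
        let ?V = "{y\<in>U. snd (w y) \<in> A}"
        have oV: "openin (Euclidean_space q) ?V" by (rule openin_Euclidean_preimage_open[OF D(3) ct A(1)])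
        have xV: "x \<in> ?V" "?V \<subseteq> U" using x A by auto
        have "\<eta> (q, U, ?c) x vs = \<eta> (q, ?V, restrict ?c ?V) x vs"
          using dforms_restrict[OF _ c D(3) oV xV(2,1), of \<eta> n vs] zB by simp
        also have "\<eta> (q, ?V, restrict ?c ?V) = e (q, ?V, pt ?V)"
          by (rule ev[OF plot_restrict[OF dR c oV xV(2)]]) (simp add: crush_def k)
        also have "\<dots> x vs = e (q, U, pt U) x vs" by (rule point_form_restrict[OF e D(3) oV xV(2,1)])
        finally show ?thesis .
      qed
      have "from_model (\<eta>, a, b) (q, U, ?u) x vs = \<eta> (q, U, ?c) x vs"
      proof (cases "x \<in> U")
        case x: True
        consider "snd (w x) < 1/3" | "2/3 < snd (w x)" | "0 < snd (w x)" "snd (w x) < 1" by linarith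
        then show ?thesis
        proof cases
          case 1
          then show ?thesis
            using from_model_ends(1)[OF z u x] ht[OF x] ends[of "{..<1/3}" a 0, OF _ _ x _ end_value(1)[OF z]] zB \<rho>_low by simp
        next
          case 2
          then show ?thesis
            using from_model_ends(2)[OF z u x] ht[OF x] ends[of "{2/3<..}" b 1, OF _ _ x _ end_value(2)[OF z]] zB \<rho>_high by simp
        next
          case 3
          let ?I = "inner_dom U ?u"
          have xI: "x \<in> ?I" using 3 x ht[OF x] unfolding inner_dom_def by simp
          have "restrict ?c ?I = crush_plot U ?u"
          proof (rule restrict_ext)
            fix y assume y: "y \<in> ?I"
            then have yU: "y \<in> U" and "0 < height (?u y)" "height (?u y) < 1" by (auto simp: inner_dom_def)
            then have "0 < snd (w y)" "snd (w y) < 1" unfolding ht[OF yU] by auto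
            then show "?c y = crush (core (?u y))" using yU by (simp add: core_cone)
          qed
          then show ?thesis
            using dforms_restrict[OF _ c D(3) open_inner[OF u] inner_subset xI, of \<eta> n vs] zB from_model_inner[OF u xI]
            by simp
        qed
      next
        case False
        then show ?thesis
          using smooth_formD(1)[OF D(3) dformsD(1)[OF _ c] False, of \<eta> n vs] zB
          by (simp add: from_model_outside(1)[OF False])
      qed
      then show ?thesis using w by (simp add: pull_def pl)
    qed (simp add: pull_def pl)
  qed
  moreover have "pull point_plots (\<lambda>_. Inl (Inl ())) (from_model (\<eta>, a, b)) = a"
    using from_model_ends(1)[OF z] zB by (intro pole poles) auto
  moreover have "pull point_plots (\<lambda>_. Inl (Inr ())) (from_model (\<eta>, a, b)) = b"
    using from_model_ends(2)[OF z] zB by (intro pole poles) auto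
  ultimately show ?thesis by (simp add: to_model_def)
qed

text \<open>Crushing followed by clamping is \<open>susp_map \<rho>\<close>; near the cone points
  both sides come from constant plots. The smoothness of this map is a premise, supplied later as a
  slice of the homotopy.\<close>

lemma from_to_model:
  assumes \<omega>: "\<omega> \<in> dforms S n" and sm: "smooth_between S S (susp_map \<rho>)"
  shows "from_model (to_model \<omega>) = pull S (susp_map \<rho>) \<omega>"
proof (intro ext)
  fix pl :: "'a susp plot" and x vs
  obtain q U u where pl: "pl = (q, U, u)" by (metis prod_cases3)
  have zB: "to_model \<omega> \<in> gcomp B n" using dga_homD(1)[OF to_model_hom, of \<omega> n] \<omega> by (simp add: deRham_simps)
  show "from_model (to_model \<omega>) pl x vs = pull S (susp_map \<rho>) \<omega> pl x vs"
  proof (cases "pl \<in> S")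
    case True
    then have u: "(q, U, u) \<in> S" by (simp add: pl)
    note U = susp_plot_open[OF u]
    let ?v = "restrict (susp_map \<rho> \<circ> u) U"
    note v = smooth_betweenD[OF sm u]
    have "from_model (to_model \<omega>) (q, U, u) x vs = \<omega> (q, U, ?v) x vs"
    proof (cases "x \<in> U")
      case x: True
      have ends: "\<omega> (q, U, restrict (\<lambda>_. p) U) x vs = \<omega> (q, U, ?v) x vs"
        if A: "open A" "height (u x) \<in> A" and p: "p \<in> susp_points M"
          and e: "\<And>y. y \<in> U \<Longrightarrow> height (u y) \<in> A \<Longrightarrow> susp_map \<rho> (u y) = p" for A p
      proof -
        let ?V = "{y\<in>U. height (u y) \<in> A}"
        have oV: "openin (Euclidean_space q) ?V" by (rule open_height_set[OF u A(1)])
        have xV: "?V \<subseteq> U" "x \<in> ?V" using x A by auto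
        have "restrict (restrict (\<lambda>_. p) U) ?V = restrict ?v ?V" by (rule restrict_ext) (simp add: e)
        then show ?thesis
          using dforms_restrict[OF \<omega> v U oV xV, of vs] dforms_restrict[OF \<omega> susp_const_plot[OF U p] U oV xV, of vs] by simp
      qed
      consider "height (u x) < 1/3" | "2/3 < height (u x)" | "0 < height (u x)" "height (u x) < 1" by linarith
      then show ?thesis
      proof cases
        case 1
        have "susp_map \<rho> (u y) = Inl (Inl ())" if "y \<in> U" "height (u y) \<in> {..<1/3}" for y
          using susp_plot_points[OF u that(1)] that(2) \<rho>_low
          by (elim susp_points_cases) (auto simp: susp_map_def cone_def)
        with 1 have "\<omega> (q, U, restrict (\<lambda>_. Inl (Inl ())) U) x vs = \<omega> (q, U, ?v) x vs"
          by (intro ends[of "{..<1/3}"] poles) auto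
        then show ?thesis
          using from_model_ends(1)[OF zB[unfolded to_model_def] u x 1] const_point_plot[OF U]
          by (simp add: to_model_def pull_def o_def)
      next
        case 2
        have "susp_map \<rho> (u y) = Inl (Inr ())" if "y \<in> U" "height (u y) \<in> {2/3<..}" for y
          using susp_plot_points[OF u that(1)] that(2) \<rho>_high
          by (elim susp_points_cases) (auto simp: susp_map_def cone_def)
        with 2 have "\<omega> (q, U, restrict (\<lambda>_. Inl (Inr ())) U) x vs = \<omega> (q, U, ?v) x vs"
          by (intro ends[of "{2/3<..}"] poles) auto
        then show ?thesis
          using from_model_ends(2)[OF zB[unfolded to_model_def] u x 2] const_point_plot[OF U]
          by (simp add: to_model_def pull_def o_def)
      next
        case 3
        let ?I = "inner_dom U u"
        have xI: "x \<in> ?I" using 3 x by (simp add: inner_dom_def)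
        have "restrict ?v ?I = restrict (cone \<circ> crush_plot U u) ?I"
        proof (rule restrict_ext)
          fix y assume y: "y \<in> ?I"
          then have "y \<in> U" using inner_subset by blast
          moreover obtain w where "u y = Inr w" using inner_point(1)[OF u y] by blast
          ultimately show "?v y = (cone \<circ> crush_plot U u) y" using y by (simp add: susp_map_def crush_def)
        qed
        then show ?thesis
          using dforms_restrict[OF \<omega> v U open_inner[OF u] inner_subset xI, of vs] from_model_inner[OF u xI] crush_plot_in[OF u]
          by (simp add: to_model_def pull_def)
      qed
    next
      case False
      then show ?thesis
        using smooth_formD(1)[OF U dformsD(1)[OF \<omega> v] False] by (simp add: from_model_outside(1)[OF False])
    qed
    then show ?thesis using u by (simp add: pull_def pl)
  next
    case False
    then show ?thesis by (simp add: pull_def pl from_model_outside(2))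
  qed
qed

text \<open>The linear homotopy from the identity to \<rho>, run with \<lambda>(s) in place of s:
  the parameter ranges over the whole line, and \<lambda>(s) stays in [0,1], so the unit interval is
  preserved for every s.\<close>

definition slide :: "real \<Rightarrow> real \<Rightarrow> real" where
  "slide t s = (1 - lam s) * t + lam s * \<rho> t"

lemma smooth2_slide: "smooth2 slide"
  unfolding smooth2_def slide_def
  by (intro allI impI smooth_on_add smooth_on_mult smooth_on_diff smooth_on_const open_vecs_subset smooth_lam smooth_\<rho>)

lemma slide_ends: "slide 0 s = 0" "slide 1 s = 1" "slide t 0 = t" "slide t 1 = \<rho> t"
  by (simp_all add: slide_def \<rho>_low \<rho>_high lam_0 lam_1)

lemma slide_range:
  assumes "0 \<le> t" "t \<le> 1"
  shows "0 \<le> slide t s \<and> slide t s \<le> 1"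
proof -
  have r: "0 \<le> \<rho> t" "\<rho> t \<le> 1" by (simp_all add: \<rho>_def lam_range)
  have "(1 - lam s) * t + lam s * \<rho> t \<le> (1 - lam s) * 1 + lam s * 1"
    using assms r lam_range[of s] by (intro add_mono mult_left_mono) auto
  then show ?thesis using assms r lam_range[of s] by (simp add: slide_def)
qed

lemma from_to_cohomologous:
  assumes \<omega>: "\<omega> \<in> cocycles (deRham S) n"
  shows "\<exists>b\<in>coboundaries (deRham S) n. from_model (to_model \<omega>) = gadd (deRham S) n \<omega> b"
proof -
  have \<omega>f: "\<omega> \<in> dforms S n" and d\<omega>: "gdiff (deRham S) n \<omega> = (\<lambda>_ _ _. 0)"
    using \<omega> by (simp_all add: cocycles_def deRham_simps(1,2))
  let ?H = "\<lambda>z s. susp_map (\<lambda>t. slide t s) z"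
  have H: "smooth_htpy S S ?H" by (rule smooth_htpy_susp[OF smooth2_slide slide_ends(1,2) slide_range])
  \<comment> \<open>The slice of the homotopy at s = 1 is \<open>susp_map \<rho>\<close>, so its
    smoothness comes with that of the homotopy.\<close>
  have sm: "smooth_between S S (susp_map \<rho>)" using smooth_htpy_slice[OF dS dS H, of 1] by (simp add: slide_ends)
  have id: "pull S (\<lambda>z. ?H z 0) \<omega> = \<omega>"
  proof (intro ext)
    fix pl :: "'a susp plot" and x vs
    obtain q U u where pl: "pl = (q, U, u)" by (metis prod_cases3)
    show "pull S (\<lambda>z. ?H z 0) \<omega> pl x vs = \<omega> pl x vs"
    proof (cases "pl \<in> S")
      case True
      then have u: "(q, U, u) \<in> S" by (simp add: pl)
      have "restrict ((\<lambda>z. ?H z 0) \<circ> u) U = u"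
      proof
        fix y show "restrict ((\<lambda>z. ?H z 0) \<circ> u) U y = u y"
        proof (cases "y \<in> U")
          case True
          show ?thesis using susp_plot_points[OF u True] True
            by (elim susp_points_cases) (auto simp: susp_map_def cone_def slide_ends)
        qed (use susp_plot_ext[OF u] in \<open>simp add: extensional_def\<close>)
      qed
      then show ?thesis using u by (simp add: pull_def pl)
    qed (simp add: pull_def pl dformsD(2)[OF \<omega>f])
  qed
  let ?b = "gdiff (deRham S) (n - 1) (htpy_op S ?H \<omega>)"
  have "from_model (to_model \<omega>) = gadd (deRham S) n \<omega> ?b"
    using htpy_formula[OF dS dS H \<omega>f, of "n - 1" n]
    unfolding from_to_model[OF \<omega>f sm] d\<omega> htpy_op_zero id by (simp add: slide_ends deRham_simps(3))
  moreover have "?b \<in> coboundaries (deRham S) n"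
  proof (cases n)
    case 0
    \<comment> \<open>There is no degree -1: in degree 0 the operator vanishes, and the correction
      is the zero coboundary.\<close>
    then have "htpy_op S ?H \<omega> = gzero (deRham S) 0" using htpy_op_degree_0[OF dS dS H] \<omega>f by (simp add: deRham_simps)
    then show ?thesis using 0 dga.diff_zero[OF dga_deRham[OF dS], of 0] by (simp add: coboundaries_def deRham_simps(2))
  next
    case (Suc k)
    then show ?thesis using htpy_op_in[OF dS dS H \<omega>f] by (auto simp: coboundaries_def deRham_simps(1))
  qed
  ultimately show ?thesis by blast
qed

lemma pull_zero: "pull P f (\<lambda>_ _ _. 0) = (\<lambda>_ _ _. 0)"
  by (auto simp: pull_def fun_eq_iff)

lemma in_B_zero_ends:
  assumes "\<eta> \<in> dforms R n" "pull (mfd_plots M) (\<lambda>x. (x, 0)) \<eta> = (\<lambda>_ _ _. 0)" "pull (mfd_plots M) (\<lambda>x. (x, 1)) \<eta> = (\<lambda>_ _ _. 0)"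
  shows "(\<eta>, \<lambda>_ _ _. 0, \<lambda>_ _ _. 0) \<in> gcomp B n"
  using assms by (simp add: in_B_iff pull_zero dforms_zero[OF diffeology_point])

text \<open>The homotopy is stationary at height c. For both ends this places the primitive,
  completed by zeros, in the fibre product.\<close>

lemma htpy_op_end:
  assumes "\<eta> \<in> dforms R n" "\<And>s. h c s = c"
  shows "pull (mfd_plots M) (\<lambda>x. (x, c)) (htpy_op R (\<lambda>w s. (fst w, h (snd w) s)) \<eta>) = (\<lambda>_ _ _. 0)"
  using htpy_op_stationary[OF dM smooth_between_slice assms(1) dR]
  by (simp add: pull_htpy_op[OF smooth_between_slice] assms(2))

lemma gdiff_zero: "gdiff (deRham P) n (\<lambda>_ _ _. 0) = (\<lambda>_ _ _. 0)"
  by (auto simp: deRham_simps ext_deriv_zero fun_eq_iff)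

lemma to_from_cohomologous:
  assumes z: "z \<in> cocycles B n"
  shows "\<exists>b\<in>coboundaries B n. to_model (from_model z) = gadd B n z b"
proof -
  obtain \<eta> a b where ze: "z = (\<eta>, a, b)" by (metis prod_cases3)
  have zB: "(\<eta>, a, b) \<in> gcomp B n" and dz: "gdiff B n (\<eta>, a, b) = gzero B (Suc n)" using z by (simp_all add: cocycles_def ze)
  have \<eta>: "\<eta> \<in> dforms R n" using zB by (simp add: in_B_iff)
  have d\<eta>: "gdiff \<Omega>R n \<eta> = (\<lambda>_ _ _. 0)" using dz by (simp add: B_ops deRham_simps(2))
  let ?H = "\<lambda>w s. (fst w, slide (snd w) s)"
  have H: "smooth_htpy R R ?H" by (rule smooth_htpy_R[OF smooth2_slide])
  let ?K = "htpy_op R ?H \<eta>"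
  have id: "pull R (\<lambda>w. ?H w 0) \<eta> = \<eta>"
  proof (intro ext)
    fix pl :: "('a \<times> real) plot" and x vs
    obtain q U w where pl: "pl = (q, U, w)" by (metis prod_cases3)
    show "pull R (\<lambda>w. ?H w 0) \<eta> pl x vs = \<eta> pl x vs"
    proof (cases "pl \<in> R")
      case True
      then have "restrict ((\<lambda>w. ?H w 0) \<circ> w) U = w"
        using R_plotD(4)[of q U w] by (auto simp: pl extensional_def fun_eq_iff slide_ends)
      then show ?thesis using True by (simp add: pull_def pl)
    qed (simp add: pull_def pl dformsD(2)[OF \<eta>])
  qed
  have "pull R crush \<eta> = gadd \<Omega>R n \<eta> (gdiff \<Omega>R (n - 1) ?K)"
    using htpy_formula[OF dR dR H \<eta>, of "n - 1" n] unfolding d\<eta> htpy_op_zero id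
    by (simp add: slide_ends crush_def[abs_def] deRham_simps(3))
  then have "to_model (from_model z) = gadd B n z (gdiff B (n - 1) (?K, \<lambda>_ _ _. 0, \<lambda>_ _ _. 0))"
    unfolding ze to_from_model[OF zB] B_ops(2,3) by (simp add: gdiff_zero deRham_simps(3))
  moreover have "gdiff B (n - 1) (?K, \<lambda>_ _ _. 0, \<lambda>_ _ _. 0) \<in> coboundaries B n"
  proof (cases n)
    case 0
    then have "?K = (\<lambda>_ _ _. 0)" using htpy_op_degree_0[OF dR dR H] \<eta> by simp
    then show ?thesis using 0 by (simp add: coboundaries_def B_ops(1,3) gdiff_zero deRham_simps(2))
  next
    case (Suc k)
    \<comment> \<open>The primitive has to lie in the fibre product and not merely among the forms
      on M \<times> \<real>; this holds because \<open>slide\<close> fixes 0 and 1.\<close>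
    have "(?K, \<lambda>_ _ _. 0, \<lambda>_ _ _. 0) \<in> gcomp B k"
      using htpy_op_in[OF dR dR H \<eta>] Suc htpy_op_end[OF \<eta>] slide_ends by (intro in_B_zero_ends) auto
    then show ?thesis using Suc by (auto simp: coboundaries_def)
  qed
  ultimately show ?thesis by blast
qed

definition \<Upsilon> :: "nat \<Rightarrow> 'a susp dform set \<Rightarrow> (('a \<times> real) dform \<times> unit dform \<times> unit dform) set" where
  "\<Upsilon> n X = (\<Union>\<omega>\<in>X. cohom_class B n (to_model \<omega>))"

text \<open>The operations are respected because \<open>to_model\<close> is a homomorphism.
  Surjectivity is \<open>to_from_cohomologous\<close>; for injectivity, w and w' are joined by the
  cohomologous cocycles \<open>from_model (to_model w)\<close> and
  \<open>from_model (to_model w')\<close>, using that \<open>from_model\<close> is additive and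
  preserves coboundaries.\<close>

lemma galg_iso_\<Upsilon>: "galg_iso (cohomology (deRham S)) (cohomology B) \<Upsilon>"
proof -
  interpret A: dga "deRham S" by (rule dga_deRham[OF dS])
  interpret B: dga B by (rule dga_B)
  have fb: "from_model b \<in> coboundaries (deRham S) n" if b: "b \<in> coboundaries B n" for b n
  proof (cases n)
    case 0
    then show ?thesis using b from_model_zero[of 0] by (simp add: coboundaries_def)
  next
    case (Suc k)
    then obtain c where "c \<in> gcomp B k" "b = gdiff B k c" using b by (auto simp: coboundaries_def)
    then show ?thesis using Suc from_model_diff[of c k] from_model_in[of c k] by (auto simp: coboundaries_def deRham_simps(1))
  qed
  have "galg_iso (cohomology (deRham S)) (cohomology B) (\<lambda>n X. \<Union>\<omega>\<in>X. cohom_class B n (to_model \<omega>))"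
  proof (rule galg_iso_cohomology[OF A.dga_axioms B.dga_axioms to_model_hom])
    fix n z assume z: "z \<in> cocycles B n"
    then have zB: "z \<in> gcomp B n" by (rule B.cocycles_in)
    have "from_model z \<in> cocycles (deRham S) n"
      using from_model_in[OF zB] from_model_diff[OF zB] z from_model_zero[of "Suc n"] by (simp add: cocycles_def deRham_simps(1))
    moreover obtain b where b: "b \<in> coboundaries B n" "to_model (from_model z) = gadd B n z b"
      using to_from_cohomologous[OF z] by blast
    have "sym (cohomologous B n)" using B.equiv_cohomologous by (rule equivE)
    then have "(to_model (from_model z), z) \<in> cohomologous B n"
      using B.cohomologousI[OF z b(1)] b(2) by (auto dest: symD)
    ultimately show "\<exists>w\<in>cocycles (deRham S) n. (to_model w, z) \<in> cohomologous B n" by blast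
  next
    fix n w w' assume w: "w \<in> cocycles (deRham S) n" and w': "w' \<in> cocycles (deRham S) n"
      and c: "(to_model w, to_model w') \<in> cohomologous B n"
    obtain b where b: "b \<in> coboundaries B n" "to_model w' = gadd B n (to_model w) b"
      using c by (rule B.cohomologousE)
    obtain e where e: "e \<in> coboundaries (deRham S) n" "from_model (to_model w) = gadd (deRham S) n w e"
      using from_to_cohomologous[OF w] by blast
    obtain e' where e': "e' \<in> coboundaries (deRham S) n" "from_model (to_model w') = gadd (deRham S) n w' e'"
      using from_to_cohomologous[OF w'] by blast
    have s: "sym (cohomologous (deRham S) n)" and t: "trans (cohomologous (deRham S) n)"
      using A.equiv_cohomologous[of n] by (auto elim: equivE)
    note 1 = A.cohomologousI[OF w e(1)] and 2 = A.cohomologousI[OF w' e'(1)]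
    have "gadd (deRham S) n w' e' = gadd (deRham S) n (gadd (deRham S) n w e) (from_model b)"
      unfolding e'(2)[symmetric] b(2) from_model_add e(2) ..
    then have "(gadd (deRham S) n w e, gadd (deRham S) n w' e') \<in> cohomologous (deRham S) n"
      using A.cohomologousI[OF A.add_cocycle[OF w A.coboundary_in_cocycles[OF e(1)]] fb[OF b(1)]] by simp
    then show "(w, w') \<in> cohomologous (deRham S) n"
      using 1 2 symD[OF s] transD[OF t] by blast
  qed
  then show ?thesis unfolding \<Upsilon>_def[abs_def] .
qed

end

subsection \<open>Representing classes of positive degree\<close>

lemma wedge_one_right:
  "alt q p (\<beta> x) \<Longrightarrow> g x = (\<lambda>vs. if vs = [] then 1 else 0) \<Longrightarrow> wedge \<beta> g x vs = \<beta> x vs"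
proof (induction vs arbitrary: p \<beta>)
  case Nil
  then show ?case by (simp add: wedge_Nil)
next
  case (Cons v vs)
  have "contr v g x = (\<lambda>vs. 0)" using Cons.prems(2) by (simp add: contr_def)
  moreover have "wedge (contr v \<beta>) g x vs = contr v \<beta> x vs"
    using Cons.prems alt_tail by (intro Cons.IH[of "p - 1"]) (auto simp: contr_def)
  moreover have "wedge \<beta> g x (v # vs) = wedge (contr v \<beta>) g x vs + (- 1) ^ p * wedge \<beta> (contr v g) x vs"
    by (rule wedge_Cons) (rule alt_length[OF Cons.prems(1)])
  ultimately show ?case by (simp add: wedge_zero_right) (simp add: contr_def)
qed

text \<open>The coordinate of the line as a 0-form; it is a primitive of \<open>dt\<close>.\<close>

definition coord_form :: "real dform" where
  "coord_form = (\<lambda>(q, U, u) x vs. if (q, U, u) \<in> mfd_plots real_mfd \<and> x \<in> U \<and> vs = [] then u x else 0)"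

lemma diffeology_real: "diffeology (mfd_plots real_mfd)"
  by (rule diffeology_mfd_plots[OF charted_real])

lemma coord_form_in: "coord_form \<in> dforms (mfd_plots real_mfd) 0"
proof (rule dformsI)
  fix q U u assume u: "(q, U, u) \<in> mfd_plots real_mfd"
  then have U: "openin (Euclidean_space q) U" "smooth_on q U u" by (simp_all add: real_plot_iff)
  show "smooth_form q U 0 (coord_form (q, U, u))"
  proof (rule smooth_formI[OF U(1)])
    show "smooth_on q U (\<lambda>x. coord_form (q, U, u) x vs)" for vs
      using smooth_on_cong[OF U(1), of "\<lambda>x. coord_form (q, U, u) x vs" "\<lambda>x. if vs = [] then u x else 0"] u U(2)
        smooth_on_const[OF open_vecs_subset[OF U(1)]] by (cases "vs = []") (simp_all add: coord_form_def)
  qed (auto simp: coord_form_def)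
qed (use diffeologyD(2)[OF diffeology_real] in \<open>auto simp: coord_form_def pull_eform_def fun_eq_iff\<close>)

lemma gdiff_coord_form: "gdiff (deRham (mfd_plots real_mfd)) n coord_form = dt"
proof (intro ext)
  fix pl :: "real plot" and x vs
  obtain q U u where pl: "pl = (q, U, u)" by (metis prod_cases3)
  show "gdiff (deRham (mfd_plots real_mfd)) n coord_form pl x vs = dt pl x vs"
  proof (cases "(q, U, u) \<in> mfd_plots real_mfd \<and> x \<in> U \<and> set vs \<subseteq> vecs q")
    case True
    then have U: "openin (Euclidean_space q) U" and x: "x \<in> U" by (auto simp: real_plot_iff)
    have 0: "pd k (\<lambda>y. coord_form (q, U, u) y us) x = (if us = [] then pd k u x else 0)" if "k < q" for k us
    proof -
      have "pd k (\<lambda>y. coord_form (q, U, u) y us) x = pd k (\<lambda>y. if us = [] then u y else 0) x"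
        using True by (intro pd_cong[OF U x that]) (simp add: coord_form_def)
      then show ?thesis by (simp add: pd_const)
    qed
    show ?thesis
    proof (cases "length vs = 1")
      case len: True
      then obtain v where "vs = [v]" by (auto simp: length_Suc_conv)
      then show ?thesis using True 0 by (simp add: pl dt_def deRham_simps(7) ext_deriv_def mult.commute)
    next
      case len: False
      have "(\<Sum>i<length vs. (- 1) ^ i * (\<Sum>k<q. (vs ! i) k * pd k (\<lambda>y. coord_form (q, U, u) y (take i vs @ drop (Suc i) vs)) x)) = 0"
      proof (intro sum.neutral ballI)
        fix i assume "i \<in> {..<length vs}"
        \<comment> \<open>When the list does not have length 1, every shortened list is nonempty,
          and a 0-form vanishes on it.\<close>
        then have "length (take i vs @ drop (Suc i) vs) \<noteq> 0" using len by auto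
        then have ne: "take i vs @ drop (Suc i) vs \<noteq> []" by (metis list.size(3))
        have "pd k (\<lambda>y. coord_form (q, U, u) y (take i vs @ drop (Suc i) vs)) x = 0" if "k < q" for k
          unfolding 0[OF that] using ne by (rule if_not_P)
        then show "(- 1) ^ i * (\<Sum>k<q. (vs ! i) k * pd k (\<lambda>y. coord_form (q, U, u) y (take i vs @ drop (Suc i) vs)) x) = 0"
          by simp
      qed
      then show ?thesis using True len by (simp add: pl dt_def deRham_simps(7) ext_deriv_def)
    qed
  next
    case False
    then have "ext_deriv q U (coord_form (q, U, u)) x vs = 0"
    proof (cases "(q, U, u) \<in> mfd_plots real_mfd")
      case False
      then have "coord_form (q, U, u) = (\<lambda>_ _. 0)" by (auto simp: coord_form_def fun_eq_iff)
      then show ?thesis by (simp add: ext_deriv_zero)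
    qed (use False in \<open>auto simp: ext_deriv_def\<close>)
    with False show ?thesis by (auto simp: pl dt_def deRham_simps(7))
  qed
qed

context suspended
begin

lemma smooth_between_lam: "smooth_between (mfd_plots real_mfd) (mfd_plots real_mfd) lam"
  unfolding smooth_between_def
proof safe
  fix q U u assume "(q, U, u) \<in> mfd_plots real_mfd"
  then have U: "openin (Euclidean_space q) U" "smooth_on q U u" by (simp_all add: real_plot_iff)
  have "smooth_on q U (restrict (lam \<circ> u) U)"
    by (rule iffD1[OF smooth_on_cong[OF U(1)] smooth_lam[OF U]]) simp
  then show "(q, U, restrict (lam \<circ> u) U) \<in> mfd_plots real_mfd" using U(1) by (simp add: real_plot_iff)
qed

text \<open>The function \<lambda>(t) on M \<times> \<real>, as a primitive of the 1-form in the
  representative.\<close>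

definition cutoff_form :: "('a \<times> real) dform" where
  "cutoff_form = pull R snd (pull (mfd_plots real_mfd) lam coord_form)"

lemma cutoff_form_in: "cutoff_form \<in> dforms R 0"
  unfolding cutoff_form_def
  by (intro pull_in[OF dR smooth_between_snd] pull_in[OF diffeology_real smooth_between_lam] coord_form_in)

lemma gdiff_cutoff_form: "gdiff \<Omega>R 0 cutoff_form = pull R snd (pull (mfd_plots real_mfd) lam dt)"
proof -
  note h1 = dga_homD(7)[OF dga_hom_pull[OF dR smooth_between_snd], unfolded deRham_simps(1)]
  note h2 = dga_homD(7)[OF dga_hom_pull[OF diffeology_real smooth_between_lam], unfolded deRham_simps(1)]
  show ?thesis
    unfolding cutoff_form_def h1[OF pull_in[OF diffeology_real smooth_between_lam coord_form_in], symmetric]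
      h2[OF coord_form_in, symmetric] gdiff_coord_form ..
qed

lemma cutoff_form_slice:
  assumes m: "(q, U, m) \<in> mfd_plots M" and x: "x \<in> U"
  shows "pull (mfd_plots M) (\<lambda>x. (x, c)) cutoff_form (q, U, m) x = (\<lambda>vs. if vs = [] then lam c else 0)"
proof -
  have "pull (mfd_plots M) (\<lambda>x. (x, c)) cutoff_form (q, U, m) = cutoff_form (q, U, restrict ((\<lambda>x. (x, c)) \<circ> m) U)"
    using m by (simp add: pull_def)
  moreover have s1: "(q, U, restrict ((\<lambda>x. (x, c)) \<circ> m) U) \<in> R" by (rule smooth_betweenD[OF smooth_between_slice m])
  moreover note s2 = smooth_betweenD[OF smooth_between_snd s1] and s3 = smooth_betweenD[OF smooth_between_lam s2]
  ultimately show ?thesis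
    using x s2 s3 by (auto simp: cutoff_form_def pull_def coord_form_def fun_eq_iff)
qed

text \<open>On the slice at height c the 0-form \<open>cutoff_form\<close> is the constant
  \<lambda>(c), and the pullback of \<beta> along the projection restricts to \<beta> again.\<close>

lemma slice_times_cutoff:
  assumes \<beta>: "\<beta> \<in> dforms (mfd_plots M) p"
  shows "lam c = 0 \<Longrightarrow> pull (mfd_plots M) (\<lambda>x. (x, c)) (gmult \<Omega>R p 0 (pull R fst \<beta>) cutoff_form) = (\<lambda>_ _ _. 0)"
    and "lam c = 1 \<Longrightarrow> pull (mfd_plots M) (\<lambda>x. (x, c)) (gmult \<Omega>R p 0 (pull R fst \<beta>) cutoff_form) = \<beta>"
proof -
  let ?P = "pull (mfd_plots M) (\<lambda>x. (x, c))"
  have P\<beta>: "?P (pull R fst \<beta>) = \<beta>"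
  proof -
    have "?P (pull R fst \<beta>) = pull (mfd_plots M) (\<lambda>x. x) \<beta>" by (simp add: pull_pull[OF smooth_between_slice] o_def)
    also have "\<dots> = \<beta>"
    proof (intro ext)
      fix pl :: "'a plot" and x vs
      obtain q U u where pl: "pl = (q, U, u)" by (metis prod_cases3)
      show "pull (mfd_plots M) (\<lambda>x. x) \<beta> pl x vs = \<beta> pl x vs"
      proof (cases "pl \<in> mfd_plots M")
        case True
        then have "restrict ((\<lambda>x. x) \<circ> u) U = u" using mfd_plotsD(2)[of q U u M] by (simp add: pl o_def extensional_restrict)
        then show ?thesis using True by (simp add: pull_def pl)
      qed (simp add: pull_def pl dformsD(2)[OF \<beta>])
    qed
    finally show ?thesis .
  qed
  have mult: "?P (gmult \<Omega>R p 0 (pull R fst \<beta>) cutoff_form) = gmult \<Omega>M p 0 \<beta> (?P cutoff_form)"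
    using dga_homD(6)[OF dga_hom_pull[OF dM smooth_between_slice], unfolded deRham_simps(1),
        OF pull_in[OF dR smooth_between_fst \<beta>] cutoff_form_in, of c] by (simp add: P\<beta>)
  have val: "wedge (\<beta> pl) (?P cutoff_form pl) x vs = lam c * \<beta> pl x vs" if l: "lam c = 0 \<or> lam c = 1" for pl x vs
  proof -
    obtain q U u where pl: "pl = (q, U, u)" by (metis prod_cases3)
    show ?thesis
    proof (cases "pl \<in> mfd_plots M \<and> x \<in> U")
      case True
      then have m: "(q, U, u) \<in> mfd_plots M" and x: "x \<in> U" by (auto simp: pl)
      note alt\<beta> = smooth_form_alt[OF mfd_plotsD(1)[OF m] dformsD(1)[OF \<beta> m]]
      show ?thesis
      proof (cases "lam c = 0")
        case True
        then have "?P cutoff_form pl x = (\<lambda>vs. 0)" using cutoff_form_slice[OF m x, of c] by (auto simp: pl fun_eq_iff)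
        then show ?thesis using True by (simp add: wedge_zero_right)
      next
        case False
        then have l1: "lam c = 1" using l by simp
        have one: "?P cutoff_form (q, U, u) x = (\<lambda>vs. if vs = [] then 1 else 0)"
          unfolding cutoff_form_slice[OF m x] l1 ..
        show ?thesis
          using wedge_one_right[where \<beta> = "\<beta> (q, U, u)" and x = x and g = "?P cutoff_form (q, U, u)" and vs = vs, OF alt\<beta> one] l1 by (simp add: pl)
      qed
    next
      case False
      have "\<beta> pl x = (\<lambda>vs. 0)"
      proof (cases "pl \<in> mfd_plots M")
        case True
        then have m: "(q, U, u) \<in> mfd_plots M" by (simp add: pl)
        then show ?thesis using False smooth_formD(1)[OF mfd_plotsD(1)[OF m] dformsD(1)[OF \<beta> m]] by (auto simp: pl fun_eq_iff)
      qed (simp add: dformsD(2)[OF \<beta>])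
      then show ?thesis by (simp add: wedge_zero_left)
    qed
  qed
  show "?P (gmult \<Omega>R p 0 (pull R fst \<beta>) cutoff_form) = (\<lambda>_ _ _. 0)" if "lam c = 0"
    unfolding mult using val that by (simp add: deRham_simps fun_eq_iff)
  show "?P (gmult \<Omega>R p 0 (pull R fst \<beta>) cutoff_form) = \<beta>" if "lam c = 1"
    unfolding mult using val that by (simp add: deRham_simps fun_eq_iff)
qed

lemma cocycle_representative:
  assumes z: "z \<in> cocycles B (Suc m)"
  shows "\<exists>\<beta>\<in>cocycles \<Omega>M m. cohom_class B (Suc m) z =
    cohom_class B (Suc m) (times_cutoff_dt M lam m \<beta>, gzero (prod_cdga \<Omega>P \<Omega>P) (Suc m))"
proof -
  interpret B: dga B by (rule dga_B)
  interpret R: dga \<Omega>R by (rule dga_deRham[OF dR])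
  let ?Z = "\<lambda>_ _ _. 0"
  obtain \<eta> a b where ze: "z = (\<eta>, a, b)" by (metis prod_cases3)
  have zB: "(\<eta>, a, b) \<in> gcomp B (Suc m)" and dz: "gdiff B (Suc m) (\<eta>, a, b) = gzero B (Suc (Suc m))"
    using z by (simp_all add: cocycles_def ze)
  note zB' = zB[unfolded in_B_iff]
  have a0: "a = ?Z" and b0: "b = ?Z" using zB' point_forms_positive by blast+
  have \<eta>: "\<eta> \<in> dforms R (Suc m)" using zB' by simp
  have d\<eta>: "gdiff \<Omega>R (Suc m) \<eta> = ?Z" using dz by (simp add: B_ops deRham_simps(2))
  have e0: "pull (mfd_plots M) (\<lambda>x. (x, 0)) \<eta> = ?Z" and e1: "pull (mfd_plots M) (\<lambda>x. (x, 1)) \<eta> = ?Z"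
    using zB' by (simp_all add: a0 b0 pull_zero)
  \<comment> \<open>This contraction fixes height 0, so \<kappa> vanishes there. It moves height 1,
    so \<kappa> may be nonzero at that end, and its restriction there is the source of
    \<beta>.\<close>
  let ?H = "\<lambda>w s. (fst w, snd w * s)"
  have "smooth2 (*)" by (simp add: smooth2_def smooth_on_mult)
  then have H: "smooth_htpy R R ?H" by (rule smooth_htpy_R)
  define \<kappa> where "\<kappa> = htpy_op R ?H \<eta>"
  have \<kappa>: "\<kappa> \<in> dforms R m" using htpy_op_in[OF dR dR H \<eta>] by (simp add: \<kappa>_def)
  \<comment> \<open>At s = 0 the contraction factors through M at height 0, where \<eta>
    vanishes.\<close>
  have "pull R (\<lambda>w. ?H w 0) \<eta> = pull R fst (pull (mfd_plots M) (\<lambda>x. (x, 0)) \<eta>)"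
    by (simp add: pull_pull[OF smooth_between_fst] o_def)
  then have H0: "pull R (\<lambda>w. ?H w 0) \<eta> = ?Z" by (simp add: e0 pull_zero)
  have H1: "pull R (\<lambda>w. ?H w 1) \<eta> = \<eta>"
  proof (intro ext)
    fix pl :: "('a \<times> real) plot" and x vs
    obtain q U w where pl: "pl = (q, U, w)" by (metis prod_cases3)
    show "pull R (\<lambda>w. ?H w 1) \<eta> pl x vs = \<eta> pl x vs"
    proof (cases "pl \<in> R")
      case True
      then have "restrict ((\<lambda>w. ?H w 1) \<circ> w) U = w"
        using R_plotD(4)[of q U w] by (simp add: pl o_def extensional_restrict)
      then show ?thesis using True by (simp add: pull_def pl)
    qed (simp add: pull_def pl dformsD(2)[OF \<eta>])
  qed
  \<comment> \<open>Since \<eta> is closed and its pullback at s = 0 vanishes, only the differential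
    of the homotopy operator survives in the homotopy formula.\<close>
  have d\<kappa>: "gdiff \<Omega>R m \<kappa> = \<eta>"
    using htpy_formula[OF dR dR H \<eta>, of m "Suc m"] unfolding d\<eta> htpy_op_zero H0 H1 \<kappa>_def by simp
  have \<kappa>0: "pull (mfd_plots M) (\<lambda>x. (x, 0)) \<kappa> = ?Z"
    unfolding \<kappa>_def using htpy_op_end[OF \<eta>, of "\<lambda>t s. t * s" 0] by simp
  define \<beta>1 where "\<beta>1 = pull (mfd_plots M) (\<lambda>x. (x, 1)) \<kappa>"
  have \<beta>1: "\<beta>1 \<in> dforms (mfd_plots M) m" unfolding \<beta>1_def by (rule pull_in[OF dM smooth_between_slice \<kappa>])
  have d\<beta>1: "gdiff \<Omega>M m \<beta>1 = ?Z"
    using dga_homD(7)[OF dga_hom_pull[OF dM smooth_between_slice], unfolded deRham_simps(1), OF \<kappa>, of 1]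
    by (simp add: \<beta>1_def d\<kappa> e1)
  \<comment> \<open>The Leibniz rule puts the sign (-1)^m in front of the product of \<beta>1 with
    the differential of the cut-off; the sign is moved into \<beta>.\<close>
  define \<beta> where "\<beta> = gscale \<Omega>M m ((- 1) ^ m) \<beta>1"
  have "\<beta> \<in> cocycles \<Omega>M m"
  proof -
    interpret M: dga \<Omega>M by (rule dga_deRham[OF dM])
    have "\<beta>1 \<in> cocycles \<Omega>M m" using \<beta>1 d\<beta>1 by (simp add: cocycles_def deRham_simps(1,2))
    then show ?thesis unfolding \<beta>_def by (rule M.scale_cocycle)
  qed
  define \<beta>' where "\<beta>' = pull R fst \<beta>1"
  have \<beta>': "\<beta>' \<in> dforms R m" unfolding \<beta>'_def by (rule pull_in[OF dR smooth_between_fst \<beta>1])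
  have d\<beta>': "gdiff \<Omega>R m \<beta>' = ?Z"
    using dga_homD(7)[OF dga_hom_pull[OF dR smooth_between_fst], unfolded deRham_simps(1), OF \<beta>1]
    by (simp add: \<beta>'_def d\<beta>1 pull_zero)
  let ?bf = "gmult \<Omega>R m 0 \<beta>' cutoff_form"
  have bf: "?bf \<in> dforms R m" using R.mult_in[of \<beta>' m cutoff_form 0] \<beta>' cutoff_form_in by (simp add: deRham_simps(1))
  have dbf: "gdiff \<Omega>R m ?bf = times_cutoff_dt M lam m \<beta>"
  proof -
    have "gdiff \<Omega>R m ?bf = gadd \<Omega>R (Suc m) (gmult \<Omega>R (Suc m) 0 ?Z cutoff_form)
        (gscale \<Omega>R (Suc m) ((- 1) ^ m) (gmult \<Omega>R m (Suc 0) \<beta>' (gdiff \<Omega>R 0 cutoff_form)))"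
      using R.leibniz[of \<beta>' m cutoff_form 0] \<beta>' cutoff_form_in by (simp add: deRham_simps(1) d\<beta>')
    also have "\<dots> = (\<lambda>pl x vs. (- 1) ^ m * wedge (\<beta>' pl) (gdiff \<Omega>R 0 cutoff_form pl) x vs)"
      by (simp add: deRham_simps(3,4,6) wedge_zero_left)
    also have "\<dots> = times_cutoff_dt M lam m \<beta>"
    proof (intro ext)
      fix pl x vs
      have "pull R fst \<beta> pl = (\<lambda>x vs. (- 1) ^ m * \<beta>' pl x vs)"
        by (cases pl) (auto simp: \<beta>_def \<beta>'_def pull_def deRham_simps fun_eq_iff)
      then show "(- 1) ^ m * wedge (\<beta>' pl) (gdiff \<Omega>R 0 cutoff_form pl) x vs = times_cutoff_dt M lam m \<beta> pl x vs"
        using wedge_lin_left[of "(- 1) ^ m" "\<beta>' pl" 0 "\<beta>' pl" "gdiff \<Omega>R 0 cutoff_form pl" x vs]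
        by (simp add: times_cutoff_dt_def gdiff_cutoff_form deRham_simps(6))
    qed
    finally show ?thesis .
  qed
  \<comment> \<open>Both terms vanish at height 0, and they agree at height 1, where \<lambda> is 1.
    So \<theta>, completed by zeros, lies in the fibre product, and adding its differential to z
    replaces \<eta> by the product form.\<close>
  define \<theta> where "\<theta> = (\<lambda>pl x vs. 1 * ?bf pl x vs + (- 1) * \<kappa> pl x vs)"
  have \<theta>: "\<theta> \<in> dforms R m" unfolding \<theta>_def by (rule dforms_lin[OF dR bf \<kappa>])
  have lin: "pull (mfd_plots M) f \<theta> = (\<lambda>pl x vs. pull (mfd_plots M) f ?bf pl x vs - pull (mfd_plots M) f \<kappa> pl x vs)" for f
    by (auto simp: \<theta>_def pull_def fun_eq_iff)
  have "(\<theta>, ?Z, ?Z) \<in> gcomp B m"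
    using \<theta> slice_times_cutoff[OF \<beta>1, folded \<beta>'_def] \<kappa>0 lam_0[of 0] lam_1[of 1]
    by (intro in_B_zero_ends) (simp_all add: lin \<beta>1_def)
  then have cob: "gdiff B m (\<theta>, ?Z, ?Z) \<in> coboundaries B (Suc m)" by (auto simp: coboundaries_def)
  have "gdiff \<Omega>R m \<theta> = (\<lambda>pl x vs. gdiff \<Omega>R m ?bf pl x vs - gdiff \<Omega>R m \<kappa> pl x vs)"
  proof -
    have "\<theta> = gadd \<Omega>R m ?bf (gscale \<Omega>R m (- 1) \<kappa>)" by (simp add: \<theta>_def deRham_simps(3,4))
    then show ?thesis
      using R.diff_add[of ?bf m "gscale \<Omega>R m (- 1) \<kappa>"] R.diff_scale[of \<kappa> m "- 1"] R.scale_in[of \<kappa> m "- 1"] bf \<kappa>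
      by (simp add: deRham_simps(1,3,4))
  qed
  then have "gadd B (Suc m) z (gdiff B m (\<theta>, ?Z, ?Z)) = (times_cutoff_dt M lam m \<beta>, gzero (prod_cdga \<Omega>P \<Omega>P) (Suc m))"
    by (simp add: ze a0 b0 B_ops(2,3) gdiff_zero deRham_simps(2,3) d\<kappa> dbf prod_cdga_def)
  then show ?thesis
    using B.cohom_class_eqI[OF B.cohomologousI[OF z cob]] \<open>\<beta> \<in> cocycles \<Omega>M m\<close> by auto
qed

lemma \<Upsilon>_representative:
  assumes n: "n > 0" and \<omega>: "\<omega> \<in> gcomp (cohomology (deRham S)) n"
  shows "\<exists>\<beta>\<in>cocycles \<Omega>M (n - 1). \<Upsilon> n \<omega> =
    cohom_class B n (times_cutoff_dt M lam (n - 1) \<beta>, gzero (prod_cdga \<Omega>P \<Omega>P) n)"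
proof -
  obtain m where m: "n = Suc m" using n by (cases n) auto
  have "\<Upsilon> n \<omega> \<in> gcomp (cohomology B) n"
    using galg_iso_\<Upsilon> \<omega> unfolding galg_iso_def bij_betw_def by blast
  then obtain z where "z \<in> cocycles B n" "\<Upsilon> n \<omega> = cohom_class B n z" by (rule dga.in_cohomE[OF dga_B])
  then show ?thesis using cocycle_representative[of z m] m by simp
qed

end

theorem propositionB2:
  fixes M :: "'a mfd" and lam :: "real \<Rightarrow> real"
  assumes "closed_manifold M"
    and "smooth_fun real_mfd lam"
    and "\<And>s. s \<le> 0 \<Longrightarrow> lam s = 0"
    and "\<And>s. s \<ge> 1 \<Longrightarrow> lam s = 1"
    and "\<And>s. 0 < s \<Longrightarrow> s < 1 \<Longrightarrow> 0 < lam s \<and> lam s < 1"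
  shows "\<exists>\<Upsilon>. galg_iso (cohomology (deRham (suspension M))) (cohomology (susp_model M)) \<Upsilon> \<and>
    (\<forall>n>0. \<forall>\<omega>\<in>gcomp (cohomology (deRham (suspension M))) n.
       \<exists>\<beta>\<in>cocycles (deRham (mfd_plots M)) (n - 1).
         \<Upsilon> n \<omega> = cohom_class (susp_model M) n
           (times_cutoff_dt M lam (n - 1) \<beta>,
            gzero (prod_cdga (deRham point_plots) (deRham point_plots)) n))"
proof -
  interpret suspended lam M
    using assms by unfold_locales (auto simp: closed_manifold_def)
  show ?thesis using galg_iso_\<Upsilon> \<Upsilon>_representative by blast
qed

end
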